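(* Let $\{\mathcal{A},\mathcal{G},\mathcal{G}',\chi\}$ be a reliable Long-Moody system such that the groups $H_n=\mathcal{A}(\underline n)$ are free for all $n\in\mathbb{N}$. Then the associated Long-Moody functor $\mathbf{LM}$ on $\mathbf{Fct}(\mathfrak{U}\mathcal{G},R\text{-}\mathfrak{Mod})$ increases by one both the very strong and the weak polynomial degrees: for every $d\in\mathbb{N}$ and every object $F$ of $\mathbf{Fct}(\mathfrak{U}\mathcal{G},R\text{-}\mathfrak{Mod})$, (1) if $F$ is very strong polynomial of degree $d$, then $\mathbf{LM}(F)$ is very strong polynomial of degree $d+1$; (2) if $F$ is weak polynomial of degree $d$, then $\mathbf{LM}(F)$ is weak polynomial of degree $d+1$.
   Context: $\mathbb{N}=\{0,1,2,\ldots\}$. $R$ is a fixed non-trivial commutative ring; $\mathfrak{Gr}$ is the category of groups, $*$ the free product; $\mathbf{Fct}(\mathfrak{C},\mathfrak{D})$ is the category of functors. For a group $G$, $\mathcal{I}_{R[G]}$ is the augmentation ideal (a right $R[G]$-module), functorial in $G$ via $\mathcal{I}_{R[-]}$. Quillen's bracket construction. For a strict monoidal groupoid $(\mathcal{G}',\natural,0)$, $\mathfrak{U}\mathcal{G}'$ has the same objects; a morphism $A\to B$ is a class $[X,f]$ of pairs with $f:X\natural A\to B$ in $\mathcal{G}'$, where $(X,f)\sim(X',f')$ iff there is an isomorphism $\psi:X\to X'$ with $f'\circ(\psi\natural id_A)=f$; $[Y,g]\circ[X,f]=[Y\natural X,g\circ(id_Y\natural f)]$; identities $[0,id]$. A morphism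 $\varphi$ of $\mathcal{G}'$ is identified with $[0,\varphi]$; $0$ is initial in $\mathfrak{U}\mathcal{G}'$ and $\iota_X:0\to X$ is the unique morphism. If $\mathcal{G}'$ has a braiding $b$, $\mathfrak{U}\mathcal{G}'$ is strict monoidal with $[X,f]\natural[Y,g]=[X\natural Y,(f\natural g)\circ(id_X\natural b_{A,Y}^{-1}\natural id_C)]$ for $[X,f]:A\to B$, $[Y,g]:C\to D$. Setting. $(\mathcal{G}',\natural,0,b)$ is a locally small strict braided monoidal groupoid with no zero divisors ($A\natural B\cong0$ iff $A\cong B\cong 0$) and $\mathrm{Aut}(0)=\{id_0\}$; $\underline{0},1$ are fixed objects with $1\not\cong 0$; $\underline{n}=1^{\natural n}\natural\underline{0}$. $\mathcal{G}$ is the full subgroupoid of $\mathcal{G}'$ on $\{\underline{n}\}_{n\in\mathbb{N}}$, $G_n=\mathrm{Aut}(\underline{n})$, and $\mathfrak{U}\mathcal{G}$ is the full subcategory of $\mathfrak{U}\mathcal{G}'$ on $\{\underline{n}\}_{n\in\mathbb{N}}$. Long-Moody systems. For $\mathcal{A}:\mathfrak{U}\mathcal{G}\to\mathfrak{Gr}$, the Grothendieck construction $\int^{\mathfrak{U}\mathcal{G}}\mathcal{A}$ has objects $\underline{n}$, morphisms $\underline{n}\to\underline{n'}$ the pairs $(h,\varphi)$ with $\varphi\in\mathrm{Hom}_{\mathfrak{U}\mathcal{G}}(\underline n,\underline n')$, $h\in\mathcal{A}(\underline{n'})$, and composition $(h',\varphi')\circ(h,\varphi)=(h'\mathcal{A}(\varphi')(h),\varphi'\varphi)$;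 $\mathfrak{s}_{\mathcal{A}}(\varphi)=(e,\varphi)$; similarly over $\mathcal{G}$. $\{\mathcal{A},\mathcal{G},\mathcal{G}',\chi\}$ is a coherent Long-Moody system if $\chi:\int^{\mathcal{G}}\mathcal{A}\to\mathcal{G}$ is a functor with $\chi\circ\mathfrak{s}_{\mathcal{A}}=1\natural-$ which extends to a functor $\chi:\int^{\mathfrak{U}\mathcal{G}}\mathcal{A}\to\mathfrak{U}\mathcal{G}$ with $\chi\circ\mathfrak{s}_{\mathcal{A}}=1\natural-$. Put $\chi_n(h)=\chi(h,id_{\underline{n}})$, $\chi_n:\mathcal{A}(\underline{n})\to G_{n+1}$. Its Long-Moody functor is the endofunctor $\mathbf{LM}$ of $\mathbf{Fct}(\mathfrak{U}\mathcal{G},R\text{-}\mathfrak{Mod})$ with $\mathbf{LM}(F)(\underline{n})=\mathcal{I}_{R[\mathcal{A}(\underline{n})]}\otimes_{R[\mathcal{A}(\underline{n})]}F(\underline{n+1})$ ($F(\underline{n+1})$ a left module via $F\circ\chi_n$), $\mathbf{LM}(F)(\varphi)(i\otimes v)=\mathcal{I}_{R[-]}(\mathcal{A}(\varphi))(i)\otimes F(id_1\natural\varphi)(v)$, and $\mathbf{LM}(\eta)_{\underline{n}}=id\otimes\eta_{\underline{n+1}}$. Reliable. A coherent Long-Moody system is reliable if: $\mathcal{A}$ is the restriction of a functor $\mathfrak{U}\mathcal{G}'\to\mathfrak{Gr}$ (still denoted $\mathcal{A}$); there are groups $H_0$ and $H$, with $H$ non-trivial, such that $\mathcal{A}(1^{\natural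 m})=H^{*m}$ and $\mathcal{A}(\underline{n})=H_n:=H^{*n}*H_0$ for all $m,n\in\mathbb{N}$; for all finite monoidal products $X,Y$ of the objects $0,\underline{0},1$ one has $\mathcal{A}(\iota_X\natural id_Y)=\iota_{\mathcal{A}(X)}*id_{\mathcal{A}(Y)}$ and $\mathcal{A}(id_Y\natural\iota_X)=id_{\mathcal{A}(Y)}*\iota_{\mathcal{A}(X)}$ ($\iota_G$ is the morphism from the trivial group to a group $G$); and for all $n$ and $h\in H_n$, in $G_{n+2}$: $(b_{1,1}^{-1}\natural id_{\underline{n}})\circ(id_1\natural\chi_n(h))=\chi_{n+1}((\iota_H*id_{H_n})(h))\circ(b_{1,1}^{-1}\natural id_{\underline{n}})$. Polynomiality. Let $\mathrm{Obj}_\natural$ be the set of objects $m$ of $\mathfrak{U}\mathcal{G}'$ such that $m\natural\underline{n}$ is an object of $\mathfrak{U}\mathcal{G}$ for all $n$. For $m\in\mathrm{Obj}_\natural$, $\tau_m(F)=F(m\natural-)$, $i_m:Id\to\tau_m$ is induced by $\iota_m:0\to m$, $\delta_m=\mathrm{coker}(i_m)$, $\kappa_m=\ker(i_m)$. Strong/very strong: $\mathcal{P}ol^{strong}_d=\mathcal{VP}ol_d=\{0\}$ for $d<0$; for $d\ge0$, $F\in\mathcal{P}ol_d^{strong}$ iff $\delta_m(F)\in\mathcal{P}ol_{d-1}^{strong}$ for all $m\in\mathrm{Obj}_\natural$; $F\in\mathcal{VP}ol_d$ iff $F\in\mathcal{P}ol_d^{strong}$ and $\kappa_m(F)=0$,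 $\delta_m(F)\in\mathcal{VP}ol_{d-1}$ for all $m\in\mathrm{Obj}_\natural$. If $F$ is very strong polynomial (i.e. lies in some $\mathcal{VP}ol_n$, $n\in\mathbb{N}$), its very strong degree is the smallest natural number $d\in\mathbb{N}$ with $F\in\mathcal{VP}ol_d$. Weak: $\kappa(F)=\sum_{m\in\mathrm{Obj}_\natural}\kappa_m(F)\subseteq F$; $K$ is the full subcategory of those $F$ with $\kappa(F)=F$, which is a thick (Serre) subcategory; $\mathbf{St}=\mathbf{Fct}(\mathfrak{U}\mathcal{G},R\text{-}\mathfrak{Mod})/K$ with quotient functor $\pi$; $\tau_m,\delta_m$ induce exact endofunctors of $\mathbf{St}$ commuting with $\pi$. $\mathcal{P}ol_d\subseteq\mathbf{St}$ consists, for $d<0$, of the objects of $K$ (the zero objects of $\mathbf{St}$), and for $d\geq 0$ of those $F$ with $\delta_m(F)\in\mathcal{P}ol_{d-1}$ for all $m\in\mathrm{Obj}_\natural$. $F\in\mathbf{Fct}(\mathfrak{U}\mathcal{G},R\text{-}\mathfrak{Mod})$ is weak polynomial of degree at most $n$ if $\pi(F)\in\mathcal{P}ol_n$, and its (weak) degree is then the smallest natural number $d\in\mathbb{N}$ with $\pi(F)\in\mathcal{P}ol_d$.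
   Formalization: In (1) F is assumed nonzero and in (2) F is assumed not to lie in K; otherwise F has degree 0 and LM(F) is again zero (resp. in K), so it also has degree 0, not 1, and the claim fails. For d ≥ 1 both conditions are automatic. *)

theory Defs
  imports "HOL-Algebra.Module" "HOL-Algebra.AbelCoset" "HOL-Algebra.Elementary_Groups"
    "HOL-Algebra.Generated_Groups"
begin

section \<open>Categories and strict braided monoidal groupoids\<close>

record ('o, 'a) precat =
  Obj :: "'o set"
  Arr :: "'a set"
  Src :: "'a \<Rightarrow> 'o"
  Tgt :: "'a \<Rightarrow> 'o"
  Idn :: "'o \<Rightarrow> 'a"
  Cmp :: "'a \<Rightarrow> 'a \<Rightarrow> 'a" (infixr "\<cdot>\<index>" 70)

definition homs :: "('o, 'a, 'x) precat_scheme \<Rightarrow> 'o \<Rightarrow> 'o \<Rightarrow> 'a set" where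
  "homs C X Y = {f \<in> Arr C. Src C f = X \<and> Tgt C f = Y}"

locale category =
  fixes C (structure)
  assumes src_obj: "f \<in> Arr C \<Longrightarrow> Src C f \<in> Obj C"
    and tgt_obj: "f \<in> Arr C \<Longrightarrow> Tgt C f \<in> Obj C"
    and idn_hom: "X \<in> Obj C \<Longrightarrow> Idn C X \<in> homs C X X"
    and cmp_hom: "f \<in> homs C X Y \<Longrightarrow> g \<in> homs C Y Z \<Longrightarrow> g \<cdot> f \<in> homs C X Z"
    and idn_left: "f \<in> homs C X Y \<Longrightarrow> Idn C Y \<cdot> f = f"
    and idn_right: "f \<in> homs C X Y \<Longrightarrow> f \<cdot> Idn C X = f"
    and cmp_assoc: "f \<in> homs C W X \<Longrightarrow> g \<in> homs C X Y \<Longrightarrow> h \<in> homs C Y Z \<Longrightarrow>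
      (h \<cdot> g) \<cdot> f = h \<cdot> (g \<cdot> f)"

definition inverse_arrows :: "('o, 'a, 'x) precat_scheme \<Rightarrow> 'a \<Rightarrow> 'a \<Rightarrow> bool" where
  "inverse_arrows C f g \<longleftrightarrow> f \<in> Arr C \<and> g \<in> homs C (Tgt C f) (Src C f) \<and>
     g \<cdot>\<^bsub>C\<^esub> f = Idn C (Src C f) \<and> f \<cdot>\<^bsub>C\<^esub> g = Idn C (Tgt C f)"

definition inv_arrow :: "('o, 'a, 'x) precat_scheme \<Rightarrow> 'a \<Rightarrow> 'a" where
  "inv_arrow C f = (THE g. inverse_arrows C f g)"

definition isos :: "('o, 'a, 'x) precat_scheme \<Rightarrow> 'o \<Rightarrow> 'o \<Rightarrow> 'a set" where
  "isos C X Y = {f \<in> homs C X Y. \<exists>g. inverse_arrows C f g}"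

definition isomorphic :: "('o, 'a, 'x) precat_scheme \<Rightarrow> 'o \<Rightarrow> 'o \<Rightarrow> bool" where
  "isomorphic C X Y \<longleftrightarrow> isos C X Y \<noteq> {}"

definition full_sub :: "('o, 'a, 'x) precat_scheme \<Rightarrow> 'o set \<Rightarrow> ('o, 'a, 'x) precat_scheme" where
  "full_sub C S = C\<lparr>Obj := S \<inter> Obj C, Arr := {f \<in> Arr C. Src C f \<in> S \<and> Tgt C f \<in> S}\<rparr>"

locale cat_functor =
  dom: category C + cod: category D
  for C :: "('o, 'a, 'x) precat_scheme" and D :: "('p, 'b, 'y) precat_scheme" +
  fixes Fo :: "'o \<Rightarrow> 'p" and Fa :: "'a \<Rightarrow> 'b"
  assumes map_obj: "X \<in> Obj C \<Longrightarrow> Fo X \<in> Obj D"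
    and map_hom: "f \<in> homs C X Y \<Longrightarrow> Fa f \<in> homs D (Fo X) (Fo Y)"
    and map_idn: "X \<in> Obj C \<Longrightarrow> Fa (Idn C X) = Idn D (Fo X)"
    and map_cmp: "f \<in> homs C X Y \<Longrightarrow> g \<in> homs C Y Z \<Longrightarrow>
      Fa (g \<cdot>\<^bsub>C\<^esub> f) = Fa g \<cdot>\<^bsub>D\<^esub> Fa f"

record ('o, 'a) moncat = "('o, 'a) precat" +
  TOb :: "'o \<Rightarrow> 'o \<Rightarrow> 'o" (infixr "\<natural>\<index>" 80)
  TAr :: "'a \<Rightarrow> 'a \<Rightarrow> 'a" (infixr "\<boxtimes>\<index>" 80)
  Unit :: "'o"

record ('o, 'a) brcat = "('o, 'a) moncat" +
  Brd :: "'o \<Rightarrow> 'o \<Rightarrow> 'a"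

locale strict_monoidal_category = category C
  for C :: "('o, 'a, 'x) moncat_scheme" (structure) +
  assumes unit_obj: "Unit C \<in> Obj C"
    and tensor_obj: "X \<in> Obj C \<Longrightarrow> Y \<in> Obj C \<Longrightarrow> X \<natural> Y \<in> Obj C"
    and tensor_hom: "f \<in> homs C X X' \<Longrightarrow> g \<in> homs C Y Y' \<Longrightarrow>
      f \<boxtimes> g \<in> homs C (X \<natural> Y) (X' \<natural> Y')"
    and tensor_idn: "X \<in> Obj C \<Longrightarrow> Y \<in> Obj C \<Longrightarrow>
      Idn C X \<boxtimes> Idn C Y = Idn C (X \<natural> Y)"
    and interchange: "f \<in> homs C X X' \<Longrightarrow> f' \<in> homs C X' X'' \<Longrightarrow>
      g \<in> homs C Y Y' \<Longrightarrow> g' \<in> homs C Y' Y'' \<Longrightarrow>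
      (f' \<cdot> f) \<boxtimes> (g' \<cdot> g) = (f' \<boxtimes> g') \<cdot> (f \<boxtimes> g)"
    and tensor_obj_assoc: "X \<in> Obj C \<Longrightarrow> Y \<in> Obj C \<Longrightarrow> Z \<in> Obj C \<Longrightarrow>
      (X \<natural> Y) \<natural> Z = X \<natural> (Y \<natural> Z)"
    and tensor_arr_assoc: "f \<in> Arr C \<Longrightarrow> g \<in> Arr C \<Longrightarrow> h \<in> Arr C \<Longrightarrow>
      (f \<boxtimes> g) \<boxtimes> h = f \<boxtimes> (g \<boxtimes> h)"
    and unit_obj_left: "X \<in> Obj C \<Longrightarrow> Unit C \<natural> X = X"
    and unit_obj_right: "X \<in> Obj C \<Longrightarrow> X \<natural> Unit C = X"
    and unit_arr_left: "f \<in> Arr C \<Longrightarrow> Idn C (Unit C) \<boxtimes> f = f"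
    and unit_arr_right: "f \<in> Arr C \<Longrightarrow> f \<boxtimes> Idn C (Unit C) = f"

locale strict_braided_groupoid = strict_monoidal_category C
  for C :: "('o, 'a, 'x) brcat_scheme" (structure) +
  assumes arr_iso: "f \<in> Arr C \<Longrightarrow> \<exists>g. inverse_arrows C f g"
    and braid_hom: "X \<in> Obj C \<Longrightarrow> Y \<in> Obj C \<Longrightarrow> Brd C X Y \<in> homs C (X \<natural> Y) (Y \<natural> X)"
    and braid_natural: "f \<in> homs C X X' \<Longrightarrow> g \<in> homs C Y Y' \<Longrightarrow>
      Brd C X' Y' \<cdot> (f \<boxtimes> g) = (g \<boxtimes> f) \<cdot> Brd C X Y"
    and hexagon1: "X \<in> Obj C \<Longrightarrow> Y \<in> Obj C \<Longrightarrow> Z \<in> Obj C \<Longrightarrow>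
      Brd C X (Y \<natural> Z) = (Idn C Y \<boxtimes> Brd C X Z) \<cdot> (Brd C X Y \<boxtimes> Idn C Z)"
    and hexagon2: "X \<in> Obj C \<Longrightarrow> Y \<in> Obj C \<Longrightarrow> Z \<in> Obj C \<Longrightarrow>
      Brd C (X \<natural> Y) Z = (Brd C X Z \<boxtimes> Idn C Y) \<cdot> (Idn C X \<boxtimes> Brd C Y Z)"


section \<open>Quillen's bracket construction\<close>

text \<open>
  An arrow carries its source and its target, because neither the equivalence class alone nor the
  source \<open>X \<natural> A\<close> of a representative determines \<open>A\<close>.
\<close>

type_synonym ('o, 'a) qarr = "'o \<times> 'o \<times> ('o \<times> 'a) set"

definition bracket :: "('o, 'a, 'x) moncat_scheme \<Rightarrow> 'o \<Rightarrow> 'o \<Rightarrow> 'a \<Rightarrow> ('o, 'a) qarr" where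
  "bracket G A X f = (A, Tgt G f,
     {(X', f'). X' \<in> Obj G \<and> f' \<in> homs G (X' \<natural>\<^bsub>G\<^esub> A) (Tgt G f) \<and>
        (\<exists>\<psi> \<in> isos G X X'. f' \<cdot>\<^bsub>G\<^esub> (\<psi> \<boxtimes>\<^bsub>G\<^esub> Idn G A) = f)})"

definition qrep :: "('o, 'a) qarr \<Rightarrow> 'o \<times> 'a" where
  "qrep u = (SOME p. p \<in> snd (snd u))"

definition quillen :: "('o, 'a, 'x) brcat_scheme \<Rightarrow> ('o, ('o, 'a) qarr) moncat" where
  "quillen G =
    \<lparr>Obj = Obj G,
     Arr = {bracket G A X f | A X f. A \<in> Obj G \<and> X \<in> Obj G \<and> f \<in> Arr G \<and> Src G f = X \<natural>\<^bsub>G\<^esub> A},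
     Src = fst,
     Tgt = (\<lambda>u. fst (snd u)),
     Idn = (\<lambda>A. bracket G A (Unit G) (Idn G A)),
     Cmp = (\<lambda>v u. let (Y, g) = qrep v; (X, f) = qrep u in
        bracket G (fst u) (Y \<natural>\<^bsub>G\<^esub> X) (g \<cdot>\<^bsub>G\<^esub> (Idn G Y \<boxtimes>\<^bsub>G\<^esub> f))),
     TOb = TOb G,
     TAr = (\<lambda>u v. let (X, f) = qrep u; (Y, g) = qrep v; A = fst u; C = fst v in
        bracket G (A \<natural>\<^bsub>G\<^esub> C) (X \<natural>\<^bsub>G\<^esub> Y)
          ((f \<boxtimes>\<^bsub>G\<^esub> g) \<cdot>\<^bsub>G\<^esub> (Idn G X \<boxtimes>\<^bsub>G\<^esub> inv_arrow G (Brd G A Y) \<boxtimes>\<^bsub>G\<^esub> Idn G C))),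
     Unit = Unit G\<rparr>"

definition embed :: "('o, 'a, 'x) moncat_scheme \<Rightarrow> 'a \<Rightarrow> ('o, 'a) qarr" where
  "embed G f = bracket G (Src G f) (Unit G) f"

definition iota :: "('o, 'a, 'x) moncat_scheme \<Rightarrow> 'o \<Rightarrow> ('o, 'a) qarr" where
  "iota G X = bracket G (Unit G) X (Idn G X)"


section \<open>Setting\<close>

text \<open>In the following, \<open>u\<close> is the object written 1 and \<open>z\<close> the object written 0 underlined.\<close>

definition tensor_power :: "('o, 'a, 'x) moncat_scheme \<Rightarrow> 'o \<Rightarrow> nat \<Rightarrow> 'o" where
  "tensor_power G u n = ((\<lambda>X. u \<natural>\<^bsub>G\<^esub> X) ^^ n) (Unit G)"

definition stage :: "('o, 'a, 'x) moncat_scheme \<Rightarrow> 'o \<Rightarrow> 'o \<Rightarrow> nat \<Rightarrow> 'o" where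
  "stage G u z n = tensor_power G u n \<natural>\<^bsub>G\<^esub> z"

definition stage_groupoid ::
    "('o, 'a, 'x) brcat_scheme \<Rightarrow> 'o \<Rightarrow> 'o \<Rightarrow> ('o, 'a, 'x) brcat_scheme" where
  "stage_groupoid G u z = full_sub G (range (stage G u z))"

definition stage_quillen ::
    "('o, 'a, 'x) brcat_scheme \<Rightarrow> 'o \<Rightarrow> 'o \<Rightarrow> ('o, ('o, 'a) qarr) moncat" where
  "stage_quillen G u z = full_sub (quillen G) (range (stage G u z))"

locale long_moody_setting = strict_braided_groupoid G
  for G :: "('o, 'a, 'x) brcat_scheme" (structure) +
  fixes u z :: 'o
  assumes no_zero_divisors: "X \<in> Obj G \<Longrightarrow> Y \<in> Obj G \<Longrightarrow>
      isomorphic G (X \<natural> Y) (Unit G) \<longleftrightarrow> isomorphic G X (Unit G) \<and> isomorphic G Y (Unit G)"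
    and aut_unit: "homs G (Unit G) (Unit G) = {Idn G (Unit G)}"
    and u_obj: "u \<in> Obj G"
    and z_obj: "z \<in> Obj G"
    and u_not_unit: "\<not> isomorphic G u (Unit G)"


section \<open>Group-valued functors and Long-Moody systems\<close>

record ('o, 'a, 'g) gfun =
  GOb :: "'o \<Rightarrow> 'g monoid"
  GAr :: "'a \<Rightarrow> 'g \<Rightarrow> 'g"

locale group_functor = category C
  for C :: "('o, 'a, 'x) precat_scheme" +
  fixes A :: "('o, 'a, 'g) gfun"
  assumes map_group: "X \<in> Obj C \<Longrightarrow> group (GOb A X)"
    and map_hom: "f \<in> homs C X Y \<Longrightarrow> GAr A f \<in> hom (GOb A X) (GOb A Y)"
    and map_idn: "X \<in> Obj C \<Longrightarrow> g \<in> carrier (GOb A X) \<Longrightarrow> GAr A (Idn C X) g = g"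
    and map_cmp: "f \<in> homs C X Y \<Longrightarrow> f' \<in> homs C Y Z \<Longrightarrow> g \<in> carrier (GOb A X) \<Longrightarrow>
      GAr A (f' \<cdot>\<^bsub>C\<^esub> f) g = GAr A f' (GAr A f g)"

definition gfun_restrict ::
    "('o, 'a, 'x) moncat_scheme \<Rightarrow> ('o, ('o, 'a) qarr, 'g) gfun \<Rightarrow> ('o, 'a, 'g) gfun" where
  "gfun_restrict G A = \<lparr>GOb = GOb A, GAr = (\<lambda>f. GAr A (embed G f))\<rparr>"

definition grothendieck ::
    "('o, 'a, 'x) precat_scheme \<Rightarrow> ('o, 'a, 'g) gfun \<Rightarrow> ('o, 'g \<times> 'a) precat" where
  "grothendieck C A =
    \<lparr>Obj = Obj C,
     Arr = {(h, f). f \<in> Arr C \<and> h \<in> carrier (GOb A (Tgt C f))},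
     Src = (\<lambda>(h, f). Src C f),
     Tgt = (\<lambda>(h, f). Tgt C f),
     Idn = (\<lambda>X. (\<one>\<^bsub>GOb A X\<^esub>, Idn C X)),
     Cmp = (\<lambda>(h', f') (h, f). (h' \<otimes>\<^bsub>GOb A (Tgt C f')\<^esub> GAr A f' h, f' \<cdot>\<^bsub>C\<^esub> f))\<rparr>"

definition groth_section ::
    "('o, 'a, 'x) precat_scheme \<Rightarrow> ('o, 'a, 'g) gfun \<Rightarrow> 'a \<Rightarrow> 'g \<times> 'a" where
  "groth_section C A f = (\<one>\<^bsub>GOb A (Tgt C f)\<^esub>, f)"

text \<open>
  The functor \<open>chi\<close> is given by its action on arrows: composing it with the section yields
  tensoring with \<open>u\<close>, so on objects it is \<open>\<lambda>X. u \<natural> X\<close>.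
\<close>

locale coherent_long_moody_system = long_moody_setting G u z
  for G :: "('o, 'a, 'x) brcat_scheme" (structure) and u z :: 'o +
  fixes A :: "('o, ('o, 'a) qarr, 'g) gfun" and chi :: "'g \<times> 'a \<Rightarrow> 'a"
  assumes A_functor: "group_functor (stage_quillen G u z) A"
    and chi_functor: "cat_functor (grothendieck (stage_groupoid G u z) (gfun_restrict G A))
      (stage_groupoid G u z) (\<lambda>X. u \<natural> X) chi"
    and chi_section: "f \<in> Arr (stage_groupoid G u z) \<Longrightarrow>
      chi (groth_section (stage_groupoid G u z) (gfun_restrict G A) f) = Idn G u \<boxtimes> f"
    and chi_extends: "\<exists>chi'.
      cat_functor (grothendieck (stage_quillen G u z) A) (stage_quillen G u z)
        (\<lambda>X. u \<natural> X) chi' \<and>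
      (\<forall>f \<in> Arr (stage_quillen G u z).
        chi' (groth_section (stage_quillen G u z) A f) =
          Idn (quillen G) u \<boxtimes>\<^bsub>quillen G\<^esub> f) \<and>
      (\<forall>(h, f) \<in> Arr (grothendieck (stage_groupoid G u z) (gfun_restrict G A)).
        chi' (h, embed G f) = embed G (chi (h, f)))"

definition chi_at :: "('o, 'a, 'x) moncat_scheme \<Rightarrow> ('g \<times> 'a \<Rightarrow> 'a) \<Rightarrow> 'o \<Rightarrow> 'g \<Rightarrow> 'a" where
  "chi_at G chi X h = chi (h, Idn G X)"


section \<open>Free products and free groups\<close>

definition fp_words :: "'i set \<Rightarrow> ('i \<Rightarrow> ('g, 'x) monoid_scheme) \<Rightarrow> ('i \<times> 'g) list set" where
  "fp_words I K = {w. \<forall>(i, g) \<in> set w. i \<in> I \<and> g \<in> carrier (K i)}"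

inductive fp_eq ::
    "'i set \<Rightarrow> ('i \<Rightarrow> ('g, 'x) monoid_scheme) \<Rightarrow> ('i \<times> 'g) list \<Rightarrow> ('i \<times> 'g) list \<Rightarrow> bool"
  for I K where
  fp_refl: "w \<in> fp_words I K \<Longrightarrow> fp_eq I K w w"
| fp_sym: "fp_eq I K v w \<Longrightarrow> fp_eq I K w v"
| fp_trans: "fp_eq I K v w \<Longrightarrow> fp_eq I K w x \<Longrightarrow> fp_eq I K v x"
| fp_one: "v \<in> fp_words I K \<Longrightarrow> w \<in> fp_words I K \<Longrightarrow> i \<in> I \<Longrightarrow>
    fp_eq I K (v @ (i, \<one>\<^bsub>K i\<^esub>) # w) (v @ w)"
| fp_mult: "v \<in> fp_words I K \<Longrightarrow> w \<in> fp_words I K \<Longrightarrow> i \<in> I \<Longrightarrow>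
    g \<in> carrier (K i) \<Longrightarrow> h \<in> carrier (K i) \<Longrightarrow>
    fp_eq I K (v @ (i, g) # (i, h) # w) (v @ (i, g \<otimes>\<^bsub>K i\<^esub> h) # w)"

definition free_product ::
    "'i set \<Rightarrow> ('i \<Rightarrow> ('g, 'x) monoid_scheme) \<Rightarrow> ('i \<times> 'g) list set monoid" where
  "free_product I K =
    \<lparr>carrier = {{w. fp_eq I K v w} | v. v \<in> fp_words I K},
     monoid.mult = (\<lambda>P Q. {w. \<exists>p \<in> P. \<exists>q \<in> Q. fp_eq I K (p @ q) w}),
     one = {w. fp_eq I K [] w}\<rparr>"

definition fp_incl ::
    "'i set \<Rightarrow> ('i \<Rightarrow> ('g, 'x) monoid_scheme) \<Rightarrow> 'i \<Rightarrow> 'g \<Rightarrow> ('i \<times> 'g) list set" where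
  "fp_incl I K i g = {w. fp_eq I K [(i, g)] w}"

definition group_pair ::
    "('g, 'x) monoid_scheme \<Rightarrow> ('g, 'x) monoid_scheme \<Rightarrow> bool \<Rightarrow> ('g, 'x) monoid_scheme" where
  "group_pair K L = (\<lambda>second. if second then L else K)"

definition word_value :: "('g, 'x) monoid_scheme \<Rightarrow> ('g \<times> bool) list \<Rightarrow> 'g" where
  "word_value K w =
    foldr (\<lambda>(s, pos) x. (if pos then s else inv\<^bsub>K\<^esub> s) \<otimes>\<^bsub>K\<^esub> x) w \<one>\<^bsub>K\<^esub>"

definition reduced_word :: "('g \<times> bool) list \<Rightarrow> bool" where
  "reduced_word w \<longleftrightarrow> successively (\<lambda>(s, p) (t, q). s = t \<longrightarrow> p = q) w"

definition free_group :: "('g, 'x) monoid_scheme \<Rightarrow> bool" where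
  "free_group K \<longleftrightarrow> group K \<and>
     (\<exists>S \<subseteq> carrier K. generate K S = carrier K \<and>
       (\<forall>w. w \<noteq> [] \<and> fst ` set w \<subseteq> S \<and> reduced_word w \<longrightarrow> word_value K w \<noteq> \<one>\<^bsub>K\<^esub>))"


section \<open>Reliable Long-Moody systems\<close>

inductive_set unit_products :: "('o, 'a, 'x) moncat_scheme \<Rightarrow> 'o \<Rightarrow> 'o \<Rightarrow> 'o set"
  for G u z where
  "Unit G \<in> unit_products G u z"
| "z \<in> unit_products G u z"
| "u \<in> unit_products G u z"
| "X \<in> unit_products G u z \<Longrightarrow> Y \<in> unit_products G u z \<Longrightarrow>
    X \<natural>\<^bsub>G\<^esub> Y \<in> unit_products G u z"

text \<open>
  The values of \<open>A\<close> are free products up to isomorphism. The identification of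
  \<open>A (X \<natural> Y)\<close> with the free product of \<open>A X\<close> and \<open>A Y\<close> is the map \<open>c\<close> below; it turns
  \<open>A (\<iota>\<^sub>X \<natural> id\<^sub>Y)\<close> and \<open>A (id\<^sub>X \<natural> \<iota>\<^sub>Y)\<close> into the canonical inclusions of the second and of
  the first factor. In particular \<open>\<iota>\<^sub>H * id\<close> on \<open>A (stage n)\<close> is \<open>A (\<iota>\<^sub>u \<natural> id)\<close>.
\<close>

locale reliable_long_moody_system = coherent_long_moody_system G u z A chi
  for G :: "('o, 'a, 'x) brcat_scheme" (structure) and u z :: 'o
    and A :: "('o, ('o, 'a) qarr, 'g) gfun" and chi :: "'g \<times> 'a \<Rightarrow> 'a" +
  fixes H H0 :: "'g monoid"
  assumes A_functor_quillen: "group_functor (quillen G) A"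
    and H_group: "group H"
    and H0_group: "group H0"
    and H_nontrivial: "\<not> trivial_group H"
    and A_power: "GOb A (tensor_power G u m) \<cong> free_product {..<m} (\<lambda>_. H)"
    and A_stage: "GOb A (stage G u z n) \<cong> free_product {..n} (\<lambda>i. if i < n then H else H0)"
    and A_free_product:
      "X \<in> unit_products G u z \<Longrightarrow> Y \<in> unit_products G u z \<Longrightarrow>
       \<exists>c \<in> iso (free_product UNIV (group_pair (GOb A X) (GOb A Y))) (GOb A (X \<natural> Y)).
         (\<forall>x \<in> carrier (GOb A X).
            GAr A (Idn (quillen G) X \<boxtimes>\<^bsub>quillen G\<^esub> iota G Y) x =
              c (fp_incl UNIV (group_pair (GOb A X) (GOb A Y)) False x)) \<and>
         (\<forall>y \<in> carrier (GOb A Y).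
            GAr A (iota G X \<boxtimes>\<^bsub>quillen G\<^esub> Idn (quillen G) Y) y =
              c (fp_incl UNIV (group_pair (GOb A X) (GOb A Y)) True y))"
    and chi_braid:
      "h \<in> carrier (GOb A (stage G u z n)) \<Longrightarrow>
       (inv_arrow G (Brd G u u) \<boxtimes> Idn G (stage G u z n)) \<cdot>
         (Idn G u \<boxtimes> chi_at G chi (stage G u z n) h) =
       chi_at G chi (stage G u z (Suc n))
           (GAr A (iota G u \<boxtimes>\<^bsub>quillen G\<^esub> Idn (quillen G) (stage G u z n)) h) \<cdot>
         (inv_arrow G (Brd G u u) \<boxtimes> Idn G (stage G u z n))"


section \<open>Modules, group algebras and tensor products\<close>

definition mod_hom ::
    "('r, 'x) ring_scheme \<Rightarrow> ('r, 'm) module \<Rightarrow> ('r, 'n) module \<Rightarrow> ('m \<Rightarrow> 'n) set" where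
  "mod_hom R M N = {f \<in> carrier M \<rightarrow> carrier N.
     (\<forall>x \<in> carrier M. \<forall>y \<in> carrier M. f (x \<oplus>\<^bsub>M\<^esub> y) = f x \<oplus>\<^bsub>N\<^esub> f y) \<and>
     (\<forall>a \<in> carrier R. \<forall>x \<in> carrier M. f (a \<odot>\<^bsub>M\<^esub> x) = a \<odot>\<^bsub>N\<^esub> f x)}"

text \<open>
  Quotient modules have chosen representatives of the cosets as elements, so that they have the
  same element type as the original module.
\<close>

definition quot_rep :: "('r, 'm) module \<Rightarrow> 'm set \<Rightarrow> 'm \<Rightarrow> 'm" where
  "quot_rep M N x = (SOME y. y \<in> N +>\<^bsub>M\<^esub> x)"

definition quot_module :: "('r, 'm) module \<Rightarrow> 'm set \<Rightarrow> ('r, 'm) module" where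
  "quot_module M N =
    \<lparr>carrier = quot_rep M N ` carrier M,
     monoid.mult = undefined,
     one = undefined,
     zero = quot_rep M N \<zero>\<^bsub>M\<^esub>,
     add = (\<lambda>x y. quot_rep M N (x \<oplus>\<^bsub>M\<^esub> y)),
     smult = (\<lambda>a x. quot_rep M N (a \<odot>\<^bsub>M\<^esub> x))\<rparr>"

definition module_span :: "('r, 'x) ring_scheme \<Rightarrow> ('r, 'm) module \<Rightarrow> 'm set \<Rightarrow> 'm set" where
  "module_span R M S = \<Inter>{N. submodule N R M \<and> S \<subseteq> N}"

definition supp :: "('r, 'x) ring_scheme \<Rightarrow> ('s \<Rightarrow> 'r) \<Rightarrow> 's set" where
  "supp R f = {x. f x \<noteq> \<zero>\<^bsub>R\<^esub>}"

definition single :: "('r, 'x) ring_scheme \<Rightarrow> 's \<Rightarrow> 's \<Rightarrow> 'r" where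
  "single R p = (\<lambda>q. if q = p then \<one>\<^bsub>R\<^esub> else \<zero>\<^bsub>R\<^esub>)"

definition group_algebra :: "('r, 'x) ring_scheme \<Rightarrow> ('g, 'y) monoid_scheme \<Rightarrow> ('r, 'g \<Rightarrow> 'r) module" where
  "group_algebra R K =
    \<lparr>carrier = {f. range f \<subseteq> carrier R \<and> finite (supp R f) \<and> supp R f \<subseteq> carrier K},
     monoid.mult = (\<lambda>f g x. if x \<in> carrier K
        then \<Oplus>\<^bsub>R\<^esub>y \<in> supp R f. f y \<otimes>\<^bsub>R\<^esub> g (inv\<^bsub>K\<^esub> y \<otimes>\<^bsub>K\<^esub> x) else \<zero>\<^bsub>R\<^esub>),
     one = single R \<one>\<^bsub>K\<^esub>,
     zero = (\<lambda>x. \<zero>\<^bsub>R\<^esub>),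
     add = (\<lambda>f g x. f x \<oplus>\<^bsub>R\<^esub> g x),
     smult = (\<lambda>a f x. a \<otimes>\<^bsub>R\<^esub> f x)\<rparr>"

definition augmentation_ideal ::
    "('r, 'x) ring_scheme \<Rightarrow> ('g, 'y) monoid_scheme \<Rightarrow> ('r, 'g \<Rightarrow> 'r) module" where
  "augmentation_ideal R K = (group_algebra R K)
     \<lparr>carrier := {f \<in> carrier (group_algebra R K). (\<Oplus>\<^bsub>R\<^esub>x \<in> supp R f. f x) = \<zero>\<^bsub>R\<^esub>}\<rparr>"

text \<open>The map induced on augmentation ideals by a group homomorphism.\<close>

definition pushforward :: "('r, 'x) ring_scheme \<Rightarrow> ('g \<Rightarrow> 'h) \<Rightarrow> ('g \<Rightarrow> 'r) \<Rightarrow> 'h \<Rightarrow> 'r" where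
  "pushforward R \<alpha> f = (\<lambda>y. \<Oplus>\<^bsub>R\<^esub>x \<in> {x \<in> supp R f. \<alpha> x = y}. f x)"

definition free_module :: "('r, 'x) ring_scheme \<Rightarrow> 's set \<Rightarrow> ('r, 's \<Rightarrow> 'r) module" where
  "free_module R S =
    \<lparr>carrier = {f. range f \<subseteq> carrier R \<and> finite (supp R f) \<and> supp R f \<subseteq> S},
     monoid.mult = undefined,
     one = undefined,
     zero = (\<lambda>x. \<zero>\<^bsub>R\<^esub>),
     add = (\<lambda>f g x. f x \<oplus>\<^bsub>R\<^esub> g x),
     smult = (\<lambda>a f x. a \<otimes>\<^bsub>R\<^esub> f x)\<rparr>"

text \<open>
  Tensor product over an \<open>R\<close>-algebra \<open>S\<close> of a right \<open>S\<close>-module \<open>M\<close> (action \<open>ract\<close>) and a left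
  \<open>S\<close>-module \<open>N\<close> (action \<open>lact\<close>). As the scalars are central, it is the free \<open>R\<close>-module on
  \<open>M \<times> N\<close> modulo biadditivity, \<open>S\<close>-balancedness and \<open>a (m \<otimes> n) = m \<otimes> a n\<close>.
\<close>

definition tensor_relations ::
    "('r, 'x) ring_scheme \<Rightarrow> 's set \<Rightarrow> ('r, 'm) module \<Rightarrow> ('m \<Rightarrow> 's \<Rightarrow> 'm) \<Rightarrow>
     ('r, 'n) module \<Rightarrow> ('s \<Rightarrow> 'n \<Rightarrow> 'n) \<Rightarrow> ('m \<times> 'n \<Rightarrow> 'r) set" where
  "tensor_relations R S M ract N lact = (let E = free_module R (carrier M \<times> carrier N) in
     {single R (m \<oplus>\<^bsub>M\<^esub> m', n) \<ominus>\<^bsub>E\<^esub> (single R (m, n) \<oplus>\<^bsub>E\<^esub> single R (m', n)) | m m' n.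
        m \<in> carrier M \<and> m' \<in> carrier M \<and> n \<in> carrier N} \<union>
     {single R (m, n \<oplus>\<^bsub>N\<^esub> n') \<ominus>\<^bsub>E\<^esub> (single R (m, n) \<oplus>\<^bsub>E\<^esub> single R (m, n')) | m n n'.
        m \<in> carrier M \<and> n \<in> carrier N \<and> n' \<in> carrier N} \<union>
     {single R (ract m s, n) \<ominus>\<^bsub>E\<^esub> single R (m, lact s n) | m s n.
        m \<in> carrier M \<and> s \<in> S \<and> n \<in> carrier N} \<union>
     {a \<odot>\<^bsub>E\<^esub> single R (m, n) \<ominus>\<^bsub>E\<^esub> single R (m, a \<odot>\<^bsub>N\<^esub> n) | a m n.
        a \<in> carrier R \<and> m \<in> carrier M \<and> n \<in> carrier N})"

definition tensor_kernel ::
    "('r, 'x) ring_scheme \<Rightarrow> 's set \<Rightarrow> ('r, 'm) module \<Rightarrow> ('m \<Rightarrow> 's \<Rightarrow> 'm) \<Rightarrow>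
     ('r, 'n) module \<Rightarrow> ('s \<Rightarrow> 'n \<Rightarrow> 'n) \<Rightarrow> ('m \<times> 'n \<Rightarrow> 'r) set" where
  "tensor_kernel R S M ract N lact =
     module_span R (free_module R (carrier M \<times> carrier N)) (tensor_relations R S M ract N lact)"

definition tensor_module ::
    "('r, 'x) ring_scheme \<Rightarrow> 's set \<Rightarrow> ('r, 'm) module \<Rightarrow> ('m \<Rightarrow> 's \<Rightarrow> 'm) \<Rightarrow>
     ('r, 'n) module \<Rightarrow> ('s \<Rightarrow> 'n \<Rightarrow> 'n) \<Rightarrow> ('r, 'm \<times> 'n \<Rightarrow> 'r) module" where
  "tensor_module R S M ract N lact =
     quot_module (free_module R (carrier M \<times> carrier N)) (tensor_kernel R S M ract N lact)"

definition pure_tensor ::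
    "('r, 'x) ring_scheme \<Rightarrow> 's set \<Rightarrow> ('r, 'm) module \<Rightarrow> ('m \<Rightarrow> 's \<Rightarrow> 'm) \<Rightarrow>
     ('r, 'n) module \<Rightarrow> ('s \<Rightarrow> 'n \<Rightarrow> 'n) \<Rightarrow> 'm \<Rightarrow> 'n \<Rightarrow> ('m \<times> 'n \<Rightarrow> 'r)" where
  "pure_tensor R S M ract N lact m n =
     quot_rep (free_module R (carrier M \<times> carrier N)) (tensor_kernel R S M ract N lact)
       (single R (m, n))"


section \<open>Module-valued functors and the Long-Moody functor\<close>

record ('o, 'a, 'r, 'm) mfun =
  MOb :: "'o \<Rightarrow> ('r, 'm) module"
  MAr :: "'a \<Rightarrow> 'm \<Rightarrow> 'm"

locale module_functor = category C
  for R :: "'r ring" and C :: "('o, 'a, 'x) precat_scheme" +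
  fixes F :: "('o, 'a, 'r, 'm) mfun"
  assumes map_module: "X \<in> Obj C \<Longrightarrow> module R (MOb F X)"
    and map_hom: "f \<in> homs C X Y \<Longrightarrow> MAr F f \<in> mod_hom R (MOb F X) (MOb F Y)"
    and map_idn: "X \<in> Obj C \<Longrightarrow> v \<in> carrier (MOb F X) \<Longrightarrow> MAr F (Idn C X) v = v"
    and map_cmp: "f \<in> homs C X Y \<Longrightarrow> g \<in> homs C Y Z \<Longrightarrow> v \<in> carrier (MOb F X) \<Longrightarrow>
      MAr F (g \<cdot>\<^bsub>C\<^esub> f) v = MAr F g (MAr F f v)"

context
  fixes R :: "'r ring"
    and G :: "('o, 'a, 'x) brcat_scheme" (structure)
    and u :: 'o
    and A :: "('o, ('o, 'a) qarr, 'g) gfun"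
    and chi :: "'g \<times> 'a \<Rightarrow> 'a"
begin

definition chi_action ::
    "('o, ('o, 'a) qarr, 'r, 'm) mfun \<Rightarrow> 'o \<Rightarrow> ('g \<Rightarrow> 'r) \<Rightarrow> 'm \<Rightarrow> 'm" where
  "chi_action F X s v = (\<Oplus>\<^bsub>MOb F (u \<natural> X)\<^esub>h \<in> supp R s.
     s h \<odot>\<^bsub>MOb F (u \<natural> X)\<^esub> MAr F (embed G (chi_at G chi X h)) v)"

definition long_moody_ob ::
    "('o, ('o, 'a) qarr, 'r, 'm) mfun \<Rightarrow> 'o \<Rightarrow> ('r, ('g \<Rightarrow> 'r) \<times> 'm \<Rightarrow> 'r) module" where
  "long_moody_ob F X =
     tensor_module R (carrier (group_algebra R (GOb A X)))
       (augmentation_ideal R (GOb A X)) (monoid.mult (group_algebra R (GOb A X)))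
       (MOb F (u \<natural> X)) (chi_action F X)"

definition long_moody_pure ::
    "('o, ('o, 'a) qarr, 'r, 'm) mfun \<Rightarrow> 'o \<Rightarrow> ('g \<Rightarrow> 'r) \<Rightarrow> 'm \<Rightarrow>
     (('g \<Rightarrow> 'r) \<times> 'm \<Rightarrow> 'r)" where
  "long_moody_pure F X i v =
     pure_tensor R (carrier (group_algebra R (GOb A X)))
       (augmentation_ideal R (GOb A X)) (monoid.mult (group_algebra R (GOb A X)))
       (MOb F (u \<natural> X)) (chi_action F X) i v"

text \<open>
  The representative \<open>x\<close> of an element of the tensor product stands for the sum of the
  \<open>x (i, v) (i \<otimes> v)\<close>.
\<close>

definition long_moody :: "('o, ('o, 'a) qarr, 'r, 'm) mfun \<Rightarrow>
    ('o, ('o, 'a) qarr, 'r, ('g \<Rightarrow> 'r) \<times> 'm \<Rightarrow> 'r) mfun" where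
  "long_moody F =
    \<lparr>MOb = long_moody_ob F,
     MAr = (\<lambda>\<phi> x. let T = long_moody_ob F (Tgt (quillen G) \<phi>) in
       \<Oplus>\<^bsub>T\<^esub>p \<in> supp R x. x p \<odot>\<^bsub>T\<^esub>
         long_moody_pure F (Tgt (quillen G) \<phi>) (pushforward R (GAr A \<phi>) (fst p))
           (MAr F (Idn (quillen G) u \<boxtimes>\<^bsub>quillen G\<^esub> \<phi>) (snd p)))\<rparr>"

end


section \<open>Polynomial functors\<close>

definition obj_natural :: "('o, 'a, 'x) brcat_scheme \<Rightarrow> 'o \<Rightarrow> 'o \<Rightarrow> 'o set" where
  "obj_natural G u z = {m \<in> Obj (quillen G).
     \<forall>n. m \<natural>\<^bsub>quillen G\<^esub> stage G u z n \<in> Obj (stage_quillen G u z)}"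

context
  fixes R :: "'r ring"
    and G :: "('o, 'a, 'x) brcat_scheme" (structure)
    and u z :: 'o
begin

definition tau :: "'o \<Rightarrow> ('o, ('o, 'a) qarr, 'r, 'm) mfun \<Rightarrow> ('o, ('o, 'a) qarr, 'r, 'm) mfun" where
  "tau m F = \<lparr>MOb = (\<lambda>X. MOb F (m \<natural> X)),
     MAr = (\<lambda>\<phi>. MAr F (Idn (quillen G) m \<boxtimes>\<^bsub>quillen G\<^esub> \<phi>))\<rparr>"

definition i_trans :: "'o \<Rightarrow> ('o, ('o, 'a) qarr, 'r, 'm) mfun \<Rightarrow> 'o \<Rightarrow> 'm \<Rightarrow> 'm" where
  "i_trans m F X = MAr F (iota G m \<boxtimes>\<^bsub>quillen G\<^esub> Idn (quillen G) X)"

definition delta_image :: "'o \<Rightarrow> ('o, ('o, 'a) qarr, 'r, 'm) mfun \<Rightarrow> 'o \<Rightarrow> 'm set" where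
  "delta_image m F X = i_trans m F X ` carrier (MOb F X)"

definition delta :: "'o \<Rightarrow> ('o, ('o, 'a) qarr, 'r, 'm) mfun \<Rightarrow> ('o, ('o, 'a) qarr, 'r, 'm) mfun" where
  "delta m F = \<lparr>MOb = (\<lambda>X. quot_module (MOb (tau m F) X) (delta_image m F X)),
     MAr = (\<lambda>\<phi> x. quot_rep (MOb (tau m F) (Tgt (quillen G) \<phi>))
        (delta_image m F (Tgt (quillen G) \<phi>)) (MAr (tau m F) \<phi> x))\<rparr>"

definition kappa_at :: "'o \<Rightarrow> ('o, ('o, 'a) qarr, 'r, 'm) mfun \<Rightarrow> 'o \<Rightarrow> 'm set" where
  "kappa_at m F X = {v \<in> carrier (MOb F X). i_trans m F X v = \<zero>\<^bsub>MOb (tau m F) X\<^esub>}"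

definition kappa_zero :: "'o \<Rightarrow> ('o, ('o, 'a) qarr, 'r, 'm) mfun \<Rightarrow> bool" where
  "kappa_zero m F \<longleftrightarrow> (\<forall>X \<in> Obj (stage_quillen G u z). kappa_at m F X = {\<zero>\<^bsub>MOb F X\<^esub>})"

definition kappa :: "('o, ('o, 'a) qarr, 'r, 'm) mfun \<Rightarrow> 'o \<Rightarrow> 'm set" where
  "kappa F X = generate (add_monoid (MOb F X)) (\<Union>m \<in> obj_natural G u z. kappa_at m F X)"

definition zero_functor :: "('o, ('o, 'a) qarr, 'r, 'm) mfun \<Rightarrow> bool" where
  "zero_functor F \<longleftrightarrow> (\<forall>X \<in> Obj (stage_quillen G u z). carrier (MOb F X) = {\<zero>\<^bsub>MOb F X\<^esub>})"

text \<open>Membership in the Serre subcategory \<open>K\<close>.\<close>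

definition stably_zero :: "('o, ('o, 'a) qarr, 'r, 'm) mfun \<Rightarrow> bool" where
  "stably_zero F \<longleftrightarrow> (\<forall>X \<in> Obj (stage_quillen G u z). kappa F X = carrier (MOb F X))"

function strong_pol :: "int \<Rightarrow> ('o, ('o, 'a) qarr, 'r, 'm) mfun \<Rightarrow> bool" where
  "strong_pol d F \<longleftrightarrow>
    (if d < 0 then zero_functor F
     else \<forall>m \<in> obj_natural G u z. strong_pol (d - 1) (delta m F))"
  by pat_completeness auto
termination by (relation "measure (\<lambda>(d, _). nat (d + 1))") auto

function very_strong_pol :: "int \<Rightarrow> ('o, ('o, 'a) qarr, 'r, 'm) mfun \<Rightarrow> bool" where
  "very_strong_pol d F \<longleftrightarrow>
    (if d < 0 then zero_functor F
     else strong_pol d F \<and>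
       (\<forall>m \<in> obj_natural G u z. kappa_zero m F \<and> very_strong_pol (d - 1) (delta m F)))"
  by pat_completeness auto
termination by (relation "measure (\<lambda>(d, _). nat (d + 1))") auto

text \<open>
  The quotient category \<open>St\<close> by \<open>K\<close> has the same objects as the functor category, the quotient
  functor is the identity on objects, the zero objects of \<open>St\<close> are the objects of \<open>K\<close>, and the
  endofunctor of \<open>St\<close> induced by \<open>delta m\<close> agrees with \<open>delta m\<close> on objects.
  Hence \<open>weak_pol d F\<close> says that the image of \<open>F\<close> in \<open>St\<close> is polynomial of degree at most \<open>d\<close>.
\<close>

function weak_pol :: "int \<Rightarrow> ('o, ('o, 'a) qarr, 'r, 'm) mfun \<Rightarrow> bool" where
  "weak_pol d F \<longleftrightarrow>
    (if d < 0 then stably_zero F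
     else \<forall>m \<in> obj_natural G u z. weak_pol (d - 1) (delta m F))"
  by pat_completeness auto
termination by (relation "measure (\<lambda>(d, _). nat (d + 1))") auto

declare strong_pol.simps [simp del] very_strong_pol.simps [simp del] weak_pol.simps [simp del]

text \<open>
  Degrees are natural numbers, so a zero functor has very strong degree 0, and an object of \<open>K\<close>
  has weak degree 0.
\<close>

definition very_strong_pol_of_degree :: "nat \<Rightarrow> ('o, ('o, 'a) qarr, 'r, 'm) mfun \<Rightarrow> bool" where
  "very_strong_pol_of_degree d F \<longleftrightarrow>
     (\<exists>n::nat. very_strong_pol (int n) F) \<and> d = (LEAST n. very_strong_pol (int n) F)"

definition weak_pol_of_degree :: "nat \<Rightarrow> ('o, ('o, 'a) qarr, 'r, 'm) mfun \<Rightarrow> bool" where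
  "weak_pol_of_degree d F \<longleftrightarrow>
     (\<exists>n::nat. weak_pol (int n) F) \<and> d = (LEAST n. weak_pol (int n) F)"

end

end

theory Submission
  imports Defs
begin

text \<open>
 The augmentation ideal is a right module over the group ring, and a derivation \<open>D (g h) v = D g (h v) + D h v\<close>
 is the same as a linear map out of \<open>I \<otimes> V\<close>; \<open>br g v\<close> below is \<open>(g - 1) \<otimes> v\<close>. A derivation on a free product is
 given by its restrictions to the factors, which yields retractions of \<open>I \<otimes> V\<close> along \<open>A (m \<natural> X) \<rightarrow> A (m \<natural> n \<natural> X)\<close>.
 Freeness of the groups makes \<open>I \<otimes> V\<close> a sum of copies of \<open>V\<close>, through the Fox derivatives.

 Upper bound: the cokernel of \<open>LM F \<rightarrow> tau m (LM F)\<close> is an extension of \<open>I\<^bsub>A(m \<natural> X)\<^esub> \<otimes> F\<close> modulo \<open>I\<^bsub>A X\<^esub> \<otimes> F\<close>, of the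
 degree of \<open>F\<close>, by \<open>I \<otimes> delta m F\<close>, treated by induction on the degree.

 Lower bound: Fox derivatives of elements of \<open>A u\<close> are natural maps from the cokernel of \<open>LM F \<rightarrow> tau u (LM F)\<close> to
 \<open>tau u (tau u F)\<close>. If they all vanished on a quotient of the target, \<open>A u\<close> would act trivially there and its
 exponent sums would all be divisible by some \<open>n \<noteq> 1\<close>; as \<open>A u\<close> is a retract of a free group, the Magnus
 representation shows that it would be trivial.
\<close>

text \<open>Reliability decomposes \<open>A\<close> only on products of the generating objects, and
  the resulting retractions depend on choices. They are therefore used at one object at a time, to
  show that a natural map is injective modulo a subfunctor; the maps that must be natural are
  \<open>jj\<close> for the upper bound and the Fox maps \<open>theta\<close> for the lower one.
  With functors kept as pairs, quotients of the coefficients and quotients by part of the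
  augmentation ideal are both described by subgroups of one fixed tensor product, which makes the
  induction uniform.

  Freeness makes \<open>I \<otimes> -\<close> preserve injections, and the vanishing of kernels in
  the very strong case rests on this. In the lower bound it is given for
  \<open>A (u \<natural> z)\<close> but not for its factor \<open>A u\<close>; a basis of the
  former, fixed once for all objects, makes the Fox derivatives natural. The bound reaches
  \<open>tau u (tau u F)\<close> first, and coming down to \<open>F\<close> involves the kernel of
  \<open>F \<rightarrow> tau u F\<close>: it is zero for very strong \<open>F\<close> and stably
  zero always.\<close>

abbreviation (input) cr where "cr == carrier"

section \<open>Modules\<close>

text \<open>Additive subgroups suffice for degrees: whether an element is zero, in a kernel or in an
  image is a question about the additive group, so scalars are not carried through the induction on
  the degree. They enter when tensor products are formed.\<close>

definition asub :: "('r, 'm) module => 'm set => bool" where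
 "asub M N \<longleftrightarrow> N <= cr M & \<zero>\<^bsub>M\<^esub> : N &
   (ALL x:N. ALL y:N. x \<oplus>\<^bsub>M\<^esub> y : N) & (ALL x:N. \<ominus>\<^bsub>M\<^esub> x : N)"

lemma asubD:
 assumes "asub M N"
 shows "N <= cr M" "x : N ==> x : cr M" "\<zero>\<^bsub>M\<^esub> : N"
  "x : N ==> y : N ==> x \<oplus>\<^bsub>M\<^esub> y : N" "x : N ==> \<ominus>\<^bsub>M\<^esub> x : N"
  "x : N ==> y : N ==> x \<ominus>\<^bsub>M\<^esub> y : N"
 using assms unfolding asub_def a_minus_def by auto

lemma asub_finsum:
 assumes "abelian_group M" "asub M N" "finite T" "!!t. t : T ==> f t : N"
 shows "(\<Oplus>\<^bsub>M\<^esub>t\<in>T. f t) : N"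
proof -
 interpret M: abelian_group M by fact
 note N = asubD[OF assms(2)]
 show ?thesis using assms(3,4)
 proof (induction T)
  case (insert t T)
  then have "f : T \<rightarrow> cr M" "f t : cr M" using N(2) by auto
  with insert show ?case by (simp add: N(4))
 qed (simp add: N(3))
qed

text \<open>Meant for families such as all \<open>(g - 1) \<otimes> v\<close>: when \<open>v\<close>
  runs through a whole module, scalars can be absorbed into \<open>v\<close>, so the additive span
  is already closed under them.\<close>

inductive_set aspan :: "('r, 'm) module => 'm set => 'm set" for M S where
 aspan_zero: "\<zero>\<^bsub>M\<^esub> : aspan M S"
| aspan_gen: "x : S ==> x : aspan M S"
| aspan_add: "x : aspan M S ==> y : aspan M S ==> x \<oplus>\<^bsub>M\<^esub> y : aspan M S"
| aspan_inv: "x : aspan M S ==> \<ominus>\<^bsub>M\<^esub> x : aspan M S"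

lemma aspan_least:
 assumes "asub M N" "S <= N" "x : aspan M S"
 shows "x : N"
 using assms(3) by induction (use assms(1,2) in \<open>auto simp: asub_def\<close>)

lemma aspan_mono: "x : aspan M S ==> S <= T ==> x : aspan M T"
 by (induction rule: aspan.induct) (auto intro: aspan.intros)

lemma aspan_asub:
 assumes "abelian_group M" "S <= cr M"
 shows "asub M (aspan M S)"
proof -
 interpret M: abelian_group M by fact
 have "x : cr M" if "x : aspan M S" for x
  using that by induction (use assms(2) in auto)
 then show ?thesis unfolding asub_def by (auto intro: aspan.intros)
qed

definition addmap :: "('r, 'm) module => ('r, 'n) module => ('m => 'n) => bool" where
 "addmap M N f \<longleftrightarrow> f : cr M \<rightarrow> cr N &
   (ALL x:cr M. ALL y:cr M. f (x \<oplus>\<^bsub>M\<^esub> y) = f x \<oplus>\<^bsub>N\<^esub> f y)"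

lemma addmapD:
 assumes "addmap M N f" "abelian_group M" "abelian_group N"
 shows "x : cr M ==> f x : cr N"
  "x : cr M ==> y : cr M ==> f (x \<oplus>\<^bsub>M\<^esub> y) = f x \<oplus>\<^bsub>N\<^esub> f y"
  "f \<zero>\<^bsub>M\<^esub> = \<zero>\<^bsub>N\<^esub>"
  "x : cr M ==> f (\<ominus>\<^bsub>M\<^esub> x) = \<ominus>\<^bsub>N\<^esub> f x"
  "x : cr M ==> y : cr M ==> f (x \<ominus>\<^bsub>M\<^esub> y) = f x \<ominus>\<^bsub>N\<^esub> f y"
proof -
 interpret M: abelian_group M by fact
 interpret N: abelian_group N by fact
 have c: "f x : cr N" if "x : cr M" for x using that assms(1) by (auto simp: addmap_def)
 have a: "f (x \<oplus>\<^bsub>M\<^esub> y) = f x \<oplus>\<^bsub>N\<^esub> f y" if "x : cr M" "y : cr M" for x y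
  using that assms(1) by (auto simp: addmap_def)
 have z: "f \<zero>\<^bsub>M\<^esub> = \<zero>\<^bsub>N\<^esub>"
  using a[of "\<zero>\<^bsub>M\<^esub>" "\<zero>\<^bsub>M\<^esub>"] c[of "\<zero>\<^bsub>M\<^esub>"] by (metis M.zero_closed M.l_zero N.add.l_cancel_one N.r_zero)
 have i: "f (\<ominus>\<^bsub>M\<^esub> x) = \<ominus>\<^bsub>N\<^esub> f x" if "x : cr M" for x
  using a[of "\<ominus>\<^bsub>M\<^esub> x" x] z c that
  by (metis M.a_inv_closed M.l_neg N.minus_equality)
 show "x : cr M ==> f x : cr N"
  "x : cr M ==> y : cr M ==> f (x \<oplus>\<^bsub>M\<^esub> y) = f x \<oplus>\<^bsub>N\<^esub> f y"
  "f \<zero>\<^bsub>M\<^esub> = \<zero>\<^bsub>N\<^esub>"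
  "x : cr M ==> f (\<ominus>\<^bsub>M\<^esub> x) = \<ominus>\<^bsub>N\<^esub> f x"
  "x : cr M ==> y : cr M ==> f (x \<ominus>\<^bsub>M\<^esub> y) = f x \<ominus>\<^bsub>N\<^esub> f y"
  using c a z i by (auto simp: a_minus_def)
qed

lemma mod_hom_addmap: "f : mod_hom R M N ==> addmap M N f"
 by (auto simp: mod_hom_def addmap_def)

lemma mod_homI:
 assumes "!!x. x : cr M ==> f x : cr N"
  "!!x y. x : cr M ==> y : cr M ==> f (x \<oplus>\<^bsub>M\<^esub> y) = f x \<oplus>\<^bsub>N\<^esub> f y"
  "!!a x. a : cr R ==> x : cr M ==> f (a \<odot>\<^bsub>M\<^esub> x) = a \<odot>\<^bsub>N\<^esub> f x"
 shows "f : mod_hom R M N"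
 using assms by (auto simp: mod_hom_def)

lemma mod_homD:
 assumes "f : mod_hom R M N"
 shows "x : cr M ==> f x : cr N"
  "x : cr M ==> y : cr M ==> f (x \<oplus>\<^bsub>M\<^esub> y) = f x \<oplus>\<^bsub>N\<^esub> f y"
  "a : cr R ==> x : cr M ==> f (a \<odot>\<^bsub>M\<^esub> x) = a \<odot>\<^bsub>N\<^esub> f x"
 using assms by (auto simp: mod_hom_def)

lemma mod_hom_comp: "f : mod_hom R M N ==> g : mod_hom R N P ==> (%x. g (f x)) : mod_hom R M P"
 by (auto simp: mod_hom_def Pi_iff)

lemma module_abelian: "module R M ==> abelian_group M"
 by (simp add: module_def)

lemma addmap_aspan:
 assumes "addmap M N f" "abelian_group M" "abelian_group N" "S <= cr M" "x : aspan M S"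
 shows "f x : aspan N (f ` S)"
 using assms(5)
proof induction
 case (aspan_add x y)
 then show ?case using asubD(2)[OF aspan_asub[OF assms(2,4)]]
  by (simp add: addmapD(2)[OF assms(1-3)] aspan.intros)
next
 case (aspan_inv x)
 then show ?case using asubD(2)[OF aspan_asub[OF assms(2,4)]]
  by (simp add: addmapD(4)[OF assms(1-3)] aspan.intros)
qed (auto simp: addmapD(3)[OF assms(1-3)] intro: aspan.intros)

lemma addmap_zero_on_aspan:
 assumes "addmap M N f" "abelian_group M" "abelian_group N" "S <= cr M" "x : aspan M S"
  "!!s. s : S ==> f s : N'" "asub N N'"
 shows "f x : N'"
 using addmap_aspan[OF assms(1-5)] aspan_least[OF assms(7)] assms(6) by (metis image_subsetI)

lemma addmap_eq_on_aspan:
 assumes "addmap M N f" "addmap M N g" "abelian_group M" "abelian_group N" "S <= cr M"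
  "x : aspan M S" "!!s. s : S ==> f s = g s"
 shows "f x = g x"
 using assms(6)
proof induction
 case (aspan_add x y)
 then show ?case using asubD(2)[OF aspan_asub[OF assms(3,5)]]
  by (simp add: addmapD(2)[OF assms(1,3,4)] addmapD(2)[OF assms(2,3,4)])
next
 case (aspan_inv x)
 then show ?case using asubD(2)[OF aspan_asub[OF assms(3,5)]]
  by (simp add: addmapD(4)[OF assms(1,3,4)] addmapD(4)[OF assms(2,3,4)])
qed (auto simp: addmapD(3)[OF assms(1,3,4)] addmapD(3)[OF assms(2,3,4)] assms(7))

section \<open>Quotients\<close>

lemma a_r_coset_iff: "y : N +>\<^bsub>M\<^esub> x \<longleftrightarrow> (EX n:N. y = n \<oplus>\<^bsub>M\<^esub> x)"
 by (auto simp: a_r_coset_def r_coset_def)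

locale module_quotient =
 M: abelian_group M for M :: "('r, 'm) module" +
 fixes N assumes asub: "asub M N"
begin

lemmas N = asubD[OF asub]

abbreviation q where "q == quot_rep M N"

lemma q_ex: "x : cr M ==> EX n:N. q x = n \<oplus>\<^bsub>M\<^esub> x"
proof -
 have "\<zero>\<^bsub>M\<^esub> \<oplus>\<^bsub>M\<^esub> x : N +>\<^bsub>M\<^esub> x" using N(3) by (auto simp: a_r_coset_iff)
 then have "q x : N +>\<^bsub>M\<^esub> x" unfolding quot_rep_def by (rule someI)
 then show ?thesis by (simp add: a_r_coset_iff)
qed

lemma q_closed: "x : cr M ==> q x : cr M"
 using q_ex[of x] N(2) by auto

text \<open>Elements of the quotient are chosen representatives. The choice looks at the coset
  alone, so congruent elements receive the same representative; this makes \<open>q\<close> a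
  projection although it takes values in \<open>M\<close> itself.\<close>

lemma q_eq_iff:
 assumes "x : cr M" "y : cr M"
 shows "q x = q y \<longleftrightarrow> x \<ominus>\<^bsub>M\<^esub> y : N"
proof
 assume eq: "q x = q y"
 obtain n n' where n: "n : N" "n' : N" "q x = n \<oplus>\<^bsub>M\<^esub> x" "q y = n' \<oplus>\<^bsub>M\<^esub> y"
  using q_ex[OF assms(1)] q_ex[OF assms(2)] by auto
 have c: "n : cr M" "n' : cr M" using N(2) n(1,2) by blast+
 have "n \<oplus>\<^bsub>M\<^esub> x = n' \<oplus>\<^bsub>M\<^esub> y" using n eq by simp
 then have "x = \<ominus>\<^bsub>M\<^esub> n \<oplus>\<^bsub>M\<^esub> (n' \<oplus>\<^bsub>M\<^esub> y)" using c assms by (metis M.r_neg1)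
 then have "x \<ominus>\<^bsub>M\<^esub> y = \<ominus>\<^bsub>M\<^esub> n \<oplus>\<^bsub>M\<^esub> n'"
  using c assms by (simp add: a_minus_def M.a_assoc M.r_neg)
 then show "x \<ominus>\<^bsub>M\<^esub> y : N" using n N by auto
next
 assume d: "x \<ominus>\<^bsub>M\<^esub> y : N"
 have "(EX n:N. z = n \<oplus>\<^bsub>M\<^esub> x) = (EX n:N. z = n \<oplus>\<^bsub>M\<^esub> y)" for z
 proof
  assume "EX n:N. z = n \<oplus>\<^bsub>M\<^esub> x"
  then obtain n where n: "n : N" "z = n \<oplus>\<^bsub>M\<^esub> x" by blast
  have "z = (n \<oplus>\<^bsub>M\<^esub> (x \<ominus>\<^bsub>M\<^esub> y)) \<oplus>\<^bsub>M\<^esub> y"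
   using n N(2) assms by (simp add: a_minus_def M.a_assoc M.l_neg)
  then show "EX n:N. z = n \<oplus>\<^bsub>M\<^esub> y" using n d N by blast
 next
  assume "EX n:N. z = n \<oplus>\<^bsub>M\<^esub> y"
  then obtain n where n: "n : N" "z = n \<oplus>\<^bsub>M\<^esub> y" by blast
  have "z = (n \<ominus>\<^bsub>M\<^esub> (x \<ominus>\<^bsub>M\<^esub> y)) \<oplus>\<^bsub>M\<^esub> x"
   using n N(2) assms by (simp add: a_minus_def M.a_assoc M.l_neg M.minus_add M.a_comm[of "\<ominus>\<^bsub>M\<^esub> x"])
  then show "EX n:N. z = n \<oplus>\<^bsub>M\<^esub> x" using n d N(6) by blast
 qed
 then show "q x = q y" unfolding quot_rep_def a_r_coset_iff by simp
qed

lemma q_add: "x : cr M ==> y : cr M ==> q (x \<oplus>\<^bsub>M\<^esub> y) = q x \<oplus>\<^bsub>quot_module M N\<^esub> q y"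
proof -
 assume c: "x : cr M" "y : cr M"
 obtain n n' where n: "n : N" "n' : N" "q x = n \<oplus>\<^bsub>M\<^esub> x" "q y = n' \<oplus>\<^bsub>M\<^esub> y"
  using q_ex[OF c(1)] q_ex[OF c(2)] by auto
 have nc: "n : cr M" "n' : cr M" using N(2) n(1,2) by blast+
 have "q x \<oplus>\<^bsub>M\<^esub> q y \<ominus>\<^bsub>M\<^esub> (x \<oplus>\<^bsub>M\<^esub> y) = n \<oplus>\<^bsub>M\<^esub> n'"
  using nc c unfolding n a_minus_def
  by (simp add: M.minus_add M.a_ac M.r_neg M.r_neg1 M.r_neg2)
 then have "q (q x \<oplus>\<^bsub>M\<^esub> q y) = q (x \<oplus>\<^bsub>M\<^esub> y)"
  using q_eq_iff c n N(4) q_closed by (metis M.add.m_closed)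
 then show ?thesis by (simp add: quot_module_def)
qed

lemma q_carrier: "x : cr M ==> q x : cr (quot_module M N)"
 by (simp add: quot_module_def)

lemma q_surj: "cr (quot_module M N) = q ` cr M"
 by (simp add: quot_module_def)

lemma q_zero: "\<zero>\<^bsub>quot_module M N\<^esub> = q \<zero>\<^bsub>M\<^esub>"
 by (simp add: quot_module_def)

lemma q_zero_iff: "x : cr M ==> q x = \<zero>\<^bsub>quot_module M N\<^esub> \<longleftrightarrow> x : N"
 unfolding q_zero using q_eq_iff[of x "\<zero>\<^bsub>M\<^esub>"]
 by (simp add: a_minus_def M.minus_equality[of "\<zero>\<^bsub>M\<^esub>" "\<zero>\<^bsub>M\<^esub>"])

end

lemma abelian_group_image:
 assumes "abelian_group M" "cr Q = p ` cr M" "\<zero>\<^bsub>Q\<^esub> = p \<zero>\<^bsub>M\<^esub>"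
  "!!x y. x : cr M ==> y : cr M ==> p (x \<oplus>\<^bsub>M\<^esub> y) = p x \<oplus>\<^bsub>Q\<^esub> p y"
 shows "abelian_group Q"
proof -
 interpret M: abelian_group M by fact
 show ?thesis
 proof (rule abelian_groupI)
  fix x assume "x : cr Q"
  then obtain a where a: "x = p a" "a : cr M" using assms(2) by auto
  show "EX y:cr Q. y \<oplus>\<^bsub>Q\<^esub> x = \<zero>\<^bsub>Q\<^esub>"
   using assms(4)[of "\<ominus>\<^bsub>M\<^esub> a" a] a by (auto simp: assms(2,3) M.l_neg intro!: bexI[of _ "\<ominus>\<^bsub>M\<^esub> a"])
 next
  fix x y z assume "x : cr Q" "y : cr Q" "z : cr Q"
  then obtain a b c where a: "x = p a" "a : cr M" "y = p b" "b : cr M"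
   "z = p c" "c : cr M" using assms(2) by auto
  show "x \<oplus>\<^bsub>Q\<^esub> y \<oplus>\<^bsub>Q\<^esub> z = x \<oplus>\<^bsub>Q\<^esub> (y \<oplus>\<^bsub>Q\<^esub> z)"
   using a by (simp flip: assms(4) add: M.a_assoc)
 next
  fix x y assume "x : cr Q" "y : cr Q"
  then obtain a b where a: "x = p a" "a : cr M" "y = p b" "b : cr M"
   using assms(2) by auto
  show "x \<oplus>\<^bsub>Q\<^esub> y = y \<oplus>\<^bsub>Q\<^esub> x" using a by (simp flip: assms(4) add: M.a_comm)
  show "x \<oplus>\<^bsub>Q\<^esub> y : cr Q" using a by (simp flip: assms(4) add: assms(2))
 next
  fix x assume "x : cr Q"
  then obtain a where a: "x = p a" "a : cr M" using assms(2) by auto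
  show "\<zero>\<^bsub>Q\<^esub> \<oplus>\<^bsub>Q\<^esub> x = x" using a by (simp flip: assms(4) add: assms(3))
 qed (simp add: assms(2,3))
qed

lemma (in module_quotient) quot_abelian: "abelian_group (quot_module M N)"
 by (rule abelian_group_image[where p = q, OF M.abelian_group_axioms]) (simp_all add: q_surj q_zero q_add)

lemma quot_smult:
 assumes "module R M" "asub M N" "ALL a:cr R. ALL x:N. a \<odot>\<^bsub>M\<^esub> x : N"
  "a : cr R" "x : cr M"
 shows "quot_rep M N (a \<odot>\<^bsub>M\<^esub> x) = a \<odot>\<^bsub>quot_module M N\<^esub> quot_rep M N x"
proof -
 interpret M: module R M by fact
 interpret Q: module_quotient M N
  by (simp add: module_quotient_def module_quotient_axioms_def M.abelian_group_axioms assms(2))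
 obtain n where n: "n : N" "Q.q x = n \<oplus>\<^bsub>M\<^esub> x" using Q.q_ex[OF assms(5)] by metis
 have nc: "n : cr M" by (rule Q.N(2)[OF n(1)])
 have "a \<odot>\<^bsub>M\<^esub> Q.q x \<ominus>\<^bsub>M\<^esub> a \<odot>\<^bsub>M\<^esub> x = a \<odot>\<^bsub>M\<^esub> n"
  using n nc assms(4,5) by (simp add: M.smult_r_distr a_minus_def M.a_assoc M.M.r_neg)
 then have "Q.q (a \<odot>\<^bsub>M\<^esub> Q.q x) = Q.q (a \<odot>\<^bsub>M\<^esub> x)"
  using Q.q_eq_iff assms n Q.q_closed by (metis M.smult_closed)
 then show ?thesis by (simp add: quot_module_def)
qed

lemma quot_is_module:
 assumes "module R M" "asub M N" "ALL a:cr R. ALL x:N. a \<odot>\<^bsub>M\<^esub> x : N"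
 shows "module R (quot_module M N)"
proof -
 interpret M: module R M by fact
 interpret Q: module_quotient M N
  by (simp add: module_quotient_def module_quotient_axioms_def M.abelian_group_axioms assms(2))
 note s = quot_smult[OF assms]
 show ?thesis
 proof (rule moduleI)
  show "cring R" by (rule M.is_cring)
  show "abelian_group (quot_module M N)" by (rule Q.quot_abelian)
 next
  fix a x assume a: "a : cr R" and "x : cr (quot_module M N)"
  then obtain c where c: "x = Q.q c" "c : cr M" by (auto simp: Q.q_surj)
  show "a \<odot>\<^bsub>quot_module M N\<^esub> x : cr (quot_module M N)"
   using a c by (simp add: Q.q_carrier flip: s)
  fix y assume "y : cr (quot_module M N)"
  then obtain d where d: "y = Q.q d" "d : cr M" by (auto simp: Q.q_surj)
  show "a \<odot>\<^bsub>quot_module M N\<^esub> (x \<oplus>\<^bsub>quot_module M N\<^esub> y) =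
    a \<odot>\<^bsub>quot_module M N\<^esub> x \<oplus>\<^bsub>quot_module M N\<^esub> a \<odot>\<^bsub>quot_module M N\<^esub> y"
   using a c d by (simp add: M.smult_r_distr flip: s Q.q_add)
 next
  fix a b x assume a: "a : cr R" "b : cr R" and "x : cr (quot_module M N)"
  then obtain c where c: "x = Q.q c" "c : cr M" by (auto simp: Q.q_surj)
  show "(a \<oplus>\<^bsub>R\<^esub> b) \<odot>\<^bsub>quot_module M N\<^esub> x =
    a \<odot>\<^bsub>quot_module M N\<^esub> x \<oplus>\<^bsub>quot_module M N\<^esub> b \<odot>\<^bsub>quot_module M N\<^esub> x"
   "(a \<otimes>\<^bsub>R\<^esub> b) \<odot>\<^bsub>quot_module M N\<^esub> x = a \<odot>\<^bsub>quot_module M N\<^esub> (b \<odot>\<^bsub>quot_module M N\<^esub> x)"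
   using a c by (simp_all add: M.smult_l_distr M.smult_assoc1 flip: s Q.q_add)
 next
  fix x assume "x : cr (quot_module M N)"
  then obtain c where c: "x = Q.q c" "c : cr M" by (auto simp: Q.q_surj)
  then show "\<one>\<^bsub>R\<^esub> \<odot>\<^bsub>quot_module M N\<^esub> x = x" by (simp flip: s)
 qed
qed

section \<open>Free products\<close>

definition fpval :: "('k, 'y) monoid_scheme => ('i => 'g => 'k) => ('i \<times> 'g) list => 'k" where
 "fpval L f w = foldr (%(i, g) x. f i g \<otimes>\<^bsub>L\<^esub> x) w \<one>\<^bsub>L\<^esub>"

lemma fp_words_simps [simp]:
 "[] : fp_words I K"
 "(i, g) # w : fp_words I K \<longleftrightarrow> i : I & g : cr (K i) & w : fp_words I K"
 "v @ w : fp_words I K \<longleftrightarrow> v : fp_words I K & w : fp_words I K"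
 by (auto simp: fp_words_def)

text \<open>The calculus of words and the induced map to \<open>L\<close> are developed together.
  Where facts about the free product itself are wanted, the maps to \<open>L\<close> can be taken
  constant.\<close>

locale fp_target =
 fixes I :: "'i set" and K :: "'i => ('g, 'x) monoid_scheme" and L :: "('k, 'y) monoid_scheme"
  and f :: "'i => 'g => 'k"
 assumes K: "!!i. i : I ==> group (K i)" and L: "group L"
  and f: "!!i. i : I ==> f i : hom (K i) L"
begin

interpretation L: group L by (rule L)

lemma f_one: "i : I ==> f i \<one>\<^bsub>K i\<^esub> = \<one>\<^bsub>L\<^esub>"
 using hom_one[OF f] K L by auto

lemma f_carrier: "i : I ==> g : cr (K i) ==> f i g : cr L"
 using f by (auto simp: hom_def)

lemma f_mult: "i : I ==> g : cr (K i) ==> h : cr (K i) ==>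
 f i (g \<otimes>\<^bsub>K i\<^esub> h) = f i g \<otimes>\<^bsub>L\<^esub> f i h"
 using f by (auto simp: hom_def)

lemma fpval_simps [simp]:
 "fpval L f [] = \<one>\<^bsub>L\<^esub>" "fpval L f ((i, g) # w) = f i g \<otimes>\<^bsub>L\<^esub> fpval L f w"
 by (simp_all add: fpval_def)

lemma fpval_closed: "w : fp_words I K ==> fpval L f w : cr L"
 by (induction w) (auto simp: f_carrier)

lemma fpval_append: "v : fp_words I K ==> w : fp_words I K ==>
 fpval L f (v @ w) = fpval L f v \<otimes>\<^bsub>L\<^esub> fpval L f w"
 by (induction v) (auto simp: f_carrier fpval_closed L.m_assoc)

lemma fp_eq_words: "fp_eq I K v w ==> v : fp_words I K & w : fp_words I K"
proof (induction rule: fp_eq.induct)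
 case (fp_one v w i)
 then show ?case using K[of i] by (simp add: group.is_monoid)
next
 case (fp_mult v w i g h)
 then show ?case using K[of i] by (simp add: group.is_monoid monoid.m_closed)
qed auto

lemma fp_eq_val: "fp_eq I K v w ==> fpval L f v = fpval L f w"
proof (induction rule: fp_eq.induct)
 case (fp_one v w i)
 then show ?case using K[of i]
  by (simp add: fpval_append group.is_monoid f_one fpval_closed)
next
 case (fp_mult v w i g h)
 then show ?case using K[of i]
  by (simp add: fpval_append group.is_monoid monoid.m_closed f_mult fpval_closed f_carrier L.m_assoc)
qed auto

lemma fp_eq_prepend: "fp_eq I K v w ==> x : fp_words I K ==> fp_eq I K (x @ v) (x @ w)"
proof (induction rule: fp_eq.induct)
 case (fp_one v w i)
 then show ?case using fp_eq.fp_one[of "x @ v" I K w i] by simp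
next
 case (fp_mult v w i g h)
 then show ?case using fp_eq.fp_mult[of "x @ v" I K w i g h] by simp
qed (auto intro: fp_eq.intros)

lemma fp_eq_append: "fp_eq I K v w ==> x : fp_words I K ==> fp_eq I K (v @ x) (w @ x)"
proof (induction rule: fp_eq.induct)
 case (fp_one v w i)
 then show ?case using fp_eq.fp_one[of v I K "w @ x" i] by simp
next
 case (fp_mult v w i g h)
 then show ?case using fp_eq.fp_mult[of v I K "w @ x" i g h] by simp
qed (auto intro: fp_eq.intros)

definition cls where "cls v = {w. fp_eq I K v w}"

lemma cls_mem: "v : fp_words I K ==> v : cls v"
 by (auto simp: cls_def intro: fp_eq.fp_refl)

lemma cls_mult:
 assumes "v : fp_words I K" "w : fp_words I K"
 shows "cls v \<otimes>\<^bsub>free_product I K\<^esub> cls w = cls (v @ w)"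
proof -
 have "fp_eq I K (v @ w) x" if "fp_eq I K v p" "fp_eq I K w q" "fp_eq I K (p @ q) x" for p q x
 proof -
  have "fp_eq I K (v @ w) (p @ w)" using that(1) assms(2) by (rule fp_eq_append)
  moreover have "fp_eq I K (p @ w) (p @ q)"
   using that(2) fp_eq_words[OF that(1)] by (auto intro: fp_eq_prepend)
  ultimately show ?thesis using that(3) by (blast intro: fp_eq.fp_trans)
 qed
 moreover have "fp_eq I K v v" "fp_eq I K w w" using assms by (auto intro: fp_eq.fp_refl)
 ultimately show ?thesis by (auto simp: free_product_def cls_def)
qed

lemma free_product_carrier: "cr (free_product I K) = cls ` fp_words I K"
 by (auto simp: free_product_def cls_def)

definition fplift where "fplift P = fpval L f (SOME w. w : P)"

lemma fplift_cls: "v : fp_words I K ==> fplift (cls v) = fpval L f v"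
 unfolding fplift_def using someI[of "%w. w : cls v" v] cls_mem[of v]
 by (auto simp: cls_def dest: fp_eq_val)

lemma fplift_hom: "fplift : hom (free_product I K) L"
 by (rule homI) (auto simp: free_product_carrier fplift_cls fpval_closed cls_mult fpval_append)

lemma fplift_incl: "i : I ==> g : cr (K i) ==> fplift (fp_incl I K i g) = f i g"
 using fplift_cls[of "[(i, g)]"] by (auto simp: cls_def fp_incl_def f_carrier)

lemma fp_incl_hom: "i : I ==> g : cr (K i) ==> h : cr (K i) ==>
 fp_incl I K i (g \<otimes>\<^bsub>K i\<^esub> h) = fp_incl I K i g \<otimes>\<^bsub>free_product I K\<^esub> fp_incl I K i h"
proof -
 assume a: "i : I" "g : cr (K i)" "h : cr (K i)"
 have e: "fp_eq I K [(i, g), (i, h)] [(i, g \<otimes>\<^bsub>K i\<^esub> h)]"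
  using fp_eq.fp_mult[of "[]" I K "[]" i g h] a by simp
 then have "cls [(i, g), (i, h)] = cls [(i, g \<otimes>\<^bsub>K i\<^esub> h)]"
  by (auto simp: cls_def intro: fp_eq.fp_trans fp_eq.fp_sym)
 then show ?thesis using cls_mult[of "[(i, g)]" "[(i, h)]"] a
  by (simp add: fp_incl_def cls_def)
qed

lemma fp_incl_carrier: "i : I ==> g : cr (K i) ==> fp_incl I K i g : cr (free_product I K)"
 by (auto simp: free_product_carrier cls_def fp_incl_def)

lemma free_product_induct:
 assumes "p : cr (free_product I K)" "P \<one>\<^bsub>free_product I K\<^esub>"
  "!!i g p. i : I ==> g : cr (K i) ==> p : cr (free_product I K) ==> P p ==>
   P (fp_incl I K i g \<otimes>\<^bsub>free_product I K\<^esub> p)"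
 shows "P p"
proof -
 have "P (cls w)" if "w : fp_words I K" for w
  using that
 proof (induction w)
  case Nil
  then show ?case using assms(2) by (simp add: free_product_def cls_def)
 next
  case (Cons a w)
  obtain i g where a: "a = (i, g)" by force
  with Cons have "cls (a # w) = fp_incl I K i g \<otimes>\<^bsub>free_product I K\<^esub> cls w"
   using cls_mult[of "[(i, g)]" w] by (simp add: fp_incl_def cls_def)
  then show ?case using assms(3)[of i g "cls w"] Cons a by (simp add: free_product_carrier)
 qed
 then show ?thesis using assms(1) by (auto simp: free_product_carrier)
qed

end

text \<open>A universal property would have to quantify over target groups of all types, so the
  coproduct is expressed by an isomorphism with the word model, from which the property follows for
  targets of any type. The intermediate groups \<open>Q1\<close> and \<open>Q2\<close> let the
  notion be transported along isomorphisms of the factors.\<close>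

definition is_coproduct :: "'g monoid => 'g monoid => 'g monoid => ('g => 'g) => ('g => 'g) => bool" where
 "is_coproduct Z B1 B2 i1 i2 \<longleftrightarrow> group Z & group B1 & group B2 &
   (\<exists>(Q1 :: 'g monoid) (Q2 :: 'g monoid) g1 g2 c. group Q1 & group Q2 & g1 : iso B1 Q1 & g2 : iso B2 Q2 &
    c : iso (free_product UNIV (group_pair Q1 Q2)) Z &
    (ALL x:cr B1. i1 x = c (fp_incl UNIV (group_pair Q1 Q2) False (g1 x))) &
    (ALL x:cr B2. i2 x = c (fp_incl UNIV (group_pair Q1 Q2) True (g2 x))))"

lemma coproductE:
 fixes Z B1 B2 :: "'g monoid"
 assumes "is_coproduct Z B1 B2 i1 i2"
 obtains Q1 Q2 :: "'g monoid" and g1 g2 c where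
  "group Q1" "group Q2" "g1 : iso B1 Q1" "g2 : iso B2 Q2"
  "c : iso (free_product UNIV (group_pair Q1 Q2)) Z"
  "ALL x:cr B1. i1 x = c (fp_incl UNIV (group_pair Q1 Q2) False (g1 x))"
  "ALL x:cr B2. i2 x = c (fp_incl UNIV (group_pair Q1 Q2) True (g2 x))"
 using assms unfolding is_coproduct_def by blast

lemma isoD: "f : iso G H ==> f : hom G H" "f : iso G H ==> bij_betw f (cr G) (cr H)"
 by (auto simp: iso_def)

lemma coproduct_universal:
 fixes Z B1 B2 :: "'g monoid" and L :: "('k, 'y) monoid_scheme"
 assumes "is_coproduct Z B1 B2 i1 i2" "group L" "f1 : hom B1 L" "f2 : hom B2 L"
 shows "EX f:hom Z L. (ALL x:cr B1. f (i1 x) = f1 x) & (ALL x:cr B2. f (i2 x) = f2 x)"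
proof -
 from assms(1) obtain Q1 Q2 :: "'g monoid" and g1 g2 c where Q: "group Q1" "group Q2" "g1 : iso B1 Q1" "g2 : iso B2 Q2"
  "c : iso (free_product UNIV (group_pair Q1 Q2)) Z"
  "ALL x:cr B1. i1 x = c (fp_incl UNIV (group_pair Q1 Q2) False (g1 x))"
  "ALL x:cr B2. i2 x = c (fp_incl UNIV (group_pair Q1 Q2) True (g2 x))"
  by (rule coproductE)
 have grp: "group Z" "group B1" "group B2" using assms(1) by (auto simp: is_coproduct_def)
 define h1 where "h1 = inv_into (cr B1) g1"
 define h2 where "h2 = inv_into (cr B2) g2"
 have h: "h1 : hom Q1 B1" "h2 : hom Q2 B2"
  using group.iso_set_sym[OF grp(2) Q(3)] group.iso_set_sym[OF grp(3) Q(4)] h1_def h2_def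
  by (auto simp: iso_def)
 define k where "k = (%b. if b then f2 \<circ> h2 else f1 \<circ> h1)"
 interpret T: fp_target UNIV "group_pair Q1 Q2" L k
 proof (rule fp_target.intro)
  show "k i : hom (group_pair Q1 Q2 i) L" for i
   using hom_compose[OF h(1) assms(3)] hom_compose[OF h(2) assms(4)]
   by (auto simp: k_def group_pair_def)
  show "group (group_pair Q1 Q2 i)" for i
   using Q(1,2) by (simp add: group_pair_def)
 qed (rule assms(2))
 define d where "d = inv_into (cr (free_product UNIV (group_pair Q1 Q2))) c"
 note cb = isoD(2)[OF Q(5)]
 have dc: "d (c p) = p" if "p : cr (free_product UNIV (group_pair Q1 Q2))" for p
  using that cb by (auto simp: d_def bij_betw_def)
 have cd: "c (d z) = z" "d z : cr (free_product UNIV (group_pair Q1 Q2))" if "z : cr Z" for z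
  using that cb bij_betw_inv_into[OF cb] unfolding d_def
  by (auto simp: bij_betw_inv_into_right) (auto simp: bij_betw_def)
 have mc: "p \<otimes>\<^bsub>free_product UNIV (group_pair Q1 Q2)\<^esub> q : cr (free_product UNIV (group_pair Q1 Q2))"
  if "p : cr (free_product UNIV (group_pair Q1 Q2))" "q : cr (free_product UNIV (group_pair Q1 Q2))" for p q
  using that by (auto simp: T.free_product_carrier T.cls_mult)
 have dhom: "d : hom Z (free_product UNIV (group_pair Q1 Q2))"
 proof (rule homI)
  fix x y assume xy: "x : cr Z" "y : cr Z"
  have "c (d x \<otimes>\<^bsub>free_product UNIV (group_pair Q1 Q2)\<^esub> d y) = x \<otimes>\<^bsub>Z\<^esub> y"
   using isoD(1)[OF Q(5)] cd xy by (simp add: hom_def)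
  then show "d (x \<otimes>\<^bsub>Z\<^esub> y) = d x \<otimes>\<^bsub>free_product UNIV (group_pair Q1 Q2)\<^esub> d y"
   using dc mc cd xy by metis
 qed (use cd in auto)
 have "T.fplift \<circ> d : hom Z L" using hom_compose[OF dhom T.fplift_hom] .
 moreover have "(T.fplift \<circ> d) (i1 x) = f1 x" if "x : cr B1" for x
 proof -
  have "g1 x : cr Q1" using isoD(1)[OF Q(3)] that by (auto simp: hom_def)
  moreover have "h1 (g1 x) = x" using isoD(2)[OF Q(3)] that by (auto simp: h1_def bij_betw_def)
  ultimately show ?thesis
   using that Q(6) T.fplift_incl[of False "g1 x"] T.fp_incl_carrier[of False "g1 x"]
   by (simp add: dc group_pair_def k_def)
 qed
 moreover have "(T.fplift \<circ> d) (i2 x) = f2 x" if "x : cr B2" for x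
 proof -
  have "g2 x : cr Q2" using isoD(1)[OF Q(4)] that by (auto simp: hom_def)
  moreover have "h2 (g2 x) = x" using isoD(2)[OF Q(4)] that by (auto simp: h2_def bij_betw_def)
  ultimately show ?thesis
   using that Q(7) T.fplift_incl[of True "g2 x"] T.fp_incl_carrier[of True "g2 x"]
   by (simp add: dc group_pair_def k_def)
 qed
 ultimately show ?thesis by blast
qed

text \<open>Classes of words are built letter by letter from the left, and a letter belongs to one
  of the factors; hence the form of the induction, which is the one the cocycle rule of derivations
  needs.\<close>

lemma coproduct_hom:
 fixes Z B1 B2 :: "'g monoid"
 assumes "is_coproduct Z B1 B2 i1 i2"
 shows "i1 : hom B1 Z" "i2 : hom B2 Z"
  and coproduct_induct: "x : cr Z ==> P \<one>\<^bsub>Z\<^esub> ==>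
   (!!b x. b : cr B1 ==> x : cr Z ==> P x ==> P (i1 b \<otimes>\<^bsub>Z\<^esub> x)) ==>
   (!!b x. b : cr B2 ==> x : cr Z ==> P x ==> P (i2 b \<otimes>\<^bsub>Z\<^esub> x)) ==> P x"
proof -
 from assms(1) obtain Q1 Q2 :: "'g monoid" and g1 g2 c where Q: "group Q1" "group Q2" "g1 : iso B1 Q1" "g2 : iso B2 Q2"
  "c : iso (free_product UNIV (group_pair Q1 Q2)) Z"
  "ALL x:cr B1. i1 x = c (fp_incl UNIV (group_pair Q1 Q2) False (g1 x))"
  "ALL x:cr B2. i2 x = c (fp_incl UNIV (group_pair Q1 Q2) True (g2 x))"
  by (rule coproductE)
 have grp: "group Z" "group B1" "group B2" using assms(1) by (auto simp: is_coproduct_def)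
 let ?F = "free_product UNIV (group_pair Q1 Q2)"
 interpret T: fp_target UNIV "group_pair Q1 Q2" Z "%b x. \<one>\<^bsub>Z\<^esub>"
  using Q(1,2) grp by (intro fp_target.intro) (auto simp: group_pair_def hom_def group.is_monoid)
 have c: "c : hom ?F Z" using isoD Q(5) by blast
 have cm: "c (p \<otimes>\<^bsub>?F\<^esub> q) = c p \<otimes>\<^bsub>Z\<^esub> c q" if "p : cr ?F" "q : cr ?F" for p q
  using c that by (auto simp: hom_def)
 have cc: "c p : cr Z" if "p : cr ?F" for p using c that by (auto simp: hom_def)
 have g: "g1 x : cr Q1" if "x : cr B1" for x using isoD(1)[OF Q(3)] that by (auto simp: hom_def)
 have g': "g2 x : cr Q2" if "x : cr B2" for x using isoD(1)[OF Q(4)] that by (auto simp: hom_def)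
 have inc: "fp_incl UNIV (group_pair Q1 Q2) False (g1 x) : cr ?F" if "x : cr B1" for x
  using T.fp_incl_carrier[of False "g1 x"] g[OF that] by (simp add: group_pair_def)
 have inc': "fp_incl UNIV (group_pair Q1 Q2) True (g2 x) : cr ?F" if "x : cr B2" for x
  using T.fp_incl_carrier[of True "g2 x"] g'[OF that] by (simp add: group_pair_def)
 show "i1 : hom B1 Z"
 proof (rule homI)
  fix x y assume xy: "x : cr B1" "y : cr B1"
  have "g1 (x \<otimes>\<^bsub>B1\<^esub> y) = g1 x \<otimes>\<^bsub>Q1\<^esub> g1 y" using isoD(1)[OF Q(3)] xy by (auto simp: hom_def)
  then show "i1 (x \<otimes>\<^bsub>B1\<^esub> y) = i1 x \<otimes>\<^bsub>Z\<^esub> i1 y"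
   using T.fp_incl_hom[of False "g1 x" "g1 y"] g xy Q(6) cm inc grp
   by (simp add: group_pair_def group.is_monoid monoid.m_closed)
 qed (use Q(6) inc cc in auto)
 show "i2 : hom B2 Z"
 proof (rule homI)
  fix x y assume xy: "x : cr B2" "y : cr B2"
  have "g2 (x \<otimes>\<^bsub>B2\<^esub> y) = g2 x \<otimes>\<^bsub>Q2\<^esub> g2 y" using isoD(1)[OF Q(4)] xy by (auto simp: hom_def)
  then show "i2 (x \<otimes>\<^bsub>B2\<^esub> y) = i2 x \<otimes>\<^bsub>Z\<^esub> i2 y"
   using T.fp_incl_hom[of True "g2 x" "g2 y"] g' xy Q(7) cm inc' grp
   by (simp add: group_pair_def group.is_monoid monoid.m_closed)
 qed (use Q(7) inc' cc in auto)
 assume x: "x : cr Z" and one: "P \<one>\<^bsub>Z\<^esub>"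
  and s1: "!!b x. b : cr B1 ==> x : cr Z ==> P x ==> P (i1 b \<otimes>\<^bsub>Z\<^esub> x)"
  and s2: "!!b x. b : cr B2 ==> x : cr Z ==> P x ==> P (i2 b \<otimes>\<^bsub>Z\<^esub> x)"
 have e: "\<one>\<^bsub>?F\<^esub> : cr ?F"
  by (auto simp: free_product_def intro!: exI[of _ "[]"])
 have ee: "\<one>\<^bsub>?F\<^esub> \<otimes>\<^bsub>?F\<^esub> \<one>\<^bsub>?F\<^esub> = \<one>\<^bsub>?F\<^esub>"
  using T.cls_mult[of "[]" "[]"] by (simp add: T.cls_def free_product_def)
 have c1: "c \<one>\<^bsub>?F\<^esub> = \<one>\<^bsub>Z\<^esub>"
  using cm[OF e e] cc[OF e] grp(1) ee by (metis group.r_cancel_one)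
 have "P (c p)" if "p : cr ?F" for p
  using that
 proof (induction p rule: T.free_product_induct)
  case 1 then show ?case by fact
 next
  case 2 then show ?case using one c1 by simp
 next
  case (3 i y p)
  show ?case
  proof (cases i)
   case True
   with 3 obtain b where b: "b : cr B2" "y = g2 b"
    using isoD(2)[OF Q(4)] by (auto simp: bij_betw_def group_pair_def)
   with s2[of b "c p"] 3 True show ?thesis using Q(7) cm cc inc' by simp
  next
   case False
   with 3 obtain b where b: "b : cr B1" "y = g1 b"
    using isoD(2)[OF Q(3)] by (auto simp: bij_betw_def group_pair_def)
   with s1[of b "c p"] 3 False show ?thesis using Q(6) cm cc inc by simp
  qed
 qed
 moreover have "x : c ` cr ?F"
  using bij_betw_imp_surj_on[OF isoD(2)[OF Q(5)]] x by simp
 ultimately show "P x" by (auto elim!: imageE)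
qed

lemma coproduct_iso:
 fixes Z B1 B2 Z' B1' B2' :: "'g monoid"
 assumes "is_coproduct Z' B1' B2' j1 j2" "group Z" "group B1" "group B2"
  "k : iso Z' Z" "h1 : iso B1 B1'" "h2 : iso B2 B2'"
  "!!x. x : cr B1 ==> i1 x = k (j1 (h1 x))" "!!x. x : cr B2 ==> i2 x = k (j2 (h2 x))"
 shows "is_coproduct Z B1 B2 i1 i2"
proof -
 from assms(1) obtain Q1 Q2 :: "'g monoid" and g1 g2 c where Q: "group Q1" "group Q2" "g1 : iso B1' Q1" "g2 : iso B2' Q2"
  "c : iso (free_product UNIV (group_pair Q1 Q2)) Z'"
  "ALL x:cr B1'. j1 x = c (fp_incl UNIV (group_pair Q1 Q2) False (g1 x))"
  "ALL x:cr B2'. j2 x = c (fp_incl UNIV (group_pair Q1 Q2) True (g2 x))"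
  by (rule coproductE)
 have a: "h1 x : cr B1'" if "x : cr B1" for x using assms(6) that by (auto simp: iso_def hom_def)
 have b: "h2 x : cr B2'" if "x : cr B2" for x using assms(7) that by (auto simp: iso_def hom_def)
 have "g1 \<circ> h1 : iso B1 Q1" "g2 \<circ> h2 : iso B2 Q2" "k \<circ> c : iso (free_product UNIV (group_pair Q1 Q2)) Z"
  using iso_set_trans[OF assms(6) Q(3)] iso_set_trans[OF assms(7) Q(4)] iso_set_trans[OF Q(5) assms(5)]
  by auto
 moreover have "ALL x:cr B1. i1 x = (k \<circ> c) (fp_incl UNIV (group_pair Q1 Q2) False ((g1 \<circ> h1) x))"
  "ALL x:cr B2. i2 x = (k \<circ> c) (fp_incl UNIV (group_pair Q1 Q2) True ((g2 \<circ> h2) x))"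
  using assms(8,9) Q(6,7) a b by auto
 ultimately show ?thesis unfolding is_coproduct_def using assms(2-4) Q(1,2) by blast
qed

lemma coproduct_hom_eq:
 assumes "is_coproduct Z B1 B2 i1 i2" "group L" "f : hom Z L" "g : hom Z L"
  "!!b. b : cr B1 ==> f (i1 b) = g (i1 b)" "!!b. b : cr B2 ==> f (i2 b) = g (i2 b)"
  "x : cr Z"
 shows "f x = g x"
 using assms(7)
proof (induction x rule: coproduct_induct[OF assms(1)])
 have Z: "group Z" using assms(1) by (simp add: is_coproduct_def)
 case 2
 show ?case using hom_one[OF assms(3) Z assms(2)] hom_one[OF assms(4) Z assms(2)] by simp
next
 case (3 b x)
 moreover have "i1 b : cr Z" using coproduct_hom(1)[OF assms(1)] 3 by (auto simp: hom_def)
 ultimately show ?case using assms(3,4) assms(5)[of b] by (simp add: hom_def)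
next
 case (4 b x)
 moreover have "i2 b : cr Z" using coproduct_hom(2)[OF assms(1)] 4 by (auto simp: hom_def)
 ultimately show ?case using assms(3,4) assms(6)[of b] by (simp add: hom_def)
qed fact


section \<open>Representations and derivations\<close>

definition rep :: "'r ring => 'g monoid => ('r, 'm) module => ('g => 'm => 'm) => bool" where
 "rep R B V act \<longleftrightarrow> module R V & group B & (ALL g:cr B. act g : mod_hom R V V) &
   (ALL v:cr V. act \<one>\<^bsub>B\<^esub> v = v) &
   (ALL g:cr B. ALL h:cr B. ALL v:cr V. act (g \<otimes>\<^bsub>B\<^esub> h) v = act g (act h v))"

lemma repD:
 assumes "rep R B V act"
 shows "module R V" "group B" "g : cr B ==> act g : mod_hom R V V"
  "g : cr B ==> v : cr V ==> act g v : cr V"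
  "v : cr V ==> act \<one>\<^bsub>B\<^esub> v = v"
  "g : cr B ==> h : cr B ==> v : cr V ==> act (g \<otimes>\<^bsub>B\<^esub> h) v = act g (act h v)"
  "g : cr B ==> v : cr V ==> act (inv\<^bsub>B\<^esub> g) (act g v) = v"
  "g : cr B ==> v : cr V ==> act g (act (inv\<^bsub>B\<^esub> g) v) = v"
proof -
 have B: "group B" using assms by (simp add: rep_def)
 show "module R V" "group B" "g : cr B ==> act g : mod_hom R V V"
  "g : cr B ==> v : cr V ==> act g v : cr V"
  "v : cr V ==> act \<one>\<^bsub>B\<^esub> v = v"
  "g : cr B ==> h : cr B ==> v : cr V ==> act (g \<otimes>\<^bsub>B\<^esub> h) v = act g (act h v)"
  using assms by (auto simp: rep_def mod_hom_def)
 show "g : cr B ==> v : cr V ==> act (inv\<^bsub>B\<^esub> g) (act g v) = v"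
  "g : cr B ==> v : cr V ==> act g (act (inv\<^bsub>B\<^esub> g) v) = v"
  using assms B group.inv_closed[OF B] group.l_inv[OF B] group.r_inv[OF B]
  unfolding rep_def by metis+
qed

lemma rep_pullback: "rep R B V act ==> group C ==> f : hom C B ==> rep R C V (%g. act (f g))"
 using hom_one[of f C B] unfolding rep_def by (auto simp: hom_def Pi_iff)

definition der :: "'r ring => 'g monoid => ('r, 'm) module => ('g => 'm => 'm) => ('r, 'n) module =>
  ('g => 'm => 'n) => bool" where
 "der R B V act W D \<longleftrightarrow> module R W & (ALL g:cr B. D g : mod_hom R V W) &
   (ALL g:cr B. ALL h:cr B. ALL v:cr V. D (g \<otimes>\<^bsub>B\<^esub> h) v = D g (act h v) \<oplus>\<^bsub>W\<^esub> D h v)"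

lemma derD:
 assumes "der R B V act W D"
 shows "module R W" "g : cr B ==> D g : mod_hom R V W"
  "g : cr B ==> v : cr V ==> D g v : cr W"
  "g : cr B ==> h : cr B ==> v : cr V ==> D (g \<otimes>\<^bsub>B\<^esub> h) v = D g (act h v) \<oplus>\<^bsub>W\<^esub> D h v"
 using assms by (auto simp: der_def mod_hom_def)

lemma der_one:
 assumes "der R B V act W D" "rep R B V act" "v : cr V"
 shows "D \<one>\<^bsub>B\<^esub> v = \<zero>\<^bsub>W\<^esub>"
proof -
 interpret W: abelian_group W using derD(1)[OF assms(1)] by (rule module_abelian)
 interpret B: group B by (rule repD(2)[OF assms(2)])
 have "D \<one>\<^bsub>B\<^esub> v = D \<one>\<^bsub>B\<^esub> v \<oplus>\<^bsub>W\<^esub> D \<one>\<^bsub>B\<^esub> v"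
  using derD(4)[OF assms(1) B.one_closed B.one_closed assms(3)] repD(5)[OF assms(2,3)] by simp
 then show ?thesis using derD(3)[OF assms(1) B.one_closed assms(3)]
  by (metis W.add.l_cancel_one')
qed

lemma der_inv:
 assumes "der R B V act W D" "rep R B V act" "v : cr V" "g : cr B"
 shows "D (inv\<^bsub>B\<^esub> g) v = \<ominus>\<^bsub>W\<^esub> D g (act (inv\<^bsub>B\<^esub> g) v)"
proof -
 interpret W: abelian_group W using derD(1)[OF assms(1)] by (rule module_abelian)
 interpret B: group B by (rule repD(2)[OF assms(2)])
 have i: "inv\<^bsub>B\<^esub> g : cr B" using assms(4) by simp
 have a: "act (inv\<^bsub>B\<^esub> g) v : cr V" using repD(4)[OF assms(2) i assms(3)] .
 have "\<zero>\<^bsub>W\<^esub> = D g (act (inv\<^bsub>B\<^esub> g) v) \<oplus>\<^bsub>W\<^esub> D (inv\<^bsub>B\<^esub> g) v"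
  using derD(4)[OF assms(1,4) i assms(3)] assms(4) der_one[OF assms(1-3)] by simp
 then show ?thesis
  using derD(3)[OF assms(1) assms(4) a] derD(3)[OF assms(1) i assms(3)]
  by (metis W.a_comm W.minus_equality)
qed

text \<open>In \<open>D (g h) k = D g (h k) + D h k\<close> the first term is evaluated at
  \<open>h k\<close>, so \<open>K\<close> has to be stable under the action. Stability under the
  inverses takes care of inverse generators, since \<open>D\<close> at the inverse of
  \<open>g\<close> is minus \<open>D g\<close> at a translate of \<open>k\<close>.\<close>

lemma der_generate_mem:
 assumes "der R B V act W D" "rep R B V act" "S <= cr B" "asub W N"
  and K: "K <= cr V" "ALL g:cr B. ALL k:K. act g k : K"
  and S: "ALL s:S. ALL k:K. D s k : N"
  and g: "g : generate B S"
 shows "ALL k:K. D g k : N"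
 using g
proof (induction g rule: generate.induct)
 interpret B: group B by (rule repD(2)[OF assms(2)])
 case one
 then show ?case using der_one[OF assms(1,2)] K asubD(3)[OF assms(4)] by auto
next
 case (incl h)
 then show ?case using S by auto
next
 interpret B: group B by (rule repD(2)[OF assms(2)])
 case (inv h)
 then have h: "h : cr B" using assms(3) by auto
 show ?case
 proof
  fix k assume k: "k : K"
  then have "act (inv\<^bsub>B\<^esub> h) k : K" using K h by simp
  then show "D (inv\<^bsub>B\<^esub> h) k : N"
   using der_inv[OF assms(1,2) _ h] k K S inv asubD(5)[OF assms(4)] by auto
 qed
next
 interpret B: group B by (rule repD(2)[OF assms(2)])
 case (eng h1 h2)
 then have h: "h1 : cr B" "h2 : cr B" using B.generate_in_carrier[OF assms(3)] by auto
 show ?case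
 proof
  fix k assume k: "k : K"
  then have "act h2 k : K" using K h by simp
  then show "D (h1 \<otimes>\<^bsub>B\<^esub> h2) k : N"
   using derD(4)[OF assms(1) h] k K eng asubD(4)[OF assms(4)] by auto
 qed
qed

lemma der_generate_eq:
 assumes "der R B V act W D" "der R B V act W D'" "rep R B V act" "S <= cr B"
  and S: "ALL s:S. ALL v:cr V. D s v = D' s v"
  and g: "g : generate B S"
 shows "ALL v:cr V. D g v = D' g v"
 using g
proof (induction g rule: generate.induct)
 case one
 then show ?case using der_one[OF assms(1,3)] der_one[OF assms(2,3)] by simp
next
 case (incl h)
 then show ?case using S by auto
next
 interpret B: group B by (rule repD(2)[OF assms(3)])
 case (inv h)
 then have h: "h : cr B" using assms(4) by auto
 then show ?case
  using der_inv[OF assms(1,3) _ h] der_inv[OF assms(2,3) _ h] S inv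
   repD(4)[OF assms(3) B.inv_closed[OF h]] by simp
next
 interpret B: group B by (rule repD(2)[OF assms(3)])
 case (eng h1 h2)
 then have h: "h1 : cr B" "h2 : cr B" using B.generate_in_carrier[OF assms(4)] by auto
 then show ?case
  using derD(4)[OF assms(1) h] derD(4)[OF assms(2) h] eng repD(4)[OF assms(3) h(2)] by simp
qed

text \<open>Linear maps from \<open>V\<close> to \<open>W\<close>, extended by \<open>B\<close> so
  that derivations on \<open>B\<close> are exactly the second components of homomorphic sections of
  the projection to \<open>B\<close>. Universal properties for homomorphisms thereby become
  universal properties for derivations. The restriction to \<open>extensional\<close> functions
  makes equality of pairs mean equality on \<open>V\<close>.\<close>

definition semidirect :: "'r ring => 'g monoid => ('r, 'm) module => ('g => 'm => 'm) => ('r, 'n) module =>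
  ('g \<times> ('m => 'n)) monoid" where
 "semidirect R B V act W = \<lparr>carrier = cr B \<times> (mod_hom R V W \<inter> extensional (cr V)),
   monoid.mult = (%(g, d) (h, e). (g \<otimes>\<^bsub>B\<^esub> h, \<lambda>v\<in>cr V. d (act h v) \<oplus>\<^bsub>W\<^esub> e v)),
   one = (\<one>\<^bsub>B\<^esub>, \<lambda>v\<in>cr V. \<zero>\<^bsub>W\<^esub>)\<rparr>"

lemma mod_hom_zero: "module R V ==> module R W ==> (%v. \<zero>\<^bsub>W\<^esub>) : mod_hom R V W"
proof -
 assume "module R V" "module R W"
 then interpret W: module R W by simp
 show ?thesis by (auto simp: mod_hom_def W.smult_r_null)
qed

lemma mod_hom_plus:
 assumes "module R W" "module R V" "f : mod_hom R V W" "g : mod_hom R V W"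
 shows "(%v. f v \<oplus>\<^bsub>W\<^esub> g v) : mod_hom R V W"
proof -
 interpret W: module R W by fact
 note fd = mod_homD[OF assms(3)] and gd = mod_homD[OF assms(4)]
 show ?thesis
  by (rule mod_homI) (simp_all add: fd gd W.smult_r_distr W.a_ac)
qed

lemma mod_hom_neg:
 assumes "module R W" "module R V" "f : mod_hom R V W"
 shows "(%v. \<ominus>\<^bsub>W\<^esub> f v) : mod_hom R V W"
proof -
 interpret W: module R W by fact
 note fd = mod_homD[OF assms(3)]
 show ?thesis
  by (rule mod_homI) (simp_all add: fd W.minus_add W.smult_r_minus)
qed

lemma mod_hom_restrict: "module R V ==> f : mod_hom R V W ==> restrict f (cr V) : mod_hom R V W"
proof -
 assume a: "module R V" "f : mod_hom R V W"
 interpret V: module R V by fact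
 note fd = mod_homD[OF a(2)]
 show ?thesis by (rule mod_homI) (simp_all add: fd)
qed

lemma semidirect_group:
 assumes "rep R B V act" "module R W"
 shows "group (semidirect R B V act W)"
proof -
 interpret B: group B by (rule repD(2)[OF assms(1)])
 interpret W: module R W by fact
 note V = repD(1)[OF assms(1)] and r = repD[OF assms(1)]
 note c = mod_homD(1)
 show ?thesis
 proof (rule groupI)
  fix x y assume "x : cr (semidirect R B V act W)" "y : cr (semidirect R B V act W)"
  then obtain g d h e where x: "x = (g, d)" "g : cr B" "d : mod_hom R V W"
   and y: "y = (h, e)" "h : cr B" "e : mod_hom R V W"
   by (auto simp: semidirect_def)
  have "(%v. d (act h v)) : mod_hom R V W" by (rule mod_hom_comp[OF r(3)[OF y(2)] x(3)])
  then have "restrict (%v. d (act h v) \<oplus>\<^bsub>W\<^esub> e v) (cr V) : mod_hom R V W"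
   by (intro mod_hom_restrict[OF V] mod_hom_plus[OF assms(2) V] y(3))
  then show "x \<otimes>\<^bsub>semidirect R B V act W\<^esub> y : cr (semidirect R B V act W)"
   using x y by (simp add: semidirect_def)
 next
  show "\<one>\<^bsub>semidirect R B V act W\<^esub> : cr (semidirect R B V act W)"
   using mod_hom_restrict[OF V mod_hom_zero[OF V assms(2)]] by (simp add: semidirect_def)
 next
  fix x y z assume "x : cr (semidirect R B V act W)" "y : cr (semidirect R B V act W)"
   "z : cr (semidirect R B V act W)"
  then obtain g d h e k f where x: "x = (g, d)" "g : cr B" "d : mod_hom R V W"
   and y: "y = (h, e)" "h : cr B" "e : mod_hom R V W"
   and z: "z = (k, f)" "k : cr B" "f : mod_hom R V W"
   by (auto simp: semidirect_def)
  show "x \<otimes>\<^bsub>semidirect R B V act W\<^esub> y \<otimes>\<^bsub>semidirect R B V act W\<^esub> z =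
   x \<otimes>\<^bsub>semidirect R B V act W\<^esub> (y \<otimes>\<^bsub>semidirect R B V act W\<^esub> z)"
   unfolding x(1) y(1) z(1) semidirect_def
   by (auto simp: B.m_assoc x y z r(4,6) c[OF x(3)] c[OF y(3)] c[OF z(3)] W.a_assoc intro!: restrict_ext)
 next
  fix x assume "x : cr (semidirect R B V act W)"
  then obtain g d where x: "x = (g, d)" "g : cr B" "d : mod_hom R V W" "d : extensional (cr V)"
   by (auto simp: semidirect_def)
  show "\<one>\<^bsub>semidirect R B V act W\<^esub> \<otimes>\<^bsub>semidirect R B V act W\<^esub> x = x"
   using x r(4) c[OF x(3)] by (auto simp: semidirect_def extensional_def fun_eq_iff)
  let ?e = "\<lambda>v\<in>cr V. \<ominus>\<^bsub>W\<^esub> d (act (inv\<^bsub>B\<^esub> g) v)"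
  have "?e : mod_hom R V W"
   by (intro mod_hom_restrict[OF V] mod_hom_neg[OF assms(2) V] mod_hom_comp[OF r(3) x(3)] B.inv_closed x(2))
  then show "EX y:cr (semidirect R B V act W). y \<otimes>\<^bsub>semidirect R B V act W\<^esub> x = \<one>\<^bsub>semidirect R B V act W\<^esub>"
   using x r(4,7) c[OF x(3)]
   by (intro bexI[of _ "(inv\<^bsub>B\<^esub> g, ?e)"]) (auto simp: semidirect_def W.M.l_neg intro!: restrict_ext)
 qed
qed

lemma der_to_hom:
 assumes "rep R B V act" "group C" "f : hom C B" "der R C V (%c. act (f c)) W D"
 shows "(%c. (f c, restrict (D c) (cr V))) : hom C (semidirect R B V act W)"
proof -
 note d = derD[OF assms(4)] and r = repD[OF assms(1)]
 have fc: "f c : cr B" if "c : cr C" for c using assms(3) that by (auto simp: hom_def)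
 show ?thesis
 proof (rule homI)
  fix x assume "x : cr C"
  then show "(f x, restrict (D x) (cr V)) : cr (semidirect R B V act W)"
   using fc d(2) mod_hom_restrict[OF r(1)] by (auto simp: semidirect_def)
 next
  fix x y assume xy: "x : cr C" "y : cr C"
  then have "f (x \<otimes>\<^bsub>C\<^esub> y) = f x \<otimes>\<^bsub>B\<^esub> f y" using assms(3) by (auto simp: hom_def)
  then show "(f (x \<otimes>\<^bsub>C\<^esub> y), restrict (D (x \<otimes>\<^bsub>C\<^esub> y)) (cr V)) =
   (f x, restrict (D x) (cr V)) \<otimes>\<^bsub>semidirect R B V act W\<^esub> (f y, restrict (D y) (cr V))"
   using xy fc r(4) d(4) by (auto simp: semidirect_def intro!: restrict_ext)
 qed
qed

lemma hom_to_der: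
 assumes "rep R B V act" "module R W" "F : hom B (semidirect R B V act W)"
  "!!g. g : cr B ==> fst (F g) = g"
 shows "der R B V act W (%g. snd (F g))"
proof -
 have m: "F (g \<otimes>\<^bsub>B\<^esub> h) = F g \<otimes>\<^bsub>semidirect R B V act W\<^esub> F h" if "g : cr B" "h : cr B" for g h
  using assms(3) that by (auto simp: hom_def)
 have "snd (F g) : mod_hom R V W" if "g : cr B" for g
  using assms(3) that by (auto simp: hom_def semidirect_def Pi_iff mem_Times_iff)
 moreover have "snd (F (g \<otimes>\<^bsub>B\<^esub> h)) v = snd (F g) (act h v) \<oplus>\<^bsub>W\<^esub> snd (F h) v"
  if "g : cr B" "h : cr B" "v : cr V" for g h v
  using m[OF that(1,2)] that assms(4)[OF that(2)]
  by (simp add: semidirect_def case_prod_beta)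
 ultimately show ?thesis using assms(2) by (simp add: der_def)
qed

lemma semidirect_fst: "fst : hom (semidirect R B V act W) B"
 by (rule homI) (auto simp: semidirect_def)

text \<open>Derivations on the two factors are homomorphisms to one and the same semidirect product,
  where the universal property of the coproduct glues them.\<close>

lemma coproduct_der:
 fixes Z B1 B2 :: "'g monoid"
 assumes cp: "is_coproduct Z B1 B2 i1 i2" and rp: "rep R Z V act"
  and d1: "der R B1 V (%b. act (i1 b)) W D1" and d2: "der R B2 V (%b. act (i2 b)) W D2"
 shows "EX D. der R Z V act W D & (ALL b:cr B1. ALL v:cr V. D (i1 b) v = D1 b v) &
  (ALL b:cr B2. ALL v:cr V. D (i2 b) v = D2 b v)"
proof -
 have g: "group Z" "group B1" "group B2" using cp by (auto simp: is_coproduct_def)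
 note W = derD(1)[OF d1]
 let ?S = "semidirect R Z V act W"
 obtain F where F: "F : hom Z ?S" "ALL x:cr B1. F (i1 x) = (i1 x, restrict (D1 x) (cr V))"
  "ALL x:cr B2. F (i2 x) = (i2 x, restrict (D2 x) (cr V))"
  using coproduct_universal[OF cp semidirect_group[OF rp W]
   der_to_hom[OF rp g(2) coproduct_hom(1)[OF cp] d1] der_to_hom[OF rp g(3) coproduct_hom(2)[OF cp] d2]]
  by blast
 \<comment> \<open>The glued homomorphism is a section of the projection because its first component
   is the identity on both factors. Only for a section is the second component a derivation for the
   given action.\<close>
 have "(fst \<circ> F) x = id x" if "x : cr Z" for x
  by (rule coproduct_hom_eq[OF cp g(1) hom_compose[OF F(1) semidirect_fst] _ _ _ that])
   (use F(2,3) in \<open>auto simp: hom_def\<close>)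
 then have "der R Z V act W (%g. snd (F g))"
  by (intro hom_to_der[OF rp W F(1)]) simp
 then show ?thesis using F(2,3) by (intro exI[of _ "%g. snd (F g)"]) auto
qed

section \<open>Free groups\<close>

definition free_basis :: "('g, 'x) monoid_scheme => 'g set => bool" where
 "free_basis K S \<longleftrightarrow> group K & S <= cr K & generate K S = cr K &
   (ALL w. w ~= [] & fst ` set w <= S & reduced_word w --> word_value K w ~= \<one>\<^bsub>K\<^esub>)"

lemma free_group_basis: "free_group K \<longleftrightarrow> (EX S. free_basis K S)"
 by (auto simp: free_group_def free_basis_def)

definition wval :: "('g, 'x) monoid_scheme => ('s => 'g) => ('s \<times> bool) list => 'g" where
 "wval K sigma w = foldr (%(s, p) x. (if p then sigma s else inv\<^bsub>K\<^esub> sigma s) \<otimes>\<^bsub>K\<^esub> x) w \<one>\<^bsub>K\<^esub>"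

lemma wval_word_value: "wval K (%s. s) w = word_value K w"
 by (simp add: wval_def word_value_def)

lemma wval_simps [simp]:
 "wval K sigma [] = \<one>\<^bsub>K\<^esub>"
 "wval K sigma ((s, p) # w) = (if p then sigma s else inv\<^bsub>K\<^esub> sigma s) \<otimes>\<^bsub>K\<^esub> wval K sigma w"
 by (simp_all add: wval_def)

definition inv_word :: "('s \<times> bool) list => ('s \<times> bool) list" where
 "inv_word w = rev (map (%(s, p). (s, \<not> p)) w)"

lemma inv_word_letters: "fst ` set (inv_word w) = fst ` set w"
 by (force simp: inv_word_def)

context
 fixes K (structure) and sigma :: "'s => 'g" and S
 assumes K: "group K" and sigma: "sigma : S \<rightarrow> cr K"
begin

interpretation K: group K by (rule K)

lemma wval_closed: "fst ` set w <= S ==> wval K sigma w : cr K"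
proof (induction w)
 case (Cons a w)
 then show ?case using sigma by (cases a) (auto simp: Pi_iff)
qed simp

lemma wval_append: "fst ` set v <= S ==> fst ` set w <= S ==>
 wval K sigma (v @ w) = wval K sigma v \<otimes> wval K sigma w"
proof (induction v)
 case Nil
 then show ?case using wval_closed[of w] by simp
next
 case (Cons a v)
 then show ?case using sigma wval_closed[of v] wval_closed[of w]
  by (cases a) (auto simp: Pi_iff K.m_assoc)
qed

lemma wval_cancel:
 assumes "fst ` set v <= S" "fst ` set w <= S" "s : S"
 shows "wval K sigma (v @ (s, p) # (s, \<not> p) # w) = wval K sigma (v @ w)"
proof -
 have "wval K sigma ((s, p) # (s, \<not> p) # w) = wval K sigma w"
  using assms(3) sigma wval_closed[OF assms(2)] by (auto simp: Pi_iff simp flip: K.m_assoc)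
 then show ?thesis
  using wval_append[OF assms(1), of "(s, p) # (s, \<not> p) # w"] wval_append[OF assms(1,2)] assms
  by simp
qed

lemma wval_inv_word: "fst ` set w <= S ==> wval K sigma (inv_word w) = inv (wval K sigma w)"
proof (induction w)
 case Nil
 then show ?case by (simp add: inv_word_def)
next
 case (Cons a w)
 obtain s p where a: "a = (s, p)" by force
 have "inv_word (a # w) = inv_word w @ [(s, \<not> p)]" by (simp add: inv_word_def a)
 moreover have "fst ` set (inv_word w) <= S" using Cons inv_word_letters[of w] by simp
 moreover have "sigma s : cr K" using Cons a sigma by auto
 ultimately show ?case using Cons a wval_closed[of w]
  by (auto simp: wval_append K.inv_mult_group)
qed

end

lemma not_reduced_split:
 "\<not> reduced_word w ==> EX v s p x. w = v @ (s, p) # (s, \<not> p) # x"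
 unfolding reduced_word_def
proof (induction w rule: induct_list012)
 case (3 a b w)
 obtain s p t q where ab: "a = (s, p)" "b = (t, q)" by force
 show ?case
 proof (cases "s = t --> p = q")
  case True
  then obtain v s p x where "b # w = v @ (s, p) # (s, \<not> p) # x" using 3 ab by auto
  then show ?thesis by (intro exI[of _ "a # v"]) auto
 next
  case False
  then show ?thesis using ab by (intro exI[of _ "[]"]) auto
 qed
qed auto

text \<open>Freeness is given as nontriviality of reduced words. A nonempty word with trivial value
  is therefore not reduced, and cancelling an adjacent inverse pair changes its value neither in
  \<open>B\<close> nor in \<open>L\<close>.\<close>

lemma free_word_trivial:
 assumes "free_basis B S" "group L" "sigma : S \<rightarrow> cr L"
 shows "fst ` set w <= S ==> word_value B w = \<one>\<^bsub>B\<^esub> ==> wval L sigma w = \<one>\<^bsub>L\<^esub>"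
proof (induction w rule: length_induct)
 case (1 w)
 show ?case
 proof (cases "w = []")
  case False
  then have "\<not> reduced_word w" using 1 assms(1) by (auto simp: free_basis_def)
  then obtain v s p x where w: "w = v @ (s, p) # (s, \<not> p) # x" using not_reduced_split by blast
  have l: "fst ` set v <= S" "fst ` set x <= S" "s : S" using 1 w by auto
  have B: "group B" "(%s. s) : S \<rightarrow> cr B" using assms(1) by (auto simp: free_basis_def)
  have "word_value B (v @ x) = \<one>\<^bsub>B\<^esub>"
   using 1 w wval_cancel[OF B l] by (simp add: wval_word_value)
  then have "wval L sigma (v @ x) = \<one>\<^bsub>L\<^esub>" using 1 l w by (auto simp: image_Un)
  then show ?thesis using wval_cancel[OF assms(2,3) l] w by simp
 qed simp
qed

lemma generate_word:
 assumes "group B" "S <= cr B" "g : generate B S"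
 shows "EX w. fst ` set w <= S & word_value B w = g"
 using assms(3)
proof (induction rule: generate.induct)
 interpret B: group B by fact
 case one
 then show ?case by (intro exI[of _ "[]"]) (simp add: word_value_def)
next
 interpret B: group B by fact
 case (incl h)
 then show ?case using assms(2) by (intro exI[of _ "[(h, True)]"]) (auto simp: word_value_def)
next
 interpret B: group B by fact
 case (inv h)
 then show ?case using assms(2) by (intro exI[of _ "[(h, False)]"]) (auto simp: word_value_def)
next
 case (eng h1 h2)
 then obtain v w where vw: "fst ` set v <= S" "word_value B v = h1" "fst ` set w <= S" "word_value B w = h2"
  by blast
 have "(%s. s) : S \<rightarrow> cr B" using assms(2) by auto
 from wval_append[OF assms(1) this vw(1,3)] vw show ?case
  by (intro exI[of _ "v @ w"]) (auto simp: wval_word_value)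
qed

text \<open>Two words for the same element differ by a word with trivial value, so any choice of
  words defines the map. The clause about whole words is what later identifies the Magnus
  representation of an element with \<open>magv\<close> of any word for it.\<close>

lemma free_universal:
 assumes fb: "free_basis B S" and L: "group L" and sigma: "sigma : S \<rightarrow> cr L"
 shows "EX f:hom B L. (ALL s:S. f s = sigma s) & (ALL w. fst ` set w <= S --> f (word_value B w) = wval L sigma w)"
proof -
 have B: "group B" "S <= cr B" "generate B S = cr B" "(%s. s) : S \<rightarrow> cr B"
  using fb by (auto simp: free_basis_def)
 interpret B: group B by fact
 interpret L: group L by fact
 define W where "W g = (SOME w. fst ` set w <= S & word_value B w = g)" for g
 have W: "fst ` set (W g) <= S" "word_value B (W g) = g" if "g : cr B" for g
  using someI_ex[OF generate_word[OF B(1,2), of g]] that B(3) by (auto simp: W_def)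
 have wd: "wval L sigma v = wval L sigma w" if v: "fst ` set v <= S" and w: "fst ` set w <= S"
  and e: "word_value B v = word_value B w" for v w
 proof -
  have i: "fst ` set (inv_word w) <= S" using w inv_word_letters[of w] by simp
  have "word_value B (v @ inv_word w) = \<one>\<^bsub>B\<^esub>"
   using wval_append[OF B(1,4) v i] wval_inv_word[OF B(1,4) w] e wval_closed[OF B(1,4) w]
   by (simp add: wval_word_value B.r_inv)
  then have "wval L sigma (v @ inv_word w) = \<one>\<^bsub>L\<^esub>"
   using v i by (intro free_word_trivial[OF fb L sigma]) auto
  then have "wval L sigma v \<otimes>\<^bsub>L\<^esub> inv\<^bsub>L\<^esub> wval L sigma w = \<one>\<^bsub>L\<^esub>"
   using wval_append[OF L sigma v i] wval_inv_word[OF L sigma w] by simp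
  then show ?thesis using wval_closed[OF L sigma v] wval_closed[OF L sigma w]
   by (metis L.inv_equality L.inv_inv L.inv_closed)
 qed
 define f where "f g = wval L sigma (W g)" for g
 have fw: "f (word_value B w) = wval L sigma w" if "fst ` set w <= S" for w
  unfolding f_def using that W wval_closed[OF B(1,4) that] by (intro wd) (auto simp: wval_word_value)
 have "f : hom B L"
 proof (rule homI)
  fix g assume "g : cr B"
  then show "f g : cr L" using W wval_closed[OF L sigma] by (simp add: f_def)
 next
  fix g h assume gh: "g : cr B" "h : cr B"
  have "g \<otimes>\<^bsub>B\<^esub> h = word_value B (W g @ W h)"
   using wval_append[OF B(1,4)] W gh by (simp add: wval_word_value)
  then have "f (g \<otimes>\<^bsub>B\<^esub> h) = wval L sigma (W g @ W h)" using fw[of "W g @ W h"] W gh by (auto simp: image_Un)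
  then show "f (g \<otimes>\<^bsub>B\<^esub> h) = f g \<otimes>\<^bsub>L\<^esub> f h"
   using wval_append[OF L sigma] W gh by (simp add: f_def)
 qed
 moreover have "f s = sigma s" if "s : S" for s
 proof -
  have "s : cr B" "sigma s : cr L" using that B sigma by auto
  then show ?thesis using fw[of "[(s, True)]"] that by (simp add: word_value_def)
 qed
 ultimately show ?thesis using fw by blast
qed

lemma free_der:
 assumes fb: "free_basis B S" and rp: "rep R B V act" and W: "module R W"
  and sigma: "ALL s:S. sigma s : mod_hom R V W"
 shows "EX D. der R B V act W D & (ALL s:S. ALL v:cr V. D s v = sigma s v)"
proof -
 let ?S = "semidirect R B V act W"
 have B: "group B" "S <= cr B" "generate B S = cr B"
  using fb by (auto simp: free_basis_def)
 interpret B: group B by fact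
 have "(%s. (s, restrict (sigma s) (cr V))) : S \<rightarrow> cr ?S"
  using B sigma by (auto simp: semidirect_def intro!: mod_hom_restrict[OF repD(1)[OF rp]])
 then obtain F where F: "F : hom B ?S" "ALL s:S. F s = (s, restrict (sigma s) (cr V))"
  using free_universal[OF fb semidirect_group[OF rp W]] by blast
 have h: "fst \<circ> F : hom B B" by (rule hom_compose[OF F(1) semidirect_fst])
 interpret h: group_hom B B "fst \<circ> F" using h by (simp add: group_hom_def group_hom_axioms_def B(1))
 have "(fst \<circ> F) x = x" if "x : generate B S" for x
  using that
 proof induction
  case (inv s)
  then show ?case using F(2) B(2) h.hom_inv[of s] by auto
 next
  case (eng x y)
  then show ?case using B h.hom_mult[of x y] B.generate_in_carrier[OF B(2)] by auto
 qed (use F(2) h.hom_one in auto)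
 then have "der R B V act W (%g. snd (F g))"
  using B(3) by (intro hom_to_der[OF rp W F(1)]) simp
 then show ?thesis using F(2) by (intro exI[of _ "%g. snd (F g)"]) auto
qed

section \<open>The Magnus representation\<close>

declare wval_simps [simp del]

text \<open>
 A function on words is a formal power series in noncommuting variables; the letter \<open>s\<close> of a free
 group acts as left multiplication by \<open>1 + X\<^sub>s\<close>.
\<close>

fun mag :: "'s => ('s list => int) => 's list => int" where
 "mag s f [] = f []"
| "mag s f (t # w) = f (t # w) + (if t = s then f w else 0)"

text \<open>Left multiplication by the inverse series \<open>1 - X_s + X_s^2 - ...\<close>; the
  recursion runs along the initial block of letters \<open>s\<close>. Its existence is the reason
  for admitting functions of infinite support.\<close>

fun mag' :: "'s => ('s list => int) => 's list => int" where
 "mag' s f [] = f []"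
| "mag' s f (t # w) = f (t # w) - (if t = s then mag' s f w else 0)"

lemma mag_mag': "mag s (mag' s f) = f"
proof
 show "mag s (mag' s f) w = f w" for w by (cases w) auto
qed

lemma mag'_mag: "mag' s (mag s f) = f"
proof
 show "mag' s (mag s f) w = f w" for w by (induction w) auto
qed

definition additive_op :: "(('s => int) => 's => int) => bool" where
 "additive_op phi \<longleftrightarrow> (ALL f g. phi (%w. f w + g w) = (%w. phi f w + phi g w))"

definition op_group :: "(('s => int) => 's => int) monoid" where
 "op_group = \<lparr>carrier = {phi. bij phi & additive_op phi}, monoid.mult = (\<circ>), one = id\<rparr>"

lemma op_group_ops: "phi \<otimes>\<^bsub>op_group\<^esub> psi = phi \<circ> psi" "\<one>\<^bsub>op_group\<^esub> = id"
 by (simp_all add: op_group_def)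

lemma op_group_group: "group op_group"
proof (rule groupI)
 fix phi :: "('s => int) => 's => int" assume p: "phi : cr op_group"
 then have b: "bij phi" and a: "additive_op phi" by (auto simp: op_group_def)
 have i: "inv_into UNIV phi (phi f) = f" "phi (inv_into UNIV phi f) = f" for f
  using b by (auto simp: bij_is_inj bij_is_surj surj_f_inv_f)
 have "additive_op (inv_into UNIV phi)" unfolding additive_op_def
 proof (intro allI)
  fix f g
  have "phi (%w. inv_into UNIV phi f w + inv_into UNIV phi g w) = (%w. f w + g w)"
   using a i unfolding additive_op_def by metis
  then show "inv_into UNIV phi (%w. f w + g w) = (%w. inv_into UNIV phi f w + inv_into UNIV phi g w)"
   using i by metis
 qed
 moreover have "inv_into UNIV phi \<circ> phi = id" using i by auto
 ultimately show "EX psi:cr op_group. psi \<otimes>\<^bsub>op_group\<^esub> phi = \<one>\<^bsub>op_group\<^esub>"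
  using bij_imp_bij_inv[OF b] by (intro bexI[of _ "inv_into UNIV phi"]) (auto simp: op_group_def)
qed (auto simp: op_group_def additive_op_def bij_comp o_assoc)

lemma mag_op: "mag s : cr op_group"
proof -
 have "bij (mag s)" by (rule o_bij[of "mag' s"]) (auto simp: mag_mag' mag'_mag fun_eq_iff)
 moreover have "mag s (%w. f w + g w) w = mag s f w + mag s g w" for f g w by (cases w) auto
 ultimately show ?thesis by (auto simp: op_group_def additive_op_def)
qed

lemma mag_inv: "inv\<^bsub>op_group\<^esub> (mag s) = mag' s"
proof -
 interpret group op_group by (rule op_group_group)
 have "mag' s (%w. f w + g w) w = mag' s f w + mag' s g w" for f g w by (induction w) auto
 moreover have "bij (mag' s)" by (rule o_bij[of "mag s"]) (auto simp: mag_mag' mag'_mag fun_eq_iff)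
 ultimately have "mag' s : cr op_group" by (auto simp: op_group_def additive_op_def)
 moreover have "mag' s \<otimes>\<^bsub>op_group\<^esub> mag s = \<one>\<^bsub>op_group\<^esub>" by (auto simp: op_group_def mag'_mag)
 ultimately show ?thesis by (intro inv_equality mag_op)
qed

abbreviation magv :: "('s \<times> bool) list => ('s list => int) => 's list => int" where
 "magv == wval op_group mag"

lemma magv_simps [simp]:
 "magv [] f = f" "magv ((s, p) # w) f = (if p then mag s (magv w f) else mag' s (magv w f))"
 by (simp_all add: op_group_ops wval_simps mag_inv)

lemma mag_not_hd: "v = [] \<or> hd v ~= s ==> mag s f v = f v" "v = [] \<or> hd v ~= s ==> mag' s f v = f v"
 by (cases v; auto)+

definition alt :: "'s list => bool" where "alt = successively (~=)"

lemma alt_Cons: "alt (s # v) \<longleftrightarrow> (v = [] \<or> hd v ~= s) & alt v"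
 by (cases v) (auto simp: alt_def)

lemma mag_alt:
 "alt (s # v) ==> mag s f (s # v) = f (s # v) + f v"
 "alt (s # v) ==> mag' s f (s # v) = f (s # v) - f v"
 using mag_not_hd(2)[of v s f] by (auto simp: alt_Cons)

text \<open>
 The word \<open>s # w'\<close> lists the letters of the syllables of \<open>x\<close>, and \<open>e\<close> is the exponent of the
 first syllable.
\<close>

lemma magnus_coefficient:
 assumes "reduced_word ((s, p) # y)"
 shows "EX w' c e. alt (s # w') & c ~= 0 & (if p then e > 0 else e < 0) &
  magv ((s, p) # y) (%w. if w = [] then 1 else 0) w' = c &
  magv ((s, p) # y) (%w. if w = [] then 1 else 0) (s # w') = e * c &
  (ALL v. alt v & (v = [] \<or> hd v ~= s) & length v > length w' -->
    magv ((s, p) # y) (%w. if w = [] then 1 else 0) v = 0) &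
  (ALL v. alt v & length v > Suc (length w') --> magv ((s, p) # y) (%w. if w = [] then 1 else 0) v = 0)"
 using assms
proof (induction y arbitrary: s p)
 let ?d = "%w. if w = [] then 1 else (0::int)"
 \<comment> \<open>A letter that does not prolong the first syllable opens a new one, of exponent 1
   or -1. Only alternating words are inspected: there \<open>mag s\<close> and its inverse differ
   from the identity by a single term, so powers of one variable never appear.\<close>
 have new: "EX w' c e. alt (s # w') & c ~= 0 & (if p then e > 0 else e < 0) &
  magv ((s, p) # y) ?d w' = c & magv ((s, p) # y) ?d (s # w') = e * c &
  (ALL v. alt v & (v = [] \<or> hd v ~= s) & length v > length w' --> magv ((s, p) # y) ?d v = 0) &
  (ALL v. alt v & length v > Suc (length w') --> magv ((s, p) # y) ?d v = 0)"
  if w: "alt (s # w')" "magv y ?d w' ~= 0" "ALL v. alt v & length v > length w' --> magv y ?d v = 0"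
  for s p w' and y :: "('a \<times> bool) list"
 proof (intro exI conjI allI impI)
  have a: "w' = [] \<or> hd w' ~= s" "alt w'" using w(1) by (auto simp: alt_Cons)
  show "alt (s # w')" "magv y ?d w' ~= 0" by fact+
  show "if p then (if p then 1 else - 1 :: int) > 0 else (if p then 1 else - 1 :: int) < 0" by simp
  show "magv ((s, p) # y) ?d w' = magv y ?d w'" using mag_not_hd[OF a(1)] by simp
  show "magv ((s, p) # y) ?d (s # w') = (if p then 1 else - 1) * magv y ?d w'"
   using mag_alt[OF w(1)] w(1,3) by simp
  fix v :: "'a list"
  { assume v: "alt v & (v = [] \<or> hd v ~= s) & length v > length w'"
   then show "magv ((s, p) # y) ?d v = 0" using mag_not_hd[of v s] w(3) by simp }
  assume v: "alt v & length v > Suc (length w')"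
  show "magv ((s, p) # y) ?d v = 0"
  proof (cases "v = [] \<or> hd v ~= s")
   case True
   then show ?thesis using mag_not_hd[of v s] w(3) v by simp
  next
   case False
   then obtain v' where v': "v = s # v'" by (cases v) auto
   then have "alt v'" "length v' > length w'" using v by (auto simp: alt_Cons)
   then show ?thesis using mag_alt[of s v'] v v' w(3) by simp
  qed
 qed
 {
  case Nil
  show ?case by (rule new[of s "[]"]) (auto simp: alt_def)
 next
  case (Cons a y)
  obtain t q where a: "a = (t, q)" by force
  have "reduced_word ((t, q) # y)" using Cons.prems a by (simp add: reduced_word_def)
  then obtain w' c e where IH: "alt (t # w')" "c ~= 0" "if q then e > 0 else e < 0"
   "magv ((t, q) # y) ?d w' = c" "magv ((t, q) # y) ?d (t # w') = e * c"
   "!!v. alt v & (v = [] \<or> hd v ~= t) & length v > length w' ==> magv ((t, q) # y) ?d v = 0"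
   "!!v. alt v & length v > Suc (length w') ==> magv ((t, q) # y) ?d v = 0"
   using Cons.IH[of t q] by blast
  show ?case
  \<comment> \<open>A different letter opens a new syllable in front of \<open>t # w'\<close>. The
    same letter carries the same sign, the word being reduced, so the exponent \<open>e\<close>
    moves further away from zero.\<close>
  proof (cases "s = t")
   case False
   show ?thesis unfolding a
    by (rule new[of s "t # w'"]) (use IH False in \<open>auto simp: alt_Cons split: if_splits\<close>)
  next
   case True
   then have q: "q = p" using Cons.prems a by (simp add: reduced_word_def)
   note IH = IH[unfolded True[symmetric] q]
   show ?thesis unfolding a True[symmetric] q
   proof (intro exI conjI allI impI)
    have b: "w' = [] \<or> hd w' ~= s" "alt w'" using IH(1) by (auto simp: alt_Cons)
    show "alt (s # w')" "c ~= 0" by fact+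
    show "if p then (if p then e + 1 else e - 1) > 0 else (if p then e + 1 else e - 1) < 0"
     using IH(3) by (auto split: if_splits)
    have m: "magv ((s, p) # (s, p) # y) ?d = (if p then mag s else mag' s) (magv ((s, p) # y) ?d)"
     by simp
    show "magv ((s, p) # (s, p) # y) ?d w' = c"
     unfolding m using mag_not_hd[OF b(1)] IH(4) by (cases p) (simp_all del: magv_simps)
    show "magv ((s, p) # (s, p) # y) ?d (s # w') = (if p then e + 1 else e - 1) * c"
     unfolding m using mag_alt[OF IH(1)] IH(4,5)
     by (cases p) (simp_all del: magv_simps mag.simps mag'.simps add: distrib_right left_diff_distrib)
    fix v :: "'a list"
    { assume v: "alt v & (v = [] \<or> hd v ~= s) & length v > length w'"
     then show "magv ((s, p) # (s, p) # y) ?d v = 0"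
      unfolding m using mag_not_hd[of v s] IH(6)[of v]
      by (cases p) (simp_all del: magv_simps mag.simps mag'.simps) }
    assume v: "alt v & length v > Suc (length w')"
    show "magv ((s, p) # (s, p) # y) ?d v = 0"
    proof (cases "v = [] \<or> hd v ~= s")
     case True
     then show ?thesis unfolding m using mag_not_hd[of v s] IH(7)[of v] v
      by (cases p) (simp_all del: magv_simps mag.simps mag'.simps)
    next
     case False
     then obtain v' where v': "v = s # v'" by (cases v) auto
     then have "alt v'" "v' = [] \<or> hd v' ~= s" "length v' > length w'" using v by (auto simp: alt_Cons)
     then show ?thesis unfolding m using mag_alt[of s v'] v v' IH(6)[of v'] IH(7)[of v]
      by (cases p) (simp_all del: magv_simps mag.simps mag'.simps)
    qed
   qed
  qed
 }
qed

text \<open>Applied to the series 1, the word produces a nonzero coefficient at a nonempty word of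
  letters, namely a product of nonzero exponents, whereas 1 itself has none there.\<close>

lemma magnus_faithful:
 assumes "reduced_word x" "x ~= []"
 shows "magv x ~= (%f. f)"
proof
 assume e: "magv x = (%f. f)"
 obtain s p y where x: "x = (s, p) # y" using assms(2) by (cases x) auto
 from magnus_coefficient[OF assms(1)[unfolded x]]
 obtain w' c e where "c ~= 0" "if p then e > 0 else e < 0"
  "magv x (%w. if w = [] then 1 else 0) (s # w') = e * c"
  unfolding x[symmetric] by (elim exE conjE) (rule that)
 then show False unfolding e by (auto split: if_splits)
qed

definition low :: "nat => ('s list => int) set" where
 "low k = {f. ALL w. length w < k --> f w = 0}"

text \<open>\<open>low k\<close> consists of the series of order at least \<open>k\<close>, and the
  condition says that \<open>phi - 1\<close> raises orders by \<open>d\<close>. For the operators of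
  a free group this is the Magnus filtration by depth.\<close>

definition unip :: "nat => (('s list => int) => 's list => int) => bool" where
 "unip d phi \<longleftrightarrow> (ALL k. ALL f:low k. (%w. phi f w - f w) : low (k + d))"

lemma unip_comp:
 fixes phi psi :: "('s list => int) => 's list => int"
 shows "unip d phi ==> unip d psi ==> unip d (phi \<circ> psi)"
 unfolding unip_def
proof (intro allI ballI)
 fix k and f :: "'s list => int"
 assume a: "ALL k. ALL f:low k. (%w. phi f w - f w) : low (k + d)"
  "ALL k. ALL f:low k. (%w. psi f w - f w) : low (k + d)" and f: "f : low k"
 have p: "(%w. psi f w - f w) : low (k + d)" using a f by blast
 then have "psi f : low k" using f by (auto simp: low_def)
 then have "(%w. phi (psi f) w - psi f w) : low (k + d)" using a by blast
 with p show "(%w. (phi \<circ> psi) f w - f w) : low (k + d)" by (fastforce simp: low_def)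
qed

lemma unip_mag: "unip 1 (mag s)" "unip 1 (mag' s)"
proof -
 have "mag s f w = f w" if "f : low k" "length w < Suc k" for f k w
  using that by (cases w) (auto simp: low_def)
 then show "unip 1 (mag s)" by (auto simp: unip_def low_def)
 have z: "mag' s f w = 0" if "f : low k" "length w < k" for f k w
  using that by (induction w) (auto simp: low_def)
 have "mag' s f w = f w" if "f : low k" "length w < Suc k" for f k w
  using that z[OF that(1)] by (cases w) (auto simp: low_def)
 then show "unip 1 (mag' s)" by (auto simp: unip_def low_def)
qed

lemma unip_magv: "unip 1 (magv w)"
proof (induction w)
 case Nil
 then show ?case by (simp add: unip_def low_def)
next
 case (Cons a w)
 obtain s p where a: "a = (s, p)" by force
 have "magv (a # w) = (if p then mag s else mag' s) \<circ> magv w" by (rule ext) (simp add: a)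
 then show ?case using unip_comp[OF unip_mag(1) Cons] unip_comp[OF unip_mag(2) Cons]
  by (cases p) (simp_all only: if_True if_False)
qed

fun expo :: "'s => ('s \<times> bool) list => int" where
 "expo s [] = 0"
| "expo s ((t, p) # w) = (if t = s then if p then 1 else - 1 else 0) + expo s w"

lemma hom_int_word:
 fixes phi :: "'g => int"
 assumes "group B" "S <= cr B" "!!g h. g : cr B ==> h : cr B ==> phi (g \<otimes>\<^bsub>B\<^esub> h) = phi g + phi h"
  "finite T" "T <= S" "fst ` set w <= T"
 shows "phi (word_value B w) = (\<Sum>s\<in>T. expo s w * phi s)"
 using assms(6)
proof (induction w)
 interpret B: group B by fact
 case Nil
 have "phi \<one>\<^bsub>B\<^esub> = 0" using assms(3)[of "\<one>\<^bsub>B\<^esub>" "\<one>\<^bsub>B\<^esub>"] by simp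
 then show ?case by (simp add: word_value_def)
next
 interpret B: group B by fact
 case (Cons a w)
 obtain t p where a: "a = (t, p)" by force
 have t: "t : T" "t : cr B" using Cons a assms(2,5) by auto
 have o: "phi \<one>\<^bsub>B\<^esub> = 0" using assms(3)[of "\<one>\<^bsub>B\<^esub>" "\<one>\<^bsub>B\<^esub>"] by simp
 have i: "phi (inv\<^bsub>B\<^esub> t) = - phi t" using assms(3)[of "inv\<^bsub>B\<^esub> t" t] t o by simp
 have "(%s. s) : S \<rightarrow> cr B" using assms(2) by auto
 moreover have "fst ` set w <= S" using Cons assms(5) by auto
 ultimately have c: "word_value B w : cr B"
  unfolding wval_word_value[symmetric] by (rule wval_closed[OF assms(1)])
 have "word_value B (a # w) = (if p then t else inv\<^bsub>B\<^esub> t) \<otimes>\<^bsub>B\<^esub> word_value B w"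
  by (simp add: word_value_def a)
 then have "phi (word_value B (a # w)) = (if p then 1 else -1) * phi t + (\<Sum>s\<in>T. expo s w * phi s)"
  using assms(3) c t i Cons by auto
 also have "(if p then 1 else -1) * phi t = (\<Sum>s\<in>T. (if t = s then if p then 1 else - 1 else 0) * phi s)"
  using t(1) assms(4) by (simp add: if_distrib[of "%x. x * _"] sum.delta cong: if_cong)
 also have "\<dots> + (\<Sum>s\<in>T. expo s w * phi s) = (\<Sum>s\<in>T. expo s (a # w) * phi s)"
  by (simp add: a sum.distrib[symmetric] distrib_right)
 finally show ?case .
qed

text \<open>The value \<open>n = 0\<close> is a real case: in \<open>coef_core\<close> it is the
  exponent attached to an element of infinite order.\<close>

lemma all_powers_dvd_zero:
 fixes n x :: int
 assumes "!!j. n ^ j dvd x" "\<bar>n\<bar> ~= 1"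
 shows "x = 0"
proof (rule ccontr)
 assume x: "x ~= 0"
 show False
 proof (cases "n = 0")
  case True
  then show False using assms(1)[of 1] x by simp
 next
  case False
  then have "\<bar>n\<bar> \<ge> 2" using assms(2) by linarith
  then have "2 ^ nat \<bar>x\<bar> \<le> \<bar>n\<bar> ^ nat \<bar>x\<bar>" by (intro power_mono) auto
  moreover have "\<bar>n\<bar> ^ nat \<bar>x\<bar> \<le> \<bar>x\<bar>"
   using dvd_imp_le_int[OF x assms(1)] by (simp add: power_abs)
  moreover have "\<bar>x\<bar> < 2 ^ nat \<bar>x\<bar>" using less_exp[of "nat \<bar>x\<bar>"]
   by (metis abs_ge_zero int_nat_eq nat_less_iff of_nat_less_iff of_nat_numeral of_nat_power)
  ultimately show False by linarith
 qed
qed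

lemma free_reduced_word:
 assumes "free_basis B S" "g : cr B"
 shows "EX w. fst ` set w <= S & word_value B w = g & reduced_word w"
proof -
 have B: "group B" "S <= cr B" "generate B S = cr B" "(%s. s) : S \<rightarrow> cr B"
  using assms(1) by (auto simp: free_basis_def)
 have "EX w. fst ` set w <= S & word_value B w = g" using generate_word[OF B(1,2)] B(3) assms(2) by simp
 then obtain w0 where "fst ` set w0 <= S & word_value B w0 = g" by blast
 from ex_has_least_nat[where P = "%w. fst ` set w <= S & word_value B w = g" and m = length, OF this]
 obtain w where w: "fst ` set w <= S & word_value B w = g"
  "!!v. fst ` set v <= S & word_value B v = g ==> length w \<le> length v" by auto
 have "reduced_word w"
 proof (rule ccontr)
  assume "\<not> reduced_word w"
  then obtain v s p x where v: "w = v @ (s, p) # (s, \<not> p) # x" using not_reduced_split by blast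
  have l: "fst ` set v <= S" "fst ` set x <= S" "s : S" using w(1) v by auto
  have "word_value B (v @ x) = g" using wval_cancel[OF B(1,4) l] w(1) v by (simp add: wval_word_value)
  then show False using w(2)[of "v @ x"] l v by auto
 qed
 then show ?thesis using w by blast
qed

text \<open>
 A nontrivial retract of a free group therefore has an element with prescribed
 nondivisible exponent sum; the proof pushes \<open>r\<close> down the lower central filtration, one
 Magnus degree at a time.
\<close>

lemma free_retract_trivial:
 fixes B :: "('g, 'x) monoid_scheme" and n :: int
 assumes fb: "free_basis B S" and r: "r : hom B B" "!!g. g : cr B ==> r (r g) = r g"
  and n: "\<bar>n\<bar> ~= 1"
  and e: "!!w s. fst ` set w <= S ==> word_value B w : r ` cr B ==> s : S ==> n dvd expo s w"
  and g: "g : cr B"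
 shows "r g = \<one>\<^bsub>B\<^esub>"
proof -
 have B: "group B" "S <= cr B" "generate B S = cr B" "(%s. s) : S \<rightarrow> cr B"
  using fb by (auto simp: free_basis_def)
 interpret B: group B by fact
 have rc: "r g : cr B" if "g : cr B" for g using r(1) that by (auto simp: hom_def)
 have "mag : S \<rightarrow> cr op_group" by (simp add: mag_op)
 then obtain mu where mu: "mu : hom B op_group" "ALL w. fst ` set w <= S --> mu (word_value B w) = magv w"
  using free_universal[OF fb op_group_group, of mag] by auto
 have muc: "additive_op (mu g)" if "g : cr B" for g
  using mu(1) that by (auto simp: hom_def op_group_def)
 have mum: "mu (g \<otimes>\<^bsub>B\<^esub> h) = mu g \<circ> mu h" if "g : cr B" "h : cr B" for g h
  using mu(1) that by (auto simp: hom_def op_group_def)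
 \<comment> \<open>Elements of the image of \<open>r\<close> lie arbitrarily deep in the Magnus
   filtration. At any given word they then act trivially, and faithfulness finishes the
   proof.\<close>
 have main: "ALL g:cr B. unip (Suc d) (mu (r g))" for d
 proof (induction d)
  case 0
  show ?case
  proof
   fix g assume g: "g : cr B"
   then obtain w where "fst ` set w <= S" "word_value B w = r g"
    using generate_word[OF B(1,2), of "r g"] B(3) rc[OF g] by auto
   then show "unip (Suc 0) (mu (r g))" using mu(2) unip_magv[of w] by (metis One_nat_def)
  qed
 next
  case (Suc d)
  \<comment> \<open>The part of \<open>mu (r g) - 1\<close> of degree exactly \<open>Suc d\<close>
    is isolated here; its coefficients are integer-valued functions of \<open>g\<close>, and these
    are shown to vanish one by one.\<close>
  have van: "mu (r g) f w - f w = 0"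
   if f: "f : low k" and w: "length w = k + Suc d" and g: "g : cr B"
   for f :: "'g list => int" and k w g
  proof -
   define phi where "phi g = mu (r g) f w - f w" for g
   \<comment> \<open>The deviation \<open>x\<close> caused by \<open>mu (r h)\<close> has order at
     least \<open>k + Suc d\<close>, and \<open>mu (r g)\<close> alters it only in still higher
     order. Without a cross term the leading coefficient is additive in \<open>g\<close>.\<close>
   have add: "phi (g \<otimes>\<^bsub>B\<^esub> h) = phi g + phi h" if gh: "g : cr B" "h : cr B" for g h
   proof -
    define x where "x = (%w. mu (r h) f w - f w)"
    have x: "x : low (k + Suc d)" using Suc gh f by (auto simp: unip_def x_def)
    have "unip (Suc d) (mu (r g))" using Suc gh(1) by blast
    then have "(%w. mu (r g) x w - x w) : low (k + Suc d + Suc d)"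
     using x unfolding unip_def by blast
    then have "mu (r g) x w = x w" using w by (auto simp: low_def)
    moreover have "mu (r h) f = (%w. f w + x w)" by (auto simp: x_def)
    then have "mu (r g) (mu (r h) f) = (%w. mu (r g) f w + mu (r g) x w)"
     using muc[OF rc[OF gh(1)]] by (simp add: additive_op_def)
    moreover have "r (g \<otimes>\<^bsub>B\<^esub> h) = r g \<otimes>\<^bsub>B\<^esub> r h" using r(1) gh by (auto simp: hom_def)
    ultimately show ?thesis using mum[OF rc[OF gh(1)] rc[OF gh(2)]] by (simp add: phi_def x_def)
   qed
   \<comment> \<open>As \<open>r\<close> is idempotent, \<open>phi g = phi (r g)\<close>. Additivity
     writes \<open>phi (r g)\<close> as a combination of the \<open>phi s\<close> whose coefficients
     are exponent sums of an element of the image of \<open>r\<close>, hence divisible by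
     \<open>n\<close>. Each pass gains one factor \<open>n\<close>.\<close>
   have "ALL g:cr B. n ^ j dvd phi g" for j
   proof (induction j)
    case (Suc j)
    show ?case
    proof
     fix g assume g: "g : cr B"
     obtain w0 where w0: "fst ` set w0 <= S" "word_value B w0 = r g"
      using generate_word[OF B(1,2), of "r g"] B(3) rc[OF g] by auto
     have "phi (r g) = (\<Sum>s\<in>fst ` set w0. expo s w0 * phi s)"
      using hom_int_word[OF B(1,2), of phi "fst ` set w0" w0] add w0 by simp
     moreover have "n * n ^ j dvd expo s w0 * phi s" if "s : fst ` set w0" for s
      using e[OF w0(1)] w0 g that Suc B(2) by (intro mult_dvd_mono) auto
     ultimately have "n ^ Suc j dvd phi (r g)" by (simp add: dvd_sum)
     then show "n ^ Suc j dvd phi g" using r(2)[OF g] by (simp add: phi_def)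
    qed
   qed simp
   then have "phi g = 0" using all_powers_dvd_zero[OF _ n] g by blast
   then show ?thesis by (simp add: phi_def)
  qed
  show ?case unfolding unip_def
  proof (intro ballI allI)
   fix g k and f :: "'g list => int" assume a: "g : cr B" "f : low k"
   have "mu (r g) f w - f w = 0" if "length w < k + Suc d" for w
    using Suc a that by (auto simp: unip_def low_def)
   with van[OF a(2) _ a(1)] show "(%w. mu (r g) f w - f w) : low (k + Suc (Suc d))"
    unfolding low_def by (auto simp: less_Suc_eq)
  qed
 qed
 obtain w where w: "fst ` set w <= S" "word_value B w = r g" "reduced_word w"
  using free_reduced_word[OF fb rc[OF g]] by blast
 have "magv w f v = f v" for f v
 proof -
  \<comment> \<open>The depth is chosen beyond the length of \<open>v\<close>, so the coefficient at
    \<open>v\<close> cannot be touched.\<close>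
  have "unip (Suc (length v)) (mu (r g))" "f : low 0"
   using main[of "length v"] g by (auto simp: low_def)
  then have "(%v. mu (r g) f v - f v) : low (0 + Suc (length v))"
   unfolding unip_def by blast
  moreover have "magv w = mu (r g)" using mu(2) w by metis
  ultimately show ?thesis by (simp add: low_def)
 qed
 then have "magv w = (%f. f)" by blast
 then have "w = []" using magnus_faithful[OF w(3)] by blast
 then show ?thesis using w(2) by (simp add: word_value_def)
qed

section \<open>Finitely supported functions\<close>

lemma a_inv_zero: "abelian_group M ==> \<ominus>\<^bsub>M\<^esub> \<zero>\<^bsub>M\<^esub> = \<zero>\<^bsub>M\<^esub>"
 by (rule abelian_group.minus_equality) (auto simp: abelian_group.axioms abelian_monoid.zero_closed abelian_monoid.l_zero)

text \<open>The linear extension of \<open>beta\<close> from a basis. It is kept as an explicit sum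
  over the support because the action of \<open>long_moody\<close> on arrows is such a sum.\<close>

definition tl :: "'r ring => ('r, 'n) module => ('s => 'n) => ('s => 'r) => 'n" where
 "tl R W beta x = (\<Oplus>\<^bsub>W\<^esub>p \<in> supp R x. x p \<odot>\<^bsub>W\<^esub> beta p)"

lemma tl_super:
 assumes "module R W" "finite T" "supp R x <= T" "beta : T \<rightarrow> cr W" "range x <= cr R"
 shows "tl R W beta x = (\<Oplus>\<^bsub>W\<^esub>p \<in> T. x p \<odot>\<^bsub>W\<^esub> beta p)"
proof -
 interpret W: module R W by fact
 have "(%p. x p \<odot>\<^bsub>W\<^esub> beta p) : T \<rightarrow> cr W" using assms(4,5) by (auto intro!: W.smult_closed)
 moreover have "x p \<odot>\<^bsub>W\<^esub> beta p = \<zero>\<^bsub>W\<^esub>" if "p : T - supp R x" for p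
  using that assms(4) by (simp add: supp_def Pi_iff W.smult_l_null)
 ultimately show ?thesis unfolding tl_def
  by (intro W.M.add.finprod_mono_neutral_cong_left assms(2,3)) auto
qed

lemma free_module_carrier:
 "x : cr (free_module R S) \<longleftrightarrow> range x <= cr R & finite (supp R x) & supp R x <= S"
 by (simp add: free_module_def)

lemma free_module_ops:
 "x \<oplus>\<^bsub>free_module R S\<^esub> y = (%p. x p \<oplus>\<^bsub>R\<^esub> y p)"
 "a \<odot>\<^bsub>free_module R S\<^esub> x = (%p. a \<otimes>\<^bsub>R\<^esub> x p)"
 "\<zero>\<^bsub>free_module R S\<^esub> = (%p. \<zero>\<^bsub>R\<^esub>)"
 by (simp_all add: free_module_def)

context
 fixes R :: "'r ring" (structure)
 assumes R: "cring R"
begin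

interpretation R: cring R by (rule R)

lemma supp_add: "range x <= cr R ==> range y <= cr R ==> supp R (%p. x p \<oplus> y p) <= supp R x \<union> supp R y"
 by (auto simp: supp_def)

lemma supp_smult: "a : cr R ==> supp R (%p. a \<otimes> x p) <= supp R x"
 by (auto simp: supp_def)

lemma free_module_add_closed:
 "x : cr (free_module R S) ==> y : cr (free_module R S) ==>
  (%p. x p \<oplus> y p) : cr (free_module R S)"
 using supp_add[of x y] finite_subset[of "supp R (%p. x p \<oplus> y p)" "supp R x \<union> supp R y"]
 by (auto simp: free_module_carrier image_subset_iff)

lemma free_module_smult_closed:
 "a : cr R ==> x : cr (free_module R S) ==> (%p. a \<otimes> x p) : cr (free_module R S)"
 using supp_smult[of a x] finite_subset[of "supp R (%p. a \<otimes> x p)" "supp R x"]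
 by (auto simp: free_module_carrier image_subset_iff)

lemma free_module_val: "x : cr (free_module R S) ==> x p : cr R"
 by (auto simp: free_module_carrier)

lemma free_module_module: "module R (free_module R S)"
proof (rule moduleI)
 note v = free_module_val
 show "cring R" by (rule R)
 show "abelian_group (free_module R S)"
 proof (rule abelian_groupI)
  fix x assume x: "x : cr (free_module R S)"
  have "(%p. (\<ominus> \<one>) \<otimes> x p) : cr (free_module R S)" using x by (intro free_module_smult_closed) auto
  moreover have "(\<ominus> \<one>) \<otimes> x p \<oplus> x p = \<zero>" for p
   using v[OF x, of p] by (simp add: R.l_minus R.l_neg)
  ultimately show "EX y:cr (free_module R S). y \<oplus>\<^bsub>free_module R S\<^esub> x = \<zero>\<^bsub>free_module R S\<^esub>"
   by (intro bexI[of _ "%p. (\<ominus> \<one>) \<otimes> x p"]) (simp_all add: free_module_ops)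
 next
  show "\<zero>\<^bsub>free_module R S\<^esub> : cr (free_module R S)"
   by (auto simp: free_module_def supp_def)
 qed (auto simp: free_module_ops free_module_add_closed R.a_ac v)
qed (auto simp: free_module_ops free_module_smult_closed free_module_val R.l_distr R.r_distr R.m_assoc)

lemma single_closed: "p : S ==> single R p : cr (free_module R S)"
proof -
 assume "p : S"
 moreover have "supp R (single R p) <= {p}" by (auto simp: supp_def single_def)
 ultimately show ?thesis using finite_subset[of "supp R (single R p)" "{p}"]
  by (auto simp: free_module_carrier single_def)
qed

lemma free_module_span:
 assumes "x : cr (free_module R S)"
 shows "x : aspan (free_module R S) {a \<odot>\<^bsub>free_module R S\<^esub> single R p | a p. a : cr R & p : S}"
proof -
 let ?A = "aspan (free_module R S) {a \<odot>\<^bsub>free_module R S\<^esub> single R p | a p. a : cr R & p : S}"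
 have "!!x. x : cr (free_module R S) ==> supp R x <= T ==> x : ?A" if "finite T" for T
  using that
 proof (induction T)
  case empty
  then have "x = \<zero>\<^bsub>free_module R S\<^esub>" by (auto simp: supp_def free_module_ops)
  then show ?case by (simp add: aspan_zero)
 next
  case (insert p T)
  show ?case
  proof (cases "p : S")
   case False
   then have "p \<notin> supp R x" using insert.prems by (auto simp: free_module_carrier)
   then show ?thesis using insert by auto
  next
   case True
   define y where "y = (%q. if q = p then \<zero> else x q)"
   have s: "supp R y <= supp R x - {p}" by (auto simp: y_def supp_def)
   then have "y : cr (free_module R S)" using insert.prems finite_subset[OF s]
    by (auto simp: free_module_carrier y_def)
   moreover have "supp R y <= T" using s insert.prems by auto
   ultimately have "y : ?A" using insert by auto
   moreover have "x p \<odot>\<^bsub>free_module R S\<^esub> single R p : ?A"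
    using True free_module_val[OF insert.prems(1)] by (intro aspan_gen) auto
   ultimately have "y \<oplus>\<^bsub>free_module R S\<^esub> x p \<odot>\<^bsub>free_module R S\<^esub> single R p : ?A"
    by (rule aspan_add)
   moreover have "x = y \<oplus>\<^bsub>free_module R S\<^esub> x p \<odot>\<^bsub>free_module R S\<^esub> single R p"
    using free_module_val[OF insert.prems(1)]
    by (auto simp: free_module_ops y_def single_def fun_eq_iff)
   ultimately show ?thesis by (simp only:)
  qed
 qed
 then show ?thesis using assms by (auto simp: free_module_carrier)
qed

lemma mod_hom_single_eq:
 assumes "module R W" "f : mod_hom R (free_module R S) W" "g : mod_hom R (free_module R S) W"
  "!!p. p : S ==> f (single R p) = g (single R p)" "x : cr (free_module R S)"
 shows "f x = g x"
proof (rule addmap_eq_on_aspan[OF mod_hom_addmap[OF assms(2)] mod_hom_addmap[OF assms(3)]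
  module_abelian[OF free_module_module] module_abelian[OF assms(1)] _ free_module_span[OF assms(5)]])
 show "{a \<odot>\<^bsub>free_module R S\<^esub> single R p |a p. a : cr R & p : S} <= cr (free_module R S)"
  by (clarify, intro module.smult_closed[OF free_module_module] single_closed)
 fix s assume "s : {a \<odot>\<^bsub>free_module R S\<^esub> single R p |a p. a : cr R & p : S}"
 then obtain a p where "s = a \<odot>\<^bsub>free_module R S\<^esub> single R p" "a : cr R" "p : S" by blast
 then show "f s = g s"
  using mod_homD(3)[OF assms(2) _ single_closed] mod_homD(3)[OF assms(3) _ single_closed] assms(4) by simp
qed

lemma tl_hom:
 assumes "module R W" "beta : S \<rightarrow> cr W"
 shows "tl R W beta : mod_hom R (free_module R S) W"
proof -
 interpret W: module R W by fact
 note v = free_module_val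
 have b: "beta p : cr W" if "p : S" for p using assms(2) that by auto
 have sup: "tl R W beta x = (\<Oplus>\<^bsub>W\<^esub>p \<in> T. x p \<odot>\<^bsub>W\<^esub> beta p)"
  if "x : cr (free_module R S)" "finite T" "supp R x <= T" "T <= S" for x T
  using that assms(2) by (intro tl_super[OF assms(1)]) (auto simp: free_module_carrier)
 have pc: "(%p. x p \<odot>\<^bsub>W\<^esub> beta p) : T \<rightarrow> cr W" if "x : cr (free_module R S)" "T <= S" for x T
  using v[OF that(1)] b that(2) by (intro Pi_I W.smult_closed) auto
 show ?thesis
 proof (rule mod_homI)
  fix x assume x: "x : cr (free_module R S)"
  then show "tl R W beta x : cr W"
   unfolding tl_def by (intro W.M.finsum_closed pc) (auto simp: free_module_carrier)
 next
  fix x y assume xy: "x : cr (free_module R S)" "y : cr (free_module R S)"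
  let ?T = "supp R x \<union> supp R y"
  have T: "finite ?T" "?T <= S" using xy by (auto simp: free_module_carrier)
  have s: "supp R (x \<oplus>\<^bsub>free_module R S\<^esub> y) <= ?T"
   using xy by (simp add: free_module_ops free_module_carrier supp_add)
  have c: "x \<oplus>\<^bsub>free_module R S\<^esub> y : cr (free_module R S)"
   using free_module_add_closed[OF xy] by (simp add: free_module_ops)
  have "tl R W beta (x \<oplus>\<^bsub>free_module R S\<^esub> y) = (\<Oplus>\<^bsub>W\<^esub>p \<in> ?T. x p \<odot>\<^bsub>W\<^esub> beta p \<oplus>\<^bsub>W\<^esub> y p \<odot>\<^bsub>W\<^esub> beta p)"
   unfolding sup[OF c T(1) s T(2)]
  proof (rule W.M.finsum_cong'[OF refl])
   show "(%p. x p \<odot>\<^bsub>W\<^esub> beta p \<oplus>\<^bsub>W\<^esub> y p \<odot>\<^bsub>W\<^esub> beta p) : ?T \<rightarrow> cr W"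
    using pc[OF xy(1) T(2)] pc[OF xy(2) T(2)] by (auto simp: Pi_iff)
   show "(x \<oplus>\<^bsub>free_module R S\<^esub> y) p \<odot>\<^bsub>W\<^esub> beta p = x p \<odot>\<^bsub>W\<^esub> beta p \<oplus>\<^bsub>W\<^esub> y p \<odot>\<^bsub>W\<^esub> beta p" if "p : ?T" for p
    using W.smult_l_distr[OF v[OF xy(1)] v[OF xy(2)] b] that T(2) by (auto simp: free_module_ops)
  qed
  also have "\<dots> = tl R W beta x \<oplus>\<^bsub>W\<^esub> tl R W beta y"
   using sup[OF xy(1) T(1) _ T(2)] sup[OF xy(2) T(1) _ T(2)] pc[OF xy(1) T(2)] pc[OF xy(2) T(2)]
   by (simp add: W.M.finsum_addf)
  finally show "tl R W beta (x \<oplus>\<^bsub>free_module R S\<^esub> y) = tl R W beta x \<oplus>\<^bsub>W\<^esub> tl R W beta y" .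
 next
  fix a x assume a: "a : cr R" and x: "x : cr (free_module R S)"
  let ?T = "supp R x"
  have T: "finite ?T" "?T <= S" using x by (auto simp: free_module_carrier)
  have c: "a \<odot>\<^bsub>free_module R S\<^esub> x : cr (free_module R S)"
   using free_module_smult_closed[OF a x] by (simp add: free_module_ops)
  have s: "supp R (a \<odot>\<^bsub>free_module R S\<^esub> x) <= ?T" using a by (simp add: free_module_ops supp_smult)
  have "a \<odot>\<^bsub>W\<^esub> tl R W beta x = (\<Oplus>\<^bsub>W\<^esub>p \<in> ?T. a \<odot>\<^bsub>W\<^esub> (x p \<odot>\<^bsub>W\<^esub> beta p))"
   unfolding tl_def by (rule W.finsum_smult_ldistr[OF T(1) a pc[OF x T(2)]])
  also have "\<dots> = tl R W beta (a \<odot>\<^bsub>free_module R S\<^esub> x)"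
   unfolding sup[OF c T(1) s T(2)]
  proof (rule W.M.finsum_cong'[OF refl])
   show "(%p. (a \<odot>\<^bsub>free_module R S\<^esub> x) p \<odot>\<^bsub>W\<^esub> beta p) : ?T \<rightarrow> cr W" by (rule pc[OF c T(2)])
   show "a \<odot>\<^bsub>W\<^esub> (x p \<odot>\<^bsub>W\<^esub> beta p) = (a \<odot>\<^bsub>free_module R S\<^esub> x) p \<odot>\<^bsub>W\<^esub> beta p" if "p : ?T" for p
    using W.smult_assoc1[OF a v[OF x] b] that T(2) by (auto simp: free_module_ops)
  qed
  finally show "tl R W beta (a \<odot>\<^bsub>free_module R S\<^esub> x) = a \<odot>\<^bsub>W\<^esub> tl R W beta x" by simp
 qed
qed

lemma tl_single:
 assumes "module R W" "beta p : cr W"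
 shows "tl R W beta (single R p) = beta p"
proof -
 interpret W: module R W by fact
 have "tl R W beta (single R p) = (\<Oplus>\<^bsub>W\<^esub>q \<in> {p}. single R p q \<odot>\<^bsub>W\<^esub> beta q)"
  using assms(2) by (intro tl_super[OF assms(1)]) (auto simp: supp_def single_def)
 then show ?thesis using assms(2) by (simp add: single_def W.M.finsum_insert)
qed

text \<open>This is where commutativity of \<open>R\<close> is used: a scalar coming from the
  parameter has to pass the coefficient \<open>x p\<close>.\<close>

lemma tl_param:
 assumes "module R W" "module R V" "!!p. p : S ==> beta p : mod_hom R V W" "x : cr (free_module R S)"
 shows "(%v. tl R W (%p. beta p v) x) : mod_hom R V W"
proof -
 interpret W: module R W by fact
 interpret V: module R V by fact
 note v = free_module_val[OF assms(4)]
 have T: "finite (supp R x)" "supp R x <= S" using assms(4) by (auto simp: free_module_carrier)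
 have b: "beta p u : cr W" if "p : supp R x" "u : cr V" for p u
  using mod_homD(1)[OF assms(3)] that T by auto
 have pc: "(%p. x p \<odot>\<^bsub>W\<^esub> beta p u) : supp R x \<rightarrow> cr W" if "u : cr V" for u
  using v b that by (intro Pi_I W.smult_closed) auto
 show ?thesis
 proof (rule mod_homI)
  fix u assume u: "u : cr V"
  show "tl R W (%p. beta p u) x : cr W" unfolding tl_def by (rule W.M.finsum_closed[OF pc[OF u]])
  fix w assume w: "w : cr V"
  have "tl R W (%p. beta p (u \<oplus>\<^bsub>V\<^esub> w)) x =
   (\<Oplus>\<^bsub>W\<^esub>p \<in> supp R x. x p \<odot>\<^bsub>W\<^esub> beta p u \<oplus>\<^bsub>W\<^esub> x p \<odot>\<^bsub>W\<^esub> beta p w)"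
   unfolding tl_def
  proof (rule W.M.finsum_cong'[OF refl])
   show "(%p. x p \<odot>\<^bsub>W\<^esub> beta p u \<oplus>\<^bsub>W\<^esub> x p \<odot>\<^bsub>W\<^esub> beta p w) : supp R x \<rightarrow> cr W"
    using pc[OF u] pc[OF w] by (auto simp: Pi_iff)
   show "x p \<odot>\<^bsub>W\<^esub> beta p (u \<oplus>\<^bsub>V\<^esub> w) = x p \<odot>\<^bsub>W\<^esub> beta p u \<oplus>\<^bsub>W\<^esub> x p \<odot>\<^bsub>W\<^esub> beta p w" if "p : supp R x" for p
    using mod_homD(2)[OF assms(3) u w] that T(2) W.smult_r_distr[OF v b[OF that u] b[OF that w]]
    by auto
  qed
  then show "tl R W (%p. beta p (u \<oplus>\<^bsub>V\<^esub> w)) x = tl R W (%p. beta p u) x \<oplus>\<^bsub>W\<^esub> tl R W (%p. beta p w) x"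
   using pc[OF u] pc[OF w] by (simp add: W.M.finsum_addf tl_def)
 next
  fix a u assume a: "a : cr R" and u: "u : cr V"
  have "a \<odot>\<^bsub>W\<^esub> tl R W (%p. beta p u) x = (\<Oplus>\<^bsub>W\<^esub>p \<in> supp R x. a \<odot>\<^bsub>W\<^esub> (x p \<odot>\<^bsub>W\<^esub> beta p u))"
   unfolding tl_def by (rule W.finsum_smult_ldistr[OF T(1) a pc[OF u]])
  also have "\<dots> = tl R W (%p. beta p (a \<odot>\<^bsub>V\<^esub> u)) x"
   unfolding tl_def
  proof (rule W.M.finsum_cong'[OF refl])
   show "(%p. x p \<odot>\<^bsub>W\<^esub> beta p (a \<odot>\<^bsub>V\<^esub> u)) : supp R x \<rightarrow> cr W"
    by (rule pc[OF V.smult_closed[OF a u]])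
   show "a \<odot>\<^bsub>W\<^esub> (x p \<odot>\<^bsub>W\<^esub> beta p u) = x p \<odot>\<^bsub>W\<^esub> beta p (a \<odot>\<^bsub>V\<^esub> u)" if "p : supp R x" for p
    using mod_homD(3)[OF assms(3) a u] that T(2) v[of p] a b[OF that u]
    by (auto simp: R.m_comm simp flip: W.smult_assoc1)
  qed
  finally show "tl R W (%p. beta p (a \<odot>\<^bsub>V\<^esub> u)) x = a \<odot>\<^bsub>W\<^esub> tl R W (%p. beta p u) x" by simp
 qed
qed

lemma tl_pointwise:
 assumes "!!p. p : S ==> beta p : cr (free_module R S')" "x : cr (free_module R S)"
 shows "tl R (free_module R S') beta x q = (\<Oplus>p\<in>supp R x. x p \<otimes> beta p q)"
proof -
 interpret F: module R "free_module R S'" by (rule free_module_module)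
 have "(\<Oplus>\<^bsub>free_module R S'\<^esub>p\<in>T. x p \<odot>\<^bsub>free_module R S'\<^esub> beta p) q = (\<Oplus>p\<in>T. x p \<otimes> beta p q)"
  if "finite T" "T <= S" for T
  using that
 proof (induction T)
  case empty
  then show ?case by (simp add: free_module_ops)
 next
  case (insert p T)
  have c: "x r \<odot>\<^bsub>free_module R S'\<^esub> beta r : cr (free_module R S')" if "r : S" for r
   using free_module_val[OF assms(2)] assms(1)[OF that] by (rule F.smult_closed)
  have c': "x r \<otimes> beta r q : cr R" if "r : S" for r
   using free_module_val[OF assms(2)] free_module_val[OF assms(1)[OF that]] by (rule R.m_closed)
  have "(\<Oplus>\<^bsub>free_module R S'\<^esub>p\<in>insert p T. x p \<odot>\<^bsub>free_module R S'\<^esub> beta p) =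
   x p \<odot>\<^bsub>free_module R S'\<^esub> beta p \<oplus>\<^bsub>free_module R S'\<^esub> (\<Oplus>\<^bsub>free_module R S'\<^esub>p\<in>T. x p \<odot>\<^bsub>free_module R S'\<^esub> beta p)"
   using insert c by (intro F.M.finsum_insert) auto
  moreover have "(\<Oplus>p\<in>insert p T. x p \<otimes> beta p q) = x p \<otimes> beta p q \<oplus> (\<Oplus>p\<in>T. x p \<otimes> beta p q)"
   using insert c' by (intro R.finsum_insert) auto
  ultimately show ?case using insert by (simp add: free_module_ops)
 qed
 then show ?thesis using assms(2) by (simp add: tl_def free_module_carrier)
qed

text \<open>\<open>R\<close> as a module over itself, so that the augmentation is a linear extension
  like the other maps and can be compared with them on group elements.\<close>

definition ring_module :: "('r, 'r) module" where
 "ring_module = \<lparr>carrier = cr R, monoid.mult = undefined, one = undefined, zero = \<zero>, add = add R,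
  smult = monoid.mult R\<rparr>"

lemma ring_module_module: "module R ring_module"
proof (rule moduleI)
 show "abelian_group ring_module"
  by (rule abelian_groupI) (auto simp: ring_module_def R.a_ac intro: bexI[of _ "\<ominus> _"] R.l_neg)
qed (auto simp: ring_module_def R R.l_distr R.r_distr R.m_assoc)

lemma finsum_ring_module: "finsum ring_module f T = finsum R f T"
 by (simp add: finsum_def finprod_def ring_module_def)

end


section \<open>Group algebras and augmentation ideals\<close>

definition lact :: "'r ring => ('r, 'm) module => ('g => 'm => 'm) => ('g => 'r) => 'm => 'm" where
 "lact R V act s v = (\<Oplus>\<^bsub>V\<^esub>h \<in> supp R s. s h \<odot>\<^bsub>V\<^esub> act h v)"

lemma lact_tl: "lact R V act s v = tl R V (%h. act h v) s"
 by (simp add: lact_def tl_def)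

definition tens :: "'r ring => 'g monoid => ('r, 'm) module => ('g => 'm => 'm) =>
  ('r, ('g => 'r) \<times> 'm => 'r) module" where
 "tens R B V act = tensor_module R (cr (group_algebra R B)) (augmentation_ideal R B)
   (monoid.mult (group_algebra R B)) V (lact R V act)"

definition pt :: "'r ring => 'g monoid => ('r, 'm) module => ('g => 'm => 'm) => ('g => 'r) => 'm =>
  (('g => 'r) \<times> 'm => 'r)" where
 "pt R B V act i v = pure_tensor R (cr (group_algebra R B)) (augmentation_ideal R B)
   (monoid.mult (group_algebra R B)) V (lact R V act) i v"

definition aug1 :: "'r ring => 'g monoid => 'g => 'g => 'r" where
 "aug1 R B h = single R h \<ominus>\<^bsub>free_module R (cr B)\<^esub> single R \<one>\<^bsub>B\<^esub>"

definition br :: "'r ring => 'g monoid => ('r, 'm) module => ('g => 'm => 'm) => 'g => 'm =>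
  (('g => 'r) \<times> 'm => 'r)" where
 "br R B V act h v = pt R B V act (aug1 R B h) v"

lemma group_algebra_free_module:
 "cr (group_algebra R B) = cr (free_module R (cr B))"
 "x \<oplus>\<^bsub>group_algebra R B\<^esub> y = x \<oplus>\<^bsub>free_module R (cr B)\<^esub> y"
 by (simp_all add: group_algebra_def free_module_def)

definition aug :: "'r ring => ('g => 'r) => 'r" where
 "aug R = tl R (ring_module R) (%_. \<one>\<^bsub>R\<^esub>)"

locale tensor_ctx =
 fixes R :: "'r ring" and B :: "'g monoid" and V :: "('r, 'm) module" and act
 assumes rp: "rep R B V act"
begin

sublocale V: module R V by (rule repD(1)[OF rp])
sublocale B: group B by (rule repD(2)[OF rp])

lemma R: "cring R" by (rule V.is_cring)

abbreviation "A == free_module R (cr B)"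
abbreviation "I == cr (augmentation_ideal R B)"
abbreviation "P == I \<times> cr V"
abbreviation "E == free_module R P"

sublocale A: module R A by (rule free_module_module[OF R])
sublocale E: module R E by (rule free_module_module[OF R])

lemma single [simp]: "h : cr B ==> single R h : cr A"
 by (rule single_closed[OF R])

lemma aug_hom: "aug R : mod_hom R A (ring_module R)"
 unfolding aug_def by (rule tl_hom[OF R ring_module_module[OF R]]) (simp add: ring_module_def[OF R])

lemma aug_single: "aug R (single R h) = \<one>\<^bsub>R\<^esub>"
 unfolding aug_def by (rule tl_single[OF R ring_module_module[OF R]]) (simp add: ring_module_def[OF R])

lemma I_iff: "i : I \<longleftrightarrow> i : cr A & aug R i = \<zero>\<^bsub>R\<^esub>"
proof -
 have "aug R i = (\<Oplus>\<^bsub>R\<^esub>x \<in> supp R i. i x)" if "i : cr A"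
 proof -
  have "aug R i = (\<Oplus>\<^bsub>R\<^esub>x \<in> supp R i. i x \<otimes>\<^bsub>R\<^esub> \<one>\<^bsub>R\<^esub>)"
   by (simp add: aug_def tl_def finsum_ring_module[OF R]) (simp add: ring_module_def[OF R])
  also have "\<dots> = (\<Oplus>\<^bsub>R\<^esub>x \<in> supp R i. i x)"
   using free_module_val[OF R that] by (intro V.R.finsum_cong') auto
  finally show ?thesis .
 qed
 then show ?thesis by (auto simp: augmentation_ideal_def group_algebra_free_module)
qed

lemma I_sub: "i : I ==> i : cr A" by (simp add: I_iff)

lemma I_asub: "asub A I"
proof -
 interpret RM: module R "ring_module R" by (rule ring_module_module[OF R])
 have z: "\<zero>\<^bsub>ring_module R\<^esub> = \<zero>\<^bsub>R\<^esub>" by (simp add: ring_module_def[OF R])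
 have e: "asub A {i : cr A. aug R i = \<zero>\<^bsub>ring_module R\<^esub>}"
  unfolding asub_def using addmapD[OF mod_hom_addmap[OF aug_hom] A.M.abelian_group_axioms RM.M.abelian_group_axioms]
  by (auto simp: a_inv_zero[OF RM.M.abelian_group_axioms])
 have "I = {i : cr A. aug R i = \<zero>\<^bsub>ring_module R\<^esub>}" by (auto simp: I_iff z)
 with e show ?thesis by simp
qed

lemma I_smult: "a : cr R ==> i : I ==> a \<odot>\<^bsub>A\<^esub> i : I"
 using mod_homD(3)[OF aug_hom, of a i] by (simp add: I_iff ring_module_def[OF R])

lemma aug1_I: "h : cr B ==> aug1 R B h : I"
proof -
 interpret RM: module R "ring_module R" by (rule ring_module_module[OF R])
 assume h: "h : cr B"
 have "aug R (aug1 R B h) = aug R (single R h) \<ominus>\<^bsub>ring_module R\<^esub> aug R (single R \<one>\<^bsub>B\<^esub>)"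
  unfolding aug1_def
  by (rule addmapD(5)[OF mod_hom_addmap[OF aug_hom] A.M.abelian_group_axioms RM.M.abelian_group_axioms])
   (use h in auto)
 also have "\<dots> = \<zero>\<^bsub>R\<^esub>"
  using RM.M.r_neg[of "\<one>\<^bsub>R\<^esub>"] by (simp add: aug_single a_minus_def) (simp add: ring_module_def[OF R])
 finally show ?thesis using h by (simp add: I_iff aug1_def)
qed

abbreviation conv where "conv i s == i \<otimes>\<^bsub>group_algebra R B\<^esub> s"

definition lsh where "lsh y s = (%x. if x : cr B then s (inv\<^bsub>B\<^esub> y \<otimes>\<^bsub>B\<^esub> x) else \<zero>\<^bsub>R\<^esub>)"

lemma lsh_closed:
 assumes "y : cr B" "s : cr A"
 shows "lsh y s : cr A"
proof -
 have "supp R (lsh y s) <= (%x. y \<otimes>\<^bsub>B\<^esub> x) ` supp R s"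
 proof
  fix x assume "x : supp R (lsh y s)"
  then have x: "x : cr B" "inv\<^bsub>B\<^esub> y \<otimes>\<^bsub>B\<^esub> x : supp R s"
   by (auto simp: supp_def lsh_def split: if_splits)
  then have "x = y \<otimes>\<^bsub>B\<^esub> (inv\<^bsub>B\<^esub> y \<otimes>\<^bsub>B\<^esub> x)" using assms(1) by (simp flip: B.m_assoc)
  with x(2) show "x : (%x. y \<otimes>\<^bsub>B\<^esub> x) ` supp R s" by blast
 qed
 moreover have "supp R (lsh y s) <= cr B" by (auto simp: supp_def lsh_def)
 ultimately show ?thesis using assms(2) finite_subset[of "supp R (lsh y s)" "(%x. y \<otimes>\<^bsub>B\<^esub> x) ` supp R s"]
  by (auto simp: free_module_carrier lsh_def)
qed

lemma lsh_hom: "y : cr B ==> lsh y : mod_hom R A A"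
 by (rule mod_homI) (auto simp: lsh_closed, auto simp: lsh_def free_module_ops)

lemma lsh_single: "y : cr B ==> g : cr B ==> lsh y (single R g) = single R (y \<otimes>\<^bsub>B\<^esub> g)"
proof
 fix x assume y: "y : cr B" "g : cr B"
 have "(inv\<^bsub>B\<^esub> y \<otimes>\<^bsub>B\<^esub> x = g) = (x = y \<otimes>\<^bsub>B\<^esub> g)" if "x : cr B"
  using that y B.inv_solve_left' B.inv_solve_left by (metis B.inv_closed B.inv_inv B.m_closed)
 then show "lsh y (single R g) x = single R (y \<otimes>\<^bsub>B\<^esub> g) x"
  using y by (auto simp: lsh_def single_def)
qed

text \<open>Convolution is the linear extension of left translations. Identities about it can then
  be checked on group elements, one variable at a time.\<close>

lemma conv_tl:
 assumes "i : cr A" "s : cr A"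
 shows "conv i s = tl R A (%y. lsh y s) i"
proof
 fix x
 have "tl R A (%y. lsh y s) i x = (\<Oplus>\<^bsub>R\<^esub>y\<in>supp R i. i y \<otimes>\<^bsub>R\<^esub> lsh y s x)"
  by (rule tl_pointwise[OF R lsh_closed assms(1)]) (use assms(2) in auto)
 also have "\<dots> = conv i s x"
 proof (cases "x : cr B")
  case False
  have "(\<Oplus>\<^bsub>R\<^esub>y\<in>supp R i. i y \<otimes>\<^bsub>R\<^esub> \<zero>\<^bsub>R\<^esub>) = \<zero>\<^bsub>R\<^esub>"
   using free_module_val[OF R assms(1)] by (intro V.R.add.finprod_one_eqI) auto
  with False show ?thesis by (simp add: group_algebra_def lsh_def)
 qed (simp add: group_algebra_def lsh_def)
 finally show "conv i s x = tl R A (%y. lsh y s) i x" by simp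
qed

lemma conv_hom_left: "s : cr A ==> (%i. tl R A (%y. lsh y s) i) : mod_hom R A A"
 by (rule tl_hom[OF R A.module_axioms]) (auto simp: lsh_closed)

lemma conv_hom_right: "i : cr A ==> (%s. tl R A (%y. lsh y s) i) : mod_hom R A A"
 by (rule tl_param[OF R A.module_axioms A.module_axioms lsh_hom])

lemma conv_closed: "i : cr A ==> s : cr A ==> conv i s : cr A"
 using mod_homD(1)[OF conv_hom_left] by (simp add: conv_tl)

lemma conv_single: "i : cr A ==> g : cr B ==>
  conv i (single R g) = tl R A (%y. single R (y \<otimes>\<^bsub>B\<^esub> g)) i"
proof -
 assume i: "i : cr A" and g: "g : cr B"
 have "tl R A (%y. lsh y (single R g)) i = tl R A (%y. single R (y \<otimes>\<^bsub>B\<^esub> g)) i"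
  by (rule mod_hom_single_eq[OF R A.module_axioms tl_hom[OF R A.module_axioms] tl_hom[OF R A.module_axioms] _ i])
   (use g in \<open>auto simp: lsh_closed lsh_single tl_single[OF R A.module_axioms]\<close>)
 then show ?thesis using i g by (simp add: conv_tl)
qed

lemma conv_single_single: "h : cr B ==> g : cr B ==>
  conv (single R h) (single R g) = single R (h \<otimes>\<^bsub>B\<^esub> g)"
 by (simp add: conv_single tl_single[OF R A.module_axioms])

lemma conv_I:
 assumes "i : I" "s : cr A"
 shows "conv i s : I"
proof -
 interpret RM: module R "ring_module R" by (rule ring_module_module[OF R])
 have i: "i : cr A" by (rule I_sub[OF assms(1)])
 have "aug R (tl R A (%y. lsh y s) i) = \<zero>\<^bsub>ring_module R\<^esub>"
 proof (rule mod_hom_single_eq[OF R RM.module_axioms mod_hom_comp[OF conv_hom_right[OF i] aug_hom]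
    mod_hom_zero[OF A.module_axioms RM.module_axioms] _ assms(2)])
  fix g assume g: "g : cr B"
  have "aug R (tl R A (%y. lsh y (single R g)) i) = aug R i"
   by (rule mod_hom_single_eq[OF R RM.module_axioms
      mod_hom_comp[OF conv_hom_left[OF single[OF g]] aug_hom] aug_hom _ i])
    (use g in \<open>simp add: tl_single[OF R A.module_axioms] lsh_closed lsh_single aug_single\<close>)
  then show "aug R (tl R A (%y. lsh y (single R g)) i) = \<zero>\<^bsub>ring_module R\<^esub>"
   using assms(1) by (simp add: I_iff ring_module_def[OF R])
 qed
 then show ?thesis using i assms(2) by (simp add: I_iff conv_closed conv_tl ring_module_def[OF R] flip: conv_tl)
qed

lemma conv_one: "i : cr A ==> conv i (single R \<one>\<^bsub>B\<^esub>) = i"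
proof -
 assume i: "i : cr A"
 have "tl R A (%y. lsh y (single R \<one>\<^bsub>B\<^esub>)) i = (%i. i) i"
  by (rule mod_hom_single_eq[OF R A.module_axioms conv_hom_left[OF single] _ _ i])
   (use i in \<open>auto simp: tl_single[OF R A.module_axioms] lsh_closed lsh_single mod_hom_def\<close>)
 then show ?thesis using i by (simp add: conv_tl)
qed

text \<open>Subtracting \<open>aug x\<close> times the unit projects the group algebra onto the
  ideal. The projection sends a group element \<open>h\<close> to \<open>h - 1\<close> and fixes
  every element of the ideal, so it carries the obvious spanning set to the desired one.\<close>

lemma I_span: "i : I ==> i : aspan A {a \<odot>\<^bsub>A\<^esub> aug1 R B h | a h. a : cr R & h : cr B}"
proof -
 assume i: "i : I"
 interpret RM: module R "ring_module R" by (rule ring_module_module[OF R])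
 let ?S = "{a \<odot>\<^bsub>A\<^esub> single R h | a h. a : cr R & h : cr B}"
 define f where "f x = x \<oplus>\<^bsub>A\<^esub> (\<ominus>\<^bsub>A\<^esub> (aug R x \<odot>\<^bsub>A\<^esub> single R \<one>\<^bsub>B\<^esub>))" for x
 have s1: "single R \<one>\<^bsub>B\<^esub> : cr A" by simp
 have "(%a. a \<odot>\<^bsub>A\<^esub> single R \<one>\<^bsub>B\<^esub>) : mod_hom R (ring_module R) A"
  using s1 by (intro mod_homI) (auto simp: ring_module_def[OF R] A.smult_l_distr A.smult_assoc1)
 from mod_hom_neg[OF A.module_axioms A.module_axioms mod_hom_comp[OF aug_hom this]]
 have fh: "f : mod_hom R A A" unfolding f_def
  by (intro mod_hom_plus[OF A.module_axioms A.module_axioms]) (auto simp: mod_hom_def)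
 have sub: "?S <= cr A" by (clarify, intro A.smult_closed single)
 have "f i : aspan A (f ` ?S)"
  by (rule addmap_aspan[OF mod_hom_addmap[OF fh] A.M.abelian_group_axioms A.M.abelian_group_axioms sub])
   (rule free_module_span[OF R I_sub[OF i]])
 moreover have "f i = i" using i s1 by (simp add: f_def I_iff A.smult_l_null a_inv_zero[OF A.M.abelian_group_axioms])
 moreover have "f (a \<odot>\<^bsub>A\<^esub> single R h) = a \<odot>\<^bsub>A\<^esub> aug1 R B h" if "a : cr R" "h : cr B" for a h
 proof -
  have "f (single R h) = aug1 R B h" using s1 by (simp add: f_def aug_single aug1_def a_minus_def)
  then show ?thesis using mod_homD(3)[OF fh that(1) single[OF that(2)]] by simp
 qed
 then have sub': "f ` ?S <= {a \<odot>\<^bsub>A\<^esub> aug1 R B h | a h. a : cr R & h : cr B}" by blast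
 ultimately show ?thesis using aspan_mono[OF _ sub'] by simp
qed

abbreviation "rels == tensor_relations R (cr (group_algebra R B)) (augmentation_ideal R B)
   (monoid.mult (group_algebra R B)) V (lact R V act)"
abbreviation "K == tensor_kernel R (cr (group_algebra R B)) (augmentation_ideal R B)
   (monoid.mult (group_algebra R B)) V (lact R V act)"

lemma aug_ops:
 "x \<oplus>\<^bsub>augmentation_ideal R B\<^esub> y = x \<oplus>\<^bsub>A\<^esub> y"
 by (simp add: augmentation_ideal_def group_algebra_free_module)

lemma lact_hom_left: "v : cr V ==> (%s. lact R V act s v) : mod_hom R A V"
 unfolding lact_tl by (rule tl_hom[OF R V.module_axioms]) (auto simp: repD(4)[OF rp])

lemma lact_closed: "s : cr A ==> v : cr V ==> lact R V act s v : cr V"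
 using mod_homD(1)[OF lact_hom_left] .

lemma lact_single: "h : cr B ==> v : cr V ==> lact R V act (single R h) v = act h v"
 unfolding lact_tl by (rule tl_single[OF R V.module_axioms]) (auto simp: repD(4)[OF rp])

lemma rels_cases:
 assumes "r : rels"
 obtains (add1) i j v where "i : I" "j : I" "v : cr V"
   "r = single R (i \<oplus>\<^bsub>A\<^esub> j, v) \<ominus>\<^bsub>E\<^esub> (single R (i, v) \<oplus>\<^bsub>E\<^esub> single R (j, v))"
  | (add2) i v w where "i : I" "v : cr V" "w : cr V"
   "r = single R (i, v \<oplus>\<^bsub>V\<^esub> w) \<ominus>\<^bsub>E\<^esub> (single R (i, v) \<oplus>\<^bsub>E\<^esub> single R (i, w))"
  | (bal) i s v where "i : I" "s : cr A" "v : cr V"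
   "r = single R (conv i s, v) \<ominus>\<^bsub>E\<^esub> single R (i, lact R V act s v)"
  | (scal) a i v where "a : cr R" "i : I" "v : cr V"
   "r = a \<odot>\<^bsub>E\<^esub> single R (i, v) \<ominus>\<^bsub>E\<^esub> single R (i, a \<odot>\<^bsub>V\<^esub> v)"
 using assms unfolding tensor_relations_def Let_def group_algebra_free_module aug_ops
 by (elim UnE CollectE exE conjE)
  ((rule that(1); assumption) | (rule that(2); assumption) | (rule that(3); assumption) | (rule that(4); assumption))+

lemma relsI:
 "i : I ==> j : I ==> v : cr V ==>
  single R (i \<oplus>\<^bsub>A\<^esub> j, v) \<ominus>\<^bsub>E\<^esub> (single R (i, v) \<oplus>\<^bsub>E\<^esub> single R (j, v)) : rels"
 "i : I ==> v : cr V ==> w : cr V ==>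
  single R (i, v \<oplus>\<^bsub>V\<^esub> w) \<ominus>\<^bsub>E\<^esub> (single R (i, v) \<oplus>\<^bsub>E\<^esub> single R (i, w)) : rels"
 "i : I ==> s : cr A ==> v : cr V ==>
  single R (conv i s, v) \<ominus>\<^bsub>E\<^esub> single R (i, lact R V act s v) : rels"
 "a : cr R ==> i : I ==> v : cr V ==>
  a \<odot>\<^bsub>E\<^esub> single R (i, v) \<ominus>\<^bsub>E\<^esub> single R (i, a \<odot>\<^bsub>V\<^esub> v) : rels"
 unfolding tensor_relations_def Let_def group_algebra_free_module aug_ops by blast+

lemma I_add: "i : I ==> j : I ==> i \<oplus>\<^bsub>A\<^esub> j : I"
 by (rule asubD(4)[OF I_asub])

lemma sE: "i : I ==> v : cr V ==> single R (i, v) : cr E"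
 by (rule single_closed[OF R]) simp

lemma rels_sub: "rels <= cr E"
proof
 fix r assume "r : rels"
 then show "r : cr E"
  by (cases rule: rels_cases) (simp_all add: sE I_add conv_I lact_closed)
qed

lemma K_iff: "x : K \<longleftrightarrow> (ALL N. submodule N R E --> rels <= N --> x : N)"
 unfolding tensor_kernel_def module_span_def by blast

lemma K_sub: "submodule K R E"
proof (rule E.submoduleI)
 show "K <= cr E"
  using K_iff E.carrier_is_submodule rels_sub by (intro subsetI) simp
 show "\<zero>\<^bsub>E\<^esub> : K" unfolding K_iff
 proof (intro allI impI)
  fix N assume "submodule N R E"
  then show "\<zero>\<^bsub>E\<^esub> : N" using subgroup.one_closed[OF submodule.axioms(1)] by fastforce
 qed
 fix a assume a: "a : K"
 show "\<ominus>\<^bsub>E\<^esub> a : K" unfolding K_iff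
 proof (intro allI impI)
  fix N assume N: "submodule N R E" "rels <= N"
  then have "a : N" using a K_iff by simp
  then show "\<ominus>\<^bsub>E\<^esub> a : N" by (rule E.submoduleE(3)[OF N(1)])
 qed
 fix b assume b: "b : K"
 show "a \<oplus>\<^bsub>E\<^esub> b : K" unfolding K_iff
 proof (intro allI impI)
  fix N assume N: "submodule N R E" "rels <= N"
  then have "a : N" "b : N" using a b K_iff by simp_all
  then show "a \<oplus>\<^bsub>E\<^esub> b : N" by (rule E.submoduleE(5)[OF N(1)])
 qed
next
 fix a x assume a: "a : cr R" "x : K"
 show "a \<odot>\<^bsub>E\<^esub> x : K" unfolding K_iff
 proof (intro allI impI)
  fix N assume N: "submodule N R E" "rels <= N"
  then have "x : N" using a K_iff by simp
  then show "a \<odot>\<^bsub>E\<^esub> x : N" by (rule E.submoduleE(4)[OF N(1) a(1)])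
 qed
qed

lemma K_least: "submodule N R E ==> rels <= N ==> K <= N"
 by (auto simp: tensor_kernel_def module_span_def)

lemma rels_K: "rels <= K"
 by (auto simp: tensor_kernel_def module_span_def)

lemma K_asub: "asub E K"
 unfolding asub_def
 using E.submoduleE[OF K_sub] subgroup.one_closed[OF submodule.axioms(1)[OF K_sub]] by auto

lemma K_smult: "ALL a:cr R. ALL x:K. a \<odot>\<^bsub>E\<^esub> x : K"
 using E.submoduleE(4)[OF K_sub] by blast

sublocale Q: module_quotient E K
 by (simp add: module_quotient_def module_quotient_axioms_def K_asub E.M.abelian_group_axioms)

lemma tens_quot: "tens R B V act = quot_module E K"
 by (simp add: tens_def tensor_module_def)

lemma tens_module: "module R (tens R B V act)"
 unfolding tens_quot by (rule quot_is_module[OF E.module_axioms K_asub K_smult])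

abbreviation "T == tens R B V act"

sublocale T: module R T by (rule tens_module)

lemma q_hom: "Q.q : mod_hom R E T"
 by (rule mod_homI)
  (simp_all add: tens_quot Q.q_carrier Q.q_add quot_smult[OF E.module_axioms K_asub K_smult])

lemma pt_q: "pt R B V act i v = Q.q (single R (i, v))"
 by (simp add: pt_def pure_tensor_def)

lemma q_rel: "x \<ominus>\<^bsub>E\<^esub> y : rels ==> x : cr E ==> y : cr E ==> Q.q x = Q.q y"
 using Q.q_eq_iff rels_K by blast

lemma pt_closed: "i : I ==> v : cr V ==> pt R B V act i v : cr T"
 using mod_homD(1)[OF q_hom sE] by (simp add: pt_q)

lemma pt_rels:
 "i : I ==> j : I ==> v : cr V ==>
  pt R B V act (i \<oplus>\<^bsub>A\<^esub> j) v = pt R B V act i v \<oplus>\<^bsub>T\<^esub> pt R B V act j v"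
 "i : I ==> v : cr V ==> w : cr V ==>
  pt R B V act i (v \<oplus>\<^bsub>V\<^esub> w) = pt R B V act i v \<oplus>\<^bsub>T\<^esub> pt R B V act i w"
 "i : I ==> s : cr A ==> v : cr V ==>
  pt R B V act (conv i s) v = pt R B V act i (lact R V act s v)"
 "a : cr R ==> i : I ==> v : cr V ==>
  pt R B V act i (a \<odot>\<^bsub>V\<^esub> v) = a \<odot>\<^bsub>T\<^esub> pt R B V act i v"
 using q_rel[OF relsI(1)] q_rel[OF relsI(2)] q_rel[OF relsI(3)] q_rel[OF relsI(4)]
  mod_homD(2)[OF q_hom sE sE] mod_homD(3)[OF q_hom _ sE]
 by (simp_all add: pt_q sE I_add conv_I lact_closed)

text \<open>The relations let a scalar act on the right factor only. On the left factor it is right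
  multiplication by \<open>a\<close> times the unit of the group algebra, which the balancing
  relation moves across.\<close>

lemma pt_smult: "a : cr R ==> i : I ==> v : cr V ==>
  pt R B V act (a \<odot>\<^bsub>A\<^esub> i) v = a \<odot>\<^bsub>T\<^esub> pt R B V act i v"
proof -
 assume a: "a : cr R" "i : I" "v : cr V"
 have s1: "single R \<one>\<^bsub>B\<^esub> : cr A" by simp
 have "conv i (a \<odot>\<^bsub>A\<^esub> single R \<one>\<^bsub>B\<^esub>) = a \<odot>\<^bsub>A\<^esub> conv i (single R \<one>\<^bsub>B\<^esub>)"
  using mod_homD(3)[OF conv_hom_right[OF I_sub[OF a(2)]] a(1) s1] a s1 I_sub by (simp add: conv_tl)
 then have "conv i (a \<odot>\<^bsub>A\<^esub> single R \<one>\<^bsub>B\<^esub>) = a \<odot>\<^bsub>A\<^esub> i" using a I_sub by (simp add: conv_one)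
 moreover have "lact R V act (a \<odot>\<^bsub>A\<^esub> single R \<one>\<^bsub>B\<^esub>) v = a \<odot>\<^bsub>V\<^esub> v"
  using mod_homD(3)[OF lact_hom_left[OF a(3)] a(1) s1] a by (simp add: lact_single repD(5)[OF rp])
 ultimately show ?thesis
  using pt_rels(3)[OF a(2) A.smult_closed[OF a(1) s1] a(3)] pt_rels(4)[OF a] by simp
qed

text \<open>In the augmentation ideal \<open>g h - 1 = (g - 1) h + (h - 1)\<close>, and
  \<open>h\<close> passes through the tensor sign to act on \<open>v\<close>.\<close>

lemma br_der: "der R B V act T (br R B V act)"
 unfolding der_def
proof (intro conjI ballI)
 show "module R T" by (rule tens_module)
 fix g assume g: "g : cr B"
 note gI = aug1_I[OF g]
 show "br R B V act g : mod_hom R V T"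
  using gI by (intro mod_homI) (simp_all add: br_def pt_closed pt_rels)
 fix h v assume h: "h : cr B" and v: "v : cr V"
 note s = single[OF g] single[OF h] single[OF B.one_closed] single[OF B.m_closed[OF g h]]
 have "conv (aug1 R B g) (single R h) = single R (g \<otimes>\<^bsub>B\<^esub> h) \<ominus>\<^bsub>A\<^esub> single R h"
 proof -
  have "conv (aug1 R B g) (single R h) = conv (single R g) (single R h) \<ominus>\<^bsub>A\<^esub> conv (single R \<one>\<^bsub>B\<^esub>) (single R h)"
   using addmapD(5)[OF mod_hom_addmap[OF conv_hom_left[OF s(2)]] A.M.abelian_group_axioms A.M.abelian_group_axioms s(1,3)]
    s I_sub[OF gI] by (simp add: conv_tl aug1_def)
  then show ?thesis using g h by (simp add: conv_single_single)
 qed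
 then have "aug1 R B (g \<otimes>\<^bsub>B\<^esub> h) = conv (aug1 R B g) (single R h) \<oplus>\<^bsub>A\<^esub> aug1 R B h"
  using s by (simp add: aug1_def a_minus_def A.M.a_assoc A.M.r_neg1)
 then show "br R B V act (g \<otimes>\<^bsub>B\<^esub> h) v = br R B V act g (act h v) \<oplus>\<^bsub>T\<^esub> br R B V act h v"
  using pt_rels(1)[OF conv_I[OF gI s(2)] aug1_I[OF h] v] pt_rels(3)[OF gI s(2) v] h v
  by (simp add: br_def lact_single)
qed

lemma pt_span: "i : I ==> v : cr V ==>
  pt R B V act i v : aspan T {br R B V act h w | h w. h : cr B & w : cr V}"
proof -
 assume i: "i : I" and v: "v : cr V"
 let ?S = "{br R B V act h w | h w. h : cr B & w : cr V}"
 have "?S <= cr T" by (clarify, rule derD(3)[OF br_der])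
 then have a: "asub T (aspan T ?S)" by (rule aspan_asub[OF T.M.abelian_group_axioms])
 let ?N = "{i : I. pt R B V act i v : aspan T ?S}"
 have z: "pt R B V act (\<ominus>\<^bsub>A\<^esub> j) v = \<ominus>\<^bsub>T\<^esub> pt R B V act j v" if j: "j : I" for j
  using pt_smult[OF _ j v, of "\<ominus>\<^bsub>R\<^esub> \<one>\<^bsub>R\<^esub>"] I_sub[OF j] pt_closed[OF j v]
  by (simp add: A.smult_l_minus T.smult_l_minus)
 have z0: "pt R B V act \<zero>\<^bsub>A\<^esub> v = \<zero>\<^bsub>T\<^esub>"
  using pt_smult[OF _ i v, of "\<zero>\<^bsub>R\<^esub>"] I_sub[OF i] pt_closed[OF i v]
  by (simp add: A.smult_l_null T.smult_l_null)
 have "asub A ?N"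
  unfolding asub_def using asubD[OF I_asub] asubD(3-5)[OF a] pt_rels(1)[OF _ _ v] z z0 by auto
 moreover have "{a \<odot>\<^bsub>A\<^esub> aug1 R B h | a h. a : cr R & h : cr B} <= ?N"
 proof clarify
  fix a h assume ah: "a : cr R" "h : cr B"
  have "pt R B V act (a \<odot>\<^bsub>A\<^esub> aug1 R B h) v = br R B V act h (a \<odot>\<^bsub>V\<^esub> v)"
   using pt_smult[OF ah(1) aug1_I[OF ah(2)] v] pt_rels(4)[OF ah(1) aug1_I[OF ah(2)] v] by (simp add: br_def)
  then show "a \<odot>\<^bsub>A\<^esub> aug1 R B h : I & pt R B V act (a \<odot>\<^bsub>A\<^esub> aug1 R B h) v : aspan T ?S"
   using I_smult[OF ah(1) aug1_I[OF ah(2)]] ah V.smult_closed[OF ah(1) v]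
   by (auto intro!: aspan_gen)
 qed
 ultimately show ?thesis using aspan_least[OF _ _ I_span[OF i], of ?N] by simp
qed

lemma tens_span: "x : cr T ==> x : aspan T {br R B V act h v | h v. h : cr B & v : cr V}"
proof -
 assume "x : cr T"
 then obtain y where y: "y : cr E" "x = Q.q y" by (auto simp: tens_quot Q.q_surj)
 let ?S = "{br R B V act h w | h w. h : cr B & w : cr V}"
 have "?S <= cr T" by (clarify, rule derD(3)[OF br_der])
 then have a: "asub T (aspan T ?S)" by (rule aspan_asub[OF T.M.abelian_group_axioms])
 show ?thesis unfolding y(2)
 proof (rule addmap_zero_on_aspan[OF mod_hom_addmap[OF q_hom] E.M.abelian_group_axioms T.M.abelian_group_axioms
    _ free_module_span[OF R y(1)] _ a])
  show "{a \<odot>\<^bsub>E\<^esub> single R p |a p. a : cr R & p : P} <= cr E"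
   by (clarify, intro E.smult_closed sE) auto
  fix s assume "s : {a \<odot>\<^bsub>E\<^esub> single R p |a p. a : cr R & p : P}"
  then obtain a i v where s: "s = a \<odot>\<^bsub>E\<^esub> single R (i, v)" "a : cr R" "i : I" "v : cr V" by blast
  then have "Q.q s = pt R B V act i (a \<odot>\<^bsub>V\<^esub> v)"
   using mod_homD(3)[OF q_hom s(2) sE[OF s(3,4)]] pt_rels(4)[OF s(2-4)] by (simp add: pt_q)
  then show "Q.q s : aspan T ?S" using pt_span s by simp
 qed
qed

text \<open>Only the values of \<open>beta\<close> on the ideal times \<open>V\<close> are
  prescribed, and the resulting map is \<open>tl\<close> with this very \<open>beta\<close>,
  evaluated on chosen representatives: such is the shape of \<open>long_moody\<close> on arrows.
  Independence of the representative holds because \<open>tl R W beta\<close> kills every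
  relation.\<close>

lemma tens_lift:
 assumes W: "module R W" and beta: "!!i v. i : I ==> v : cr V ==> beta (i, v) = tl R W (%h. D h v) i"
  and D: "der R B V act W D"
 shows "tl R W beta : mod_hom R T W" and "!!h v. h : cr B ==> v : cr V ==> tl R W beta (br R B V act h v) = D h v"
proof -
 interpret W: module R W by fact
 note d = derD[OF D]
 define b where "b i v = tl R W (%h. D h v) i" for i v
 have bl: "(%i. b i v) : mod_hom R A W" if "v : cr V" for v
  unfolding b_def using d(3) that by (intro tl_hom[OF R W]) auto
 have brh: "(%v. b i v) : mod_hom R V W" if "i : cr A" for i
  unfolding b_def using d(2) that by (intro tl_param[OF R W V.module_axioms])
 have bI: "beta (i, v) = b i v" if "i : I" "v : cr V" for i v using beta that by (simp add: b_def)
 have bc: "b i v : cr W" if "i : cr A" "v : cr V" for i v using mod_homD(1)[OF brh] that by simp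
 have bs: "b (single R h) v = D h v" if "h : cr B" "v : cr V" for h v
  unfolding b_def using d(3) that by (intro tl_single[OF R W]) auto
 have bbal: "b (conv i s) v = b i (lact R V act s v)" if i: "i : I" and s: "s : cr A" and v: "v : cr V" for i s v
 proof -
  have iA: "i : cr A" by (rule I_sub[OF i])
  have "b (tl R A (%y. lsh y s) i) v = b i (lact R V act s v)"
  proof (rule mod_hom_single_eq[OF R W mod_hom_comp[OF conv_hom_right[OF iA] bl[OF v]]
     mod_hom_comp[OF lact_hom_left[OF v] brh[OF iA]] _ s])
   fix g assume g: "g : cr B"
   have av: "act g v : cr V" by (rule repD(4)[OF rp g v])
   have cv: "(%a. a \<odot>\<^bsub>W\<^esub> D g v) : mod_hom R (ring_module R) W"
    using d(3)[OF g v] by (intro mod_homI) (auto simp: ring_module_def[OF R] W.smult_l_distr W.smult_assoc1)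
   \<comment> \<open>At a group element \<open>i = h\<close> this is the rule
     \<open>D (h g) v = D h (g v) + D g v\<close>. Linear extension in \<open>i\<close> multiplies
     the last term by the augmentation, which vanishes on the ideal; what remains is
     balancedness.\<close>
   have "b (tl R A (%y. lsh y (single R g)) i) v = b i (act g v) \<oplus>\<^bsub>W\<^esub> aug R i \<odot>\<^bsub>W\<^esub> D g v"
    by (rule mod_hom_single_eq[OF R W mod_hom_comp[OF conv_hom_left[OF single[OF g]] bl[OF v]]
       mod_hom_plus[OF W A.module_axioms bl[OF av] mod_hom_comp[OF aug_hom cv]] _ iA])
     (use g v d(3,4) av in \<open>simp add: tl_single[OF R A.module_axioms] lsh_closed lsh_single aug_single bs\<close>)
   then show "b (tl R A (%y. lsh y (single R g)) i) v = b i (lact R V act (single R g) v)"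
    using i g v d(3)[OF g v] bc[OF iA av] by (simp add: I_iff lact_single W.smult_l_null)
  qed
  then show ?thesis using iA s by (simp add: conv_tl)
 qed
 have betac: "beta : P \<rightarrow> cr W" using bI bc I_sub by auto
 have th: "tl R W beta : mod_hom R E W" by (rule tl_hom[OF R W betac])
 note ta = addmapD[OF mod_hom_addmap[OF th] E.M.abelian_group_axioms W.M.abelian_group_axioms]
 have ts: "tl R W beta (single R (i, v)) = b i v" if "i : I" "v : cr V" for i v
  using tl_single[OF R W, of beta "(i, v)"] bI[OF that] bc[OF I_sub[OF that(1)] that(2)] by simp
 let ?N = "{x : cr E. tl R W beta x = \<zero>\<^bsub>W\<^esub>}"
 have N: "submodule ?N R E"
  using ta mod_homD(3)[OF th] by (intro E.submoduleI) (auto simp: W.smult_r_null a_inv_zero[OF W.M.abelian_group_axioms])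
 have ker: "tl R W beta r = \<zero>\<^bsub>W\<^esub>" if "r : rels" for r
  using that
 proof (cases rule: rels_cases)
  case (add1 i j v)
  then show ?thesis using ta(2,5) ts mod_homD(2)[OF bl[OF add1(3)] I_sub I_sub, of i j] bc[OF I_sub]
   by (simp add: sE I_add W.M.r_neg a_minus_def[of W])
 next
  case (add2 i v w)
  then show ?thesis using ta(2,5) ts mod_homD(2)[OF brh[OF I_sub], of i v w] bc[OF I_sub]
   by (simp add: sE W.M.r_neg a_minus_def[of W])
 next
  case (bal i s v)
  then show ?thesis using ta(5) ts bbal[of i s v] bc[OF I_sub]
   by (simp add: sE conv_I lact_closed W.M.r_neg a_minus_def[of W])
 next
  case (scal a i v)
  then show ?thesis using ta(5) ts mod_homD(3)[OF th _ sE] mod_homD(3)[OF brh[OF I_sub], of i a v] bc[OF I_sub]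
   by (simp add: sE W.M.r_neg a_minus_def[of W])
 qed
 have kz: "tl R W beta k = \<zero>\<^bsub>W\<^esub>" if "k : K" for k
  using K_least[OF N] rels_sub ker that by blast
 have tq: "tl R W beta (Q.q x) = tl R W beta x" if x: "x : cr E" for x
 proof -
  obtain n where n: "n : K" "Q.q x = n \<oplus>\<^bsub>E\<^esub> x" using Q.q_ex[OF x] by auto
  then show ?thesis using ta(1,2) x Q.N(2)[OF n(1)] kz by simp
 qed
 show "tl R W beta : mod_hom R T W"
 proof (rule mod_homI)
  fix x assume "x : cr T"
  then obtain x' where x: "x = Q.q x'" "x' : cr E" by (auto simp: tens_quot Q.q_surj)
  then show "tl R W beta x : cr W" by (simp add: tq ta(1))
  { fix a assume "a : cr R"
   then show "tl R W beta (a \<odot>\<^bsub>T\<^esub> x) = a \<odot>\<^bsub>W\<^esub> tl R W beta x"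
    using x mod_homD(3)[OF q_hom, symmetric] by (simp add: tq mod_homD(3)[OF th]) }
  fix y assume "y : cr T"
  then obtain y' where y: "y = Q.q y'" "y' : cr E" by (auto simp: tens_quot Q.q_surj)
  show "tl R W beta (x \<oplus>\<^bsub>T\<^esub> y) = tl R W beta x \<oplus>\<^bsub>W\<^esub> tl R W beta y"
   using x y mod_homD(2)[OF q_hom, symmetric] by (simp add: tq ta(2))
 qed
 fix h v assume h: "h : cr B" and v: "v : cr V"
 have "tl R W beta (br R B V act h v) = b (aug1 R B h) v"
  using aug1_I[OF h] v by (simp add: br_def pt_q tq sE ts)
 also have "\<dots> = b (single R h) v \<ominus>\<^bsub>W\<^esub> b (single R \<one>\<^bsub>B\<^esub>) v"
  unfolding aug1_def
  by (rule addmapD(5)[OF mod_hom_addmap[OF bl[OF v]] A.M.abelian_group_axioms W.M.abelian_group_axioms])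
   (use h in auto)
 also have "\<dots> = D h v"
  using h v der_one[OF D rp v] d(3)[OF h v] by (simp add: bs a_minus_def a_inv_zero[OF W.M.abelian_group_axioms])
 finally show "tl R W beta (br R B V act h v) = D h v" .
qed

lemma tens_universal:
 assumes "der R B V act W D"
 shows "EX f:mod_hom R T W. ALL h:cr B. ALL v:cr V. f (br R B V act h v) = D h v"
 using tens_lift[OF derD(1)[OF assms], of "%p. tl R W (%h. D h (snd p)) (fst p)" D] assms
 by (intro bexI[of _ "tl R W (%p. tl R W (%h. D h (snd p)) (fst p))"]) auto

end

section \<open>Maps of augmentation ideals induced by group homomorphisms\<close>

lemma pushforward_tl:
 assumes "cring R" "alpha : S \<rightarrow> S'" "x : cr (free_module R S)"
 shows "pushforward R alpha x = tl R (free_module R S') (%h. single R (alpha h)) x"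
proof
 fix y
 interpret R: cring R by fact
 note v = free_module_val[OF assms(1,3)]
 have "tl R (free_module R S') (%h. single R (alpha h)) x y = (\<Oplus>\<^bsub>R\<^esub>p\<in>supp R x. x p \<otimes>\<^bsub>R\<^esub> single R (alpha p) y)"
  by (rule tl_pointwise[OF assms(1) _ assms(3)]) (use assms(2) in \<open>auto intro: single_closed[OF assms(1)]\<close>)
 also have "\<dots> = (\<Oplus>\<^bsub>R\<^esub>p\<in>{p : supp R x. alpha p = y}. x p)"
 proof (rule R.add.finprod_mono_neutral_cong_right)
  show "finite (supp R x)" using assms(3) by (simp add: free_module_carrier)
 qed (use v in \<open>auto simp: single_def\<close>)
 finally show "pushforward R alpha x y = tl R (free_module R S') (%h. single R (alpha h)) x y"
  by (simp add: pushforward_def)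
qed

text \<open>Both sides are additive in \<open>i\<close>, so \<open>i = a (h - 1)\<close> suffices.
  The right-hand side extends \<open>br\<close> from group elements, and \<open>br\<close> at the
  neutral element is zero, so \<open>h\<close> and \<open>h - 1\<close> give the same value
  there.\<close>

lemma pushforward_pt:
 assumes rp: "rep R B V act" and rp': "rep R B' V' act'" and alpha: "alpha : hom B B'"
  and w: "w : cr V'" and i: "i : cr (augmentation_ideal R B)"
 shows "pt R B' V' act' (pushforward R alpha i) w = tl R (tens R B' V' act') (%h. br R B' V' act' (alpha h) w) i"
proof -
 interpret X: tensor_ctx R B V act by unfold_locales (rule rp)
 interpret Y: tensor_ctx R B' V' act' by unfold_locales (rule rp')
 have alphac: "alpha : cr B \<rightarrow> cr B'" using alpha by (auto simp: hom_def)
 define p where "p = tl R Y.A (%h. single R (alpha h))"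
 have p: "p : mod_hom R X.A Y.A" unfolding p_def
  using alphac by (intro tl_hom[OF X.R Y.A.module_axioms]) (auto simp: Pi_iff)
 have ps: "p (single R h) = single R (alpha h)" if "h : cr B" for h
  unfolding p_def using alphac that by (intro tl_single[OF X.R Y.A.module_axioms]) (auto simp: Pi_iff)
 define f where "f = tl R Y.T (%h. br R B' V' act' (alpha h) w)"
 have fh: "f : mod_hom R X.A Y.T" unfolding f_def
  using alphac derD(3)[OF Y.br_der _ w] by (intro tl_hom[OF X.R Y.T.module_axioms]) auto
 have fs: "f (single R h) = br R B' V' act' (alpha h) w" if "h : cr B" for h
  unfolding f_def using alphac that derD(3)[OF Y.br_der _ w] by (intro tl_single[OF X.R Y.T.module_axioms]) auto
 note pa = addmapD[OF mod_hom_addmap[OF p] X.A.M.abelian_group_axioms Y.A.M.abelian_group_axioms]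
 note fa = addmapD[OF mod_hom_addmap[OF fh] X.A.M.abelian_group_axioms Y.T.M.abelian_group_axioms]
 have one: "alpha \<one>\<^bsub>B\<^esub> = \<one>\<^bsub>B'\<^esub>" by (rule hom_one[OF alpha X.B.is_group Y.B.is_group])
 have p1: "p (aug1 R B h) = aug1 R B' (alpha h)" if "h : cr B" for h
  using pa(5)[of "single R h" "single R \<one>\<^bsub>B\<^esub>"] that by (simp add: aug1_def ps one)
 have f1: "f (aug1 R B h) = br R B' V' act' (alpha h) w" if "h : cr B" for h
 proof -
  have "alpha h : cr B'" using alphac that by auto
  from derD(3)[OF Y.br_der this w] show ?thesis
   using fa(5)[of "single R h" "single R \<one>\<^bsub>B\<^esub>"] that der_one[OF Y.br_der rp' w]
   by (simp add: aug1_def fs one a_minus_def[of Y.T] a_inv_zero[OF Y.T.M.abelian_group_axioms])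
 qed
 have z: "pt R B' V' act' (\<ominus>\<^bsub>Y.A\<^esub> j) w = \<ominus>\<^bsub>Y.T\<^esub> pt R B' V' act' j w" if j: "j : Y.I" for j
  using Y.pt_smult[OF _ j w, of "\<ominus>\<^bsub>R\<^esub> \<one>\<^bsub>R\<^esub>"] Y.I_sub[OF j] Y.pt_closed[OF j w]
  by (simp add: Y.A.smult_l_minus Y.T.smult_l_minus)
 have i0: "\<zero>\<^bsub>Y.A\<^esub> : Y.I" by (rule asubD(3)[OF Y.I_asub])
 have z0: "pt R B' V' act' \<zero>\<^bsub>Y.A\<^esub> w = \<zero>\<^bsub>Y.T\<^esub>"
  using Y.pt_smult[OF _ i0 w, of "\<zero>\<^bsub>R\<^esub>"] Y.I_sub[OF i0] Y.pt_closed[OF i0 w]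
  by (simp add: Y.A.smult_l_null Y.T.smult_l_null)
 let ?N = "{i : cr X.A. p i : Y.I & pt R B' V' act' (p i) w = f i}"
 have "asub X.A ?N"
  unfolding asub_def using pa(2-4) fa(2-4) i0 z0 z asubD(4,5)[OF Y.I_asub] Y.pt_rels(1)[OF _ _ w]
  by auto
 moreover have "{a \<odot>\<^bsub>X.A\<^esub> aug1 R B h | a h. a : cr R & h : cr B} <= ?N"
 proof clarify
  fix a h assume a: "a : cr R" and h: "h : cr B"
  have hI: "aug1 R B h : cr X.A" by (rule X.I_sub[OF X.aug1_I[OF h]])
  have h': "alpha h : cr B'" using alphac h by auto
  show "a \<odot>\<^bsub>X.A\<^esub> aug1 R B h : cr X.A & p (a \<odot>\<^bsub>X.A\<^esub> aug1 R B h) : Y.I &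
   pt R B' V' act' (p (a \<odot>\<^bsub>X.A\<^esub> aug1 R B h)) w = f (a \<odot>\<^bsub>X.A\<^esub> aug1 R B h)"
   using mod_homD(3)[OF p a hI] mod_homD(3)[OF fh a hI] p1[OF h] f1[OF h]
    Y.pt_smult[OF a Y.aug1_I[OF h'] w] Y.I_smult[OF a Y.aug1_I[OF h']] X.A.smult_closed[OF a hI]
   by (simp add: br_def)
 qed
 ultimately have "i : ?N" using aspan_least[OF _ _ X.I_span[OF i], of ?N] by simp
 then show ?thesis using pushforward_tl[OF X.R alphac X.I_sub[OF i]] by (simp add: f_def p_def)
qed

section \<open>The bracket construction\<close>

context strict_braided_groupoid
begin

abbreviation (input) obj_tensor (infixr "**" 80) where "X ** Y == X \<natural> Y"
abbreviation (input) arr_tensor (infixr "##" 80) where "f ## g == f \<boxtimes> g"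

abbreviation Q where "Q == quillen C"
abbreviation (input) qcmp (infixr "$$" 70) where "f $$ g == f \<cdot>\<^bsub>Q\<^esub> g"
abbreviation (input) qid where "qid X == bracket C X (Unit C) (Idn C X)"
abbreviation Gh where "Gh X Y == homs C X Y"

lemma homsD: "f : Gh X Y ==> f : Arr C" "f : Gh X Y ==> Src C f = X" "f : Gh X Y ==> Tgt C f = Y"
 "f : Gh X Y ==> X : Obj C" "f : Gh X Y ==> Y : Obj C"
 using src_obj tgt_obj by (auto simp: homs_def)

lemma inv_arrow:
 assumes f: "f : Gh X Y"
 shows "inv_arrow C f : Gh Y X" "inv_arrow C f \<cdot> f = Idn C X" "f \<cdot> inv_arrow C f = Idn C Y"
proof -
 note d = homsD[OF f]
 obtain g where g: "inverse_arrows C f g" using arr_iso d(1) by blast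
 have un: "g' = g" if g': "inverse_arrows C f g'" for g'
 proof -
  have h: "g : Gh Y X" "g' : Gh Y X" "g' \<cdot> f = Idn C X" "f \<cdot> g = Idn C Y"
   using g g' d by (auto simp: inverse_arrows_def)
  have "g' = g' \<cdot> (f \<cdot> g)" using idn_right[OF h(2)] h(4) by simp
  also have "\<dots> = (g' \<cdot> f) \<cdot> g" by (rule cmp_assoc[OF h(1) f h(2), symmetric])
  also have "\<dots> = g" using idn_left[OF h(1)] h(3) by simp
  finally show ?thesis .
 qed
 have "inverse_arrows C f (inv_arrow C f)"
  unfolding inv_arrow_def by (rule theI[where P = "inverse_arrows C f", OF g un])
 then show "inv_arrow C f : Gh Y X" "inv_arrow C f \<cdot> f = Idn C X" "f \<cdot> inv_arrow C f = Idn C Y"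
  using d by (auto simp: inverse_arrows_def)
qed

lemma isos_homs: "isos C X Y = Gh X Y"
 using arr_iso by (auto simp: isos_def homs_def)

lemmas ic = interchange[symmetric]
lemmas [simp] = unit_obj tensor_obj tensor_idn unit_obj_left unit_obj_right tensor_obj_assoc

lemma idn_Arr [simp]: "X : Obj C ==> Idn C X : Arr C" "X : Obj C ==> Tgt C (Idn C X) = X"
  "X : Obj C ==> Src C (Idn C X) = X"
 using idn_hom by (auto simp: homs_def)

lemma tarr_assoc: "f : Gh X X' ==> g : Gh Y Y' ==> h : Gh Z Z' ==> (f##g)##h = f##(g##h)"
 by (rule tensor_arr_assoc) (auto simp: homs_def)

text \<open>With unit objects inserted, a hexagon says that the braiding is its own square, and an
  idempotent isomorphism is an identity.\<close>

lemma braid_unit: "X : Obj C ==> Brd C X (Unit C) = Idn C X" "X : Obj C ==> Brd C (Unit C) X = Idn C X"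
proof -
 assume X: "X : Obj C"
 have idem: "f = Idn C X" if f: "f : Gh X X" and e: "f = f \<cdot> f" for f
 proof -
  have "Idn C X = inv_arrow C f \<cdot> (f \<cdot> f)" using inv_arrow(2)[OF f] e by simp
  also have "\<dots> = f" using cmp_assoc[OF f f inv_arrow(1)[OF f]] inv_arrow(2)[OF f] idn_left[OF f] by simp
  finally show ?thesis by simp
 qed
 have b: "Brd C X (Unit C) : Gh X X" "Brd C (Unit C) X : Gh X X"
  using braid_hom[OF X unit_obj] braid_hom[OF unit_obj X] X by auto
 show "Brd C X (Unit C) = Idn C X"
  by (rule idem[OF b(1)]) (use hexagon1[OF X unit_obj unit_obj] homsD(1)[OF b(1)] X in \<open>simp add: unit_arr_left unit_arr_right\<close>)
 show "Brd C (Unit C) X = Idn C X"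
  by (rule idem[OF b(2)]) (use hexagon2[OF unit_obj unit_obj X] homsD(1)[OF b(2)] X in \<open>simp add: unit_arr_left unit_arr_right\<close>)
qed

abbreviation braid' where "braid' X Y == inv_arrow C (Brd C X Y)"

lemma braid'_hom: "X : Obj C ==> Y : Obj C ==> braid' X Y : Gh (Y**X) (X**Y)"
 using inv_arrow(1)[OF braid_hom] .

lemma inv_idn: "X : Obj C ==> inv_arrow C (Idn C X) = Idn C X"
 using inv_arrow(1,2)[OF idn_hom] idn_right[OF inv_arrow(1)[OF idn_hom]] by metis

lemma cancel_left: "f : Gh X Y ==> g : Gh W X ==> h : Gh W X ==> f \<cdot> g = f \<cdot> h ==> g = h"
 using cmp_assoc[of g W X f Y "inv_arrow C f" X] cmp_assoc[of h W X f Y "inv_arrow C f" X]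
  inv_arrow[of f X Y] idn_left by metis

lemma braid'_natural:
 assumes f: "f : Gh X X'" and g: "g : Gh Y Y'"
 shows "(f##g) \<cdot> braid' X Y = braid' X' Y' \<cdot> (g##f)"
proof -
 note o = homsD(4,5)[OF f] homsD(4,5)[OF g]
 note b = braid_hom[OF o(1,3)] braid_hom[OF o(2,4)] braid'_hom[OF o(1,3)] braid'_hom[OF o(2,4)]
 note fg = tensor_hom[OF f g] tensor_hom[OF g f]
 have "Brd C X' Y' \<cdot> ((f##g) \<cdot> braid' X Y) = (Brd C X' Y' \<cdot> (f##g)) \<cdot> braid' X Y"
  by (rule cmp_assoc[OF b(3) fg(1) b(2), symmetric])
 also have "\<dots> = (g##f) \<cdot> (Brd C X Y \<cdot> braid' X Y)"
  unfolding braid_natural[OF f g] by (rule cmp_assoc[OF b(3,1) fg(2)])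
 also have "\<dots> = g##f" using inv_arrow(3)[OF b(1)] idn_right[OF fg(2)] by simp
 also have "\<dots> = Brd C X' Y' \<cdot> (braid' X' Y' \<cdot> (g##f))"
  using cmp_assoc[OF fg(2) b(4,2)] inv_arrow(3)[OF b(2)] idn_left[OF fg(2)] by simp
 finally show ?thesis by (rule cancel_left[OF b(2) cmp_hom[OF b(3) fg(1)] cmp_hom[OF fg(2) b(4)]])
qed

lemma inv_arrow_eq: "f : Gh X Y ==> g : Gh Y X ==> f \<cdot> g = Idn C Y ==> inv_arrow C f = g"
 using cancel_left[of f X Y "inv_arrow C f" Y g] inv_arrow[of f X Y] by simp

lemma whisk_left: "X : Obj C ==> f : Gh Y Y' ==> Idn C X##f : Gh (X**Y) (X**Y')"
 by (rule tensor_hom[OF idn_hom])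

lemma whisk_right: "X : Obj C ==> f : Gh Y Y' ==> f##Idn C X : Gh (Y**X) (Y'**X)"
 by (rule tensor_hom[OF _ idn_hom])

lemma braid'_hex1:
 assumes "X : Obj C" "Y : Obj C" "Z : Obj C"
 shows "braid' X (Y**Z) = (braid' X Y##Idn C Z) \<cdot> (Idn C Y##braid' X Z)"
proof (rule inv_arrow_eq)
 note b = braid_hom[OF assms(1,2)] braid_hom[OF assms(1,3)] braid'_hom[OF assms(1,2)] braid'_hom[OF assms(1,3)]
 have h: "Brd C X Y##Idn C Z : Gh (X**Y**Z) (Y**X**Z)" "braid' X Y##Idn C Z : Gh (Y**X**Z) (X**Y**Z)"
  "Idn C Y##Brd C X Z : Gh (Y**X**Z) (Y**Z**X)" "Idn C Y##braid' X Z : Gh (Y**Z**X) (Y**X**Z)"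
  using whisk_right[OF assms(3) b(1)] whisk_right[OF assms(3) b(3)] whisk_left[OF assms(2) b(2)]
   whisk_left[OF assms(2) b(4)] assms by simp_all
 show "Brd C X (Y**Z) : Gh (X**Y**Z) (Y**Z**X)" using braid_hom[of X "Y**Z"] assms by simp
 show "(braid' X Y##Idn C Z) \<cdot> (Idn C Y##braid' X Z) : Gh (Y**Z**X) (X**Y**Z)"
  by (rule cmp_hom[OF h(4,2)])
 have e1: "(Brd C X Y##Idn C Z) \<cdot> (braid' X Y##Idn C Z) = Idn C (Y**X**Z)"
  using ic[OF b(3,1) idn_hom[OF assms(3)] idn_hom[OF assms(3)]] inv_arrow(3)[OF b(1)] idn_left[OF idn_hom[OF assms(3)]] assms by simp
 have e2: "(Idn C Y##Brd C X Z) \<cdot> (Idn C Y##braid' X Z) = Idn C (Y**Z**X)"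
  using ic[OF idn_hom[OF assms(2)] idn_hom[OF assms(2)] b(4,2)] inv_arrow(3)[OF b(2)] idn_left[OF idn_hom[OF assms(2)]] assms by simp
 have "Brd C X (Y**Z) \<cdot> ((braid' X Y##Idn C Z) \<cdot> (Idn C Y##braid' X Z)) =
  (Idn C Y##Brd C X Z) \<cdot> ((Brd C X Y##Idn C Z) \<cdot> ((braid' X Y##Idn C Z) \<cdot> (Idn C Y##braid' X Z)))"
  unfolding hexagon1[OF assms] by (rule cmp_assoc[OF cmp_hom[OF h(4,2)] h(1,3)])
 also have "(Brd C X Y##Idn C Z) \<cdot> ((braid' X Y##Idn C Z) \<cdot> (Idn C Y##braid' X Z)) = Idn C Y##braid' X Z"
  using cmp_assoc[OF h(4,2,1)] e1 idn_left[OF h(4)] by simp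
 finally show "Brd C X (Y**Z) \<cdot> ((braid' X Y##Idn C Z) \<cdot> (Idn C Y##braid' X Z)) = Idn C (Y**Z**X)"
  using e2 by simp
qed

lemma braid'_hex2:
 assumes "X : Obj C" "Y : Obj C" "Z : Obj C"
 shows "braid' (X**Y) Z = (Idn C X##braid' Y Z) \<cdot> (braid' X Z##Idn C Y)"
proof (rule inv_arrow_eq)
 note b = braid_hom[OF assms(1,3)] braid_hom[OF assms(2,3)] braid'_hom[OF assms(1,3)] braid'_hom[OF assms(2,3)]
 have h: "Brd C X Z##Idn C Y : Gh (X**Z**Y) (Z**X**Y)" "braid' X Z##Idn C Y : Gh (Z**X**Y) (X**Z**Y)"
  "Idn C X##Brd C Y Z : Gh (X**Y**Z) (X**Z**Y)" "Idn C X##braid' Y Z : Gh (X**Z**Y) (X**Y**Z)"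
  using whisk_right[OF assms(2) b(1)] whisk_right[OF assms(2) b(3)] whisk_left[OF assms(1) b(2)]
   whisk_left[OF assms(1) b(4)] assms by simp_all
 show "Brd C (X**Y) Z : Gh (X**Y**Z) (Z**X**Y)" using braid_hom[of "X**Y" Z] assms by simp
 show "(Idn C X##braid' Y Z) \<cdot> (braid' X Z##Idn C Y) : Gh (Z**X**Y) (X**Y**Z)"
  by (rule cmp_hom[OF h(2,4)])
 have e1: "(Brd C X Z##Idn C Y) \<cdot> (braid' X Z##Idn C Y) = Idn C (Z**X**Y)"
  using ic[OF b(3,1) idn_hom[OF assms(2)] idn_hom[OF assms(2)]] inv_arrow(3)[OF b(1)] idn_left[OF idn_hom[OF assms(2)]] assms by simp
 have e2: "(Idn C X##Brd C Y Z) \<cdot> (Idn C X##braid' Y Z) = Idn C (X**Z**Y)"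
  using ic[OF idn_hom[OF assms(1)] idn_hom[OF assms(1)] b(4,2)] inv_arrow(3)[OF b(2)] idn_left[OF idn_hom[OF assms(1)]] assms by simp
 have "Brd C (X**Y) Z \<cdot> ((Idn C X##braid' Y Z) \<cdot> (braid' X Z##Idn C Y)) =
  (Brd C X Z##Idn C Y) \<cdot> ((Idn C X##Brd C Y Z) \<cdot> ((Idn C X##braid' Y Z) \<cdot> (braid' X Z##Idn C Y)))"
  unfolding hexagon2[OF assms] by (rule cmp_assoc[OF cmp_hom[OF h(2,4)] h(3,1)])
 also have "(Idn C X##Brd C Y Z) \<cdot> ((Idn C X##braid' Y Z) \<cdot> (braid' X Z##Idn C Y)) = braid' X Z##Idn C Y"
  using cmp_assoc[OF h(2,4,3)] e2 idn_left[OF h(2)] by simp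
 finally show "Brd C (X**Y) Z \<cdot> ((Idn C X##braid' Y Z) \<cdot> (braid' X Z##Idn C Y)) = Idn C (Z**X**Y)"
  using e1 by simp
qed

lemma quillen_simps [simp]:
 "Obj Q = Obj C" "TOb Q = TOb C" "Unit Q = Unit C" "Src Q = fst" "Tgt Q = (%u. fst (snd u))"
 "Idn Q A = bracket C A (Unit C) (Idn C A)"
 by (simp_all add: quillen_def)

lemma bracket_simps: "fst (bracket C A X f) = A" "fst (snd (bracket C A X f)) = Tgt C f"
 by (simp_all add: bracket_def)

lemma bracket_hom: "A : Obj C ==> X : Obj C ==> f : Gh (X**A) B ==> bracket C A X f : homs Q A B"
 unfolding homs_def by (auto simp: bracket_simps) (auto simp: quillen_def)

lemma bracket_cases:
 assumes "phi : homs Q A B"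
 obtains X f where "A : Obj C" "X : Obj C" "f : Gh (X**A) B" "phi = bracket C A X f"
proof -
 from assms have "phi : Arr Q" "fst phi = A" "fst (snd phi) = B" by (auto simp: homs_def)
 then obtain A' X f where "phi = bracket C A' X f" "A' : Obj C" "X : Obj C" "f : Arr C" "Src C f = X**A'"
  by (auto simp: quillen_def)
 with \<open>fst phi = A\<close> \<open>fst (snd phi) = B\<close> show ?thesis
  by (intro that[of X f]) (auto simp: bracket_simps homs_def)
qed

lemma bracket_eqI:
 assumes A: "A : Obj C" and psi: "psi : Gh X X'" and f': "f' : Gh (X'**A) B" and e: "f = f' \<cdot> (psi##Idn C A)"
 shows "bracket C A X f = bracket C A X' f'"
proof -
 note o = homsD(4,5)[OF psi]
 note psiA = whisk_right[OF A psi] and psii = inv_arrow[OF psi]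
 note psiiA = whisk_right[OF A psii(1)]
 have f: "f : Gh (X**A) B" unfolding e by (rule cmp_hom[OF psiA f'])
 have t: "Tgt C f = B" "Tgt C f' = B" using homsD(3)[OF f] homsD(3)[OF f'] by auto
 have "(EX \<xi>:Gh X Y. g \<cdot> (\<xi>##Idn C A) = f) = (EX \<xi>:Gh X' Y. g \<cdot> (\<xi>##Idn C A) = f')"
  if g: "g : Gh (Y**A) B" for Y g
 proof
  assume "EX \<xi>:Gh X Y. g \<cdot> (\<xi>##Idn C A) = f"
  then obtain \<xi> where x: "\<xi> : Gh X Y" "g \<cdot> (\<xi>##Idn C A) = f" by blast
  note xA = whisk_right[OF A x(1)]
  have "(\<xi> \<cdot> inv_arrow C psi)##Idn C A = (\<xi>##Idn C A) \<cdot> (inv_arrow C psi##Idn C A)"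
   using ic[OF psii(1) x(1) idn_hom[OF A] idn_hom[OF A]] idn_left[OF idn_hom[OF A]] by simp
  then have "g \<cdot> ((\<xi> \<cdot> inv_arrow C psi)##Idn C A) = f \<cdot> (inv_arrow C psi##Idn C A)"
   using cmp_assoc[OF psiiA xA g] x(2) by simp
  also have "\<dots> = f' \<cdot> ((psi##Idn C A) \<cdot> (inv_arrow C psi##Idn C A))"
   unfolding e by (rule cmp_assoc[OF psiiA psiA f'])
  also have "\<dots> = f'"
   using ic[OF psii(1) psi idn_hom[OF A] idn_hom[OF A]] idn_left[OF idn_hom[OF A]] psii(3) o A idn_right[OF f'] by simp
  finally show "EX \<xi>:Gh X' Y. g \<cdot> (\<xi>##Idn C A) = f'" using cmp_hom[OF psii(1) x(1)] by blast
 next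
  assume "EX \<xi>:Gh X' Y. g \<cdot> (\<xi>##Idn C A) = f'"
  then obtain \<xi> where x: "\<xi> : Gh X' Y" "g \<cdot> (\<xi>##Idn C A) = f'" by blast
  note xA = whisk_right[OF A x(1)]
  have "(\<xi> \<cdot> psi)##Idn C A = (\<xi>##Idn C A) \<cdot> (psi##Idn C A)"
   using ic[OF psi x(1) idn_hom[OF A] idn_hom[OF A]] idn_left[OF idn_hom[OF A]] by simp
  then have "g \<cdot> ((\<xi> \<cdot> psi)##Idn C A) = f" using cmp_assoc[OF psiA xA g] x(2) e by simp
  then show "EX \<xi>:Gh X Y. g \<cdot> (\<xi>##Idn C A) = f" using cmp_hom[OF psi x(1)] by blast
 qed
 then show ?thesis unfolding bracket_def isos_homs t by auto
qed

lemma qrep_bracket: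
 assumes "A : Obj C" "X : Obj C" "f : Gh (X**A) B"
 obtains X' f' psi where "qrep (bracket C A X f) = (X', f')" "X' : Obj C" "f' : Gh (X'**A) B"
  "psi : Gh X X'" "f' \<cdot> (psi##Idn C A) = f"
proof -
 have t: "Tgt C f = B" by (rule homsD(3)[OF assms(3)])
 have "f \<cdot> (Idn C X##Idn C A) = f" using idn_right[OF assms(3)] assms by simp
 then have "(X, f) : snd (snd (bracket C A X f))"
  using assms idn_hom[OF assms(2)] by (auto simp: bracket_def isos_homs t intro!: bexI[of _ "Idn C X"])
 then have "qrep (bracket C A X f) : snd (snd (bracket C A X f))" unfolding qrep_def by (rule someI)
 moreover obtain X' f' where q: "qrep (bracket C A X f) = (X', f')" by force
 ultimately have "X' : Obj C" "f' : Gh (X'**A) B" "EX psi:Gh X X'. f' \<cdot> (psi##Idn C A) = f"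
  by (simp_all add: bracket_def isos_homs t)
 then show ?thesis using that[OF q] by blast
qed

text \<open>Composition is defined through representatives picked by choice. Another representative
  changes the complement by an isomorphism, and these isomorphisms tensor to one between the
  complements of the composites.\<close>

lemma quillen_cmp:
 assumes A: "A : Obj C" "X : Obj C" and f: "f : Gh (X**A) B" and Y: "Y : Obj C" and g: "g : Gh (Y**B) D"
 shows "bracket C B Y g $$ bracket C A X f = bracket C A (Y**X) (g \<cdot> (Idn C Y##f))"
proof -
 have B: "B : Obj C" by (rule homsD(5)[OF f])
 obtain X' f' psi where r: "qrep (bracket C A X f) = (X', f')" "X' : Obj C" "f' : Gh (X'**A) B"
  "psi : Gh X X'" "f' \<cdot> (psi##Idn C A) = f" by (rule qrep_bracket[OF A f])
 obtain Y' g' \<chi> where s: "qrep (bracket C B Y g) = (Y', g')" "Y' : Obj C" "g' : Gh (Y'**B) D"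
  "\<chi> : Gh Y Y'" "g' \<cdot> (\<chi>##Idn C B) = g" by (rule qrep_bracket[OF B Y g])
 have h1: "psi##Idn C A : Gh (X**A) (X'**A)" by (rule whisk_right[OF A(1) r(4)])
 have h2: "Idn C Y'##f' : Gh (Y'**X'**A) (Y'**B)" by (rule whisk_left[OF s(2) r(3)])
 have h3: "\<chi>##(psi##Idn C A) : Gh (Y**X**A) (Y'**X'**A)" by (rule tensor_hom[OF s(4) h1])
 have "g \<cdot> (Idn C Y##f) = g' \<cdot> ((\<chi>##Idn C B) \<cdot> (Idn C Y##f))"
  unfolding s(5)[symmetric] by (rule cmp_assoc[OF whisk_left[OF Y f] whisk_right[OF B s(4)] s(3)])
 also have "(\<chi>##Idn C B) \<cdot> (Idn C Y##f) = \<chi>##f"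
  using ic[OF idn_hom[OF Y] s(4) f idn_hom[OF B]] idn_left[OF f] idn_right[OF s(4)] by simp
 also have "\<dots> = (Idn C Y'##f') \<cdot> (\<chi>##(psi##Idn C A))"
  using ic[OF s(4) idn_hom[OF s(2)] h1 r(3)] r(5) idn_left[OF s(4)] by simp
 also have "g' \<cdot> \<dots> = (g' \<cdot> (Idn C Y'##f')) \<cdot> (\<chi>##(psi##Idn C A))"
  by (rule cmp_assoc[OF h3 h2 s(3), symmetric])
 also have "\<chi>##(psi##Idn C A) = (\<chi>##psi)##Idn C A"
  by (rule tarr_assoc[OF s(4) r(4) idn_hom[OF A(1)], symmetric])
 finally have "bracket C A (Y**X) (g \<cdot> (Idn C Y##f)) = bracket C A (Y'**X') (g' \<cdot> (Idn C Y'##f'))"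
  by (intro bracket_eqI[OF A(1) tensor_hom[OF s(4) r(4)], of _ D]) (use cmp_hom[OF h2 s(3)] A r s in simp_all)
 then show ?thesis by (simp add: quillen_def r(1) s(1) bracket_simps)
qed

text \<open>As for composition; the isomorphism between complements now also has to cross a
  braiding, which naturality allows.\<close>

lemma quillen_tensor:
 assumes A: "A : Obj C" "X : Obj C" and f: "f : Gh (X**A) B" and D: "D : Obj C" "Y : Obj C" and g: "g : Gh (Y**D) E"
 shows "bracket C A X f \<boxtimes>\<^bsub>Q\<^esub> bracket C D Y g =
  bracket C (A**D) (X**Y) ((f##g) \<cdot> (Idn C X##braid' A Y##Idn C D))"
proof -
 obtain X' f' psi where r: "qrep (bracket C A X f) = (X', f')" "X' : Obj C" "f' : Gh (X'**A) B"
  "psi : Gh X X'" "f' \<cdot> (psi##Idn C A) = f" by (rule qrep_bracket[OF A f])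
 obtain Y' g' \<chi> where s: "qrep (bracket C D Y g) = (Y', g')" "Y' : Obj C" "g' : Gh (Y'**D) E"
  "\<chi> : Gh Y Y'" "g' \<cdot> (\<chi>##Idn C D) = g" by (rule qrep_bracket[OF D g])
 note b = braid'_hom[OF A(1) D(2)] braid'_hom[OF A(1) s(2)]
 note iA = idn_hom[OF A(1)] and iD = idn_hom[OF D(1)] and iX = idn_hom[OF A(2)] and iX' = idn_hom[OF r(2)]
 note pA = whisk_right[OF A(1) r(4)] and cD = whisk_right[OF D(1) s(4)]
 note bD = whisk_right[OF D(1) b(1)] and bD' = whisk_right[OF D(1) b(2)]
 note cA = whisk_right[OF A(1) s(4)] and Ac = whisk_left[OF A(1) s(4)]
 have t1: "Idn C X##(braid' A Y##Idn C D) : Gh (X**Y**A**D) ((X**A)**Y**D)"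
  using whisk_left[OF A(2) bD] A D by simp
 have t2: "Idn C X'##(braid' A Y'##Idn C D) : Gh (X'**Y'**A**D) ((X'**A)**Y'**D)"
  using whisk_left[OF r(2) bD'] A D r(2) s(2) by simp
 have t3: "(psi##Idn C A)##(\<chi>##Idn C D) : Gh ((X**A)**Y**D) ((X'**A)**Y'**D)"
  by (rule tensor_hom[OF pA cD])
 have t4: "(psi##\<chi>)##Idn C (A**D) : Gh (X**Y**A**D) (X'**Y'**A**D)"
  using whisk_right[OF tensor_obj[OF A(1) D(1)] tensor_hom[OF r(4) s(4)]] A D r(2) s(2) by simp
 have fg: "f'##g' : Gh ((X'**A)**Y'**D) (B**E)" by (rule tensor_hom[OF r(3) s(3)])
 have key: "((psi##Idn C A)##(\<chi>##Idn C D)) \<cdot> (Idn C X##(braid' A Y##Idn C D)) =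
  (Idn C X'##(braid' A Y'##Idn C D)) \<cdot> ((psi##\<chi>)##Idn C (A**D))"
 proof -
  have "(psi##Idn C A)##(\<chi>##Idn C D) = psi##((Idn C A##\<chi>)##Idn C D)"
   using tarr_assoc[OF r(4) iA cD] tarr_assoc[OF iA s(4) iD] by simp
  then have "((psi##Idn C A)##(\<chi>##Idn C D)) \<cdot> (Idn C X##(braid' A Y##Idn C D)) =
   psi##(((Idn C A##\<chi>) \<cdot> braid' A Y)##Idn C D)"
   using ic[OF iX r(4) bD whisk_right[OF D(1) Ac]] ic[OF b(1) Ac iD iD] idn_right[OF r(4)] idn_left[OF iD] by simp
  also have "\<dots> = psi##((braid' A Y' \<cdot> (\<chi>##Idn C A))##Idn C D)"
   unfolding braid'_natural[OF iA s(4)] ..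
  also have "\<dots> = (Idn C X'##(braid' A Y'##Idn C D)) \<cdot> (psi##((\<chi>##Idn C A)##Idn C D))"
   using ic[OF r(4) iX' whisk_right[OF D(1) cA] bD'] ic[OF cA b(2) iD iD] idn_left[OF r(4)] idn_left[OF iD] by simp
  also have "psi##((\<chi>##Idn C A)##Idn C D) = (psi##\<chi>)##Idn C (A**D)"
   using tarr_assoc[OF s(4) iA iD] tarr_assoc[OF r(4) s(4) tensor_hom[OF iA iD]] A D by simp
  finally show ?thesis .
 qed
 have "f##g = (f'##g') \<cdot> ((psi##Idn C A)##(\<chi>##Idn C D))"
  using ic[OF pA r(3) cD s(3)] r(5) s(5) by simp
 then have "(f##g) \<cdot> (Idn C X##(braid' A Y##Idn C D)) =
  ((f'##g') \<cdot> (Idn C X'##(braid' A Y'##Idn C D))) \<cdot> ((psi##\<chi>)##Idn C (A**D))"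
  using cmp_assoc[OF t1 t3 fg] cmp_assoc[OF t4 t2 fg] key by simp
 then have "bracket C (A**D) (X**Y) ((f##g) \<cdot> (Idn C X##(braid' A Y##Idn C D))) =
  bracket C (A**D) (X'**Y') ((f'##g') \<cdot> (Idn C X'##(braid' A Y'##Idn C D)))"
  by (intro bracket_eqI[OF tensor_obj[OF A(1) D(1)] tensor_hom[OF r(4) s(4)], of _ "B**E"])
   (use cmp_hom[OF t2 fg] A D r s in simp_all)
 then show ?thesis by (simp add: quillen_def r(1) s(1) bracket_simps)
qed

abbreviation whisk where "whisk m phi == bracket C m (Unit C) (Idn C m) \<boxtimes>\<^bsub>Q\<^esub> phi"
abbreviation inc where "inc m X == iota C m \<boxtimes>\<^bsub>Q\<^esub> qid X"
abbreviation emb where "emb f == embed C f"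

lemma whisk_bracket:
 assumes m: "m : Obj C" "D : Obj C" "Y : Obj C" and g: "g : Gh (Y**D) E"
 shows "whisk m (bracket C D Y g) = bracket C (m**D) Y ((Idn C m##g) \<cdot> (braid' m Y##Idn C D))"
proof -
 have "Idn C m : Gh (Unit C**m) m" using idn_hom m by simp
 from quillen_tensor[OF m(1) unit_obj this m(2,3) g]
 show ?thesis using m homsD(1)[OF whisk_right[OF m(2) braid'_hom[OF m(1,3)]]] by (simp add: unit_arr_left)
qed

lemma iota_bracket: "iota C m = bracket C (Unit C) m (Idn C m)"
 by (simp add: iota_def)

lemma inc_bracket:
 assumes m: "m : Obj C" "X : Obj C"
 shows "inc m X = bracket C X m (Idn C (m**X))"
proof -
 have i: "Idn C m : Gh (m**Unit C) m" "Idn C X : Gh (Unit C**X) X" using idn_hom m by simp_all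
 show ?thesis
  using quillen_tensor[OF unit_obj m(1) i(1) m(2) unit_obj i(2)] m idn_left[OF idn_hom[of "m**X"]]
  by (simp add: iota_bracket braid_unit inv_idn)
qed

lemma emb_bracket: "f : Gh X Y ==> emb f = bracket C X (Unit C) f"
 by (simp add: embed_def homsD(2))

lemma emb_hom: "f : Gh X Y ==> emb f : homs Q X Y"
 using bracket_hom[of X "Unit C" f Y] by (simp add: emb_bracket homsD(4))

lemma emb_cmp: "f : Gh X Y ==> g : Gh Y Z ==> emb g $$ emb f = emb (g \<cdot> f)"
 using quillen_cmp[of X "Unit C" f Y "Unit C" g Z]
 by (simp add: emb_bracket homsD(4,5) emb_bracket[OF cmp_hom] unit_arr_left homsD(1))

lemma emb_idn: "X : Obj C ==> emb (Idn C X) = qid X"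
 using emb_bracket[OF idn_hom] .

lemma emb_cmp_bracket: "f : Gh (X**A) B ==> A : Obj C ==> X : Obj C ==> g : Gh B D ==>
  emb g $$ bracket C A X f = bracket C A X (g \<cdot> f)"
 using quillen_cmp[of A X f B "Unit C" g D]
 by (simp add: emb_bracket homsD(4,5) unit_arr_left homsD(1))

lemma whisk_hom: "m : Obj C ==> phi : homs Q X Y ==> whisk m phi : homs Q (m**X) (m**Y)"
proof -
 assume m: "m : Obj C" and p: "phi : homs Q X Y"
 obtain W f where f: "X : Obj C" "W : Obj C" "f : Gh (W**X) Y" "phi = bracket C X W f"
  by (rule bracket_cases[OF p])
 have "(Idn C m##f) \<cdot> (braid' m W##Idn C X) : Gh (W**m**X) (m**Y)"
  using whisk_right[OF f(1) braid'_hom[OF m f(2)]] whisk_left[OF m f(3)] f m by (intro cmp_hom) simp_all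
 then show ?thesis using whisk_bracket[OF m f(1-3)] f m bracket_hom by simp
qed

lemma inc_hom: "m : Obj C ==> X : Obj C ==> inc m X : homs Q X (m**X)"
 using bracket_hom[of X m] idn_hom[of "m**X"] by (simp add: inc_bracket)

lemma whisk_idn: "m : Obj C ==> X : Obj C ==>
  whisk m (qid X) = bracket C (m**X) (Unit C) (Idn C (m**X))"
 using whisk_bracket[of m X "Unit C" "Idn C X" X] idn_hom[of X] idn_left[OF idn_hom[of "m**X"]]
 by (simp add: braid_unit inv_idn)

text \<open>The hexagon splits the braiding of \<open>m\<close> with the joint complement
  \<open>W \<natural> U\<close> into two, and naturality slides the part for \<open>W\<close> past
  \<open>f\<close>. The remaining factors regroup into the two tensored arrows.\<close>

lemma whisk_cmp:
 assumes m: "m : Obj C" and p: "phi : homs Q X Y" and q: "\<gamma> : homs Q Y Z"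
 shows "whisk m (\<gamma> $$ phi) = whisk m \<gamma> $$ whisk m phi"
proof -
 obtain U f where f: "X : Obj C" "U : Obj C" "f : Gh (U**X) Y" "phi = bracket C X U f"
  by (rule bracket_cases[OF p])
 obtain W g where g: "Y : Obj C" "W : Obj C" "g : Gh (W**Y) Z" "\<gamma> = bracket C Y W g"
  by (rule bracket_cases[OF q])
 note im = idn_hom[OF m] and iW = idn_hom[OF g(2)] and iX = idn_hom[OF f(1)]
 have mf: "Idn C m##f : Gh (m**U**X) (m**Y)" by (rule whisk_left[OF m f(3)])
 have mg: "Idn C m##g : Gh (m**W**Y) (m**Z)" by (rule whisk_left[OF m g(3)])
 have Wf: "Idn C W##f : Gh (W**U**X) (W**Y)" by (rule whisk_left[OF g(2) f(3)])
 have mWf: "Idn C m##(Idn C W##f) : Gh (m**W**U**X) (m**W**Y)" by (rule whisk_left[OF m Wf])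
 note bU = braid'_hom[OF m f(2)] and bW = braid'_hom[OF m g(2)]
 have bUX: "braid' m U##Idn C X : Gh (U**m**X) (m**U**X)" using whisk_right[OF f(1) bU] f m by simp
 have bWY: "braid' m W##Idn C Y : Gh (W**m**Y) (m**W**Y)" using whisk_right[OF g(1) bW] g m by simp
 have bWUX: "braid' m W##Idn C (U**X) : Gh (W**m**U**X) (m**W**U**X)"
  using whisk_right[OF _ bW, of "U**X"] f g m by simp
 have WbUX: "Idn C W##(braid' m U##Idn C X) : Gh (W**U**m**X) (W**m**U**X)" by (rule whisk_left[OF g(2) bUX])
 have Wmf: "Idn C W##(Idn C m##f) : Gh (W**m**U**X) (W**m**Y)" by (rule whisk_left[OF g(2) mf])
 have bX: "braid' m (W**U)##Idn C X = (braid' m W##Idn C (U**X)) \<cdot> (Idn C W##(braid' m U##Idn C X))"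
 proof -
  have w: "braid' m W##Idn C U : Gh (W**m**U) (m**W**U)" "Idn C W##braid' m U : Gh (W**U**m) (W**m**U)"
   using whisk_right[OF f(2) bW] whisk_left[OF g(2) bU] f g m by simp_all
  have "braid' m (W**U)##Idn C X = ((braid' m W##Idn C U)##Idn C X) \<cdot> ((Idn C W##braid' m U)##Idn C X)"
   unfolding braid'_hex1[OF m g(2) f(2)]
   using ic[OF w(2,1) iX iX] idn_left[OF iX] by simp
  then show ?thesis using tarr_assoc[OF bW idn_hom[OF f(2)] iX] tarr_assoc[OF iW bU iX] f by simp
 qed
 have "whisk m (\<gamma> $$ phi) = bracket C (m**X) (W**U) ((Idn C m##(g \<cdot> (Idn C W##f))) \<cdot> (braid' m (W**U)##Idn C X))"
  unfolding f(4) g(4) quillen_cmp[OF f(1-3) g(2,3)]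
  using whisk_bracket[OF m f(1) tensor_obj[OF g(2) f(2)], of "g \<cdot> (Idn C W##f)" Z] cmp_hom[OF Wf g(3)] f g by simp
 also have "Idn C m##(g \<cdot> (Idn C W##f)) = (Idn C m##g) \<cdot> (Idn C m##(Idn C W##f))"
  using ic[OF im im Wf g(3)] idn_left[OF im] by simp
 also have "((Idn C m##g) \<cdot> (Idn C m##(Idn C W##f))) \<cdot> (braid' m (W**U)##Idn C X) =
  (Idn C m##g) \<cdot> ((Idn C m##(Idn C W##f)) \<cdot> (braid' m (W**U)##Idn C X))"
  unfolding bX by (rule cmp_assoc[OF cmp_hom[OF WbUX bWUX] mWf mg])
 also have "(Idn C m##(Idn C W##f)) \<cdot> (braid' m (W**U)##Idn C X) =
  ((Idn C m##(Idn C W##f)) \<cdot> (braid' m W##Idn C (U**X))) \<cdot> (Idn C W##(braid' m U##Idn C X))"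
  unfolding bX by (rule cmp_assoc[OF WbUX bWUX mWf, symmetric])
 also have "(Idn C m##(Idn C W##f)) \<cdot> (braid' m W##Idn C (U**X)) = (braid' m W##Idn C Y) \<cdot> (Idn C W##(Idn C m##f))"
 proof -
  have imW: "Idn C m##Idn C W : Gh (m**W) (m**W)" "Idn C W##Idn C m : Gh (W**m) (W**m)"
   using tensor_hom[OF im iW] tensor_hom[OF iW im] by simp_all
  have iUX: "Idn C (U**X) : Gh (U**X) (U**X)" using idn_hom[of "U**X"] f by simp
  have "(Idn C m##(Idn C W##f)) \<cdot> (braid' m W##Idn C (U**X)) = braid' m W##f"
   unfolding tarr_assoc[OF im iW f(3), symmetric] ic[OF bW imW(1) iUX f(3)]
   using idn_left[OF bW] idn_right[OF f(3)] m g by simp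
  moreover have "(braid' m W##Idn C Y) \<cdot> (Idn C W##(Idn C m##f)) = braid' m W##f"
   unfolding tarr_assoc[OF iW im f(3), symmetric] ic[OF imW(2) bW f(3) idn_hom[OF g(1)]]
   using idn_right[OF bW] idn_left[OF f(3)] m g by simp
  ultimately show ?thesis by simp
 qed
 also have "((braid' m W##Idn C Y) \<cdot> (Idn C W##(Idn C m##f))) \<cdot> (Idn C W##(braid' m U##Idn C X)) =
  (braid' m W##Idn C Y) \<cdot> (Idn C W##((Idn C m##f) \<cdot> (braid' m U##Idn C X)))"
  unfolding cmp_assoc[OF WbUX Wmf bWY] using ic[OF iW iW bUX mf] idn_left[OF iW] by simp
 also have "(Idn C m##g) \<cdot> \<dots> = ((Idn C m##g) \<cdot> (braid' m W##Idn C Y)) \<cdot> (Idn C W##((Idn C m##f) \<cdot> (braid' m U##Idn C X)))"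
  by (rule cmp_assoc[OF whisk_left[OF g(2) cmp_hom[OF bUX mf]] bWY mg, symmetric])
 also have "bracket C (m**X) (W**U) \<dots> = whisk m \<gamma> $$ whisk m phi"
  unfolding f(4) g(4) whisk_bracket[OF m f(1-3)] whisk_bracket[OF m g(1-3)]
  using f g m cmp_hom[OF bUX mf] cmp_hom[OF bWY mg] by (intro quillen_cmp[symmetric]) simp_all
 finally show ?thesis .
qed

lemma whisk_whisk:
 assumes m: "m : Obj C" "n : Obj C" and p: "phi : homs Q X Y"
 shows "whisk m (whisk n phi) = whisk (m**n) phi"
proof -
 obtain U f where f: "X : Obj C" "U : Obj C" "f : Gh (U**X) Y" "phi = bracket C X U f"
  by (rule bracket_cases[OF p])
 note im = idn_hom[OF m(1)] and iN = idn_hom[OF m(2)] and iX = idn_hom[OF f(1)]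
 note bn = braid'_hom[OF m(2) f(2)] and bm = braid'_hom[OF m(1) f(2)]
 have nf: "Idn C n##f : Gh (n**U**X) (n**Y)" by (rule whisk_left[OF m(2) f(3)])
 have bnX: "braid' n U##Idn C X : Gh (U**n**X) (n**U**X)" using whisk_right[OF f(1) bn] f m by simp
 have g: "(Idn C n##f) \<cdot> (braid' n U##Idn C X) : Gh (U**n**X) (n**Y)" by (rule cmp_hom[OF bnX nf])
 have mbnX: "Idn C m##(braid' n U##Idn C X) : Gh (m**U**n**X) (m**n**U**X)" by (rule whisk_left[OF m(1) bnX])
 have mnf: "Idn C m##(Idn C n##f) : Gh (m**n**U**X) (m**n**Y)" by (rule whisk_left[OF m(1) nf])
 have bmnX: "braid' m U##Idn C (n**X) : Gh (U**m**n**X) (m**U**n**X)"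
  using whisk_right[OF tensor_obj[OF m(2) f(1)] bm] f m by simp
 have e: "braid' (m**n) U##Idn C X = (Idn C m##(braid' n U##Idn C X)) \<cdot> (braid' m U##Idn C (n**X))"
 proof -
  have w: "braid' m U##Idn C n : Gh (U**m**n) (m**U**n)" "Idn C m##braid' n U : Gh (m**U**n) (m**n**U)"
   using whisk_right[OF m(2) bm] whisk_left[OF m(1) bn] f m by simp_all
  have "braid' (m**n) U##Idn C X = ((Idn C m##braid' n U)##Idn C X) \<cdot> ((braid' m U##Idn C n)##Idn C X)"
   unfolding braid'_hex2[OF m f(2)] using ic[OF w iX iX] idn_left[OF iX] by simp
  then show ?thesis using tarr_assoc[OF bm iN iX] tarr_assoc[OF im bn iX] f m by simp
 qed
 have "whisk m (whisk n phi) = bracket C (m**n**X) U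
  ((Idn C m##((Idn C n##f) \<cdot> (braid' n U##Idn C X))) \<cdot> (braid' m U##Idn C (n**X)))"
  unfolding f(4) whisk_bracket[OF m(2) f(1-3)] using f m g by (intro whisk_bracket) simp_all
 also have "Idn C m##((Idn C n##f) \<cdot> (braid' n U##Idn C X)) =
  (Idn C m##(Idn C n##f)) \<cdot> (Idn C m##(braid' n U##Idn C X))"
  using ic[OF im im bnX nf] idn_left[OF im] by simp
 also have "\<dots> \<cdot> (braid' m U##Idn C (n**X)) = (Idn C m##(Idn C n##f)) \<cdot> (braid' (m**n) U##Idn C X)"
  unfolding e by (rule cmp_assoc[OF bmnX mbnX mnf])
 also have "Idn C m##(Idn C n##f) = Idn C (m**n)##f"
  using tarr_assoc[OF im iN f(3)] m by simp
 finally show ?thesis unfolding f(4)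
  using whisk_bracket[OF tensor_obj[OF m] f(1-3)] f m by simp
qed

lemma whisk_unit: "phi : homs Q X Y ==> whisk (Unit C) phi = phi"
proof -
 assume p: "phi : homs Q X Y"
 obtain U f where f: "X : Obj C" "U : Obj C" "f : Gh (U**X) Y" "phi = bracket C X U f"
  by (rule bracket_cases[OF p])
 show ?thesis unfolding f(4)
  using whisk_bracket[OF unit_obj f(1-3)] f idn_right[OF f(3)]
  by (simp add: braid_unit inv_idn unit_arr_left homsD(1))
qed

text \<open>The two composites have complements \<open>m \<natural> U\<close> and
  \<open>U \<natural> m\<close>; the braiding is the isomorphism that identifies their
  classes.\<close>

lemma inc_natural:
 assumes m: "m : Obj C" and p: "phi : homs Q X Y"
 shows "inc m Y $$ phi = whisk m phi $$ inc m X"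
proof -
 obtain U f where f: "X : Obj C" "U : Obj C" "f : Gh (U**X) Y" "phi = bracket C X U f"
  by (rule bracket_cases[OF p])
 have Y: "Y : Obj C" by (rule homsD(5)[OF f(3)])
 have mf: "Idn C m##f : Gh (m**U**X) (m**Y)" by (rule whisk_left[OF m f(3)])
 have b: "braid' m U##Idn C X : Gh (U**m**X) (m**U**X)" using whisk_right[OF f(1) braid'_hom[OF m f(2)]] f m by simp
 have b0: "Brd C m U##Idn C X : Gh (m**U**X) (U**m**X)" using whisk_right[OF f(1) braid_hom[OF m f(2)]] f m by simp
 have "inc m Y $$ phi = bracket C X (m**U) (Idn C m##f)"
  unfolding f(4) inc_bracket[OF m Y]
  using quillen_cmp[OF f(1-3) m, of "Idn C (m**Y)" "m**Y"] idn_hom[of "m**Y"] idn_left[OF mf] m Y by simp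
 moreover have "whisk m phi $$ inc m X = bracket C X (U**m) ((Idn C m##f) \<cdot> (braid' m U##Idn C X))"
  unfolding f(4) inc_bracket[OF m f(1)] whisk_bracket[OF m f(1-3)]
  using quillen_cmp[of X m "Idn C (m**X)" "m**X" U, OF f(1) m _ f(2) cmp_hom[OF b mf]]
   idn_hom[of "m**X"] idn_right[OF cmp_hom[OF b mf]] m f by simp
 moreover have "bracket C X (m**U) (Idn C m##f) = bracket C X (U**m) ((Idn C m##f) \<cdot> (braid' m U##Idn C X))"
 proof (rule bracket_eqI[OF f(1) braid_hom[OF m f(2)], of _ "m**Y"])
  show "(Idn C m##f) \<cdot> (braid' m U##Idn C X) : Gh ((U**m)**X) (m**Y)" using cmp_hom[OF b mf] f m by simp
  have "(braid' m U##Idn C X) \<cdot> (Brd C m U##Idn C X) = Idn C (m**U**X)"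
   using ic[OF braid_hom[OF m f(2)] braid'_hom[OF m f(2)] idn_hom[OF f(1)] idn_hom[OF f(1)]]
    inv_arrow(2)[OF braid_hom[OF m f(2)]] idn_left[OF idn_hom[OF f(1)]] m f by simp
  then show "Idn C m##f = ((Idn C m##f) \<cdot> (braid' m U##Idn C X)) \<cdot> (Brd C m U##Idn C X)"
   using cmp_assoc[OF b0 b mf] idn_right[OF mf] by simp
 qed
 ultimately show ?thesis by simp
qed

lemma inc_inc:
 assumes m: "m : Obj C" "n : Obj C" "X : Obj C"
 shows "inc n (m**X) $$ inc m X = inc (n**m) X"
 using quillen_cmp[of X m "Idn C (m**X)" "m**X" n "Idn C (n**m**X)" "n**m**X"]
  idn_hom[of "m**X"] idn_hom[of "n**m**X"] idn_left[OF idn_hom[of "n**m**X"]] m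
 by (simp add: inc_bracket)

lemma inc_unit: "X : Obj C ==> inc (Unit C) X = qid X"
 by (simp add: inc_bracket)

lemma emb_inc:
 assumes "psi : Gh m n" "Y : Obj C"
 shows "emb (psi##Idn C Y) $$ inc m Y = inc n Y"
proof -
 note o = homsD(4,5)[OF assms(1)] and w = whisk_right[OF assms(2,1)]
 have "emb (psi##Idn C Y) $$ inc m Y = bracket C Y m (psi##Idn C Y)"
  using emb_cmp_bracket[of "Idn C (m**Y)" m Y "m**Y" "psi##Idn C Y" "n**Y"] idn_hom[of "m**Y"] w o assms(2)
   idn_right[OF w] by (simp add: inc_bracket)
 also have "\<dots> = inc n Y" unfolding inc_bracket[OF o(2) assms(2)]
  by (rule bracket_eqI[OF assms(2,1), of _ "n**Y"]) (use idn_hom[of "n**Y"] idn_left[OF w] o assms(2) in simp_all)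
 finally show ?thesis .
qed

lemma emb_whisk:
 assumes ps: "psi : Gh m n" and p: "phi : homs Q X Y"
 shows "emb (psi##Idn C Y) $$ whisk m phi = whisk n phi $$ emb (psi##Idn C X)"
proof -
 obtain U f where f: "X : Obj C" "U : Obj C" "f : Gh (U**X) Y" "phi = bracket C X U f"
  by (rule bracket_cases[OF p])
 have Y: "Y : Obj C" by (rule homsD(5)[OF f(3)])
 note o = homsD(4,5)[OF ps] and w = whisk_right[OF Y ps] and wX = whisk_right[OF f(1) ps]
 note iX = idn_hom[OF f(1)] and iU = idn_hom[OF f(2)] and iY = idn_hom[OF Y]
 note bm = braid'_hom[OF o(1) f(2)] and bn = braid'_hom[OF o(2) f(2)]
 have mf: "Idn C m##f : Gh (m**U**X) (m**Y)" by (rule whisk_left[OF o(1) f(3)])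
 have nf: "Idn C n##f : Gh (n**U**X) (n**Y)" by (rule whisk_left[OF o(2) f(3)])
 have b: "braid' m U##Idn C X : Gh (U**m**X) (m**U**X)" using whisk_right[OF f(1) bm] f o by simp
 have b': "braid' n U##Idn C X : Gh (U**n**X) (n**U**X)" using whisk_right[OF f(1) bn] f o by simp
 have Up: "Idn C U##(psi##Idn C X) : Gh (U**m**X) (U**n**X)" by (rule whisk_left[OF f(2) wX])
 have pUX: "psi##Idn C (U**X) : Gh (m**U**X) (n**U**X)" using whisk_right[OF tensor_obj[OF f(2,1)] ps] by simp
 have "emb (psi##Idn C Y) $$ whisk m phi = bracket C (m**X) U ((psi##Idn C Y) \<cdot> ((Idn C m##f) \<cdot> (braid' m U##Idn C X)))"
  unfolding f(4) whisk_bracket[OF o(1) f(1-3)]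
  by (rule emb_cmp_bracket[OF _ _ _ w]) (use cmp_hom[OF b mf] f o in simp_all)
 also have "(psi##Idn C Y) \<cdot> ((Idn C m##f) \<cdot> (braid' m U##Idn C X)) = ((psi##Idn C Y) \<cdot> (Idn C m##f)) \<cdot> (braid' m U##Idn C X)"
  by (rule cmp_assoc[OF b mf w, symmetric])
 also have "(psi##Idn C Y) \<cdot> (Idn C m##f) = (Idn C n##f) \<cdot> (psi##Idn C (U**X))"
  using ic[OF idn_hom[OF o(1)] ps f(3) iY] ic[OF ps idn_hom[OF o(2)] idn_hom[OF tensor_obj[OF f(2,1)]] f(3)]
   idn_left[OF ps] idn_right[OF ps] idn_left[OF f(3)] idn_right[OF f(3)] by simp
 also have "\<dots> \<cdot> (braid' m U##Idn C X) = (Idn C n##f) \<cdot> ((psi##Idn C (U**X)) \<cdot> (braid' m U##Idn C X))"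
  by (rule cmp_assoc[OF b pUX nf])
 also have "(psi##Idn C (U**X)) \<cdot> (braid' m U##Idn C X) = (braid' n U##Idn C X) \<cdot> (Idn C U##(psi##Idn C X))"
 proof -
  note pU = whisk_right[OF f(2) ps] and Ups = whisk_left[OF f(2) ps]
  have "psi##Idn C (U**X) = (psi##Idn C U)##Idn C X" using tarr_assoc[OF ps iU iX] f by simp
  then have "(psi##Idn C (U**X)) \<cdot> (braid' m U##Idn C X) = ((psi##Idn C U) \<cdot> braid' m U)##Idn C X"
   using ic[OF bm pU iX iX] idn_left[OF iX] by simp
  also have "\<dots> = (braid' n U \<cdot> (Idn C U##psi))##Idn C X" unfolding braid'_natural[OF ps iU] ..
  also have "\<dots> = (braid' n U##Idn C X) \<cdot> ((Idn C U##psi)##Idn C X)"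
   using ic[OF Ups bn iX iX] idn_left[OF iX] by simp
  finally show ?thesis using tarr_assoc[OF iU ps iX] by simp
 qed
 also have "(Idn C n##f) \<cdot> \<dots> = ((Idn C n##f) \<cdot> (braid' n U##Idn C X)) \<cdot> (Idn C U##(psi##Idn C X))"
  by (rule cmp_assoc[OF Up b' nf, symmetric])
 also have "bracket C (m**X) U \<dots> = whisk n phi $$ emb (psi##Idn C X)"
  unfolding f(4) whisk_bracket[OF o(2) f(1-3)] emb_bracket[OF wX]
  using quillen_cmp[of "m**X" "Unit C" "psi##Idn C X" "n**X" U, OF _ _ _ f(2) cmp_hom[OF b' nf]] wX o f by simp
 finally show ?thesis .
qed

text \<open>Compatibility of the braiding with the initial arrows: adding \<open>n\<close> in the
  middle and moving it to the front is the same as adding it in front. This lets shifts by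
  \<open>m\<close> and by \<open>n\<close> be exchanged.\<close>

lemma braid_inc:
 assumes m: "m : Obj C" "n : Obj C" "X : Obj C"
 shows "emb (Brd C m n##Idn C X) $$ whisk m (inc n X) = inc n (m**X)"
proof -
 note b = braid_hom[OF m(1,2)] and b' = braid'_hom[OF m(1,2)] and iX = idn_hom[OF m(3)]
 have bX: "Brd C m n##Idn C X : Gh (m**n**X) (n**m**X)" using whisk_right[OF m(3) b] m by simp
 have b'X: "braid' m n##Idn C X : Gh (n**m**X) (m**n**X)" using whisk_right[OF m(3) b'] m by simp
 have "whisk m (inc n X) = bracket C (m**X) n (braid' m n##Idn C X)"
  using whisk_bracket[OF m(1,3,2), of "Idn C (n**X)" "n**X"] idn_hom[of "n**X"] idn_left[OF b'X] m
  by (simp add: inc_bracket)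
 moreover have "(Brd C m n##Idn C X) \<cdot> (braid' m n##Idn C X) = Idn C (n**m**X)"
  using ic[OF b' b iX iX] inv_arrow(3)[OF b] idn_left[OF iX] m by simp
 ultimately show ?thesis
  using emb_cmp_bracket[of "braid' m n##Idn C X" n "m**X" "m**n**X" "Brd C m n##Idn C X" "n**m**X"] bX b'X m
  by (simp add: inc_bracket)
qed

text \<open>The unit is initial in the bracket category: \<open>f\<close> itself is an isomorphism
  from the complement \<open>U \<natural> X\<close> to the complement \<open>Y\<close>.\<close>

lemma inc_initial:
 assumes p: "phi : homs Q X Y"
 shows "phi $$ inc X (Unit C) = inc Y (Unit C)"
proof -
 obtain U f where f: "X : Obj C" "U : Obj C" "f : Gh (U**X) Y" "phi = bracket C X U f"
  by (rule bracket_cases[OF p])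
 have Y: "Y : Obj C" by (rule homsD(5)[OF f(3)])
 have "phi $$ inc X (Unit C) = bracket C (Unit C) (U**X) f"
  using quillen_cmp[of "Unit C" X "Idn C X" X U f Y] f idn_hom[OF f(1)] idn_right[OF f(3)] by (simp add: inc_bracket)
 also have "\<dots> = bracket C (Unit C) Y (Idn C Y)"
  by (rule bracket_eqI[OF unit_obj f(3), of _ Y]) (use idn_hom[OF Y] idn_left[OF f(3)] Y homsD(1)[OF f(3)] in \<open>simp_all add: unit_arr_right\<close>)
 finally show ?thesis using Y by (simp add: inc_bracket)
qed

lemma iota_inc: "X : Obj C ==> iota C X = inc X (Unit C)"
 by (subst inc_bracket) (simp_all add: iota_bracket)

end

section \<open>Polynomial functors as pairs\<close>

text \<open>
 Iterated cokernels \<open>delta\<close> are presented by a pair of a functor \<open>E\<close> and a subfunctor \<open>N\<close>, standing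
 for \<open>E/N\<close>. In \<open>pol k s n\<close> the natural number \<open>n\<close> is the degree plus one; \<open>k\<close> asks for the
 vanishing of the kernels (very strong), and \<open>s\<close> replaces zero functors by stably zero ones (weak).
\<close>

context long_moody_setting
begin

notation (input) obj_tensor (infixr "**" 80) and arr_tensor (infixr "##" 80) and qcmp (infixr "$$" 70)
abbreviation (input) cM where "cM E X == carrier (MOb E X)"

definition St where "St = range (stage G u z)"

lemma St_stage: "stage G u z n : St" "X : St \<longleftrightarrow> (EX n. X = stage G u z n)"
 by (auto simp: St_def)

abbreviation S where "S == stage_quillen G u z"
abbreviation M where "M == obj_natural G u z"
abbreviation hm where "hm X Y == homs S X Y"

lemma tensor_power_obj: "tensor_power G u n : Obj G"
 by (induction n) (simp_all add: tensor_power_def u_obj)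

lemma stage_obj: "stage G u z n : Obj G"
 by (simp add: stage_def tensor_power_obj z_obj)

lemma stage_0: "stage G u z 0 = z"
 by (simp add: stage_def tensor_power_def z_obj)

lemma stage_Suc: "stage G u z (Suc n) = u**stage G u z n"
proof -
 have "tensor_power G u (Suc n) = u**tensor_power G u n" by (simp add: tensor_power_def)
 then show ?thesis by (simp add: stage_def tensor_power_obj u_obj z_obj)
qed

lemma St_obj: "X : St ==> X : Obj G"
 using stage_obj by (auto simp: St_def)

lemma S_simps [simp]: "Obj S = St" "Idn S = Idn Q" "Cmp S = Cmp Q"
 using stage_obj by (auto simp: St_def stage_quillen_def full_sub_def)

lemma hm_iff: "phi : hm X Y \<longleftrightarrow> phi : homs Q X Y & X : St & Y : St"
 by (auto simp: St_def stage_quillen_def full_sub_def homs_def)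

lemma hmD: "phi : hm X Y ==> phi : homs Q X Y" "phi : hm X Y ==> X : St" "phi : hm X Y ==> Y : St"
 by (simp_all add: hm_iff)

lemma M_iff: "m : M \<longleftrightarrow> m : Obj G & (ALL X:St. m**X : St)"
 by (auto simp: obj_natural_def St_def)

lemma M_obj: "m : M ==> m : Obj G" and M_St [simp]: "m : M ==> X : St ==> m**X : St"
 by (simp_all add: M_iff)

lemma M_unit: "Unit G : M" using St_obj by (auto simp: M_iff)

lemma M_tensor: "m : M ==> n : M ==> m**n : M"
 using St_obj by (auto simp: M_iff)

lemma M_u: "u : M" using u_obj by (auto simp: M_iff St_def simp flip: stage_Suc)

lemma whisk_hm: "m : M ==> phi : hm X Y ==> whisk m phi : hm (m**X) (m**Y)"
 using whisk_hom M_obj by (simp add: hm_iff)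

lemma inc_hm: "m : M ==> X : St ==> inc m X : hm X (m**X)"
 using inc_hom M_obj St_obj by (simp add: hm_iff)

lemma emb_hm: "f : Gh X Y ==> X : St ==> Y : St ==> emb f : hm X Y"
 using emb_hom by (simp add: hm_iff)

definition subf where
 "subf E N \<longleftrightarrow> (ALL X:St. asub (MOb E X) (N X)) & (ALL X Y. ALL phi:hm X Y. ALL v:N X. MAr E phi v : N Y)"

lemma subfD: "subf E N ==> X : St ==> asub (MOb E X) (N X)"
 "subf E N ==> phi : hm X Y ==> v : N X ==> MAr E phi v : N Y"
 by (auto simp: subf_def)

text \<open>\<open>N\<close> on the shifted object plus the image of \<open>E\<close>: dividing
  \<open>tau m E\<close> by it gives the cokernel of \<open>E/N \<rightarrow> tau m (E/N)\<close>,
  so one \<open>delta\<close> step changes both components of the pair.\<close>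

definition dsub where
 "dsub m E N X = {a \<oplus>\<^bsub>MOb E (m**X)\<^esub> MAr E (inc m X) x | a x. a : N (m**X) & x : cM E X}"

primrec pol where
 "pol k s 0 E N \<longleftrightarrow> (ALL X:St. ALL x:cM E X.
   if s then EX m:M. MAr E (inc m X) x : N (m**X) else x : N X)"
| "pol k s (Suc n) E N \<longleftrightarrow> (ALL m:M.
   (k --> (ALL X:St. ALL x:cM E X. MAr E (inc m X) x : N (m**X) --> x : N X)) &
   pol k s n (tau G m E) (dsub m E N))"

lemma mf:
 assumes "module_functor R S E"
 shows "X : St ==> module R (MOb E X)" "X : St ==> abelian_group (MOb E X)"
  "phi : hm X Y ==> MAr E phi : mod_hom R (MOb E X) (MOb E Y)"
  "phi : hm X Y ==> addmap (MOb E X) (MOb E Y) (MAr E phi)"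
  "phi : hm X Y ==> v : cM E X ==> MAr E phi v : cM E Y"
  "phi : hm X Y ==> \<gamma> : hm Y Z ==> v : cM E X ==> MAr E (\<gamma> $$ phi) v = MAr E \<gamma> (MAr E phi v)"
  "X : St ==> v : cM E X ==> MAr E (qid X) v = v"
  "phi : hm X Y ==> v : cM E X ==> w : cM E X ==>
   MAr E phi (v \<oplus>\<^bsub>MOb E X\<^esub> w) = MAr E phi v \<oplus>\<^bsub>MOb E Y\<^esub> MAr E phi w"
  "phi : hm X Y ==> MAr E phi \<zero>\<^bsub>MOb E X\<^esub> = \<zero>\<^bsub>MOb E Y\<^esub>"
  "phi : hm X Y ==> v : cM E X ==> MAr E phi (\<ominus>\<^bsub>MOb E X\<^esub> v) = \<ominus>\<^bsub>MOb E Y\<^esub> MAr E phi v"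
proof -
 interpret E: module_functor R S E by fact
 show m: "X : St ==> module R (MOb E X)" for X using E.map_module by simp
 then show a: "X : St ==> abelian_group (MOb E X)" for X by (rule module_abelian)
 show h: "phi : hm X Y ==> MAr E phi : mod_hom R (MOb E X) (MOb E Y)" by (rule E.map_hom)
 then show ad: "phi : hm X Y ==> addmap (MOb E X) (MOb E Y) (MAr E phi)" by (rule mod_hom_addmap)
 show "phi : hm X Y ==> v : cM E X ==> MAr E phi v : cM E Y"
  using mod_homD(1)[OF h] .
 show "phi : hm X Y ==> \<gamma> : hm Y Z ==> v : cM E X ==> MAr E (\<gamma> $$ phi) v = MAr E \<gamma> (MAr E phi v)"
  using E.map_cmp by simp
 show "X : St ==> v : cM E X ==> MAr E (qid X) v = v"
  using E.map_idn[of X v] by simp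
 note d = hmD(2,3)[of phi X Y]
 show "phi : hm X Y ==> v : cM E X ==> w : cM E X ==>
   MAr E phi (v \<oplus>\<^bsub>MOb E X\<^esub> w) = MAr E phi v \<oplus>\<^bsub>MOb E Y\<^esub> MAr E phi w"
  "phi : hm X Y ==> MAr E phi \<zero>\<^bsub>MOb E X\<^esub> = \<zero>\<^bsub>MOb E Y\<^esub>"
  "phi : hm X Y ==> v : cM E X ==> MAr E phi (\<ominus>\<^bsub>MOb E X\<^esub> v) = \<ominus>\<^bsub>MOb E Y\<^esub> MAr E phi v"
  using addmapD(2-4)[OF ad a a] d by auto
qed

lemma tau_simps: "MOb (tau G m E) X = MOb E (m**X)" "MAr (tau G m E) phi = MAr E (whisk m phi)"
 by (simp_all add: tau_def)

lemma tau_mf: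
 assumes "module_functor R S E" "m : M"
 shows "module_functor R S (tau G m E)"
proof -
 have c: "category S" using assms(1) by (simp add: module_functor_def)
 note E = mf[OF assms(1)] and w = whisk_hm[OF assms(2)] and mo = M_obj[OF assms(2)]
 show ?thesis unfolding module_functor_def module_functor_axioms_def
 proof (intro conjI allI impI)
  show "category S" by fact
  fix X assume "X : Obj S"
  then have X: "X : St" by simp
  then show "module R (MOb (tau G m E) X)" using assms(2) E(1) by (simp add: tau_simps)
  fix v assume "v : cM (tau G m E) X"
  then show "MAr (tau G m E) (Idn S X) v = v"
   using E(7)[of "m**X" v] X assms(2) whisk_idn[OF mo St_obj[OF X]] by (simp add: tau_simps)
 next
  fix phi X Y assume p: "phi : hm X Y"
  show "MAr (tau G m E) phi : mod_hom R (MOb (tau G m E) X) (MOb (tau G m E) Y)"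
   using E(3)[OF w[OF p]] by (simp add: tau_simps)
  fix \<gamma> Z v assume q: "\<gamma> : hm Y Z" and v: "v : cM (tau G m E) X"
  show "MAr (tau G m E) (\<gamma> \<cdot>\<^bsub>S\<^esub> phi) v = MAr (tau G m E) \<gamma> (MAr (tau G m E) phi v)"
   using E(6)[OF w[OF p] w[OF q]] v whisk_cmp[OF mo hmD(1)[OF p] hmD(1)[OF q]] by (simp add: tau_simps)
 qed
qed

lemma tau_subf: "subf E N ==> m : M ==> subf (tau G m E) (%X. N (m**X))"
 using whisk_hm unfolding subf_def by (simp add: tau_simps) blast

lemma inc_nat: "m : M ==> phi : hm X Y ==> inc m Y $$ phi = whisk m phi $$ inc m X"
 by (rule inc_natural[OF M_obj hmD(1)])

lemma mf_inc_nat: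
 assumes "module_functor R S E" "m : M" "phi : hm X Y" "v : cM E X"
 shows "MAr E (inc m Y) (MAr E phi v) = MAr E (whisk m phi) (MAr E (inc m X) v)"
 using mf(6)[OF assms(1) assms(3) inc_hm[OF assms(2) hmD(3)[OF assms(3)]] assms(4)]
  mf(6)[OF assms(1) inc_hm[OF assms(2) hmD(2)[OF assms(3)]] whisk_hm[OF assms(2,3)] assms(4)]
  inc_nat[OF assms(2,3)] by simp

lemma mf_inc_inc:
 assumes "module_functor R S E" "m : M" "n : M" "X : St" "v : cM E X"
 shows "MAr E (inc n (m**X)) (MAr E (inc m X) v) = MAr E (inc (n**m) X) v"
 using mf(6)[OF assms(1) inc_hm[OF assms(2,4)] inc_hm[OF assms(3) M_St[OF assms(2,4)]] assms(5)]
  inc_inc[OF M_obj[OF assms(2)] M_obj[OF assms(3)] St_obj[OF assms(4)]] by simp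

lemma dsub_subf:
 assumes E: "module_functor R S E" and N: "subf E N" and m: "m : M"
 shows "subf (tau G m E) (dsub m E N)"
 unfolding subf_def
proof (intro conjI ballI allI)
 note e = mf[OF E]
 fix X assume X: "X : St"
 have mX: "m**X : St" using X m by simp
 interpret A: abelian_group "MOb E (m**X)" by (rule e(2)[OF mX])
 interpret B: abelian_group "MOb E X" by (rule e(2)[OF X])
 note n = asubD[OF subfD(1)[OF N mX]] and i = inc_hm[OF m X]
 note ic = e(5)[OF i] and ia = e(8)[OF i] and iz = e(9)[OF i] and im = e(10)[OF i]
 show "asub (MOb (tau G m E) X) (dsub m E N X)" unfolding asub_def tau_simps
 proof (intro conjI ballI)
  show "dsub m E N X <= cM E (m**X)" using n(2) ic by (auto simp: dsub_def)
  show "\<zero>\<^bsub>MOb E (m**X)\<^esub> : dsub m E N X" unfolding dsub_def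
   using n(3) iz by (intro CollectI exI[of _ "\<zero>\<^bsub>MOb E (m**X)\<^esub>"] exI[of _ "\<zero>\<^bsub>MOb E X\<^esub>"]) simp
  fix x assume "x : dsub m E N X"
  then obtain a v where x: "x = a \<oplus>\<^bsub>MOb E (m**X)\<^esub> MAr E (inc m X) v" "a : N (m**X)" "v : cM E X"
   by (auto simp: dsub_def)
  have "\<ominus>\<^bsub>MOb E (m**X)\<^esub> x = \<ominus>\<^bsub>MOb E (m**X)\<^esub> a \<oplus>\<^bsub>MOb E (m**X)\<^esub> MAr E (inc m X) (\<ominus>\<^bsub>MOb E X\<^esub> v)"
   using x n(2) ic im by (simp add: A.minus_add)
  then show "\<ominus>\<^bsub>MOb E (m**X)\<^esub> x : dsub m E N X" using x n(5) by (auto simp: dsub_def)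
  fix y assume "y : dsub m E N X"
  then obtain b w where y: "y = b \<oplus>\<^bsub>MOb E (m**X)\<^esub> MAr E (inc m X) w" "b : N (m**X)" "w : cM E X"
   by (auto simp: dsub_def)
  have "x \<oplus>\<^bsub>MOb E (m**X)\<^esub> y = (a \<oplus>\<^bsub>MOb E (m**X)\<^esub> b) \<oplus>\<^bsub>MOb E (m**X)\<^esub> MAr E (inc m X) (v \<oplus>\<^bsub>MOb E X\<^esub> w)"
   using x y n(2) ic ia by (simp add: A.a_ac)
  then show "x \<oplus>\<^bsub>MOb E (m**X)\<^esub> y : dsub m E N X" using x y n(4) by (auto simp: dsub_def)
 qed
next
 note e = mf[OF E]
 fix X Y phi x assume p: "phi : hm X Y" and "x : dsub m E N X"
 then obtain a v where x: "x = a \<oplus>\<^bsub>MOb E (m**X)\<^esub> MAr E (inc m X) v" "a : N (m**X)" "v : cM E X"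
  by (auto simp: dsub_def)
 have X: "X : St" "m**X : St" using hmD(2)[OF p] m by auto
 have "MAr E (whisk m phi) x = MAr E (whisk m phi) a \<oplus>\<^bsub>MOb E (m**Y)\<^esub> MAr E (inc m Y) (MAr E phi v)"
  using x asubD(2)[OF subfD(1)[OF N X(2)]] e(5)[OF inc_hm[OF m X(1)]] mf_inc_nat[OF E m p x(3)]
  by (simp add: e(8)[OF whisk_hm[OF m p]])
 then show "MAr (tau G m E) phi x : dsub m E N Y"
  using x subfD(2)[OF N whisk_hm[OF m p]] e(5)[OF p] by (auto simp: dsub_def tau_simps)
qed

lemma dsub_full: "module_functor R S E ==> subf E N ==> m : M ==> X : St ==> a : N (m**X) ==> a : dsub m E N X"
proof -
 assume a: "module_functor R S E" "subf E N" "m : M" "X : St" "a : N (m**X)"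
 have mX: "m**X : St" using a by simp
 interpret A: abelian_group "MOb E (m**X)" by (rule mf(2)[OF a(1) mX])
 interpret B: abelian_group "MOb E X" by (rule mf(2)[OF a(1,4)])
 have "a : cM E (m**X)" using asubD(2)[OF subfD(1)[OF a(2) mX]] a(5) by simp
 then show ?thesis unfolding dsub_def using a mf(9)[OF a(1) inc_hm[OF a(3,4)]]
  by (intro CollectI exI[of _ a] exI[of _ "\<zero>\<^bsub>MOb E X\<^esub>"]) simp
qed

lemma pol_full:
 "module_functor R S E ==> subf E N ==> (!!X. X : St ==> cM E X <= N X) ==> pol k s n E N"
proof (induction n arbitrary: E N)
 case 0
 have "MAr E (inc (Unit G) X) x : N (Unit G**X)" if "X : St" "x : cM E X" for X x
  using mf(7)[OF 0(1) that] that 0(3) St_obj[OF that(1)] by (auto simp: inc_unit)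
 then show ?case using 0 M_unit by auto
next
 case (Suc n)
 have "pol k s n (tau G m E) (dsub m E N)" if m: "m : M" for m
 proof (rule Suc.IH)
  show "module_functor R S (tau G m E)" by (rule tau_mf[OF Suc.prems(1) m])
  show "subf (tau G m E) (dsub m E N)" by (rule dsub_subf[OF Suc.prems(1,2) m])
  fix X assume X: "X : St"
  then show "cM (tau G m E) X <= dsub m E N X"
   using Suc.prems(3)[OF M_St[OF m X]] dsub_full[OF Suc.prems(1,2) m X] by (auto simp: tau_simps)
 qed
 then show ?case using Suc.prems(3) by auto
qed

text \<open>Restricted to \<open>k = False\<close>: passing to a larger subfunctor is passing to a
  quotient, which may acquire kernels.\<close>

lemma pol_mono:
 "(!!X. X : St ==> N X <= N' X) ==> pol False s n E N ==> pol False s n E N'"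
proof (induction n arbitrary: E N N')
 case 0
 show ?case
 proof (cases s)
  case True
  have "EX m:M. MAr E (inc m X) x : N' (m**X)" if X: "X : St" "x : cM E X" for X x
  proof -
   obtain m where "m : M" "MAr E (inc m X) x : N (m**X)" using 0(2) True X by auto
   then show ?thesis using 0(1)[OF M_St[of m X]] X by blast
  qed
  then show ?thesis using True by simp
 next
  case False
  then show ?thesis using 0 by auto
 qed
next
 case (Suc n)
 have "dsub m E N X <= dsub m E N' X" if "m : M" "X : St" for m X
  using Suc.prems(1)[of "m**X"] that by (auto simp: dsub_def)
 moreover have "pol False s n (tau G m E) (dsub m E N)" if "m : M" for m using Suc.prems(2) that by simp
 ultimately show ?case using Suc.IH by simp blast
qed

text \<open>Vanishing of the kernels is a condition on the iterated cokernels alone and does not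
  know the degree, so it can be combined with a better bound on the strong degree.\<close>

lemma pol_strong_very: "pol True s a E N ==> pol False s b E N ==> module_functor R S E ==> subf E N ==> \<not> s ==> pol True s b E N"
proof (induction b arbitrary: a E N)
 case (Suc b)
 show ?case
 proof (cases a)
  case 0
  then show ?thesis using Suc.prems by (intro pol_full) auto
 next
  case (Suc a')
  have "pol True s b (tau G m E) (dsub m E N)" if m: "m : M" for m
   by (rule Suc.IH[of a', OF _ _ tau_mf[OF Suc.prems(3) m] dsub_subf[OF Suc.prems(3,4) m] Suc.prems(5)])
    (use Suc Suc.prems(1,2) m in auto)
  then show ?thesis using Suc Suc.prems(1) by auto
 qed
qed simp

lemma pol_very_strong: "pol True s n E N ==> pol False s n E N"
 by (induction n arbitrary: E N) auto

text \<open>\<open>j\<close> stands for an exact sequence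
  \<open>E'/N' \<rightarrow> E/N \<rightarrow> E/N'' \<rightarrow> 0\<close>, exact on the left as
  well when \<open>k\<close> holds. Cokernels preserve the right-hand part. The left-hand part
  survives by the snake lemma, since under \<open>k\<close> the kernels of the third term
  vanish.\<close>

theorem pol_extension:
 assumes "module_functor R S E" "module_functor R S E'"
  "subf E N" "subf E' N'" "subf E N''"
  "!!X. X : St ==> addmap (MOb E' X) (MOb E X) (j X)"
  "!!X Y phi y. phi : hm X Y ==> y : cM E' X ==> j Y (MAr E' phi y) = MAr E phi (j X y)"
  "!!X y. X : St ==> y : N' X ==> j X y : N X"
  "!!X y. k ==> X : St ==> y : cM E' X ==> j X y : N X ==> y : N' X"
  "!!X. X : St ==> N X <= N'' X"
  "!!X y. X : St ==> y : cM E' X ==> j X y : N'' X"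
  "!!X x. X : St ==> x : N'' X ==> EX a:N X. EX y:cM E' X. x = a \<oplus>\<^bsub>MOb E X\<^esub> j X y"
  "pol k s n E' N'" "pol k s n E N''" "\<not> (k & s)"
 shows "pol k s n E N"
 using assms
proof (induction n arbitrary: E E' N N' N'' j)
 case 0
 note e = mf[OF "0.prems"(1)] and e' = mf[OF "0.prems"(2)]
 note j = addmapD[OF "0.prems"(6) e'(2) e(2)]
 show ?case
 proof (cases s)
  case False
  have "x : N X" if X: "X : St" and x: "x : cM E X" for X x
  proof -
   have "x : N'' X" using "0.prems"(14) False X x by auto
   then obtain a y where a: "a : N X" "y : cM E' X" "x = a \<oplus>\<^bsub>MOb E X\<^esub> j X y"
    using "0.prems"(12)[OF X] by blast
   then have "y : N' X" using "0.prems"(13) False X by auto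
   then show ?thesis using a "0.prems"(8)[OF X] asubD(4)[OF subfD(1)[OF "0.prems"(3) X]] by auto
  qed
  then show ?thesis using False by simp
 next
  case True
  \<comment> \<open>One inclusion kills the image of \<open>x\<close> in the third term, after which
    \<open>x\<close> comes from \<open>E'\<close>; a second inclusion kills it there. Their
    composite is the inclusion for \<open>m' \<natural> m\<close>.\<close>
  have "EX m:M. MAr E (inc m X) x : N (m**X)" if X: "X : St" and x: "x : cM E X" for X x
  proof -
   obtain m where m: "m : M" "MAr E (inc m X) x : N'' (m**X)" using "0.prems"(14) True X x by auto
   have mX: "m**X : St" using m X by simp
   obtain a y where a: "a : N (m**X)" "y : cM E' (m**X)" "MAr E (inc m X) x = a \<oplus>\<^bsub>MOb E (m**X)\<^esub> j (m**X) y"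
    using "0.prems"(12)[OF mX m(2)] by blast
   obtain m' where m': "m' : M" "MAr E' (inc m' (m**X)) y : N' (m'**m**X)"
    using "0.prems"(13) True mX a(2) by auto
   have m'mX: "m'**m**X : St" using m'(1) mX by simp
   note i = inc_hm[OF m'(1) mX]
   have "MAr E (inc (m'**m) X) x = MAr E (inc m' (m**X)) (a \<oplus>\<^bsub>MOb E (m**X)\<^esub> j (m**X) y)"
    using mf_inc_inc[OF "0.prems"(1) m(1) m'(1) X x] a(3) by simp
   also have "\<dots> = MAr E (inc m' (m**X)) a \<oplus>\<^bsub>MOb E (m'**m**X)\<^esub> j (m'**m**X) (MAr E' (inc m' (m**X)) y)"
    using e(8)[OF i] asubD(2)[OF subfD(1)[OF "0.prems"(3) mX] a(1)] j(1)[OF mX mX mX a(2)] "0.prems"(7)[OF i a(2)] by simp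
   also have "\<dots> : N (m'**m**X)"
    by (rule asubD(4)[OF subfD(1)[OF "0.prems"(3) m'mX] subfD(2)[OF "0.prems"(3) i a(1)] "0.prems"(8)[OF m'mX m'(2)]])
   finally have "MAr E (inc (m'**m) X) x : N ((m'**m)**X)" using M_obj m m' St_obj[OF X] by simp
   then show ?thesis using M_tensor[OF m'(1) m(1)] by blast
  qed
  then show ?thesis using True by simp
 qed
next
 case (Suc n)
 note e = mf[OF Suc.prems(1)] and e' = mf[OF Suc.prems(2)]
 note j = addmapD[OF Suc.prems(6) e'(2) e(2)]
 note NE = subfD[OF Suc.prems(3)] and NE' = subfD[OF Suc.prems(4)] and NE'' = subfD[OF Suc.prems(5)]
 have kap: "x : N X" if k: k and m: "m : M" and X: "X : St" and x: "x : cM E X"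
  "MAr E (inc m X) x : N (m**X)" for m X x
 proof -
  have mX: "m**X : St" using m X by simp
  interpret A: abelian_group "MOb E (m**X)" by (rule e(2)[OF mX])
  note i = inc_hm[OF m X]
  have "x : N'' X" using Suc.prems(10)[OF mX] Suc.prems(14) k m X x by auto
  then obtain a y where a: "a : N X" "y : cM E' X" "x = a \<oplus>\<^bsub>MOb E X\<^esub> j X y"
   using Suc.prems(12)[OF X] by blast
  have ac: "a : cM E X" by (rule asubD(2)[OF NE(1)[OF X] a(1)])
  have jy: "j X y : cM E X" by (rule j(1)[OF X X X a(2)])
  have "MAr E (inc m X) (j X y) = \<ominus>\<^bsub>MOb E (m**X)\<^esub> MAr E (inc m X) a \<oplus>\<^bsub>MOb E (m**X)\<^esub> MAr E (inc m X) x"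
   using e(8)[OF i ac jy] a(3) e(5)[OF i ac] e(5)[OF i jy] by (simp add: A.r_neg1)
  also have "\<dots> : N (m**X)"
   using asubD(4,5)[OF NE(1)[OF mX]] NE(2)[OF i a(1)] x(2) by simp
  finally have "j (m**X) (MAr E' (inc m X) y) : N (m**X)" using Suc.prems(7)[OF i a(2)] by simp
  then have "MAr E' (inc m X) y : N' (m**X)"
   using Suc.prems(9)[OF k mX e'(5)[OF inc_hm[OF m X] a(2)]] by simp
  then have "y : N' X" using Suc.prems(13) k m X a(2) by auto
  then show "x : N X" using a Suc.prems(8)[OF X] asubD(4)[OF NE(1)[OF X]] by auto
 qed
 have "pol k s n (tau G m E) (dsub m E N)" if m: "m : M" for m
 proof (rule Suc.IH[of "tau G m E" "tau G m E'" "dsub m E N" "dsub m E' N'" "dsub m E N''" "%X. j (m**X)"])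
  show "module_functor R S (tau G m E)" "module_functor R S (tau G m E')"
   using tau_mf m Suc.prems(1,2) by auto
  show "subf (tau G m E) (dsub m E N)" "subf (tau G m E') (dsub m E' N')" "subf (tau G m E) (dsub m E N'')"
   using dsub_subf m Suc.prems(1-5) by auto
  show "pol k s n (tau G m E') (dsub m E' N')" "pol k s n (tau G m E) (dsub m E N'')"
   using Suc.prems(13,14) m by auto
  show "\<not> (k & s)" by (rule Suc.prems(15))
  fix X assume X: "X : St"
  then have mX: "m**X : St" using m by simp
  interpret A: abelian_group "MOb E (m**X)" by (rule e(2)[OF mX])
  note i = inc_hm[OF m X]
  show "addmap (MOb (tau G m E') X) (MOb (tau G m E) X) (j (m**X))"
   using Suc.prems(6)[OF mX] by (simp add: tau_simps)
  show "dsub m E N X <= dsub m E N'' X" using Suc.prems(10)[OF mX] by (auto simp: dsub_def)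
  { fix y assume "y : dsub m E' N' X"
   then obtain a x where a: "y = a \<oplus>\<^bsub>MOb E' (m**X)\<^esub> MAr E' (inc m X) x" "a : N' (m**X)" "x : cM E' X"
    by (auto simp: dsub_def)
   then have "j (m**X) y = j (m**X) a \<oplus>\<^bsub>MOb E (m**X)\<^esub> MAr E (inc m X) (j X x)"
    using j(2)[OF mX mX mX asubD(2)[OF NE'(1)[OF mX] a(2)] e'(5)[OF i a(3)]] Suc.prems(7)[OF i a(3)] by simp
   then show "j (m**X) y : dsub m E N X" using a Suc.prems(8)[OF mX] j(1)[OF X X X] by (auto simp: dsub_def) }
  { fix y assume y: "y : cM (tau G m E') X"
   then show "j (m**X) y : dsub m E N'' X"
    using dsub_full[OF Suc.prems(1,5) m X] Suc.prems(11)[OF mX] by (simp add: tau_simps)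
   \<comment> \<open>The snake argument. If \<open>j y\<close> is congruent to the image of some
     \<open>x\<close>, then \<open>x\<close> dies in the third term because its kernels vanish,
     hence comes from some \<open>w\<close> in \<open>E'\<close>. After subtracting the image of
     \<open>w\<close>, injectivity of \<open>j\<close> modulo the subfunctors applies to
     \<open>y\<close>.\<close>
   assume k: k and d: "j (m**X) y : dsub m E N X"
   have y: "y : cM E' (m**X)" using y by (simp add: tau_simps)
   interpret A': abelian_group "MOb E' (m**X)" by (rule e'(2)[OF mX])
   obtain a x where a: "j (m**X) y = a \<oplus>\<^bsub>MOb E (m**X)\<^esub> MAr E (inc m X) x" "a : N (m**X)" "x : cM E X"
    using d by (auto simp: dsub_def)
   have ac: "a : cM E (m**X)" by (rule asubD(2)[OF NE(1)[OF mX] a(2)])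
   have ix: "MAr E (inc m X) x : cM E (m**X)" by (rule e(5)[OF i a(3)])
   have "MAr E (inc m X) x = \<ominus>\<^bsub>MOb E (m**X)\<^esub> a \<oplus>\<^bsub>MOb E (m**X)\<^esub> j (m**X) y"
    using a(1) ac ix by (simp add: A.r_neg1)
   also have "\<dots> : N'' (m**X)"
    using asubD(4,5)[OF NE''(1)[OF mX]] Suc.prems(10)[OF mX] a(2) Suc.prems(11)[OF mX y] by auto
   finally have "x : N'' X" using Suc.prems(14) k m X a(3) by auto
   then obtain b w where b: "b : N X" "w : cM E' X" "x = b \<oplus>\<^bsub>MOb E X\<^esub> j X w"
    using Suc.prems(12)[OF X] by blast
   have bc: "b : cM E X" by (rule asubD(2)[OF NE(1)[OF X] b(1)])
   have jw: "j X w : cM E X" by (rule j(1)[OF X X X b(2)])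
   define y' where "y' = y \<oplus>\<^bsub>MOb E' (m**X)\<^esub> (\<ominus>\<^bsub>MOb E' (m**X)\<^esub> MAr E' (inc m X) w)"
   have iw: "MAr E' (inc m X) w : cM E' (m**X)" by (rule e'(5)[OF i b(2)])
   have y'c: "y' : cM E' (m**X)" unfolding y'_def using y iw by simp
   have "j (m**X) y' = j (m**X) y \<oplus>\<^bsub>MOb E (m**X)\<^esub> \<ominus>\<^bsub>MOb E (m**X)\<^esub> MAr E (inc m X) (j X w)"
    unfolding y'_def using j(2,4)[OF mX mX mX] y iw Suc.prems(7)[OF i b(2)] by simp
   also have "\<dots> = a \<oplus>\<^bsub>MOb E (m**X)\<^esub> MAr E (inc m X) b"
    unfolding a(1) b(3) e(8)[OF i bc jw]
    using ac e(5)[OF i bc] e(5)[OF i jw] by (simp add: A.a_assoc A.r_neg)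
   also have "\<dots> : N (m**X)" by (rule asubD(4)[OF NE(1)[OF mX] a(2) NE(2)[OF i b(1)]])
   finally have "y' : N' (m**X)" by (rule Suc.prems(9)[OF k mX y'c])
   moreover have "y = y' \<oplus>\<^bsub>MOb E' (m**X)\<^esub> MAr E' (inc m X) w"
    unfolding y'_def using y iw by (simp add: A'.a_assoc A'.l_neg)
   ultimately show "y : dsub m E' N' X" using b(2) by (auto simp: dsub_def) }
  { fix x assume "x : dsub m E N'' X"
   then obtain a v where a: "x = a \<oplus>\<^bsub>MOb E (m**X)\<^esub> MAr E (inc m X) v" "a : N'' (m**X)" "v : cM E X"
    by (auto simp: dsub_def)
   obtain b y where b: "b : N (m**X)" "y : cM E' (m**X)" "a = b \<oplus>\<^bsub>MOb E (m**X)\<^esub> j (m**X) y"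
    using Suc.prems(12)[OF mX a(2)] by blast
   have "x = (b \<oplus>\<^bsub>MOb E (m**X)\<^esub> MAr E (inc m X) v) \<oplus>\<^bsub>MOb E (m**X)\<^esub> j (m**X) y"
    unfolding a(1) b(3) using asubD(2)[OF NE(1)[OF mX] b(1)] j(1)[OF mX mX mX b(2)] e(5)[OF i a(3)]
    by (simp add: A.a_ac)
   then show "EX a:dsub m E N X. EX y:cM (tau G m E') X. x = a \<oplus>\<^bsub>MOb (tau G m E) X\<^esub> j (m**X) y"
    using a b by (auto simp: dsub_def tau_simps) }
 next
  fix X Y phi y assume "phi : hm X Y" "y : cM (tau G m E') X"
  then show "j (m**Y) (MAr (tau G m E') phi y) = MAr (tau G m E) phi (j (m**X) y)"
   using Suc.prems(7)[OF whisk_hm[OF m]] by (simp add: tau_simps)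
 qed
 then show ?case using kap by auto
qed

lemma full_subf: "module_functor R S E ==> subf E (%X. cM E X)"
proof -
 assume E: "module_functor R S E"
 have "asub (MOb E X) (cM E X)" if "X : St" for X
 proof -
  interpret abelian_group "MOb E X" by (rule mf(2)[OF E that])
  show ?thesis by (simp add: asub_def)
 qed
 then show ?thesis using mf(5)[OF E] by (auto simp: subf_def)
qed

text \<open>The extension with third term zero. For \<open>k = False\<close> this passes to
  quotients, for \<open>k = True\<close> along isomorphisms.\<close>

lemma pol_quotient:
 assumes "module_functor R S E" "module_functor R S E'" "subf E N" "subf E' N'"
  "!!X. X : St ==> addmap (MOb E' X) (MOb E X) (j X)"
  "!!X Y phi y. phi : hm X Y ==> y : cM E' X ==> j Y (MAr E' phi y) = MAr E phi (j X y)"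
  "!!X y. X : St ==> y : N' X ==> j X y : N X"
  "!!X y. k ==> X : St ==> y : cM E' X ==> j X y : N X ==> y : N' X"
  "!!X x. X : St ==> x : cM E X ==> EX a:N X. EX y:cM E' X. x = a \<oplus>\<^bsub>MOb E X\<^esub> j X y"
  "pol k s n E' N'" "\<not> (k & s)"
 shows "pol k s n E N"
proof (rule pol_extension[where N'' = "%X. cM E X" and j = j, OF assms(1-4) full_subf[OF assms(1)]])
 show "pol k s n E (%X. cM E X)" by (rule pol_full[OF assms(1) full_subf[OF assms(1)]]) simp
 show "N X <= cM E X" if "X : St" for X by (rule asubD(1)[OF subfD(1)[OF assms(3) that]])
 show "j X y : cM E X" if "X : St" "y : cM E' X" for X y
  using addmapD(1)[OF assms(5) mf(2)[OF assms(2)] mf(2)[OF assms(1)]] that by blast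
qed (use assms in auto)

definition stab where
 "stab E N X = {x : cM E X. EX m:M. MAr E (inc m X) x : N (m**X)}"

text \<open>If \<open>m\<close> kills \<open>x\<close> and \<open>n\<close> kills \<open>y\<close>,
  then \<open>n \<natural> m\<close> kills both: for \<open>x\<close> apply the inclusion of
  \<open>n\<close> afterwards, for \<open>y\<close> use naturality. The union of the kernels is thus
  a subgroup, which is why the clause of \<open>pol\<close> at 0 asks for a single
  \<open>m\<close>.\<close>

lemma stab_subf:
 assumes E: "module_functor R S E" and N: "subf E N"
 shows "subf E (stab E N)"
 unfolding subf_def
proof (intro conjI ballI allI)
 note e = mf[OF E]
 fix X assume X: "X : St"
 interpret X: abelian_group "MOb E X" by (rule e(2)[OF X])
 show "asub (MOb E X) (stab E N X)" unfolding asub_def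
 proof (intro conjI ballI)
  show "stab E N X <= cM E X" by (auto simp: stab_def)
  show "\<zero>\<^bsub>MOb E X\<^esub> : stab E N X"
   using e(9)[OF inc_hm[OF M_unit X]] asubD(3)[OF subfD(1)[OF N M_St[OF M_unit X]]] M_unit
   by (auto simp: stab_def intro!: bexI[of _ "Unit G"])
  fix x assume "x : stab E N X"
  then obtain m where x: "x : cM E X" and m: "m : M" "MAr E (inc m X) x : N (m**X)"
   by (auto simp: stab_def)
  have mX: "m**X : St" using m X by simp
  show "\<ominus>\<^bsub>MOb E X\<^esub> x : stab E N X"
   using x m e(10)[OF inc_hm[OF m(1) X] x] asubD(5)[OF subfD(1)[OF N mX] m(2)]
   by (auto simp: stab_def intro!: bexI[of _ m])
  fix y assume "y : stab E N X"
  then obtain n where y: "y : cM E X" and n: "n : M" "MAr E (inc n X) y : N (n**X)"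
   by (auto simp: stab_def)
  have nm: "n**m : M" "(n**m)**X = n**m**X" "n**m**X : St"
   using M_tensor[OF n(1) m(1)] M_obj n m St_obj[OF X] X by simp_all
  have 1: "MAr E (inc (n**m) X) x : N (n**m**X)"
   using subfD(2)[OF N inc_hm[OF n(1) mX] m(2)] mf_inc_inc[OF E m(1) n(1) X x] by simp
  have 2: "MAr E (inc (n**m) X) y : N (n**m**X)"
   using subfD(2)[OF N whisk_hm[OF n(1) inc_hm[OF m(1) X]] n(2)] mf_inc_inc[OF E m(1) n(1) X y]
    mf_inc_nat[OF E n(1) inc_hm[OF m(1) X] y] by simp
  have "MAr E (inc (n**m) X) (x \<oplus>\<^bsub>MOb E X\<^esub> y) : N (n**m**X)"
   using e(8)[OF inc_hm[OF nm(1) X] x y] asubD(4)[OF subfD(1)[OF N nm(3)] 1 2] nm(2) by simp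
  then show "x \<oplus>\<^bsub>MOb E X\<^esub> y : stab E N X" using x y nm by (auto simp: stab_def intro!: bexI[of _ "n**m"])
 qed
next
 fix X Y phi x assume p: "phi : hm X Y" and "x : stab E N X"
 then obtain m where x: "x : cM E X" and m: "m : M" "MAr E (inc m X) x : N (m**X)"
  by (auto simp: stab_def)
 then have "MAr E (inc m Y) (MAr E phi x) : N (m**Y)"
  using mf_inc_nat[OF E m(1) p x] subfD(2)[OF N whisk_hm[OF m(1) p] m(2)] by simp
 then show "MAr E phi x : stab E N Y" using mf(5)[OF E p x] m by (auto simp: stab_def intro!: bexI[of _ m])
qed

lemma stab_full: "pol k True 0 E N \<longleftrightarrow> (ALL X:St. cM E X <= stab E N X)"
 by (auto simp: stab_def)

section \<open>Exchanging shifts\<close>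

lemma braid_shift:
 assumes F: "module_functor R S F" and m: "m : M" "n : M" and X: "X : St"
 shows "emb (Brd G m n##Idn G X) : hm (m**n**X) (n**m**X)"
  "emb (braid' m n##Idn G X) : hm (n**m**X) (m**n**X)"
  "v : cM F (n**m**X) ==> MAr F (emb (Brd G m n##Idn G X)) (MAr F (emb (braid' m n##Idn G X)) v) = v"
  "v : cM F (m**n**X) ==> MAr F (emb (braid' m n##Idn G X)) (MAr F (emb (Brd G m n##Idn G X)) v) = v"
  "v : cM F (m**X) ==>
   MAr F (emb (Brd G m n##Idn G X)) (MAr F (whisk m (inc n X)) v) = MAr F (inc n (m**X)) v"
  "v : cM F (m**X) ==>
   MAr F (emb (braid' m n##Idn G X)) (MAr F (inc n (m**X)) v) = MAr F (whisk m (inc n X)) v"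
proof -
 note mo = M_obj[OF m(1)] M_obj[OF m(2)] and Xo = St_obj[OF X]
 have St: "m**X : St" "m**n**X : St" "n**m**X : St" "n**X : St" using m X by simp_all
 note b = braid_hom[OF mo] and b' = braid'_hom[OF mo] and iX = idn_hom[OF Xo]
 have bX: "Brd G m n##Idn G X : Gh (m**n**X) (n**m**X)" using whisk_right[OF Xo b] mo Xo by simp
 have b'X: "braid' m n##Idn G X : Gh (n**m**X) (m**n**X)" using whisk_right[OF Xo b'] mo Xo by simp
 show 1: "emb (Brd G m n##Idn G X) : hm (m**n**X) (n**m**X)"
  "emb (braid' m n##Idn G X) : hm (n**m**X) (m**n**X)"
  by (rule emb_hm[OF bX St(2,3)], rule emb_hm[OF b'X St(3,2)])
 have e1: "emb (Brd G m n##Idn G X) $$ emb (braid' m n##Idn G X) = bracket G (n**m**X) (Unit G) (Idn G (n**m**X))"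
  unfolding emb_cmp[OF b'X bX] using ic[OF b' b iX iX] inv_arrow(3)[OF b] idn_left[OF iX] mo Xo
  by (simp add: emb_idn)
 have e2: "emb (braid' m n##Idn G X) $$ emb (Brd G m n##Idn G X) = bracket G (m**n**X) (Unit G) (Idn G (m**n**X))"
  unfolding emb_cmp[OF bX b'X] using ic[OF b b' iX iX] inv_arrow(2)[OF b] idn_left[OF iX] mo Xo
  by (simp add: emb_idn)
 note f = mf[OF F]
 show 3: "v : cM F (n**m**X) ==> MAr F (emb (Brd G m n##Idn G X)) (MAr F (emb (braid' m n##Idn G X)) v) = v" for v
  using f(6)[OF 1(2,1), of v] f(7)[OF St(3), of v] e1 by simp
 show 4: "v : cM F (m**n**X) ==> MAr F (emb (braid' m n##Idn G X)) (MAr F (emb (Brd G m n##Idn G X)) v) = v" for v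
  using f(6)[OF 1, of v] f(7)[OF St(2), of v] e2 by simp
 have w: "whisk m (inc n X) : hm (m**X) (m**n**X)" by (rule whisk_hm[OF m(1) inc_hm[OF m(2) X]])
 show 5: "v : cM F (m**X) ==>
   MAr F (emb (Brd G m n##Idn G X)) (MAr F (whisk m (inc n X)) v) = MAr F (inc n (m**X)) v"
  using f(6)[OF w 1(1), of v] braid_inc[OF mo Xo] by simp
 show "v : cM F (m**X) ==>
   MAr F (emb (braid' m n##Idn G X)) (MAr F (inc n (m**X)) v) = MAr F (whisk m (inc n X)) v"
  using 5 4[OF f(5)[OF w, of v]] by simp
qed

lemma braid_shift_nat:
 assumes F: "module_functor R S F" and m: "m : M" "n : M" and p: "phi : hm X Y"
 shows "v : cM F (n**m**X) ==> MAr F (emb (braid' m n##Idn G Y)) (MAr F (whisk n (whisk m phi)) v) =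
   MAr F (whisk m (whisk n phi)) (MAr F (emb (braid' m n##Idn G X)) v)"
  "v : cM F (m**n**X) ==> MAr F (emb (Brd G m n##Idn G Y)) (MAr F (whisk m (whisk n phi)) v) =
   MAr F (whisk n (whisk m phi)) (MAr F (emb (Brd G m n##Idn G X)) v)"
proof -
 note mo = M_obj[OF m(1)] M_obj[OF m(2)] and XY = hmD(2,3)[OF p]
 note w1 = whisk_hm[OF m(2) whisk_hm[OF m(1) p]] and w2 = whisk_hm[OF m(1) whisk_hm[OF m(2) p]]
 note bX = braid_shift(1,2)[OF F m XY(1)] and bY = braid_shift(1,2)[OF F m XY(2)]
 note ww = whisk_whisk[OF mo hmD(1)[OF p]] whisk_whisk[OF mo(2,1) hmD(1)[OF p]]
 show "v : cM F (n**m**X) ==> MAr F (emb (braid' m n##Idn G Y)) (MAr F (whisk n (whisk m phi)) v) =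
   MAr F (whisk m (whisk n phi)) (MAr F (emb (braid' m n##Idn G X)) v)"
  using mf(6)[OF F w1 bY(2), of v] mf(6)[OF F bX(2) w2, of v] emb_whisk[OF braid'_hom[OF mo] hmD(1)[OF p]] ww by simp
 show "v : cM F (m**n**X) ==> MAr F (emb (Brd G m n##Idn G Y)) (MAr F (whisk m (whisk n phi)) v) =
   MAr F (whisk n (whisk m phi)) (MAr F (emb (Brd G m n##Idn G X)) v)"
  using mf(6)[OF F w2 bY(1), of v] mf(6)[OF F bX(1) w1, of v] emb_whisk[OF braid_hom[OF mo] hmD(1)[OF p]] ww by simp
qed

lemma braid_shift_dsub:
 assumes F: "module_functor R S F" and K: "subf F K" and m: "m : M" "n : M" and X: "X : St"
 shows "y : dsub n F K (m**X) ==> MAr F (emb (braid' m n##Idn G X)) y : dsub n (tau G m F) (%X. K (m**X)) X"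
  "y : dsub n (tau G m F) (%X. K (m**X)) X ==> MAr F (emb (Brd G m n##Idn G X)) y : dsub n F K (m**X)"
proof -
 have St: "m**X : St" "m**n**X : St" "n**m**X : St" "n**X : St" using m X by simp_all
 note b = braid_shift[OF F m X] and f = mf[OF F]
 have w: "whisk m (inc n X) : hm (m**X) (m**n**X)" by (rule whisk_hm[OF m(1) inc_hm[OF m(2) X]])
 note i = inc_hm[OF m(2) St(1)]
 show "y : dsub n F K (m**X) ==> MAr F (emb (braid' m n##Idn G X)) y : dsub n (tau G m F) (%X. K (m**X)) X"
 proof -
  assume "y : dsub n F K (m**X)"
  then obtain a x where a: "y = a \<oplus>\<^bsub>MOb F (n**m**X)\<^esub> MAr F (inc n (m**X)) x" "a : K (n**m**X)" "x : cM F (m**X)"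
   by (auto simp: dsub_def)
  have "MAr F (emb (braid' m n##Idn G X)) y = MAr F (emb (braid' m n##Idn G X)) a \<oplus>\<^bsub>MOb F (m**n**X)\<^esub> MAr F (whisk m (inc n X)) x"
   using f(8)[OF b(2)] asubD(2)[OF subfD(1)[OF K St(3)] a(2)] f(5)[OF i a(3)] b(6)[OF a(3)] a(1) by simp
  then show ?thesis using subfD(2)[OF K b(2) a(2)] a(3) by (auto simp: dsub_def tau_simps)
 qed
 show "y : dsub n (tau G m F) (%X. K (m**X)) X ==> MAr F (emb (Brd G m n##Idn G X)) y : dsub n F K (m**X)"
 proof -
  assume "y : dsub n (tau G m F) (%X. K (m**X)) X"
  then obtain a x where a: "y = a \<oplus>\<^bsub>MOb F (m**n**X)\<^esub> MAr F (whisk m (inc n X)) x" "a : K (m**n**X)" "x : cM F (m**X)"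
   by (auto simp: dsub_def tau_simps)
  have "MAr F (emb (Brd G m n##Idn G X)) y = MAr F (emb (Brd G m n##Idn G X)) a \<oplus>\<^bsub>MOb F (n**m**X)\<^esub> MAr F (inc n (m**X)) x"
   using f(8)[OF b(1)] asubD(2)[OF subfD(1)[OF K St(2)] a(2)] f(5)[OF w a(3)] b(5)[OF a(3)] a(1) by simp
  then show ?thesis using subfD(2)[OF K b(1) a(2)] a(3) by (auto simp: dsub_def)
 qed
qed

text \<open>Shifting by \<open>m\<close> commutes with the cokernel along \<open>n\<close>: the
  braiding identifies the two values and carries one inclusion of \<open>n\<close> to the other, by
  \<open>braid_inc\<close>. The identification has an inverse, so degrees transfer both
  ways.\<close>

lemma pol_swap:
 assumes F: "module_functor R S F" and K: "subf F K" and m: "m : M" "n : M" and ks: "\<not> (k & s)"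
 shows "pol k s d (tau G m (tau G n F)) (%X. dsub n F K (m**X)) \<longleftrightarrow>
  pol k s d (tau G n (tau G m F)) (dsub n (tau G m F) (%X. K (m**X)))"
proof -
 note f = mf[OF F]
 note mfm = tau_mf[OF F m(1)] and mfn = tau_mf[OF F m(2)]
 note E1 = tau_mf[OF mfn m(1)] and E2 = tau_mf[OF mfm m(2)]
 note N1 = tau_subf[OF dsub_subf[OF F K m(2)] m(1)] and N2 = dsub_subf[OF mfm tau_subf[OF K m(1)] m(2)]
 have St: "m**X : St" "m**n**X : St" "n**m**X : St" "n**X : St" if "X : St" for X using m that by simp_all
 show ?thesis
 proof
  assume p: "pol k s d (tau G m (tau G n F)) (%X. dsub n F K (m**X))"
  show "pol k s d (tau G n (tau G m F)) (dsub n (tau G m F) (%X. K (m**X)))"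
  proof (rule pol_quotient[OF E2 E1 N2 N1 _ _ _ _ _ p ks, where j = "%X. MAr F (emb (braid' m n##Idn G X))"])
   fix X assume X: "X : St"
   note b = braid_shift[OF F m X] and bd = braid_shift_dsub[OF F K m X]
   interpret A: abelian_group "MOb F (m**n**X)" by (rule f(2)[OF St(2)[OF X]])
   show "addmap (MOb (tau G m (tau G n F)) X) (MOb (tau G n (tau G m F)) X) (MAr F (emb (braid' m n##Idn G X)))"
    using f(4)[OF b(2)] by (simp add: tau_simps)
   show "MAr F (emb (braid' m n##Idn G X)) y : dsub n (tau G m F) (%X. K (m**X)) X" if "y : dsub n F K (m**X)" for y
    by (rule bd(1)[OF that])
   show "y : dsub n F K (m**X)" if "y : cr (MOb (tau G m (tau G n F)) X)"
    "MAr F (emb (braid' m n##Idn G X)) y : dsub n (tau G m F) (%X. K (m**X)) X" for y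
    using bd(2)[OF that(2)] b(3)[of y] that(1) by (simp add: tau_simps)
   fix x assume "x : cr (MOb (tau G n (tau G m F)) X)"
   then have x: "x : cM F (m**n**X)" by (simp add: tau_simps)
   show "EX a:dsub n (tau G m F) (%X. K (m**X)) X. EX y:cr (MOb (tau G m (tau G n F)) X).
     x = a \<oplus>\<^bsub>MOb (tau G n (tau G m F)) X\<^esub> MAr F (emb (braid' m n##Idn G X)) y"
    using asubD(3)[OF subfD(1)[OF N2 X]] f(5)[OF b(1) x] b(4)[OF x] x
    by (intro bexI[of _ "\<zero>\<^bsub>MOb F (m**n**X)\<^esub>"] bexI[of _ "MAr F (emb (Brd G m n##Idn G X)) x"])
     (simp_all add: tau_simps)
  next
   fix X Y phi y assume p: "phi : hm X Y" and "y : cr (MOb (tau G m (tau G n F)) X)"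
   then show "MAr F (emb (braid' m n##Idn G Y)) (MAr (tau G m (tau G n F)) phi y) =
     MAr (tau G n (tau G m F)) phi (MAr F (emb (braid' m n##Idn G X)) y)"
    using braid_shift_nat(1)[OF F m p] by (simp add: tau_simps)
  qed
 next
  assume p: "pol k s d (tau G n (tau G m F)) (dsub n (tau G m F) (%X. K (m**X)))"
  show "pol k s d (tau G m (tau G n F)) (%X. dsub n F K (m**X))"
  proof (rule pol_quotient[OF E1 E2 N1 N2 _ _ _ _ _ p ks, where j = "%X. MAr F (emb (Brd G m n##Idn G X))"])
   fix X assume X: "X : St"
   note b = braid_shift[OF F m X] and bd = braid_shift_dsub[OF F K m X]
   interpret A: abelian_group "MOb F (n**m**X)" by (rule f(2)[OF St(3)[OF X]])
   show "addmap (MOb (tau G n (tau G m F)) X) (MOb (tau G m (tau G n F)) X) (MAr F (emb (Brd G m n##Idn G X)))"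
    using f(4)[OF b(1)] by (simp add: tau_simps)
   show "MAr F (emb (Brd G m n##Idn G X)) y : dsub n F K (m**X)" if "y : dsub n (tau G m F) (%X. K (m**X)) X" for y
    by (rule bd(2)[OF that])
   show "y : dsub n (tau G m F) (%X. K (m**X)) X" if "y : cr (MOb (tau G n (tau G m F)) X)"
    "MAr F (emb (Brd G m n##Idn G X)) y : dsub n F K (m**X)" for y
    using bd(1)[OF that(2)] b(4)[of y] that(1) by (simp add: tau_simps)
   fix x assume "x : cr (MOb (tau G m (tau G n F)) X)"
   then have x: "x : cM F (n**m**X)" by (simp add: tau_simps)
   show "EX a:dsub n F K (m**X). EX y:cr (MOb (tau G n (tau G m F)) X).
     x = a \<oplus>\<^bsub>MOb (tau G m (tau G n F)) X\<^esub> MAr F (emb (Brd G m n##Idn G X)) y"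
    using asubD(3)[OF subfD(1)[OF N1 X]] f(5)[OF b(2) x] b(3)[OF x] x
    by (intro bexI[of _ "\<zero>\<^bsub>MOb F (n**m**X)\<^esub>"] bexI[of _ "MAr F (emb (braid' m n##Idn G X)) x"])
     (simp_all add: tau_simps)
  next
   fix X Y phi y assume p: "phi : hm X Y" and "y : cr (MOb (tau G n (tau G m F)) X)"
   then show "MAr F (emb (Brd G m n##Idn G Y)) (MAr (tau G n (tau G m F)) phi y) =
     MAr (tau G m (tau G n F)) phi (MAr F (emb (Brd G m n##Idn G X)) y)"
    using braid_shift_nat(2)[OF F m p] by (simp add: tau_simps)
  qed
 qed
qed

lemma pol_tau:
 "module_functor R S F ==> subf F K ==> m : M ==> \<not> (k & s) ==> pol k s d F K ==>
  pol k s d (tau G m F) (%X. K (m**X))"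
proof (induction d arbitrary: F K)
 case 0
 note b = braid_shift[OF 0(1)]
 have "EX n:M. MAr F (whisk m (inc n X)) x : K (m**n**X)" if s: s and X: "X : St" "x : cM F (m**X)" for X x
 proof -
  obtain n where n: "n : M" "MAr F (inc n (m**X)) x : K (n**m**X)" using 0(5) s M_St[OF 0(3) X(1)] X(2) by auto
  then have "MAr F (whisk m (inc n X)) x : K (m**n**X)"
   using subfD(2)[OF 0(2) b(2)[OF 0(3) n(1) X(1)] n(2)] b(6)[OF 0(3) n(1) X] by simp
  then show ?thesis using n(1) by blast
 qed
 then show ?case using 0(3,5) by (cases s) (auto simp: tau_simps)
next
 case (Suc d)
 note b = braid_shift[OF Suc.prems(1)]
 show ?case unfolding pol.simps
 proof (intro ballI conjI impI)
  fix n assume n: "n : M"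
  have "pol k s d (tau G m (tau G n F)) (%X. dsub n F K (m**X))"
   by (rule Suc.IH[OF tau_mf[OF Suc.prems(1) n] dsub_subf[OF Suc.prems(1,2) n] Suc.prems(3,4)])
    (use Suc.prems(5) n in simp)
  then show "pol k s d (tau G n (tau G m F)) (dsub n (tau G m F) (%X. K (m**X)))"
   using pol_swap[OF Suc.prems(1,2,3) n Suc.prems(4)] by simp
  fix X x assume k: k and X: "X : St" and "x : cM (tau G m F) X" "MAr (tau G m F) (inc n X) x : K (m**n**X)"
  then have x: "x : cM F (m**X)" "MAr F (whisk m (inc n X)) x : K (m**n**X)" by (simp_all add: tau_simps)
  have "MAr F (inc n (m**X)) x : K (n**m**X)"
   using subfD(2)[OF Suc.prems(2) b(1)[OF Suc.prems(3) n X] x(2)] b(5)[OF Suc.prems(3) n X x(1)] by simp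
  then show "x : K (m**X)" using Suc.prems(5) n k x(1) M_St[OF Suc.prems(3) X] by auto
 qed
qed

text \<open>\<open>F/K\<close> is compared with its shift along the inclusion. The kernel vanishes
  when \<open>F/K\<close> is very strong, of whatever degree \<open>c\<close>; in the weak case it
  is stably zero, since \<open>m\<close> kills it.\<close>

lemma pol_tau_reverse:
 "module_functor R S F ==> subf F K ==> m : M ==> (\<not> s ==> pol True False c F K) ==>
  pol False s d (tau G m F) (%X. K (m**X)) ==> pol False s d F K"
proof (induction d arbitrary: c F K)
 case 0
 show ?case
 proof (cases s)
  case True
  have "EX n:M. MAr F (inc n X) x : K (n**X)" if X: "X : St" "x : cM F X" for X x
  proof -
   have i: "MAr F (inc m X) x : cM F (m**X)" by (rule mf(5)[OF 0(1) inc_hm[OF 0(3) X(1)] X(2)])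
   then obtain n where n: "n : M" "MAr F (whisk m (inc n X)) (MAr F (inc m X) x) : K (m**n**X)"
    using 0(5) True X(1) by (auto simp: tau_simps)
   have "MAr F (inc (m**n) X) x : K ((m**n)**X)"
    using n(2) mf_inc_nat[OF 0(1,3) inc_hm[OF n(1) X(1)] X(2)] mf_inc_inc[OF 0(1) n(1) 0(3) X]
     M_obj[OF 0(3)] M_obj[OF n(1)] St_obj[OF X(1)] by simp
   then show ?thesis using M_tensor[OF 0(3) n(1)] by blast
  qed
  then show ?thesis using True by simp
 next
  case False
  have "x : K X" if X: "X : St" "x : cM F X" for X x
  proof (cases c)
   case 0
   then show ?thesis using "0.prems"(4)[OF False] X by auto
  next
   case (Suc c')
   have i: "MAr F (inc m X) x : cM F (m**X)" by (rule mf(5)[OF "0.prems"(1) inc_hm[OF "0.prems"(3) X(1)] X(2)])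
   then have "MAr F (inc m X) x : K (m**X)" using "0.prems"(5) False X by (auto simp: tau_simps)
   then show ?thesis using "0.prems"(3) "0.prems"(4)[OF False] Suc X by auto
  qed
  then show ?thesis using False by simp
 qed
next
 case (Suc d)
 show ?case unfolding pol.simps
 proof (intro ballI conjI impI)
  fix n assume n: "n : M"
  have "pol False s d (tau G n (tau G m F)) (dsub n (tau G m F) (%X. K (m**X)))"
   using Suc.prems(5) n by simp
  then have p: "pol False s d (tau G m (tau G n F)) (%X. dsub n F K (m**X))"
   using pol_swap[OF Suc.prems(1,2,3) n] by simp
  show "pol False s d (tau G n F) (dsub n F K)"
  \<comment> \<open>For \<open>c = 0\<close> the quotient is zero already. In the other case
    \<open>c - 1\<close> is a true predecessor whenever the very strong hypothesis is in
    force.\<close>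
  proof (cases "\<not> s & c = 0")
   case True
   then have full: "cM F X <= K X" if "X : St" for X using Suc.prems(4) that by auto
   have "cM (tau G n F) X <= dsub n F K X" if "X : St" for X
    using dsub_full[OF Suc.prems(1,2) n that] full[OF M_St[OF n that]] by (auto simp: tau_simps)
   then show ?thesis by (rule pol_full[OF tau_mf[OF Suc.prems(1) n] dsub_subf[OF Suc.prems(1,2) n]])
  next
   case False
   have "pol True False (c - 1) (tau G n F) (dsub n F K)" if "\<not> s"
   proof (cases c)
    case (Suc c')
    then show ?thesis using Suc.prems(4)[OF that] n by simp
   qed (use False that in simp)
   then show ?thesis
    by (rule Suc.IH[OF tau_mf[OF Suc.prems(1) n] dsub_subf[OF Suc.prems(1,2) n] Suc.prems(3) _ p])
  qed
 qed simp
qed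

section \<open>Pairs present iterated cokernels\<close>

text \<open>The cokernels \<open>delta\<close> have chosen representatives as elements, and these
  choices pile up under iteration. The link with the pair is therefore a natural surjection
  \<open>q\<close> with kernel \<open>N\<close>, not an equality of carriers.\<close>

definition pres where
 "pres E N E0 q \<longleftrightarrow> (ALL X:St. abelian_group (MOb E0 X) & addmap (MOb E X) (MOb E0 X) (q X) &
   cM E0 X = q X ` cM E X &
   (ALL x:cM E X. q X x = \<zero>\<^bsub>MOb E0 X\<^esub> \<longleftrightarrow> x : N X)) &
  (ALL X Y. ALL phi:hm X Y. ALL x:cM E X. q Y (MAr E phi x) = MAr E0 phi (q X x))"

lemma presD:
 assumes "pres E N E0 q"
 shows "X : St ==> abelian_group (MOb E0 X)" "X : St ==> addmap (MOb E X) (MOb E0 X) (q X)"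
  "X : St ==> cM E0 X = q X ` cM E X"
  "X : St ==> x : cM E X ==> q X x = \<zero>\<^bsub>MOb E0 X\<^esub> \<longleftrightarrow> x : N X"
  "phi : hm X Y ==> x : cM E X ==> q Y (MAr E phi x) = MAr E0 phi (q X x)"
 using assms by (auto simp: pres_def)

lemma pres_delta:
 assumes E: "module_functor R S E" and N: "subf E N" and m: "m : M" and p: "pres E N E0 q"
 shows "pres (tau G m E) (dsub m E N) (delta G m E0)
  (%X x. quot_rep (MOb E0 (m**X)) (delta_image G m E0 X) (q (m**X) x))"
proof -
 note e = mf[OF E] and pd = presD[OF p]
 have im: "delta_image G m E0 X = {MAr E0 (inc m X) y | y. y : cM E0 X}" for X
  by (auto simp: delta_image_def i_trans_def)
 note ad = addmapD[OF pd(2) e(2) pd(1)]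
 have im2: "delta_image G m E0 X = q (m**X) ` (MAr E (inc m X) ` cM E X)" if X: "X : St" for X
  unfolding im pd(3)[OF X] using pd(5)[OF inc_hm[OF m X]] by force
 have mX: "m**X : St" if "X : St" for X using m that by simp
 have sub: "asub (MOb E0 (m**X)) (delta_image G m E0 X)" if X: "X : St" for X
 proof -
  interpret X: abelian_group "MOb E X" by (rule e(2)[OF X])
  note i = inc_hm[OF m X]
  note a = ad[OF mX[OF X] mX[OF X] mX[OF X]]
  show ?thesis unfolding asub_def im2[OF X]
  proof (intro conjI ballI)
   show "q (m**X) ` MAr E (inc m X) ` cM E X <= cM E0 (m**X)"
    using a(1) e(5)[OF i] by auto
   show "\<zero>\<^bsub>MOb E0 (m**X)\<^esub> : q (m**X) ` MAr E (inc m X) ` cM E X"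
    using a(3) e(9)[OF i] by (metis X.zero_closed image_eqI)
   fix x assume "x : q (m**X) ` MAr E (inc m X) ` cM E X"
   then obtain v where v: "v : cM E X" "x = q (m**X) (MAr E (inc m X) v)" by auto
   then have "\<ominus>\<^bsub>MOb E0 (m**X)\<^esub> x = q (m**X) (MAr E (inc m X) (\<ominus>\<^bsub>MOb E X\<^esub> v))"
    using a(4) e(5,10)[OF i] by simp
   then show "\<ominus>\<^bsub>MOb E0 (m**X)\<^esub> x : q (m**X) ` MAr E (inc m X) ` cM E X" using v by auto
   fix y assume "y : q (m**X) ` MAr E (inc m X) ` cM E X"
   then obtain w where w: "w : cM E X" "y = q (m**X) (MAr E (inc m X) w)" by auto
   then have "x \<oplus>\<^bsub>MOb E0 (m**X)\<^esub> y = q (m**X) (MAr E (inc m X) (v \<oplus>\<^bsub>MOb E X\<^esub> w))"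
    using v a(2) e(5,8)[OF i] by simp
   then show "x \<oplus>\<^bsub>MOb E0 (m**X)\<^esub> y : q (m**X) ` MAr E (inc m X) ` cM E X" using v w by auto
  qed
 qed
 have mq: "module_quotient (MOb E0 (m**X)) (delta_image G m E0 X)" if X: "X : St" for X
  by (simp add: module_quotient_def module_quotient_axioms_def pd(1)[OF mX[OF X]] sub[OF X])
 have ob: "MOb (delta G m E0) X = quot_module (MOb E0 (m**X)) (delta_image G m E0 X)" for X
  by (simp add: delta_def tau_simps)
 have ar: "MAr (delta G m E0) phi x = quot_rep (MOb E0 (m**Y)) (delta_image G m E0 Y) (MAr E0 (whisk m phi) x)"
  if "phi : hm X Y" for phi X Y x
  using hmD(1)[OF that] by (simp add: delta_def tau_simps homs_def)
 show ?thesis unfolding pres_def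
 proof (intro conjI ballI allI)
  fix X assume X: "X : St"
  interpret Q: module_quotient "MOb E0 (m**X)" "delta_image G m E0 X" by (rule mq[OF X])
  interpret mX: abelian_group "MOb E (m**X)" by (rule e(2)[OF mX[OF X]])
  note a = ad[OF mX[OF X] mX[OF X] mX[OF X]] and i = inc_hm[OF m X]
  show "abelian_group (MOb (delta G m E0) X)" unfolding ob by (rule Q.quot_abelian)
  show "addmap (MOb (tau G m E) X) (MOb (delta G m E0) X) (%x. quot_rep (MOb E0 (m**X)) (delta_image G m E0 X) (q (m**X) x))"
   unfolding addmap_def ob using a by (auto simp: tau_simps Q.q_add Q.q_carrier)
  show "cM (delta G m E0) X = (%x. quot_rep (MOb E0 (m**X)) (delta_image G m E0 X) (q (m**X) x)) ` cM (tau G m E) X"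
   unfolding ob Q.q_surj pd(3)[OF mX[OF X]] tau_simps by (simp add: image_image)
  fix x assume "x : cM (tau G m E) X"
  then have x: "x : cM E (m**X)" by (simp add: tau_simps)
  have "q (m**X) x : delta_image G m E0 X \<longleftrightarrow> x : dsub m E N X"
  proof
   assume "q (m**X) x : delta_image G m E0 X"
   then obtain v where v: "v : cM E X" "q (m**X) x = q (m**X) (MAr E (inc m X) v)"
    unfolding im2[OF X] by auto
   note iv = e(5)[OF i v(1)]
   have "q (m**X) (x \<ominus>\<^bsub>MOb E (m**X)\<^esub> MAr E (inc m X) v) = \<zero>\<^bsub>MOb E0 (m**X)\<^esub>"
    using a(5)[OF x iv] v(2) a(1)[OF iv] by (simp add: a_minus_def Q.M.r_neg)
   then have "x \<ominus>\<^bsub>MOb E (m**X)\<^esub> MAr E (inc m X) v : N (m**X)"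
    using pd(4)[OF mX[OF X]] x iv by simp
   moreover have "x = (x \<ominus>\<^bsub>MOb E (m**X)\<^esub> MAr E (inc m X) v) \<oplus>\<^bsub>MOb E (m**X)\<^esub> MAr E (inc m X) v"
    using x iv by (simp add: a_minus_def mX.a_assoc mX.l_neg)
   ultimately show "x : dsub m E N X" using v(1) unfolding dsub_def by blast
  next
   assume "x : dsub m E N X"
   then obtain b v where v: "x = b \<oplus>\<^bsub>MOb E (m**X)\<^esub> MAr E (inc m X) v" "b : N (m**X)" "v : cM E X"
    by (auto simp: dsub_def)
   note iv = e(5)[OF i v(3)]
   have b: "b : cM E (m**X)" by (rule asubD(2)[OF subfD(1)[OF N mX[OF X]] v(2)])
   have "q (m**X) b = \<zero>\<^bsub>MOb E0 (m**X)\<^esub>" using pd(4)[OF mX[OF X] b] v(2) by simp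
   then have "q (m**X) x = q (m**X) (MAr E (inc m X) v)" using a(2)[OF b iv] v(1) a(1)[OF iv] by simp
   then show "q (m**X) x : delta_image G m E0 X" unfolding im2[OF X] using v(3) by auto
  qed
  then show "quot_rep (MOb E0 (m**X)) (delta_image G m E0 X) (q (m**X) x) = \<zero>\<^bsub>MOb (delta G m E0) X\<^esub> \<longleftrightarrow> x : dsub m E N X"
   unfolding ob using Q.q_zero_iff a(1)[OF x] by simp
 next
  fix X Y phi x assume ph: "phi : hm X Y" and "x : cM (tau G m E) X"
  then have x: "x : cM E (m**X)" by (simp add: tau_simps)
  note X = hmD(2)[OF ph] and Y = hmD(3)[OF ph]
  interpret QX: module_quotient "MOb E0 (m**X)" "delta_image G m E0 X" by (rule mq[OF X])
  interpret QY: module_quotient "MOb E0 (m**Y)" "delta_image G m E0 Y" by (rule mq[OF Y])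
  note aX = ad[OF mX[OF X] mX[OF X] mX[OF X]] and aY = ad[OF mX[OF Y] mX[OF Y] mX[OF Y]]
  note w = whisk_hm[OF m ph] and i = inc_hm[OF m X] and iY = inc_hm[OF m Y]
  \<comment> \<open>An arrow of \<open>delta\<close> acts on the chosen representative, which
    differs from \<open>q x\<close> by an element of the image of the inclusion. Naturality keeps
    the difference in that image, where the next choice of representative forgets it.\<close>
  obtain n where n: "n : delta_image G m E0 X" "QX.q (q (m**X) x) = n \<oplus>\<^bsub>MOb E0 (m**X)\<^esub> q (m**X) x"
   using QX.q_ex[OF aX(1)[OF x]] by auto
  obtain v where v: "v : cM E X" "n = q (m**X) (MAr E (inc m X) v)" using n(1) unfolding im2[OF X] by auto
  note iv = e(5)[OF i v(1)]
  have "MAr E0 (whisk m phi) (QX.q (q (m**X) x)) = MAr E0 (whisk m phi) (q (m**X) (MAr E (inc m X) v \<oplus>\<^bsub>MOb E (m**X)\<^esub> x))"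
   using n(2) v(2) aX(2)[OF iv x] by simp
  also have "\<dots> = q (m**Y) (MAr E (whisk m phi) (MAr E (inc m X) v) \<oplus>\<^bsub>MOb E (m**Y)\<^esub> MAr E (whisk m phi) x)"
   using pd(5)[OF w] e(8)[OF w iv x] abelian_group.axioms(1)[OF e(2)[OF mX[OF X]]] iv x
   by (metis abelian_monoid.a_closed)
  also have "\<dots> = q (m**Y) (MAr E (inc m Y) (MAr E phi v)) \<oplus>\<^bsub>MOb E0 (m**Y)\<^esub> q (m**Y) (MAr E (whisk m phi) x)"
   using mf_inc_nat[OF E m ph v(1)] aY(2) e(5)[OF iY e(5)[OF ph v(1)]] e(5)[OF w x] by simp
  finally have eq: "MAr E0 (whisk m phi) (QX.q (q (m**X) x)) =
   q (m**Y) (MAr E (inc m Y) (MAr E phi v)) \<oplus>\<^bsub>MOb E0 (m**Y)\<^esub> q (m**Y) (MAr E (whisk m phi) x)" .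
  define c where "c = q (m**Y) (MAr E (inc m Y) (MAr E phi v))"
  define y where "y = q (m**Y) (MAr E (whisk m phi) x)"
  have c: "c : delta_image G m E0 Y" unfolding c_def im2[OF Y] using e(5)[OF ph v(1)] by auto
  have y: "y : cM E0 (m**Y)" unfolding y_def by (rule aY(1)[OF e(5)[OF w x]])
  have cc: "c : cM E0 (m**Y)" by (rule QY.N(2)[OF c])
  have "(c \<oplus>\<^bsub>MOb E0 (m**Y)\<^esub> y) \<ominus>\<^bsub>MOb E0 (m**Y)\<^esub> y = c"
   using c y cc by (simp add: a_minus_def QY.M.a_assoc QY.M.r_neg)
  then have "QY.q (c \<oplus>\<^bsub>MOb E0 (m**Y)\<^esub> y) = QY.q y" using QY.q_eq_iff[of "c \<oplus>\<^bsub>MOb E0 (m**Y)\<^esub> y" y] y cc c by simp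
  then show "QY.q (q (m**Y) (MAr (tau G m E) phi x)) = MAr (delta G m E0) phi (QX.q (q (m**X) x))"
   unfolding ar[OF ph] eq tau_simps by (simp add: c_def y_def)
 qed
qed

lemma pres_zero:
 assumes E: "module_functor R S E" and p: "pres E N E0 q"
 shows "zero_functor G u z E0 \<longleftrightarrow> pol k False 0 E N"
proof -
 note pd = presD[OF p]
 have "cM E0 X = {\<zero>\<^bsub>MOb E0 X\<^esub>} \<longleftrightarrow> (ALL x:cM E X. x : N X)" if X: "X : St" for X
 proof -
  interpret A: abelian_group "MOb E X" by (rule mf(2)[OF E X])
  interpret A0: abelian_group "MOb E0 X" by (rule pd(1)[OF X])
  have "cM E0 X = {\<zero>\<^bsub>MOb E0 X\<^esub>} \<longleftrightarrow> (ALL y:cM E0 X. y = \<zero>\<^bsub>MOb E0 X\<^esub>)" by auto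
  then show ?thesis unfolding pd(3)[OF X] using pd(4)[OF X] by auto
 qed
 then show ?thesis by (auto simp: zero_functor_def)
qed

text \<open>\<open>kappa\<close> is the subgroup generated by all kernels; by
  \<open>stab_subf\<close> their union is a subgroup already, so generating adds nothing and
  membership is decided by a single \<open>m\<close>.\<close>

lemma pres_stably_zero:
 assumes E: "module_functor R S E" and N: "subf E N" and p: "pres E N E0 q"
 shows "stably_zero G u z E0 \<longleftrightarrow> pol k True 0 E N"
proof -
 note e = mf[OF E] and pd = presD[OF p]
 have ka: "kappa_at G m E0 X = q X ` {x : cM E X. MAr E (inc m X) x : N (m**X)}" if X: "X : St" and m: "m : M" for X m
 proof -
  have "MAr E0 (inc m X) (q X x) = \<zero>\<^bsub>MOb E0 (m**X)\<^esub> \<longleftrightarrow> MAr E (inc m X) x : N (m**X)" if x: "x : cM E X" for x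
   using pd(5)[OF inc_hm[OF m X] x] pd(4)[OF M_St[OF m X] e(5)[OF inc_hm[OF m X] x]] by simp
  then show ?thesis by (auto simp: kappa_at_def i_trans_def tau_simps pd(3)[OF X])
 qed
 have "kappa G u z E0 X = cM E0 X \<longleftrightarrow> cM E X <= stab E N X" if X: "X : St" for X
 proof -
  interpret A: abelian_group "MOb E X" by (rule e(2)[OF X])
  interpret A0: abelian_group "MOb E0 X" by (rule pd(1)[OF X])
  note a = addmapD[OF pd(2)[OF X] e(2)[OF X] pd(1)[OF X]]
  note st = asubD[OF subfD(1)[OF stab_subf[OF E N] X]]
  have U: "(\<Union>m\<in>M. kappa_at G m E0 X) = q X ` stab E N X" using ka[OF X] by (auto simp: stab_def)
  have "subgroup (q X ` stab E N X) (add_monoid (MOb E0 X))"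
  proof (rule group.subgroupI[OF A0.a_group])
   show "q X ` stab E N X <= cr (add_monoid (MOb E0 X))" using a(1) st(2) by auto
   show "q X ` stab E N X ~= {}" using st(3) by auto
   fix y assume "y : q X ` stab E N X"
   then obtain v where v: "v : stab E N X" "y = q X v" by auto
   have "\<ominus>\<^bsub>MOb E0 X\<^esub> y = q X (\<ominus>\<^bsub>MOb E X\<^esub> v)" using a(4)[OF st(2)[OF v(1)]] v(2) by simp
   then show "inv\<^bsub>add_monoid (MOb E0 X)\<^esub> y : q X ` stab E N X"
    using st(5)[OF v(1)] unfolding a_inv_def[symmetric] by simp
   fix w assume "w : q X ` stab E N X"
   then obtain x where x: "x : stab E N X" "w = q X x" by auto
   have "y \<oplus>\<^bsub>MOb E0 X\<^esub> w = q X (v \<oplus>\<^bsub>MOb E X\<^esub> x)" using a(2)[OF st(2)[OF v(1)] st(2)[OF x(1)]] v(2) x(2) by simp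
   then show "y \<otimes>\<^bsub>add_monoid (MOb E0 X)\<^esub> w : q X ` stab E N X" using st(4)[OF v(1) x(1)] by simp
  qed
  then have "generate (add_monoid (MOb E0 X)) (q X ` stab E N X) = q X ` stab E N X"
   using A0.add.generateI[of "q X ` stab E N X" "q X ` stab E N X"] by auto
  then have "kappa G u z E0 X = q X ` stab E N X" by (simp add: kappa_def U)
  moreover have "cM E X <= stab E N X" if c: "q X ` stab E N X = q X ` cM E X"
  proof
   fix x assume x: "x : cM E X"
   then obtain y where y: "y : stab E N X" "q X x = q X y" using c by (metis imageE imageI)
   have yc: "y : cM E X" by (rule st(2)[OF y(1)])
   have "q X (x \<ominus>\<^bsub>MOb E X\<^esub> y) = \<zero>\<^bsub>MOb E0 X\<^esub>" using a(5)[OF x yc] y(2) a(1)[OF yc] by (simp add: a_minus_def A0.r_neg)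
   then have d: "x \<ominus>\<^bsub>MOb E X\<^esub> y : N X" using pd(4)[OF X] x yc by simp
   then have "x \<ominus>\<^bsub>MOb E X\<^esub> y : stab E N X"
    using x yc M_unit subfD(2)[OF N inc_hm[OF M_unit X] d] by (auto simp: stab_def)
   then have "(x \<ominus>\<^bsub>MOb E X\<^esub> y) \<oplus>\<^bsub>MOb E X\<^esub> y : stab E N X" using y(1) st(4) by blast
   then show "x : stab E N X" using x yc by (simp add: a_minus_def A.a_assoc A.l_neg)
  qed
  moreover have "stab E N X <= cM E X" by (auto simp: stab_def)
  ultimately show ?thesis unfolding pd(3)[OF X] by auto
 qed
 then show ?thesis unfolding stab_full by (simp add: stably_zero_def)
qed

lemma pres_kappa_zero:
 assumes E: "module_functor R S E" and p: "pres E N E0 q" and m: "m : M"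
 shows "kappa_zero G u z m E0 \<longleftrightarrow> (ALL X:St. ALL x:cM E X. MAr E (inc m X) x : N (m**X) --> x : N X)"
proof -
 note e = mf[OF E] and pd = presD[OF p]
 have "kappa_at G m E0 X = {\<zero>\<^bsub>MOb E0 X\<^esub>} \<longleftrightarrow> (ALL x:cM E X. MAr E (inc m X) x : N (m**X) --> x : N X)"
  if X: "X : St" for X
 proof -
  interpret A: abelian_group "MOb E X" by (rule e(2)[OF X])
  note a = addmapD[OF pd(2)[OF X] e(2)[OF X] pd(1)[OF X]]
  note a' = addmapD[OF pd(2) e(2) pd(1), OF M_St[OF m X] M_St[OF m X] M_St[OF m X]]
  have i: "MAr E0 (inc m X) (q X x) = \<zero>\<^bsub>MOb E0 (m**X)\<^esub> \<longleftrightarrow> MAr E (inc m X) x : N (m**X)" if x: "x : cM E X" for x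
   using pd(5)[OF inc_hm[OF m X] x] pd(4)[OF M_St[OF m X] e(5)[OF inc_hm[OF m X] x]] by simp
  have "MAr E0 (inc m X) \<zero>\<^bsub>MOb E0 X\<^esub> = \<zero>\<^bsub>MOb E0 (m**X)\<^esub>"
   using pd(5)[OF inc_hm[OF m X] A.zero_closed] a(3) a'(3) e(9)[OF inc_hm[OF m X]] by simp
  then have "\<zero>\<^bsub>MOb E0 X\<^esub> : kappa_at G m E0 X"
   using a(1)[OF A.zero_closed] a(3) by (simp add: kappa_at_def i_trans_def tau_simps)
  then have "kappa_at G m E0 X = {\<zero>\<^bsub>MOb E0 X\<^esub>} \<longleftrightarrow> (ALL y:kappa_at G m E0 X. y = \<zero>\<^bsub>MOb E0 X\<^esub>)" by auto
  then show ?thesis using i pd(4)[OF X] by (auto simp: kappa_at_def i_trans_def tau_simps pd(3)[OF X])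
 qed
 then show ?thesis by (simp add: kappa_zero_def)
qed

theorem pres_pol:
 assumes "module_functor R S E" "subf E N" "pres E N E0 q"
 shows "strong_pol G u z (int n - 1) E0 \<longleftrightarrow> pol False False n E N"
  "very_strong_pol G u z (int n - 1) E0 \<longleftrightarrow> pol True False n E N"
  "weak_pol G u z (int n - 1) E0 \<longleftrightarrow> pol False True n E N"
proof -
 have "(strong_pol G u z (int n - 1) E0 \<longleftrightarrow> pol False False n E N) &
  (very_strong_pol G u z (int n - 1) E0 \<longleftrightarrow> pol True False n E N) &
  (weak_pol G u z (int n - 1) E0 \<longleftrightarrow> pol False True n E N)"
  using assms
 proof (induction n arbitrary: E N E0 q)
  case 0
  show ?case
   using pres_zero[OF 0(1,3)] pres_stably_zero[OF 0(1-3)]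
   by (simp add: strong_pol.simps[of G u z "-1"] very_strong_pol.simps[of G u z "-1"] weak_pol.simps[of G u z "-1"] del: pol.simps)
 next
  case (Suc n)
  have IH: "(strong_pol G u z (int n - 1) (delta G m E0) \<longleftrightarrow> pol False False n (tau G m E) (dsub m E N)) &
   (very_strong_pol G u z (int n - 1) (delta G m E0) \<longleftrightarrow> pol True False n (tau G m E) (dsub m E N)) &
   (weak_pol G u z (int n - 1) (delta G m E0) \<longleftrightarrow> pol False True n (tau G m E) (dsub m E N))" if m: "m : M" for m
   by (rule Suc.IH[OF tau_mf[OF Suc.prems(1) m] dsub_subf[OF Suc.prems(1,2) m] pres_delta[OF Suc.prems(1,2) m Suc.prems(3)]])
  have s: "strong_pol G u z (int n) E0 \<longleftrightarrow> pol False False (Suc n) E N"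
   using IH by (simp add: strong_pol.simps[of G u z "int n"])
  have "very_strong_pol G u z (int n) E0 \<longleftrightarrow> strong_pol G u z (int n) E0 & pol True False (Suc n) E N"
   using IH pres_kappa_zero[OF Suc.prems(1,3)] by (simp add: very_strong_pol.simps[of G u z "int n"])
  then have "very_strong_pol G u z (int n) E0 \<longleftrightarrow> pol True False (Suc n) E N"
   using s pol_very_strong by blast
  moreover have "weak_pol G u z (int n) E0 \<longleftrightarrow> pol False True (Suc n) E N"
   using IH by (simp add: weak_pol.simps[of G u z "int n"])
  ultimately show ?case using s by simp
 qed
 then show "strong_pol G u z (int n - 1) E0 \<longleftrightarrow> pol False False n E N"
  "very_strong_pol G u z (int n - 1) E0 \<longleftrightarrow> pol True False n E N"
  "weak_pol G u z (int n - 1) E0 \<longleftrightarrow> pol False True n E N" by auto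
qed

definition zsub where "zsub E X = {\<zero>\<^bsub>MOb E X\<^esub>}"

lemma zsub_subf: "module_functor R S E ==> subf E (zsub E)"
 unfolding subf_def
proof (intro conjI ballI allI)
 assume E: "module_functor R S E"
 fix X assume X: "X : St"
 interpret abelian_group "MOb E X" by (rule mf(2)[OF E X])
 show "asub (MOb E X) (zsub E X)"
  by (simp add: asub_def zsub_def a_inv_zero[OF abelian_group_axioms])
qed (auto simp: zsub_def mf(9))

lemma pres_self: "module_functor R S E ==> pres E (zsub E) E (%X x. x)"
 by (auto simp: pres_def mf(2) addmap_def zsub_def)

end

section \<open>Free decompositions\<close>

lemma coproduct_der_mem:
 assumes cp: "is_coproduct Z B1 B2 i1 i2" and rp: "rep R Z V act" and D: "der R Z V act W D" and N: "asub W N"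
  and K: "K <= cr V" "!!g k. g : cr Z ==> k : K ==> act g k : K"
  and 1: "!!b k. b : cr B1 ==> k : K ==> D (i1 b) k : N"
  and 2: "!!b k. b : cr B2 ==> k : K ==> D (i2 b) k : N"
  and g: "g : cr Z"
 shows "ALL k:K. D g k : N"
proof -
 have i: "i1 b : cr Z" if "b : cr B1" for b using coproduct_hom(1)[OF cp] that by (auto simp: hom_def)
 have i': "i2 b : cr Z" if "b : cr B2" for b using coproduct_hom(2)[OF cp] that by (auto simp: hom_def)
 have c: "k : cr V" if "k : K" for k using K(1) that by auto
 show ?thesis using g
 proof (rule coproduct_induct[OF cp])
  show "ALL k:K. D \<one>\<^bsub>Z\<^esub> k : N" using der_one[OF D rp c] asubD(3)[OF N] by auto
  show "ALL k:K. D (i1 b \<otimes>\<^bsub>Z\<^esub> x) k : N" if "b : cr B1" "x : cr Z" "ALL k:K. D x k : N" for b x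
   using derD(4)[OF D i[OF that(1)] that(2) c] 1[OF that(1) K(2)[OF that(2)]] that(3) asubD(4)[OF N] by auto
  show "ALL k:K. D (i2 b \<otimes>\<^bsub>Z\<^esub> x) k : N" if "b : cr B2" "x : cr Z" "ALL k:K. D x k : N" for b x
   using derD(4)[OF D i'[OF that(1)] that(2) c] 2[OF that(1) K(2)[OF that(2)]] that(3) asubD(4)[OF N] by auto
 qed
qed

lemma coproduct_der_eq:
 assumes cp: "is_coproduct Z B1 B2 i1 i2" and rp: "rep R Z V act" and D: "der R Z V act W D" and D': "der R Z V act W D'"
  and 1: "!!b v. b : cr B1 ==> v : cr V ==> D (i1 b) v = D' (i1 b) v"
  and 2: "!!b v. b : cr B2 ==> v : cr V ==> D (i2 b) v = D' (i2 b) v"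
  and g: "g : cr Z"
 shows "ALL v:cr V. D g v = D' g v"
proof -
 have i: "i1 b : cr Z" if "b : cr B1" for b using coproduct_hom(1)[OF cp] that by (auto simp: hom_def)
 have i': "i2 b : cr Z" if "b : cr B2" for b using coproduct_hom(2)[OF cp] that by (auto simp: hom_def)
 show ?thesis using g
 proof (rule coproduct_induct[OF cp])
  show "ALL k:cr V. D \<one>\<^bsub>Z\<^esub> k = D' \<one>\<^bsub>Z\<^esub> k" using der_one[OF D rp] der_one[OF D' rp] by auto
  show "ALL k:cr V. D (i1 b \<otimes>\<^bsub>Z\<^esub> x) k = D' (i1 b \<otimes>\<^bsub>Z\<^esub> x) k"
   if "b : cr B1" "x : cr Z" "ALL k:cr V. D x k = D' x k" for b x
   using derD(4)[OF D i[OF that(1)] that(2)] derD(4)[OF D' i[OF that(1)] that(2)] 1[OF that(1) repD(4)[OF rp that(2)]] that(3) by auto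
  show "ALL k:cr V. D (i2 b \<otimes>\<^bsub>Z\<^esub> x) k = D' (i2 b \<otimes>\<^bsub>Z\<^esub> x) k"
   if "b : cr B2" "x : cr Z" "ALL k:cr V. D x k = D' x k" for b x
   using derD(4)[OF D i'[OF that(1)] that(2)] derD(4)[OF D' i'[OF that(1)] that(2)] 2[OF that(1) repD(4)[OF rp that(2)]] that(3) by auto
 qed
qed

lemma der_zero: "rep R B V act ==> module R W ==> der R B V act W (%g v. \<zero>\<^bsub>W\<^esub>)"
proof -
 assume a: "rep R B V act" "module R W"
 interpret W: module R W by (rule a(2))
 show ?thesis using mod_hom_zero[OF repD(1)[OF a(1)] a(2)] a(2) by (simp add: der_def)
qed

lemma der_pullback:
 assumes "der R B V act W D" "group C" "f : hom C B" "rep R B V act"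
  "!!c v. c : cr C ==> v : cr V ==> act' c v = act (f c) v"
 shows "der R C V act' W (%c. D (f c))"
 using assms derD(1,2,4)[OF assms(1)] by (auto simp: der_def hom_def Pi_iff)

context reliable_long_moody_system
begin

abbreviation gr where "gr X == GOb A X"
abbreviation (input) cg where "cg X == carrier (GOb A X)"
abbreviation ga where "ga phi == GAr A phi"
abbreviation UP where "UP == unit_products G u z"

sublocale AQ: group_functor Q A by (rule A_functor_quillen)

lemma gr_group: "X : Obj G ==> group (gr X)" using AQ.map_group by simp

lemma ga_hom: "phi : homs Q X Y ==> ga phi : hom (gr X) (gr Y)" by (rule AQ.map_hom)

lemma ga_closed: "phi : homs Q X Y ==> x : cg X ==> ga phi x : cg Y"
 using ga_hom[of phi X Y] by (simp add: hom_def Pi_iff)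

lemma ga_cmp: "phi : homs Q X Y ==> psi : homs Q Y Z ==> x : cg X ==>
  ga (psi $$ phi) x = ga psi (ga phi x)" by (rule AQ.map_cmp)

lemma ga_idn: "X : Obj G ==> x : cg X ==> ga (qid X) x = x"
 using AQ.map_idn[of X x] by simp

lemma UP_obj: "X : UP ==> X : Obj G"
 by (induction rule: unit_products.induct) (simp_all add: u_obj z_obj)

lemma St_UP: "X : St ==> X : UP"
proof -
 have "tensor_power G u n : UP" for n
  by (induction n) (auto simp: tensor_power_def intro: unit_products.intros)
 then show "X : St ==> X : UP" by (auto simp: St_def stage_def intro: unit_products.intros)
qed

lemma emb_iso: "f : Gh X Y ==> ga (emb f) : iso (gr X) (gr Y)"
proof -
 assume f: "f : Gh X Y"
 note i = inv_arrow[OF f] and o = homsD(4,5)[OF f]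
 have 1: "ga (emb (inv_arrow G f)) (ga (emb f) x) = x" if "x : cg X" for x
  using ga_cmp[OF emb_hom[OF f] emb_hom[OF i(1)] that] emb_cmp[OF f i(1)] i(2) ga_idn[OF o(1) that] o
  by (simp add: emb_idn)
 have 2: "ga (emb f) (ga (emb (inv_arrow G f)) y) = y" if "y : cg Y" for y
  using ga_cmp[OF emb_hom[OF i(1)] emb_hom[OF f] that] emb_cmp[OF i(1) f] i(3) ga_idn[OF o(2) that] o
  by (simp add: emb_idn)
 have "bij_betw (ga (emb f)) (cg X) (cg Y)"
  by (rule bij_betwI[of _ _ _ "ga (emb (inv_arrow G f))"])
   (use 1 2 ga_closed[OF emb_hom[OF f]] ga_closed[OF emb_hom[OF i(1)]] in auto)
 then show ?thesis using ga_hom[OF emb_hom[OF f]] by (simp add: iso_def)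
qed

abbreviation j1 where "j1 X Y == ga (whisk X (inc Y (Unit G)))"
abbreviation j2 where "j2 X Y == ga (inc X Y)"

lemma decomposition: "X : UP ==> Y : UP ==> is_coproduct (gr (X**Y)) (gr X) (gr Y) (j1 X Y) (j2 X Y)"
proof -
 assume XY: "X : UP" "Y : UP"
 note o = UP_obj[OF XY(1)] UP_obj[OF XY(2)]
 obtain c where c: "c : iso (free_product UNIV (group_pair (gr X) (gr Y))) (gr (X**Y))"
  "ALL x:cg X. ga (Idn Q X \<boxtimes>\<^bsub>Q\<^esub> iota G Y) x = c (fp_incl UNIV (group_pair (gr X) (gr Y)) False x)"
  "ALL y:cg Y. ga (iota G X \<boxtimes>\<^bsub>Q\<^esub> Idn Q Y) y = c (fp_incl UNIV (group_pair (gr X) (gr Y)) True y)"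
  using A_free_product[OF XY] by blast
 have "(%x. x) : iso (gr X) (gr X)" "(%x. x) : iso (gr Y) (gr Y)"
  using iso_set_refl by blast+
 then show ?thesis unfolding is_coproduct_def
  using c gr_group o iota_inc[OF o(2)]
  by (intro conjI exI[of _ "gr X"] exI[of _ "gr Y"] exI[of _ "%x. x"] exI[of _ c]) simp_all
qed

lemma whisk_emb: "L : Obj G ==> f : Gh X Y ==> whisk L (emb f) = emb (Idn G L##f)"
 using whisk_bracket[of L X "Unit G" f Y] homsD(4)[of f X Y] idn_right[OF whisk_left[of L f X Y]]
 by (simp add: emb_bracket emb_bracket[OF whisk_left] braid_unit inv_idn)

text \<open>Both inclusions are natural in the left object, so a decomposition is transported along
  an isomorphism of left objects. Below, this isomorphism is a braiding that brings \<open>z\<close>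
  to the front.\<close>

lemma decomposition_left:
 assumes d: "is_coproduct (gr (L**Y)) (gr L) (gr Y) (j1 L Y) (j2 L Y)" and f: "f : Gh N L" and Y: "Y : Obj G"
 shows "is_coproduct (gr (N**Y)) (gr N) (gr Y) (j1 N Y) (j2 N Y)"
proof (rule coproduct_iso[OF d])
 note i = inv_arrow[OF f] and o = homsD(4,5)[OF f]
 note fY = whisk_right[OF Y f] and iY = whisk_right[OF Y i(1)]
 show "group (gr (N**Y))" "group (gr N)" "group (gr Y)" using gr_group o Y by simp_all
 show "ga (emb (inv_arrow G f##Idn G Y)) : iso (gr (L**Y)) (gr (N**Y))" by (rule emb_iso[OF iY])
 show "ga (emb f) : iso (gr N) (gr L)" by (rule emb_iso[OF f])
 show "(%x. x) : iso (gr Y) (gr Y)" using iso_set_refl by blast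
 have y1: "inc Y (Unit G) : homs Q (Unit G) Y" using inc_hom[OF Y unit_obj] Y by simp
 show "j1 N Y x = ga (emb (inv_arrow G f##Idn G Y)) (j1 L Y (ga (emb f) x))" if x: "x : cg N" for x
 proof -
  have wM: "whisk L (inc Y (Unit G)) : homs Q L (L**Y)" "whisk N (inc Y (Unit G)) : homs Q N (N**Y)"
   using whisk_hom[OF o(2) y1] whisk_hom[OF o(1) y1] o by simp_all
  have "emb (inv_arrow G f##Idn G Y) $$ whisk L (inc Y (Unit G)) = whisk N (inc Y (Unit G)) $$ emb (inv_arrow G f)"
   using emb_whisk[OF i(1) y1] homsD(1)[OF i(1)] by (simp add: unit_arr_right)
  then have "ga (emb (inv_arrow G f##Idn G Y)) (j1 L Y (ga (emb f) x)) = ga (whisk N (inc Y (Unit G))) (ga (emb (inv_arrow G f)) (ga (emb f) x))"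
   using ga_cmp[OF wM(1) emb_hom[OF iY]] ga_cmp[OF emb_hom[OF i(1)] wM(2)] ga_closed[OF emb_hom[OF f] x] by metis
  also have "ga (emb (inv_arrow G f)) (ga (emb f) x) = x"
   using ga_cmp[OF emb_hom[OF f] emb_hom[OF i(1)] x] emb_cmp[OF f i(1)] i(2) ga_idn[OF o(1) x] o by (simp add: emb_idn)
  finally show ?thesis by simp
 qed
 show "j2 N Y x = ga (emb (inv_arrow G f##Idn G Y)) (j2 L Y x)" if x: "x : cg Y" for x
  using emb_inc[OF i(1) Y] ga_cmp[OF inc_hom[OF o(2) Y] emb_hom[OF iY] x] by simp
qed

lemma decomposition_right:
 assumes d: "is_coproduct (gr (L**Y)) (gr L) (gr Y) (j1 L Y) (j2 L Y)" and f: "f : Gh X Y" and L: "L : Obj G"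
 shows "is_coproduct (gr (L**X)) (gr L) (gr X) (j1 L X) (j2 L X)"
proof (rule coproduct_iso[OF d])
 note i = inv_arrow[OF f] and o = homsD(4,5)[OF f]
 note Mi = whisk_left[OF L i(1)] and ei = emb_hom[OF i(1)]
 show "group (gr (L**X))" "group (gr L)" "group (gr X)" using gr_group o L by simp_all
 show "ga (emb (Idn G L##inv_arrow G f)) : iso (gr (L**Y)) (gr (L**X))" by (rule emb_iso[OF Mi])
 show "ga (emb f) : iso (gr X) (gr Y)" by (rule emb_iso[OF f])
 show "(%x. x) : iso (gr L) (gr L)" using iso_set_refl by blast
 have y1: "inc Y (Unit G) : homs Q (Unit G) Y" using inc_hom[OF o(2) unit_obj] o by simp
 have wM: "whisk L (inc Y (Unit G)) : homs Q L (L**Y)" using whisk_hom[OF L y1] L by simp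
 show "j1 L X x = ga (emb (Idn G L##inv_arrow G f)) (j1 L Y x)" if x: "x : cg L" for x
  using ga_cmp[OF wM emb_hom[OF Mi] x] whisk_cmp[OF L y1 ei] inc_initial[OF ei] whisk_emb[OF L i(1)] by simp
 show "j2 L X x = ga (emb (Idn G L##inv_arrow G f)) (j2 L Y (ga (emb f) x))" if x: "x : cg X" for x
 proof -
  have "ga (emb (Idn G L##inv_arrow G f)) (j2 L Y (ga (emb f) x)) = ga (inc L X) (ga (emb (inv_arrow G f)) (ga (emb f) x))"
   using ga_cmp[OF inc_hom[OF L o(2)] emb_hom[OF Mi]] ga_cmp[OF ei inc_hom[OF L o(1)]] ga_closed[OF emb_hom[OF f] x]
    inc_natural[OF L ei] whisk_emb[OF L i(1)] by simp
  also have "ga (emb (inv_arrow G f)) (ga (emb f) x) = x"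
   using ga_cmp[OF emb_hom[OF f] emb_hom[OF i(1)] x] emb_cmp[OF f i(1)] i(2) ga_idn[OF o(1) x] o by (simp add: emb_idn)
  finally show ?thesis by simp
 qed
qed

text \<open>
 An object \<open>m\<close> of \<open>M\<close> need not be a product of the generating objects, but \<open>m \<natural> z\<close> is, being a stage.
 Since \<open>z \<natural> m\<close> is isomorphic to it, the groups become free products after tensoring with \<open>z\<close>.
\<close>

lemma z_St: "z : St" using St_stage(1)[of 0] stage_0 by simp

lemma z_decomposition:
 assumes m: "m : M" "n : M" and X: "X : St"
 shows "is_coproduct (gr (z**X)) (gr z) (gr X) (j1 z X) (j2 z X)"
  "is_coproduct (gr ((z**m)**X)) (gr (z**m)) (gr X) (j1 (z**m) X) (j2 (z**m) X)"
  "is_coproduct (gr ((z**m)**z**n**X)) (gr (z**m)) (gr (z**n**X)) (j1 (z**m) (z**n**X)) (j2 (z**m) (z**n**X))"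
proof -
 note o = M_obj[OF m(1)] M_obj[OF m(2)] St_obj[OF X] z_obj
 have mz: "m**z : UP" "n**z : UP" using St_UP M_St z_St m by blast+
 show "is_coproduct (gr (z**X)) (gr z) (gr X) (j1 z X) (j2 z X)" by (rule decomposition[OF St_UP[OF z_St] St_UP[OF X]])
 show "is_coproduct (gr ((z**m)**X)) (gr (z**m)) (gr X) (j1 (z**m) X) (j2 (z**m) X)"
  by (rule decomposition_left[OF decomposition[OF mz(1) St_UP[OF X]] braid_hom[OF o(4,1)] o(3)])
 have "(n**z)**X : UP" using mz St_UP[OF X] by (auto intro: unit_products.intros)
 from decomposition_left[OF decomposition[OF mz(1) this] braid_hom[OF o(4,1)]]
 have d: "is_coproduct (gr ((z**m)**(n**z)**X)) (gr (z**m)) (gr ((n**z)**X)) (j1 (z**m) ((n**z)**X)) (j2 (z**m) ((n**z)**X))"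
  using o by simp
 have "Brd G z n##Idn G X : Gh (z**n**X) ((n**z)**X)" using whisk_right[OF o(3) braid_hom[OF o(4,2)]] o by simp
 from decomposition_right[OF d this] show
  "is_coproduct (gr ((z**m)**z**n**X)) (gr (z**m)) (gr (z**n**X)) (j1 (z**m) (z**n**X)) (j2 (z**m) (z**n**X))"
  using o by simp
qed

text \<open>Collapses the auxiliary factor \<open>A z\<close>. Statements about
  \<open>z \<natural> Y\<close>, where free products are available, come back to \<open>Y\<close>
  along it.\<close>

definition ret where
 "ret Y = (SOME r. r : hom (gr (z**Y)) (gr Y) & (ALL x:cg z. r (j1 z Y x) = \<one>\<^bsub>gr Y\<^esub>) &
   (ALL y:cg Y. r (j2 z Y y) = y))"

lemma ret:
 assumes Y: "Y : St"
 shows "ret Y : hom (gr (z**Y)) (gr Y)" "x : cg z ==> ret Y (j1 z Y x) = \<one>\<^bsub>gr Y\<^esub>"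
  "y : cg Y ==> ret Y (j2 z Y y) = y" "w : cg (z**Y) ==> ret Y w : cg Y"
proof -
 interpret g: group "gr Y" by (rule gr_group[OF St_obj[OF Y]])
 have "(%_. \<one>\<^bsub>gr Y\<^esub>) : hom (gr z) (gr Y)" "(%y. y) : hom (gr Y) (gr Y)" by (auto simp: hom_def)
 from coproduct_universal[OF z_decomposition(1)[OF M_unit M_unit Y] g.is_group this]
 have "EX r. r : hom (gr (z**Y)) (gr Y) & (ALL x:cg z. r (j1 z Y x) = \<one>\<^bsub>gr Y\<^esub>) &
   (ALL y:cg Y. r (j2 z Y y) = y)" by auto
 from someI_ex[OF this] show "ret Y : hom (gr (z**Y)) (gr Y)" "x : cg z ==> ret Y (j1 z Y x) = \<one>\<^bsub>gr Y\<^esub>"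
  "y : cg Y ==> ret Y (j2 z Y y) = y" by (auto simp: ret_def)
 then show "w : cg (z**Y) ==> ret Y w : cg Y" by (auto simp: hom_def)
qed

end

section \<open>Folding away auxiliary factors and retracting augmentation ideals\<close>

context reliable_long_moody_system
begin

lemma ga_eq:
 assumes "phi : homs Q X Y" "psi : homs Q Y Z" "phi' : homs Q X Y'" "psi' : homs Q Y' Z" "psi $$ phi = psi' $$ phi'"
  "x : cg X"
 shows "ga psi (ga phi x) = ga psi' (ga phi' x)"
 using ga_cmp[OF assms(1,2,6)] ga_cmp[OF assms(3,4,6)] assms(5) by simp

lemma ga_initial: "L : Obj G ==> phi : homs Q X Y ==> x : cg L ==> ga (whisk L phi) (j1 L X x) = j1 L Y x"
proof -
 assume L: "L : Obj G" and p: "phi : homs Q X Y" and x: "x : cg L"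
 have X: "X : Obj G" using AQ.src_obj[of phi] p by (auto simp: homs_def)
 have i: "inc X (Unit G) : homs Q (Unit G) X" using inc_hom[OF X unit_obj] X by simp
 have "whisk L (inc X (Unit G)) : homs Q L (L**X)" using whisk_hom[OF L i] L by simp
 from ga_cmp[OF this whisk_hom[OF L p] x] show ?thesis using whisk_cmp[OF L i p] inc_initial[OF p] by simp
qed

lemma ga_inc:
 assumes "L : Obj G" "phi : homs Q X Y" "x : cg X"
 shows "ga (whisk L phi) (j2 L X x) = j2 L Y (ga phi x)"
proof -
 have o: "X : Obj G" "Y : Obj G" using AQ.src_obj[of phi] AQ.tgt_obj[of phi] assms(2) by (auto simp: homs_def)
 show ?thesis
  by (rule ga_eq[OF inc_hom[OF assms(1) o(1)] whisk_hom[OF assms(1,2)] assms(2) inc_hom[OF assms(1) o(2)] _ assms(3)])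
   (simp add: inc_natural[OF assms(1,2)])
qed

lemma ret_natural:
 assumes p: "phi : hm X Y" and y: "y : cg (z**X)"
 shows "ret Y (ga (whisk z phi) y) = ga phi (ret X y)"
proof -
 note h = hmD(1)[OF p] and X = hmD(2)[OF p] and Y = hmD(3)[OF p]
 note w = whisk_hom[OF z_obj h]
 interpret f: group_hom "gr X" "gr Y" "ga phi"
  using gr_group[OF St_obj[OF X]] gr_group[OF St_obj[OF Y]] ga_hom[OF h] by (simp add: group_hom_def group_hom_axioms_def)
 show ?thesis
 proof (rule coproduct_hom_eq[OF z_decomposition(1)[OF M_unit M_unit X] gr_group[OF St_obj[OF Y]] _ _ _ _ y])
  show "(%y. ret Y (ga (whisk z phi) y)) : hom (gr (z**X)) (gr Y)"
   using hom_compose[OF ga_hom[OF w] ret(1)[OF Y]] by (simp add: comp_def)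
  show "(%y. ga phi (ret X y)) : hom (gr (z**X)) (gr Y)"
   using hom_compose[OF ret(1)[OF X] ga_hom[OF h]] by (simp add: comp_def)
  show "ret Y (ga (whisk z phi) (j1 z X b)) = ga phi (ret X (j1 z X b))" if "b : cg z" for b
   using ga_initial[OF z_obj h that] ret(2)[OF X that] ret(2)[OF Y that] f.hom_one by simp
  show "ret Y (ga (whisk z phi) (j2 z X b)) = ga phi (ret X (j2 z X b))" if "b : cg X" for b
   using ga_inc[OF z_obj h that] ret(3)[OF X that] ret(3)[OF Y ga_closed[OF h that]] by simp
 qed
qed

context
 fixes m n X
 assumes m: "m : M" and n: "n : M" and X: "X : St"
begin

lemmas obj = M_obj[OF m] M_obj[OF n] St_obj[OF X] z_obj

lemma sts: "n**X : St" "m**X : St" "m**n**X : St" using m n X by simp_all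

lemma zo: "z**m : Obj G" "z**n : Obj G" "n**X : Obj G" "z**n**X : Obj G" "m**X : Obj G" "m**n**X : Obj G"
 using obj by simp_all

text \<open>Inserts one copy of \<open>z\<close> in front of \<open>m\<close> and another in front
  of \<open>n\<close>. The target is then a free product of the groups of
  \<open>z \<natural> m\<close> and \<open>z \<natural> n \<natural> X\<close>, and the latter
  splits again.\<close>

abbreviation alpha where "alpha == %x. ga (whisk (z**m) (inc z (n**X))) (ga (inc z (m**n**X)) x)"

lemma arrows:
 "inc n X : homs Q X (n**X)" "whisk m (inc n X) : homs Q (m**X) (m**n**X)"
 "inc z (n**X) : homs Q (n**X) (z**n**X)" "inc m X : homs Q X (m**X)" "inc m (n**X) : homs Q (n**X) (m**n**X)"
 "inc z (m**X) : homs Q (m**X) (z**m**X)" "inc z (m**n**X) : homs Q (m**n**X) (z**m**n**X)"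
 "inc (z**n) X : homs Q X (z**n**X)" "inc (z**m) X : homs Q X (z**m**X)"
 "whisk (z**m) (inc z (n**X)) : homs Q (z**m**n**X) (z**m**z**n**X)"
 "whisk (z**m) (inc (z**n) X) : homs Q (z**m**X) (z**m**z**n**X)"
 "whisk (z**m) (inc n X) : homs Q (z**m**X) (z**m**n**X)"
 "whisk z (whisk m (inc n X)) : homs Q (z**m**X) (z**m**n**X)"
 "inc (z**m) (n**X) : homs Q (n**X) (z**m**n**X)"
 "inc (z**m) (z**n**X) : homs Q (z**n**X) (z**m**z**n**X)"
proof -
 note w = whisk_hom[OF zo(1)]
 show 1: "inc n X : homs Q X (n**X)" by (rule inc_hom[OF obj(2,3)])
 show 2: "whisk m (inc n X) : homs Q (m**X) (m**n**X)" by (rule whisk_hom[OF obj(1) 1])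
 show 3: "inc z (n**X) : homs Q (n**X) (z**n**X)" by (rule inc_hom[OF obj(4) zo(3)])
 show "inc m X : homs Q X (m**X)" by (rule inc_hom[OF obj(1,3)])
 show "inc m (n**X) : homs Q (n**X) (m**n**X)" by (rule inc_hom[OF obj(1) zo(3)])
 show "inc z (m**X) : homs Q (m**X) (z**m**X)" by (rule inc_hom[OF obj(4) zo(5)])
 show "inc z (m**n**X) : homs Q (m**n**X) (z**m**n**X)" by (rule inc_hom[OF obj(4) zo(6)])
 show 4: "inc (z**n) X : homs Q X (z**n**X)" using inc_hom[OF zo(2) obj(3)] obj by simp
 show "inc (z**m) X : homs Q X (z**m**X)" using inc_hom[OF zo(1) obj(3)] obj by simp
 show "whisk (z**m) (inc z (n**X)) : homs Q (z**m**n**X) (z**m**z**n**X)"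
  using w[OF 3] obj by simp
 show "whisk (z**m) (inc (z**n) X) : homs Q (z**m**X) (z**m**z**n**X)"
  using w[OF 4] obj by simp
 show "whisk (z**m) (inc n X) : homs Q (z**m**X) (z**m**n**X)" using w[OF 1] obj by simp
 show "whisk z (whisk m (inc n X)) : homs Q (z**m**X) (z**m**n**X)" by (rule whisk_hom[OF obj(4) 2])
 show "inc (z**m) (n**X) : homs Q (n**X) (z**m**n**X)" using inc_hom[OF zo(1,3)] obj by simp
 show "inc (z**m) (z**n**X) : homs Q (z**n**X) (z**m**z**n**X)" using inc_hom[OF zo(1,4)] obj by simp
qed

lemma inc_cmps:
 "x : cg X ==> ga (inc z (n**X)) (ga (inc n X) x) = ga (inc (z**n) X) x"
 "x : cg X ==> ga (inc z (m**X)) (ga (inc m X) x) = ga (inc (z**m) X) x"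
 "y : cg (n**X) ==> ga (inc z (m**n**X)) (ga (inc m (n**X)) y) = ga (inc (z**m) (n**X)) y"
 using ga_cmp[OF arrows(1,3)] ga_cmp[OF arrows(4,6)] ga_cmp[OF arrows(5,7)]
  inc_inc[OF obj(2,4,3)] inc_inc[OF obj(1,4,3)] inc_inc[OF obj(1,4) zo(3)] by simp_all

text \<open>\<open>r1\<close> removes the inner \<open>z\<close>: it is defined on the two free
  factors, using \<open>ret\<close> on the second one. The outer \<open>z\<close> is then removed by
  \<open>ret\<close>. The values on the subgroups are identified by comparing homomorphisms on free
  factors.\<close>

lemma fold_retraction:
 obtains r where "r : hom (gr ((z**m)**z**n**X)) (gr (m**n**X))"
  "!!x. x : cg (m**n**X) ==> r (alpha x) = x"
  "!!y. y : cg (z**m**X) ==> r (ga (whisk (z**m) (inc (z**n) X)) y) = ga (whisk m (inc n X)) (ret (m**X) y)"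
  "!!c. c : cg (z**n**X) ==> r (j2 (z**m) (z**n**X) c) = ga (inc m (n**X)) (ret (n**X) c)"
proof -
 note dZ = z_decomposition(3)[OF m n X] and dP = z_decomposition(2)[OF m n sts(1)] and dX = z_decomposition(2)[OF m n X]
 have oP: "z**m**n**X : Obj G" using obj by simp
 note gP = gr_group[OF oP]
 note jP = coproduct_hom[OF dP] note jX = coproduct_hom[OF dX] note jZ = coproduct_hom[OF dZ]
 have jPc: "j1 (z**m) (n**X) : hom (gr (z**m)) (gr (z**m**n**X))" "j2 (z**m) (n**X) : hom (gr (n**X)) (gr (z**m**n**X))"
  using jP obj by simp_all
 obtain r1 where r1: "r1 : hom (gr ((z**m)**z**n**X)) (gr (z**m**n**X))"
  "ALL a:cg (z**m). r1 (j1 (z**m) (z**n**X) a) = j1 (z**m) (n**X) a"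
  "ALL c:cg (z**n**X). r1 (j2 (z**m) (z**n**X) c) = j2 (z**m) (n**X) (ret (n**X) c)"
  using coproduct_universal[OF dZ gP jPc(1) hom_compose[OF ret(1)[OF sts(1)] jPc(2), unfolded comp_def]] by auto
 have r1h: "r1 : hom (gr (z**m**z**n**X)) (gr (z**m**n**X))" using r1(1) obj by simp
 have 1: "r1 (ga (whisk (z**m) (inc z (n**X))) y) = y" if y: "y : cg (z**m**n**X)" for y
 proof (rule coproduct_hom_eq[OF dP gP, where f = "%y. r1 (ga (whisk (z**m) (inc z (n**X))) y)" and g = "%y. y"])
  show "y : cg ((z**m)**n**X)" using y obj by simp
  show "(%y. y) : hom (gr ((z**m)**n**X)) (gr (z**m**n**X))" using obj by (simp add: hom_def)
  show "(%y. r1 (ga (whisk (z**m) (inc z (n**X))) y)) : hom (gr ((z**m)**n**X)) (gr (z**m**n**X))"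
   using hom_compose[OF ga_hom[OF arrows(10)] r1h] obj by (simp add: comp_def)
  show "r1 (ga (whisk (z**m) (inc z (n**X))) (j1 (z**m) (n**X) a)) = j1 (z**m) (n**X) a" if a: "a : cg (z**m)" for a
   using ga_initial[OF zo(1) arrows(3) a] r1(2) a by simp
  show "r1 (ga (whisk (z**m) (inc z (n**X))) (j2 (z**m) (n**X) b)) = j2 (z**m) (n**X) b" if b: "b : cg (n**X)" for b
   using ga_inc[OF zo(1) arrows(3) b] r1(3) ga_closed[OF arrows(3) b] ret(3)[OF sts(1) b] by simp
 qed
 have 2: "r1 (ga (whisk (z**m) (inc (z**n) X)) y) = ga (whisk (z**m) (inc n X)) y" if y: "y : cg (z**m**X)" for y
 proof (rule coproduct_hom_eq[OF dX gP, where f = "%y. r1 (ga (whisk (z**m) (inc (z**n) X)) y)" and g = "ga (whisk (z**m) (inc n X))"])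
  show "y : cg ((z**m)**X)" using y obj by simp
  show "ga (whisk (z**m) (inc n X)) : hom (gr ((z**m)**X)) (gr (z**m**n**X))" using ga_hom[OF arrows(12)] obj by simp
  show "(%y. r1 (ga (whisk (z**m) (inc (z**n) X)) y)) : hom (gr ((z**m)**X)) (gr (z**m**n**X))"
   using hom_compose[OF ga_hom[OF arrows(11)] r1h] obj by (simp add: comp_def)
  show "r1 (ga (whisk (z**m) (inc (z**n) X)) (j1 (z**m) X a)) = ga (whisk (z**m) (inc n X)) (j1 (z**m) X a)" if a: "a : cg (z**m)" for a
   using ga_initial[OF zo(1) arrows(8) a] ga_initial[OF zo(1) arrows(1) a] r1(2) a by simp
  show "r1 (ga (whisk (z**m) (inc (z**n) X)) (j2 (z**m) X b)) = ga (whisk (z**m) (inc n X)) (j2 (z**m) X b)" if b: "b : cg X" for b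
   using ga_inc[OF zo(1) arrows(8) b] ga_inc[OF zo(1) arrows(1) b] r1(3) ga_closed[OF arrows(8) b] inc_cmps(1)[OF b]
    ret(3)[OF sts(1) ga_closed[OF arrows(1) b]] by simp
 qed
 show thesis
 proof (rule that[of "%c. ret (m**n**X) (r1 c)"])
  show "(%c. ret (m**n**X) (r1 c)) : hom (gr ((z**m)**z**n**X)) (gr (m**n**X))"
   using hom_compose[OF r1(1) ret(1)[OF sts(3)]] by (simp add: comp_def)
  show "ret (m**n**X) (r1 (alpha x)) = x" if x: "x : cg (m**n**X)" for x
   using 1[OF ga_closed[OF arrows(7) x]] ret(3)[OF sts(3) x] by simp
  show "ret (m**n**X) (r1 (ga (whisk (z**m) (inc (z**n) X)) y)) = ga (whisk m (inc n X)) (ret (m**X) y)"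
   if y: "y : cg (z**m**X)" for y
  proof -
   have "whisk m (inc n X) : hm (m**X) (m**n**X)" using arrows(2) sts by (simp add: hm_iff)
   from ret_natural[OF this y] show ?thesis using 2[OF y] whisk_whisk[OF obj(4,1) arrows(1)] by simp
  qed
  show "ret (m**n**X) (r1 (j2 (z**m) (z**n**X) c)) = ga (inc m (n**X)) (ret (n**X) c)"
   if c: "c : cg (z**n**X)" for c
   using r1(3) c inc_cmps(3)[OF ret(4)[OF sts(1) c]] ret(3)[OF sts(3) ga_closed[OF arrows(5) ret(4)[OF sts(1) c]]] by simp
 qed
qed

lemma alpha_whisk: "x : cg (m**X) ==>
  alpha (ga (whisk m (inc n X)) x) = ga (whisk (z**m) (inc (z**n) X)) (ga (inc z (m**X)) x)"
proof -
 assume x: "x : cg (m**X)"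
 have "ga (inc z (m**n**X)) (ga (whisk m (inc n X)) x) = ga (whisk (z**m) (inc n X)) (ga (inc z (m**X)) x)"
  using ga_inc[OF obj(4) arrows(2) x] whisk_whisk[OF obj(4,1) arrows(1)] by simp
 moreover have "whisk (z**m) (inc z (n**X)) $$ whisk (z**m) (inc n X) = whisk (z**m) (inc (z**n) X)"
  using whisk_cmp[OF zo(1) arrows(1,3)] inc_inc[OF obj(2,4,3)] by simp
 ultimately show ?thesis using ga_cmp[OF arrows(12,10) ga_closed[OF arrows(6) x]] by simp
qed

lemma alpha_inc: "x : cg (n**X) ==>
  alpha (ga (inc m (n**X)) x) = j2 (z**m) (z**n**X) (ga (inc z (n**X)) x)"
 using inc_cmps(3) ga_inc[OF zo(1) arrows(3)] by simp

lemma alpha_hom: "alpha : hom (gr (m**n**X)) (gr ((z**m)**z**n**X))"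
 using hom_compose[OF ga_hom[OF arrows(7)] ga_hom[OF arrows(10)]] obj by (simp add: comp_def)

definition is_fold where
 "is_fold r \<longleftrightarrow> r : hom (gr ((z**m)**z**n**X)) (gr (m**n**X)) &
   (ALL x:cg (m**n**X). r (alpha x) = x) &
   (ALL y:cg (z**m**X). r (ga (whisk (z**m) (inc (z**n) X)) y) = ga (whisk m (inc n X)) (ret (m**X) y)) &
   (ALL c:cg (z**n**X). r (j2 (z**m) (z**n**X) c) = ga (inc m (n**X)) (ret (n**X) c))"

text \<open>One folding map is fixed for all coefficient modules. Naturality of the retraction in
  \<open>V\<close> compares derivations that are twisted by the same folding.\<close>

definition fold where "fold = (SOME r. is_fold r)"

lemma fold:
 "fold : hom (gr ((z**m)**z**n**X)) (gr (m**n**X))"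
 "x : cg (m**n**X) ==> fold (alpha x) = x"
 "y : cg (z**m**X) ==> fold (ga (whisk (z**m) (inc (z**n) X)) y) = ga (whisk m (inc n X)) (ret (m**X) y)"
 "c : cg (z**n**X) ==> fold (j2 (z**m) (z**n**X) c) = ga (inc m (n**X)) (ret (n**X) c)"
proof -
 have "EX r. is_fold r" unfolding is_fold_def by (rule fold_retraction) blast
 then have "is_fold fold" unfolding fold_def by (rule someI_ex)
 then show "fold : hom (gr ((z**m)**z**n**X)) (gr (m**n**X))"
  "x : cg (m**n**X) ==> fold (alpha x) = x"
  "y : cg (z**m**X) ==> fold (ga (whisk (z**m) (inc (z**n) X)) y) = ga (whisk m (inc n X)) (ret (m**X) y)"
  "c : cg (z**n**X) ==> fold (j2 (z**m) (z**n**X) c) = ga (inc m (n**X)) (ret (n**X) c)"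
  unfolding is_fold_def by blast+
qed

text \<open>The linear map \<open>rho\<close> alone does not tell where it came from. Recording a
  derivation on the big group with known values on the free factors makes it possible to compare
  such maps for different \<open>V\<close>.\<close>

definition is_rho where
 "is_rho R V act rho \<longleftrightarrow> (EX D. let T1 = tens R (gr (m**X)) V (%b. act (ga (whisk m (inc n X)) b)) in
   der R (gr ((z**m)**z**n**X)) V (%c. act (fold c)) T1 D &
   (ALL y:cg (z**m**X). ALL v:cr V. D (ga (whisk (z**m) (inc (z**n) X)) y) v =
    br R (gr (m**X)) V (%b. act (ga (whisk m (inc n X)) b)) (ret (m**X) y) v) &
   (ALL a:cg (z**n). ALL v:cr V. D (j2 (z**m) (z**n**X) (j1 (z**n) X a)) v = \<zero>\<^bsub>T1\<^esub>) &
   (ALL g:cg (m**n**X). ALL v:cr V. rho (br R (gr (m**n**X)) V act g v) = D (alpha g) v))"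

text \<open>If \<open>m\<close>, \<open>n\<close> and \<open>X\<close> were products of generators,
  the group of \<open>m \<natural> n \<natural> X\<close> would be a free product of three groups,
  and \<open>rho\<close> would come from the derivation that is \<open>(g - 1) \<otimes> v\<close>
  on \<open>A m\<close> and \<open>A X\<close> and zero on \<open>A n\<close>. That derivation is
  formed on the larger group with the copies of \<open>z\<close>, which acts through
  \<open>fold\<close>, and is then restricted along \<open>alpha\<close>.\<close>

lemma rho:
 assumes rp: "rep R (gr (m**n**X)) V act"
 defines "act1 == %b. act (ga (whisk m (inc n X)) b)"
 defines "T == tens R (gr (m**n**X)) V act" and "T1 == tens R (gr (m**X)) V act1"
  and "b == br R (gr (m**n**X)) V act" and "b1 == br R (gr (m**X)) V act1"
 shows "EX rho:mod_hom R T T1.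
   (ALL x:cg (m**X). ALL v:cr V. rho (b (ga (whisk m (inc n X)) x) v) = b1 x v) &
   (ALL x:cg (n**X). ALL v:cr V. rho (b (ga (inc m (n**X)) x) v) : 
    aspan T1 {b1 (ga (inc m X) c) w | c w. c : cg X & w : cr V}) &
   (ALL K. K <= cr V & (ALL g:cg (m**n**X). ALL k:K. act g k : K) -->
    (ALL g:cg (m**n**X). ALL k:K. rho (b g k) : aspan T1 {b1 x w | x w. x : cg (m**X) & w : K})) &
   is_rho R V act rho"
  and "g : cg (m**n**X) ==> v : cr V ==> b g v : aspan T
   ({b (ga (whisk m (inc n X)) x) w | x w. x : cg (m**X) & w : cr V} \<union>
    {b (ga (inc m (n**X)) x) w | x w. x : cg (n**X) & w : cr V})"
proof -
 let ?P = "gr (m**n**X)" and ?Z = "gr ((z**m)**z**n**X)" and ?e = "%y. ga (whisk (z**m) (inc (z**n) X)) y"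
 note r = fold
 have oZ: "(z**m)**z**n**X : Obj G" "(z**m)**X : Obj G" "z**m**X : Obj G" "(z**n)**X : Obj G" using obj by simp_all
 note gZ = gr_group[OF oZ(1)] and gmX = gr_group[OF zo(5)] and gzmX = gr_group[OF oZ(2)] and gP = gr_group[OF zo(6)]
  and gznX = gr_group[OF zo(4)] and gzm = gr_group[OF zo(1)] and gX = gr_group[OF obj(3)]
 have eh: "?e : hom (gr (z**m**X)) ?Z" using ga_hom[OF arrows(11)] obj by simp
 note dZ = z_decomposition(3)[OF m n X] and dm = z_decomposition(2)[OF m n X] and dn = z_decomposition(2)[OF n m X]
 note jm = coproduct_hom[OF dm] and jn = coproduct_hom[OF dn] and jZ = coproduct_hom[OF dZ]
 have jmc: "j1 (z**m) X a : cg (z**m**X)" if "a : cg (z**m)" for a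
  using jm(1) that obj by (auto simp: hom_def)
 have jmc2: "j2 (z**m) X a : cg (z**m**X)" if "a : cg X" for a
  using jm(2) that obj by (auto simp: hom_def)
 have jnc: "j2 (z**n) X a : cg (z**n**X)" if "a : cg X" for a
  using jn(2) that obj by (auto simp: hom_def)
 have e1: "?e (j1 (z**m) X a) = j1 (z**m) (z**n**X) a" if "a : cg (z**m)" for a
  by (rule ga_initial[OF zo(1) arrows(8) that])
 have e2: "?e (j2 (z**m) X a) = j2 (z**m) (z**n**X) (j2 (z**n) X a)" if "a : cg X" for a
  by (rule ga_inc[OF zo(1) arrows(8) that])
 define actZ where "actZ c = act (fold c)" for c
 have rZ: "rep R ?Z V actZ" unfolding actZ_def by (rule rep_pullback[OF rp gZ r(1)])
 have rmX: "rep R (gr (m**X)) V act1" unfolding act1_def by (rule rep_pullback[OF rp gmX ga_hom[OF arrows(2)]])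
 interpret t: tensor_ctx R ?P V act by (rule tensor_ctx.intro[OF rp])
 interpret t1: tensor_ctx R "gr (m**X)" V act1 by (rule tensor_ctx.intro[OF rmX])
 note T1 = module_abelian[OF t1.tens_module]
 have b1c: "b1 x v : cr T1" if "x : cg (m**X)" "v : cr V" for x v
  using derD(3)[OF t1.br_der that] by (simp add: b1_def T1_def)
 have bc: "b x v : cr T" if "x : cr ?P" "v : cr V" for x v
  using derD(3)[OF t.br_der that] by (simp add: b_def T_def)
 define D' where "D' c = b1 (ret (m**X) c)" for c
 have D': "der R (gr (z**m**X)) V (%c. actZ (?e c)) T1 D'"
  unfolding D'_def b1_def T1_def
  by (rule der_pullback[OF t1.br_der _ ret(1)[OF sts(2)] rmX])
   (use gzmX obj r(3) in \<open>simp_all add: act1_def actZ_def\<close>)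
 have D'c: "der R (gr (z**m)) V (%a. actZ (j1 (z**m) (z**n**X) a)) T1 (%a. D' (j1 (z**m) X a))"
  by (rule der_pullback[OF D' gzm]) (use jm(1) obj rep_pullback[OF rZ _ eh] gzmX e1 in simp_all)
 have D'x: "der R (gr X) V (%a. actZ (j2 (z**m) (z**n**X) (j2 (z**n) X a))) T1 (%a. D' (j2 (z**m) X a))"
  by (rule der_pullback[OF D' gX]) (use jm(2) obj rep_pullback[OF rZ _ eh] gzmX e2 in simp_all)
 have rznX: "rep R (gr ((z**n)**X)) V (%c. actZ (j2 (z**m) (z**n**X) c))"
  using rep_pullback[OF rZ gznX jZ(2)] obj by simp
 \<comment> \<open>Zero on the group of \<open>z \<natural> n\<close>, the factor to be forgotten.
   On \<open>A X\<close> the value is forced to be that of \<open>D'\<close>, because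
   \<open>A X\<close> also lies in the group of \<open>m \<natural> X\<close>.\<close>
 have "der R (gr (z**n)) V (%a. actZ (j2 (z**m) (z**n**X) (j1 (z**n) X a))) T1 (%_ _. \<zero>\<^bsub>T1\<^esub>)"
  using der_zero[OF rep_pullback[OF rznX gr_group[OF zo(2)] jn(1)], of T1] t1.tens_module by (simp add: T1_def)
 from coproduct_der[OF dn rznX this D'x] obtain d2 where
  d2: "der R (gr ((z**n)**X)) V (%c. actZ (j2 (z**m) (z**n**X) c)) T1 d2"
  "ALL a:cg (z**n). ALL v:cr V. d2 (j1 (z**n) X a) v = \<zero>\<^bsub>T1\<^esub>"
  "ALL a:cg X. ALL v:cr V. d2 (j2 (z**n) X a) v = D' (j2 (z**m) X a) v" by auto
 have d2': "der R (gr (z**n**X)) V (%c. actZ (j2 (z**m) (z**n**X) c)) T1 d2" using d2(1) obj by simp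
 from coproduct_der[OF dZ rZ D'c d2'] obtain D where D: "der R ?Z V actZ T1 D"
  "ALL a:cg (z**m). ALL v:cr V. D (j1 (z**m) (z**n**X) a) v = D' (j1 (z**m) X a) v"
  "ALL c:cg (z**n**X). ALL v:cr V. D (j2 (z**m) (z**n**X) c) v = d2 c v" by auto
 have De: "D (?e y) v = D' y v" if y: "y : cg (z**m**X)" and v: "v : cr V" for y v
 proof -
  have "ALL v:cr V. D (?e y) v = D' y v"
  proof (rule coproduct_der_eq[OF dm, where act = "%c. actZ (?e c)" and W = T1])
   show "rep R (gr ((z**m)**X)) V (%c. actZ (?e c))" using rep_pullback[OF rZ _ eh] gzmX obj by simp
   show "der R (gr ((z**m)**X)) V (%c. actZ (?e c)) T1 (%y. D (?e y))"
    by (rule der_pullback[OF D(1) gzmX _ rZ]) (use eh obj in simp_all)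
   show "der R (gr ((z**m)**X)) V (%c. actZ (?e c)) T1 D'" using D' obj by simp
   show "D (?e (j1 (z**m) X a)) v = D' (j1 (z**m) X a) v" if "a : cg (z**m)" "v : cr V" for a v
    using e1 D(2) that by simp
   show "D (?e (j2 (z**m) X a)) v = D' (j2 (z**m) X a) v" if "a : cg X" "v : cr V" for a v
    using e2[OF that(1)] D(3) d2(3) jnc[OF that(1)] that by simp
   show "y : cg ((z**m)**X)" using y obj by simp
  qed
  then show ?thesis using v by simp
 qed
 \<comment> \<open>Along \<open>alpha\<close> the twisted action becomes the original one again, as
   \<open>fold\<close> undoes \<open>alpha\<close>.\<close>
 have dP: "der R ?P V act T1 (%g. D (alpha g))"
  by (rule der_pullback[OF D(1) gP alpha_hom rZ]) (simp add: actZ_def r(2))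
 from t.tens_universal[OF this] obtain rho where rho: "rho : mod_hom R T T1"
  "ALL h:cr ?P. ALL v:cr V. rho (b h v) = D (alpha h) v" unfolding T_def b_def by auto
 have wc: "ga (whisk m (inc n X)) x : cr ?P" if "x : cg (m**X)" for x by (rule ga_closed[OF arrows(2) that])
 have ic: "ga (inc m (n**X)) x : cr ?P" if "x : cg (n**X)" for x by (rule ga_closed[OF arrows(5) that])
 have D'2: "D' (j2 (z**m) X a) = b1 (ga (inc m X) a)" if "a : cg X" for a
  using inc_cmps(2)[OF that] ret(3)[OF sts(2) ga_closed[OF arrows(4) that]] by (simp add: D'_def)
 have c1: "rho (b (ga (whisk m (inc n X)) x) v) = b1 x v" if x: "x : cg (m**X)" and v: "v : cr V" for x v
  using rho(2) wc[OF x] v alpha_whisk[OF x] De[OF ga_closed[OF arrows(6) x] v] ret(3)[OF sts(2) x] by (simp add: D'_def)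
 let ?S = "{b1 (ga (inc m X) c) w | c w. c : cg X & w : cr V}"
 have Ss: "?S <= cr T1" using b1c ga_closed[OF arrows(4)] by auto
 have N: "asub T1 (aspan T1 ?S)" using aspan_asub[OF T1[folded T1_def] Ss] .
 have c2: "rho (b (ga (inc m (n**X)) x) v) : aspan T1 ?S" if x: "x : cg (n**X)" and v: "v : cr V" for x v
 proof -
  have c: "ga (inc z (n**X)) x : cg (z**n**X)" by (rule ga_closed[OF arrows(3) x])
  have "ALL v:cr V. d2 (ga (inc z (n**X)) x) v : aspan T1 ?S"
  proof (rule coproduct_der_mem[OF dn rznX d2(1) N])
   show "cr V <= cr V" by simp
   show "actZ (j2 (z**m) (z**n**X) g) k : cr V" if "g : cg ((z**n)**X)" "k : cr V" for g k
    by (rule repD(4)[OF rznX that])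
   show "d2 (j1 (z**n) X a) k : aspan T1 ?S" if "a : cg (z**n)" "k : cr V" for a k
    using d2(2) that asubD(3)[OF N] by simp
   show "d2 (j2 (z**n) X a) k : aspan T1 ?S" if "a : cg X" "k : cr V" for a k
    using d2(3) that D'2[OF that(1)] by (auto intro: aspan.intros)
   show "ga (inc z (n**X)) x : cg ((z**n)**X)" using c obj by simp
  qed
  then show ?thesis using rho(2) ic[OF x] v alpha_inc[OF x] D(3) c by simp
 qed
 have c3: "rho (b g k) : aspan T1 {b1 x w | x w. x : cg (m**X) & w : K}"
  if K: "K <= cr V" "ALL g:cr ?P. ALL k:K. act g k : K" and g: "g : cr ?P" and k: "k : K" for K g k
 proof -
  let ?N = "aspan T1 {b1 x w | x w. x : cg (m**X) & w : K}"
  have N: "asub T1 ?N" by (rule aspan_asub[OF T1[folded T1_def]]) (use b1c K(1) in auto)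
  have D'N: "D' y k : ?N" if "y : cg (z**m**X)" "k : K" for y k
   unfolding D'_def using ret(4)[OF sts(2) that(1)] that(2) by (auto intro!: aspan.intros)
  have aK: "actZ c k : K" if "c : cr ?Z" "k : K" for c k
   using K(2) that r(1) by (simp add: actZ_def hom_def Pi_iff)
  have d2N: "ALL k:K. d2 c k : ?N" if c: "c : cg (z**n**X)" for c
  proof (rule coproduct_der_mem[OF dn rznX d2(1) N K(1)])
   show "actZ (j2 (z**m) (z**n**X) g) k : K" if "g : cg ((z**n)**X)" "k : K" for g k
    by (rule aK[OF _ that(2)]) (use jZ(2) that obj in \<open>auto simp: hom_def\<close>)
   show "d2 (j1 (z**n) X a) k : ?N" if "a : cg (z**n)" "k : K" for a k
    using d2(2) that asubD(3)[OF N] K(1) by auto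
   show "d2 (j2 (z**n) X a) k : ?N" if "a : cg X" "k : K" for a k
    using d2(3) that D'N[OF jmc2[OF that(1)] that(2)] K(1) by auto
   show "c : cg ((z**n)**X)" using c obj by simp
  qed
  have "ALL k:K. D (alpha g) k : ?N"
  proof (rule coproduct_der_mem[OF dZ rZ D(1) N K(1) aK])
   show "D (j1 (z**m) (z**n**X) a) k : ?N" if "a : cg (z**m)" "k : K" for a k
    using D(2) that D'N[OF jmc[OF that(1)] that(2)] K(1) by auto
   show "D (j2 (z**m) (z**n**X) c) k : ?N" if "c : cg (z**n**X)" "k : K" for c k
    using D(3) d2N that K(1) by auto
   show "alpha g : cr ?Z" using alpha_hom g by (auto simp: hom_def)
  qed
  then show ?thesis using rho(2) g k K(1) by auto
 qed
 have c4: "is_rho R V act rho"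
  unfolding is_rho_def Let_def
 proof (intro exI[of _ D] conjI ballI)
  show "der R ?Z V (%c. act (fold c)) (tens R (gr (m**X)) V (%b. act (ga (whisk m (inc n X)) b))) D"
   using D(1) by (simp add: actZ_def[abs_def] T1_def act1_def)
  show "D (?e y) v = br R (gr (m**X)) V (%b. act (ga (whisk m (inc n X)) b)) (ret (m**X) y) v"
   if "y : cg (z**m**X)" "v : cr V" for y v
   using De[OF that] by (simp add: D'_def b1_def act1_def)
  show "D (j2 (z**m) (z**n**X) (j1 (z**n) X a)) v = \<zero>\<^bsub>tens R (gr (m**X)) V (%b. act (ga (whisk m (inc n X)) b))\<^esub>"
   if "a : cg (z**n)" "v : cr V" for a v
  proof -
   have "j1 (z**n) X a : cg (z**n**X)" using jn(1) that(1) obj by (auto simp: hom_def)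
   then show ?thesis using D(3) d2(2) that by (simp add: T1_def act1_def)
  qed
  show "rho (br R ?P V act g v) = D (alpha g) v" if "g : cr ?P" "v : cr V" for g v
   using rho(2) that by (simp add: b_def)
 qed
 show "EX rho:mod_hom R T T1.
   (ALL x:cg (m**X). ALL v:cr V. rho (b (ga (whisk m (inc n X)) x) v) = b1 x v) &
   (ALL x:cg (n**X). ALL v:cr V. rho (b (ga (inc m (n**X)) x) v) : aspan T1 ?S) &
   (ALL K. K <= cr V & (ALL g:cr ?P. ALL k:K. act g k : K) -->
    (ALL g:cr ?P. ALL k:K. rho (b g k) : aspan T1 {b1 x w | x w. x : cg (m**X) & w : K})) &
   is_rho R V act rho"
  using rho(1) c1 c2 c3 c4 by (intro bexI[of _ rho] conjI allI ballI impI) simp_all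
 show "b g v : aspan T
   ({b (ga (whisk m (inc n X)) x) w | x w. x : cg (m**X) & w : cr V} \<union>
    {b (ga (inc m (n**X)) x) w | x w. x : cg (n**X) & w : cr V})" (is "_ : aspan T ?A")
  if g: "g : cr ?P" and v: "v : cr V"
 proof -
  have As: "?A <= cr T" using bc wc ic by auto
  have N: "asub T (aspan T ?A)" by (rule aspan_asub[OF _ As]) (use module_abelian[OF t.tens_module] in \<open>simp add: T_def\<close>)
  \<comment> \<open>For generation, \<open>br\<close> is pulled back along \<open>fold\<close> to
    the big group. Its factor for \<open>z \<natural> m\<close> folds into the image of
    \<open>A (m \<natural> X)\<close>, the factor for \<open>z \<natural> n \<natural> X\<close>
    into that of \<open>A (n \<natural> X)\<close>, and the cocycle rule spreads membership from the
    factors.\<close>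
  have d: "der R ?Z V actZ T (%c. b (fold c))" unfolding b_def T_def
   by (rule der_pullback[OF t.br_der gZ r(1) rp]) (simp add: actZ_def)
  have "ALL v:cr V. b (fold (alpha g)) v : aspan T ?A"
  proof (rule coproduct_der_mem[OF dZ rZ d N])
   show "cr V <= cr V" by simp
   show "actZ g k : cr V" if "g : cr ?Z" "k : cr V" for g k
    by (rule repD(4)[OF rZ that])
   show "b (fold (j1 (z**m) (z**n**X) a)) k : aspan T ?A" if "a : cg (z**m)" "k : cr V" for a k
    using e1[OF that(1)] r(3)[OF jmc[OF that(1)]] ret(4)[OF sts(2) jmc[OF that(1)]] that(2) by (auto intro!: aspan.intros)
   show "b (fold (j2 (z**m) (z**n**X) c)) k : aspan T ?A" if "c : cg (z**n**X)" "k : cr V" for c k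
    using r(4)[OF that(1)] ret(4)[OF sts(1) that(1)] that(2) by (auto intro!: aspan.intros)
   show "alpha g : cr ?Z" using alpha_hom g by (auto simp: hom_def)
  qed
  then show ?thesis using r(2)[OF g] v by simp
 qed
qed

text \<open>Both sides are derivations on the big group with values in the second tensor product.
  They agree on the free factors, where \<open>is_rho\<close> prescribes the values, hence
  everywhere and in particular along \<open>alpha\<close>.\<close>

lemma rho_natural:
 assumes rp: "rep R (gr (m**n**X)) V act" and rp': "rep R (gr (m**n**X)) V' act'"
  and rho: "is_rho R V act rho" "is_rho R V' act' rho'"
  and f: "f : mod_hom R V V'" "!!g v. g : cg (m**n**X) ==> v : cr V ==> f (act g v) = act' g (f v)"
  and Phi: "Phi : mod_hom R (tens R (gr (m**X)) V (%b. act (ga (whisk m (inc n X)) b)))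
    (tens R (gr (m**X)) V' (%b. act' (ga (whisk m (inc n X)) b)))"
   "!!x v. x : cg (m**X) ==> v : cr V ==>
    Phi (br R (gr (m**X)) V (%b. act (ga (whisk m (inc n X)) b)) x v) =
    br R (gr (m**X)) V' (%b. act' (ga (whisk m (inc n X)) b)) x (f v)"
  and g: "g : cg (m**n**X)" and v: "v : cr V"
 shows "rho' (br R (gr (m**n**X)) V' act' g (f v)) = Phi (rho (br R (gr (m**n**X)) V act g v))"
proof -
 let ?P = "gr (m**n**X)" and ?Z = "gr ((z**m)**z**n**X)" and ?e = "%y. ga (whisk (z**m) (inc (z**n) X)) y"
 let ?a = "%b. act (ga (whisk m (inc n X)) b)" and ?a' = "%b. act' (ga (whisk m (inc n X)) b)"
 let ?T = "tens R (gr (m**X)) V ?a" and ?T' = "tens R (gr (m**X)) V' ?a'"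
 obtain D where D: "der R ?Z V (%c. act (fold c)) ?T D"
  "ALL y:cg (z**m**X). ALL v:cr V. D (?e y) v = br R (gr (m**X)) V ?a (ret (m**X) y) v"
  "ALL a:cg (z**n). ALL v:cr V. D (j2 (z**m) (z**n**X) (j1 (z**n) X a)) v = \<zero>\<^bsub>?T\<^esub>"
  "ALL g:cr ?P. ALL v:cr V. rho (br R ?P V act g v) = D (alpha g) v"
  using rho(1) unfolding is_rho_def Let_def by auto
 obtain D' where D': "der R ?Z V' (%c. act' (fold c)) ?T' D'"
  "ALL y:cg (z**m**X). ALL v:cr V'. D' (?e y) v = br R (gr (m**X)) V' ?a' (ret (m**X) y) v"
  "ALL a:cg (z**n). ALL v:cr V'. D' (j2 (z**m) (z**n**X) (j1 (z**n) X a)) v = \<zero>\<^bsub>?T'\<^esub>"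
  "ALL g:cr ?P. ALL v:cr V'. rho' (br R ?P V' act' g v) = D' (alpha g) v"
  using rho(2) unfolding is_rho_def Let_def by auto
 have oZ: "(z**m)**z**n**X : Obj G" using obj by simp
 note gZ = gr_group[OF oZ] and gmX = gr_group[OF zo(5)]
 note dZ = z_decomposition(3)[OF m n X] and dm = z_decomposition(2)[OF m n X] and dn = z_decomposition(2)[OF n m X]
 note jm = coproduct_hom[OF dm] and jn = coproduct_hom[OF dn] and jZ = coproduct_hom[OF dZ]
 have jmc: "j1 (z**m) X a : cg (z**m**X)" if "a : cg (z**m)" for a
  using jm(1) that obj by (auto simp: hom_def)
 have jmc2: "j2 (z**m) X a : cg (z**m**X)" if "a : cg X" for a
  using jm(2) that obj by (auto simp: hom_def)
 have e1: "?e (j1 (z**m) X a) = j1 (z**m) (z**n**X) a" if "a : cg (z**m)" for a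
  by (rule ga_initial[OF zo(1) arrows(8) that])
 have e2: "?e (j2 (z**m) X a) = j2 (z**m) (z**n**X) (j2 (z**n) X a)" if "a : cg X" for a
  by (rule ga_inc[OF zo(1) arrows(8) that])
 have r: "rep R ?Z V (%c. act (fold c))" by (rule rep_pullback[OF rp gZ fold(1)])
 note T = derD(1)[OF D(1)] and T' = derD(1)[OF D'(1)]
 note fd = mod_homD[OF f(1)]
 have fc: "fold c : cr ?P" if "c : cr ?Z" for c using fold(1) that by (auto simp: hom_def)
 have 1: "der R ?Z V (%c. act (fold c)) ?T' (%c v. Phi (D c v))"
  unfolding der_def
  using mod_hom_comp[OF derD(2)[OF D(1)] Phi(1)] derD(4)[OF D(1)] T'
   mod_homD(2)[OF Phi(1) derD(3)[OF D(1)] derD(3)[OF D(1)]] repD(4)[OF r] by auto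
 have 2: "der R ?Z V (%c. act (fold c)) ?T' (%c v. D' c (f v))"
  unfolding der_def
  using mod_hom_comp[OF f(1) derD(2)[OF D'(1)]] derD(4)[OF D'(1) _ _ fd(1)] T' f(2)[OF fc] by auto
 have ee: "Phi (D (?e y) v) = D' (?e y) (f v)" if "y : cg (z**m**X)" "v : cr V" for y v
  using D(2) D'(2) that fd(1) Phi(2) ret(4)[OF sts(2) that(1)] by simp
 have jj: "ALL v:cr V. Phi (D (j2 (z**m) (z**n**X) c) v) = D' (j2 (z**m) (z**n**X) c) (f v)"
  if c: "c : cg (z**n**X)" for c
 proof (rule coproduct_der_eq[OF dn, where act = "%c. act (fold (j2 (z**m) (z**n**X) c))" and W = ?T'
   and D = "%c v. Phi (D (j2 (z**m) (z**n**X) c) v)" and D' = "%c v. D' (j2 (z**m) (z**n**X) c) (f v)"])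
  have go: "group (gr ((z**n)**X))" and jh: "j2 (z**m) (z**n**X) : hom (gr ((z**n)**X)) ?Z"
   using gr_group[OF zo(4)] jZ(2) obj by simp_all
  show "rep R (gr ((z**n)**X)) V (%c. act (fold (j2 (z**m) (z**n**X) c)))"
   by (rule rep_pullback[OF r go jh])
  show "der R (gr ((z**n)**X)) V (%c. act (fold (j2 (z**m) (z**n**X) c))) ?T' (%c v. Phi (D (j2 (z**m) (z**n**X) c) v))"
   by (rule der_pullback[OF 1 go jh r]) simp
  show "der R (gr ((z**n)**X)) V (%c. act (fold (j2 (z**m) (z**n**X) c))) ?T' (%c v. D' (j2 (z**m) (z**n**X) c) (f v))"
   by (rule der_pullback[OF 2 go jh r]) simp
  show "Phi (D (j2 (z**m) (z**n**X) (j1 (z**n) X a)) v) = D' (j2 (z**m) (z**n**X) (j1 (z**n) X a)) (f v)"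
   if "a : cg (z**n)" "v : cr V" for a v
   using D(3) D'(3) that fd(1) addmapD(3)[OF mod_hom_addmap[OF Phi(1)] module_abelian[OF T] module_abelian[OF T']] by simp
  show "Phi (D (j2 (z**m) (z**n**X) (j2 (z**n) X a)) v) = D' (j2 (z**m) (z**n**X) (j2 (z**n) X a)) (f v)"
   if "a : cg X" "v : cr V" for a v
   using ee[OF jmc2[OF that(1)] that(2)] e2[OF that(1)] by simp
  show "c : cg ((z**n)**X)" using c obj by simp
 qed
 have "ALL v:cr V. Phi (D (alpha g) v) = D' (alpha g) (f v)"
 proof (rule coproduct_der_eq[OF dZ r 1 2])
  show "Phi (D (j1 (z**m) (z**n**X) a) v) = D' (j1 (z**m) (z**n**X) a) (f v)"
   if "a : cg (z**m)" "v : cr V" for a v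
   using ee[OF jmc[OF that(1)] that(2)] e1[OF that(1)] by simp
  show "Phi (D (j2 (z**m) (z**n**X) c) v) = D' (j2 (z**m) (z**n**X) c) (f v)"
   if "c : cg (z**n**X)" "v : cr V" for c v
   using jj[OF that(1)] that(2) by simp
  show "alpha g : cr ?Z" using alpha_hom g by (auto simp: hom_def)
 qed
 then show ?thesis using D(4) D'(4) g v fd(1) by simp
qed

end

end

section \<open>Free groups and exactness\<close>

locale free_tensor = tensor_ctx R B V act for R :: "'r ring" and B :: "'g monoid" and V :: "('r, 'm) module" and act +
 fixes S assumes fb: "free_basis B S"
begin

abbreviation "b == br R B V act"

lemma S: "S <= cr B" "generate B S = cr B" using fb by (auto simp: free_basis_def)

text \<open>The coordinate at the basis element \<open>s\<close> of the tensor product, viewed as a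
  sum of copies of \<open>V\<close>. As a function of \<open>g\<close>, the element
  \<open>coef s (b g v)\<close> is the Fox derivative of \<open>g\<close> with respect to
  \<open>s\<close>, applied to \<open>v\<close>.\<close>

definition coef where
 "coef s = (SOME f. f : mod_hom R T V & (ALL t:S. ALL v:cr V. f (b t v) = (if t = s then v else \<zero>\<^bsub>V\<^esub>)))"

lemma coef: "coef s : mod_hom R T V" "t : S ==> v : cr V ==> coef s (b t v) = (if t = s then v else \<zero>\<^bsub>V\<^esub>)"
proof -
 have "ALL t:S. (%v. if t = s then v else \<zero>\<^bsub>V\<^esub>) : mod_hom R V V"
  by (auto intro!: mod_homI)
 from free_der[OF fb rp V.module_axioms this] obtain D where D: "der R B V act V D"
  "ALL t:S. ALL v:cr V. D t v = (if t = s then v else \<zero>\<^bsub>V\<^esub>)" by auto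
 from tens_universal[OF D(1)] obtain f where "f : mod_hom R T V" "ALL h:cr B. ALL v:cr V. f (b h v) = D h v" by auto
 then have "f : mod_hom R T V & (ALL t:S. ALL v:cr V. f (b t v) = (if t = s then v else \<zero>\<^bsub>V\<^esub>))"
  using D(2) S(1) by auto
 from someI[where P = "%f. f : mod_hom R T V & (ALL t:S. ALL v:cr V. f (b t v) = (if t = s then v else \<zero>\<^bsub>V\<^esub>))", OF this]
 show "coef s : mod_hom R T V" "t : S ==> v : cr V ==> coef s (b t v) = (if t = s then v else \<zero>\<^bsub>V\<^esub>)"
  by (simp_all add: coef_def)
qed

lemma coef_der: "der R B V act V (%g v. coef s (b g v))"
 unfolding der_def
 using mod_hom_comp[OF derD(2)[OF br_der] coef(1)] derD(4)[OF br_der]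
  mod_homD(2)[OF coef(1) derD(3)[OF br_der] derD(3)[OF br_der]] repD(4)[OF rp] V.module_axioms by auto

lemma b_closed: "g : cr B ==> v : cr V ==> b g v : cr T" by (rule derD(3)[OF br_der])

lemma coef_mem:
 assumes W: "asub V W" "ALL g:cr B. ALL k:W. act g k : W"
  and x: "x : aspan T {b g k | g k. g : cr B & k : W}"
 shows "coef s x : W"
proof (rule addmap_zero_on_aspan[OF mod_hom_addmap[OF coef(1)] module_abelian[OF tens_module] module_abelian[OF V.module_axioms] _ x _ W(1)])
 note KV = asubD(2)[OF W(1)]
 show "{b g k | g k. g : cr B & k : W} <= cr T" using b_closed KV by auto
 fix y assume "y : {b g k | g k. g : cr B & k : W}"
 then obtain g k where gk: "y = b g k" "g : cr B" "k : W" by auto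
 have "ALL k:W. coef s (b g k) : W"
  by (rule der_generate_mem[OF coef_der rp S(1) W(1) asubD(1)[OF W(1)] W(2)])
   (use coef(2) KV asubD(3)[OF W(1)] S(2) gk in auto)
 then show "coef s y : W" using gk by simp
qed

lemma b_basis_span: "x : cr T ==> x : aspan T {b s v | s v. s : S & v : cr V}"
proof (rule aspan_least[OF _ _ tens_span])
 let ?A = "{b s v | s v. s : S & v : cr V}"
 have sub: "?A <= cr T" using b_closed S(1) by auto
 show N: "asub T (aspan T ?A)" by (rule aspan_asub[OF module_abelian[OF tens_module] sub])
 have "ALL v:cr V. b g v : aspan T ?A" if "g : cr B" for g
  by (rule der_generate_mem[OF br_der rp S(1) N _ _ _ that[folded S(2)]]) (use repD(4)[OF rp] in \<open>auto intro: aspan.intros\<close>)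
 then show "{b h v |h v. h : cr B & v : cr V} <= aspan T ?A" by auto
qed

lemma coef_expansion:
 assumes x: "x : cr T"
 obtains J where "finite J" "J <= S" "x = (\<Oplus>\<^bsub>T\<^esub>s\<in>J. b s (coef s x))"
proof -
 let ?L = "%J x. (\<Oplus>\<^bsub>T\<^esub>s\<in>J. b s (coef s x))"
 let ?A = "{b s v | s v. s : S & v : cr V}"
 have sub: "?A <= cr T" using b_closed S(1) by auto
 note aT = module_abelian[OF tens_module]
 have sc: "b s (coef s y) : cr T" if "s : S" "y : cr T" for s y
  using b_closed S(1) that mod_homD(1)[OF coef(1)] by auto
 have L: "addmap T T (?L J)" if "finite J" "J <= S" for J
  unfolding addmap_def
 proof (intro conjI ballI)
  show "?L J : cr T \<rightarrow> cr T" using sc that by (auto intro!: T.M.finsum_closed)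
  fix y w assume yw: "y : cr T" "w : cr T"
  have "?L J (y \<oplus>\<^bsub>T\<^esub> w) = (\<Oplus>\<^bsub>T\<^esub>s\<in>J. b s (coef s y) \<oplus>\<^bsub>T\<^esub> b s (coef s w))"
  proof (rule T.M.finsum_cong')
   fix s assume "s : J"
   then have s: "s : cr B" using that S(1) by auto
   show "b s (coef s (y \<oplus>\<^bsub>T\<^esub> w)) = b s (coef s y) \<oplus>\<^bsub>T\<^esub> b s (coef s w)"
    using mod_homD(2)[OF coef(1) yw] mod_homD(2)[OF derD(2)[OF br_der s] mod_homD(1)[OF coef(1) yw(1)] mod_homD(1)[OF coef(1) yw(2)]]
    by simp
  qed (use sc that yw in auto)
  moreover have "(%s. b s (coef s y)) : J \<rightarrow> cr T" "(%s. b s (coef s w)) : J \<rightarrow> cr T"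
   using sc that yw by auto
  ultimately show "?L J (y \<oplus>\<^bsub>T\<^esub> w) = ?L J y \<oplus>\<^bsub>T\<^esub> ?L J w"
   by (simp only: T.M.finsum_addf)
 qed
 \<comment> \<open>The expansion is claimed for every finite subset of the basis containing
   \<open>J\<close>, so that two elements can be expanded over a common set and the claim passes to
   sums.\<close>
 have "EX J. finite J & J <= S & (ALL J'. finite J' & J <= J' & J' <= S --> ?L J' x = x)" (is "?P x")
  using b_basis_span[OF x]
 proof (induction rule: aspan.induct)
  case aspan_zero
  show ?case using addmapD(3)[OF L aT aT] by auto
 next
  case (aspan_add y w)
  then obtain J1 J2 where J: "finite J1" "J1 <= S" "!!J'. finite J' ==> J1 <= J' ==> J' <= S ==> ?L J' y = y"
   "finite J2" "J2 <= S" "!!J'. finite J' ==> J2 <= J' ==> J' <= S ==> ?L J' w = w" by auto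
  have "y : cr T" "w : cr T" using aspan_add asubD(2)[OF aspan_asub[OF aT sub]] by auto
  then show ?case using J addmapD(2)[OF L aT aT] by (intro exI[of _ "J1 \<union> J2"]) auto
 next
  case (aspan_inv y)
  then obtain J1 where J: "finite J1" "J1 <= S" "!!J'. finite J' ==> J1 <= J' ==> J' <= S ==> ?L J' y = y" by auto
  have "y : cr T" using aspan_inv asubD(2)[OF aspan_asub[OF aT sub]] by auto
  then show ?case using J addmapD(4)[OF L aT aT] by (intro exI[of _ J1]) auto
 next
  case (aspan_gen y)
  then obtain s v where s: "y = b s v" "s : S" "v : cr V" by auto
  have "?L J y = y" if J: "finite J" "{s} <= J" "J <= S" for J
  proof -
   have "?L J y = (\<Oplus>\<^bsub>T\<^esub>t\<in>J. if s = t then b t v else \<zero>\<^bsub>T\<^esub>)"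
   proof (rule T.M.finsum_cong')
    fix t assume "t : J"
    then have t: "t : cr B" "t : S" using J S(1) by auto
    show "b t (coef t y) = (if s = t then b t v else \<zero>\<^bsub>T\<^esub>)"
     using coef(2)[OF s(2,3)] s(1) addmapD(3)[OF mod_hom_addmap[OF derD(2)[OF br_der t(1)]] module_abelian[OF V.module_axioms] aT] by simp
   qed (use b_closed J S(1) s(3) in auto)
   also have "\<dots> = b s v" by (rule T.M.finsum_singleton) (use b_closed J S(1) s(3) in auto)
   finally show ?thesis using s by simp
  qed
  then show ?case using s by (intro exI[of _ "{s}"]) auto
 qed
 then obtain J where "finite J" "J <= S" "?L J x = x" by blast
 then show thesis using that[of J] by simp
qed

lemma coef_detect:
 assumes W: "asub V W" and x: "x : cr T" and c: "!!s. s : S ==> coef s x : W"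
 shows "x : aspan T {b g k | g k. g : cr B & k : W}"
proof -
 obtain J where J: "finite J" "J <= S" "x = (\<Oplus>\<^bsub>T\<^esub>s\<in>J. b s (coef s x))" by (rule coef_expansion[OF x])
 have "{b g k | g k. g : cr B & k : W} <= cr T" using b_closed asubD(2)[OF W] by auto
 note N = aspan_asub[OF module_abelian[OF tens_module] this]
 have "(\<Oplus>\<^bsub>T\<^esub>s\<in>J. b s (coef s x)) : aspan T {b g k | g k. g : cr B & k : W}"
  by (rule asub_finsum[OF module_abelian[OF tens_module] N J(1)])
   (rule aspan_gen, use c J(2) S(1) in blast)
 then show ?thesis using J(3) by simp
qed

end

text \<open>Over a free group the tensor product is a sum of copies of the coefficients, and
  \<open>Phi\<close> is \<open>f\<close> in each coordinate. Membership in the part generated by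
  \<open>K\<close> can therefore be tested coordinatewise, where it is the hypothesis on
  \<open>f\<close>.\<close>

lemma free_exact:
 assumes fb: "free_group B" and rp: "rep R B V act" and rp': "rep R B V' act'"
  and f: "f : mod_hom R V V'" "!!g v. g : cr B ==> v : cr V ==> f (act g v) = act' g (f v)"
  and Phi: "addmap (tens R B V act) (tens R B V' act') Phi"
   "!!g v. g : cr B ==> v : cr V ==> Phi (br R B V act g v) = br R B V' act' g (f v)"
  and K: "asub V K" and K': "asub V' K'" "!!g k. g : cr B ==> k : K' ==> act' g k : K'"
  and pull: "!!v. v : cr V ==> f v : K' ==> v : K"
  and x: "x : cr (tens R B V act)"
   "Phi x : aspan (tens R B V' act') {br R B V' act' g k | g k. g : cr B & k : K'}"
 shows "x : aspan (tens R B V act) {br R B V act g k | g k. g : cr B & k : K}"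
proof -
 obtain S where S: "free_basis B S" using fb free_group_basis by auto
 interpret t: free_tensor R B V act S by (intro free_tensor.intro tensor_ctx.intro rp free_tensor_axioms.intro S)
 interpret t': free_tensor R B V' act' S by (intro free_tensor.intro tensor_ctx.intro rp' free_tensor_axioms.intro S)
 note aT = module_abelian[OF t.tens_module] and aT' = module_abelian[OF t'.tens_module]
 have d1: "der R B V act V' (%g v. f (t.coef s (t.b g v)))" for s
  unfolding der_def
  using mod_hom_comp[OF derD(2)[OF t.coef_der] f(1)] derD(4)[OF t.coef_der]
   mod_homD(2)[OF f(1) derD(3)[OF t.coef_der] derD(3)[OF t.coef_der]] repD(4)[OF rp] t'.V.module_axioms by auto
 have d2: "der R B V act V' (%g v. t'.coef s (t'.b g (f v)))" for s
  unfolding der_def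
  using mod_hom_comp[OF f(1) derD(2)[OF t'.coef_der]] derD(4)[OF t'.coef_der _ _ mod_homD(1)[OF f(1)]] f(2) t'.V.module_axioms
  by auto
 have f0: "f \<zero>\<^bsub>V\<^esub> = \<zero>\<^bsub>V'\<^esub>"
  by (rule addmapD(3)[OF mod_hom_addmap[OF f(1)] module_abelian[OF t.V.module_axioms] module_abelian[OF t'.V.module_axioms]])
 have nat: "t'.coef s (Phi y) = f (t.coef s y)" if "y : cr (tens R B V act)" for s y
 proof (rule addmap_eq_on_aspan[OF _ _ aT module_abelian[OF t'.V.module_axioms] _ t.tens_span[OF that],
    where f = "%y. t'.coef s (Phi y)" and g = "%y. f (t.coef s y)"])
  show "addmap (tens R B V act) V' (%y. t'.coef s (Phi y))"
   unfolding addmap_def using addmapD(1,2)[OF Phi(1) aT aT'] mod_homD(1,2)[OF t'.coef(1)] by auto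
  show "addmap (tens R B V act) V' (%y. f (t.coef s y))"
   by (rule mod_hom_addmap[OF mod_hom_comp[OF t.coef(1) f(1)]])
  show "{t.b h v |h v. h : cr B & v : cr V} <= cr (tens R B V act)" using t.b_closed by auto
  fix w assume "w : {t.b h v |h v. h : cr B & v : cr V}"
  then obtain h v where h: "w = t.b h v" "h : cr B" "v : cr V" by auto
  have "ALL v:cr V. t'.coef s (t'.b h (f v)) = f (t.coef s (t.b h v))"
   by (rule der_generate_eq[OF d2 d1 rp t.S(1)])
    (use t.coef(2) t'.coef(2) mod_homD(1)[OF f(1)] f0 t.S(2) h(2) in auto)
  then show "t'.coef s (Phi w) = f (t.coef s w)" using h Phi(2) by simp
 qed
 show ?thesis
 proof (rule t.coef_detect[OF K x(1)])
  fix s assume "s : S"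
  have "f (t.coef s x) : K'" using t'.coef_mem[OF K'(1) _ x(2)] K'(2) nat[OF x(1)] by metis
  then show "t.coef s x : K" using pull mod_homD(1)[OF t.coef(1) x(1)] by blast
 qed
qed

section \<open>Long-Moody functors with parameters\<close>

context reliable_long_moody_system
begin

context
 fixes R :: "'r ring"
begin

text \<open>
 Translating a Long-Moody functor by \<open>m\<close> changes the group \<open>A X\<close> to \<open>A (m \<natural> X)\<close> and \<open>F\<close> to its
 translate. Functors of the following shape are closed under this.
\<close>

abbreviation TT where "TT a F act X == tens R (gr (a**X)) (MOb F X) (act X)"
abbreviation bb where "bb a F act X == br R (gr (a**X)) (MOb F X) (act X)"

definition equi where
 "equi a F act \<longleftrightarrow> a : M & module_functor R S F & (ALL X:St. rep R (gr (a**X)) (MOb F X) (act X)) &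
   (ALL X Y. ALL phi:hm X Y. ALL g:cg (a**X). ALL v:cM F X.
    MAr F phi (act X g v) = act Y (ga (whisk a phi) g) (MAr F phi v))"

definition isL where
 "isL a E F act \<longleftrightarrow> equi a F act & module_functor R S E & (ALL X:St. MOb E X = TT a F act X) &
   (ALL X Y. ALL phi:hm X Y. ALL g:cg (a**X). ALL v:cM F X.
    MAr E phi (bb a F act X g v) = bb a F act Y (ga (whisk a phi) g) (MAr F phi v))"

lemma equiD:
 assumes "equi a F act"
 shows "a : M" "module_functor R S F" "X : St ==> rep R (gr (a**X)) (MOb F X) (act X)"
  "X : St ==> tensor_ctx R (gr (a**X)) (MOb F X) (act X)"
  "phi : hm X Y ==> g : cg (a**X) ==> v : cM F X ==>
    MAr F phi (act X g v) = act Y (ga (whisk a phi) g) (MAr F phi v)"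
 using assms by (auto simp: equi_def intro: tensor_ctx.intro)

lemma isLD:
 assumes "isL a E F act"
 shows "equi a F act" "module_functor R S E" "X : St ==> MOb E X = TT a F act X"
  "phi : hm X Y ==> g : cg (a**X) ==> v : cM F X ==>
    MAr E phi (bb a F act X g v) = bb a F act Y (ga (whisk a phi) g) (MAr F phi v)"
 using assms by (auto simp: isL_def)

lemma TT:
 assumes "equi a F act" "X : St"
 shows "module R (TT a F act X)" "abelian_group (TT a F act X)"
  "g : cg (a**X) ==> v : cM F X ==> bb a F act X g v : cr (TT a F act X)"
  "x : cr (TT a F act X) ==>
   x : aspan (TT a F act X) {bb a F act X g v | g v. g : cg (a**X) & v : cM F X}"
proof -
 interpret t: tensor_ctx R "gr (a**X)" "MOb F X" "act X" by (rule equiD(4)[OF assms])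
 show "module R (TT a F act X)" "abelian_group (TT a F act X)"
  using t.tens_module module_abelian[OF t.tens_module] by simp_all
 show "g : cg (a**X) ==> v : cM F X ==> bb a F act X g v : cr (TT a F act X)"
  by (rule derD(3)[OF t.br_der])
 show "x : cr (TT a F act X) ==>
   x : aspan (TT a F act X) {bb a F act X g v | g v. g : cg (a**X) & v : cM F X}"
  by (rule t.tens_span)
qed

lemma TT_eq:
 assumes "equi a F act" "X : St" "addmap (TT a F act X) W f" "addmap (TT a F act X) W f'" "abelian_group W"
  "!!g v. g : cg (a**X) ==> v : cM F X ==> f (bb a F act X g v) = f' (bb a F act X g v)"
  "x : cr (TT a F act X)"
 shows "f x = f' x"
 by (rule addmap_eq_on_aspan[OF assms(3,4) TT(2)[OF assms(1,2)] assms(5) _ TT(4)[OF assms(1,2,7)]])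
  (use TT(3)[OF assms(1,2)] assms(6) in auto)

lemma ga_whisk_closed: "a : M ==> phi : hm X Y ==> g : cg (a**X) ==> ga (whisk a phi) g : cg (a**Y)"
 using ga_closed whisk_hom M_obj hmD(1) by blast

lemma ga_whisk_cmp: "a : M ==> phi : hm X Y ==> \<gamma> : hm Y Z ==> g : cg (a**X) ==>
  ga (whisk a (\<gamma> $$ phi)) g = ga (whisk a \<gamma>) (ga (whisk a phi) g)"
 using ga_cmp[OF whisk_hom[of a phi X Y] whisk_hom[of a \<gamma> Y Z]] whisk_cmp[of a phi X Y \<gamma> Z] M_obj hmD(1) by metis

lemma isLI:
 assumes e: "equi a F act" and ob: "!!X. X : St ==> MOb E X = TT a F act X"
  and hom: "!!X Y phi. phi : hm X Y ==> MAr E phi : mod_hom R (TT a F act X) (TT a F act Y)"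
  and ar: "!!X Y phi g v. phi : hm X Y ==> g : cg (a**X) ==> v : cM F X ==>
    MAr E phi (bb a F act X g v) = bb a F act Y (ga (whisk a phi) g) (MAr F phi v)"
 shows "isL a E F act"
proof -
 note F = equiD(2)[OF e] and a = equiD(1)[OF e]
 note mfF = mf[OF F]
 interpret f: module_functor R S F by (rule F)
 have id: "qid X : hm X X" if "X : St" for X using f.idn_hom[of X] that by simp
 have "module_functor R S E"
 proof (intro module_functor.intro module_functor_axioms.intro f.category_axioms, goal_cases)
  case (1 X)
  then show ?case using ob TT(1)[OF e] by simp
 next
  case (2 phi X Y)
  then show ?case using hom[OF 2] ob hmD[OF 2] by simp
 next
  case (3 X v)
  then have X: "X : St" and v: "v : cr (TT a F act X)" using ob by auto
  have "MAr E (qid X) v = v"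
  proof (rule TT_eq[OF e X mod_hom_addmap[OF hom[OF id[OF X]]] _ TT(2)[OF e X] _ v, where f' = "%x. x"])
   show "addmap (TT a F act X) (TT a F act X) (%x. x)" by (simp add: addmap_def)
   fix g w assume "g : cg (a**X)" "w : cM F X"
   then show "MAr E (qid X) (bb a F act X g w) = bb a F act X g w"
    using ar[OF id[OF X]] mfF(7)[OF X] whisk_idn[OF M_obj[OF a] St_obj[OF X]] ga_idn[of "a**X"] M_obj[OF a] St_obj[OF X] by simp
  qed
  then show ?case by simp
 next
  case (4 phi X Y \<gamma> Z v)
  have X: "X : St" and Z: "Z : St" using hmD[OF 4(1)] hmD[OF 4(2)] by auto
  have c: "\<gamma> $$ phi : hm X Z" using f.cmp_hom[OF 4(1,2)] by simp
  have v: "v : cr (TT a F act X)" using 4 ob X by simp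
  have "MAr E (\<gamma> $$ phi) v = MAr E \<gamma> (MAr E phi v)"
  proof (rule TT_eq[OF e X mod_hom_addmap[OF hom[OF c]] mod_hom_addmap[OF mod_hom_comp[OF hom[OF 4(1)] hom[OF 4(2)]]] TT(2)[OF e Z] _ v])
   fix g w assume g: "g : cg (a**X)" "w : cM F X"
   show "MAr E (\<gamma> $$ phi) (bb a F act X g w) = MAr E \<gamma> (MAr E phi (bb a F act X g w))"
    using ar[OF c g] ar[OF 4(1) g] ar[OF 4(2) ga_whisk_closed[OF a 4(1) g(1)] mfF(5)[OF 4(1) g(2)]]
     mfF(6)[OF 4(1,2) g(2)] ga_whisk_cmp[OF a 4(1,2) g(1)] by simp
  qed
  then show ?case by simp
 qed
 then show ?thesis using e ob ar by (simp add: isL_def)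
qed

lemma TT_map:
 assumes e: "equi a F act" "equi a' F' act'" and X: "X : St" "Y : St"
  and f: "f : mod_hom R (MOb F X) (MOb F' Y)"
  and beta: "beta : hom (gr (a**X)) (gr (a'**Y))"
  and eq: "!!g v. g : cg (a**X) ==> v : cM F X ==> f (act X g v) = act' Y (beta g) (f v)"
 shows "EX h:mod_hom R (TT a F act X) (TT a' F' act' Y).
  ALL g:cg (a**X). ALL v:cM F X. h (bb a F act X g v) = bb a' F' act' Y (beta g) (f v)"
proof -
 interpret t: tensor_ctx R "gr (a**X)" "MOb F X" "act X" by (rule equiD(4)[OF e(1) X(1)])
 interpret t': tensor_ctx R "gr (a'**Y)" "MOb F' Y" "act' Y" by (rule equiD(4)[OF e(2) X(2)])
 have bc: "beta g : cg (a'**Y)" if "g : cg (a**X)" for g using beta that by (auto simp: hom_def)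
 have bm: "beta (g \<otimes>\<^bsub>gr (a**X)\<^esub> h) = beta g \<otimes>\<^bsub>gr (a'**Y)\<^esub> beta h" if "g : cg (a**X)" "h : cg (a**X)" for g h
  using beta that by (auto simp: hom_def)
 have "der R (gr (a**X)) (MOb F X) (act X) (TT a' F' act' Y) (%g v. bb a' F' act' Y (beta g) (f v))"
  unfolding der_def
  using mod_hom_comp[OF f derD(2)[OF t'.br_der bc]] derD(4)[OF t'.br_der bc bc mod_homD(1)[OF f]] eq bm t'.tens_module
  by simp
 from t.tens_universal[OF this] show ?thesis .
qed

lemma ga_whisk_hom: "a : M ==> phi : hm X Y ==> ga (whisk a phi) : hom (gr (a**X)) (gr (a**Y))"
 using ga_hom whisk_hom M_obj hmD(1) by blast

lemma isL_exists:
 assumes e: "equi a F act"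
 shows "EX E. isL a E F act"
proof -
 note a = equiD(1)[OF e] and mfF = mf[OF equiD(2)[OF e]]
 let ?P = "%phi h. h : mod_hom R (TT a F act (fst phi)) (TT a F act (fst (snd phi))) &
  (ALL g:cg (a**fst phi). ALL v:cM F (fst phi).
   h (bb a F act (fst phi) g v) = bb a F act (fst (snd phi)) (ga (whisk a phi) g) (MAr F phi v))"
 define E where "E = \<lparr>MOb = TT a F act, MAr = (%phi. SOME h. ?P phi h)\<rparr>"
 have ends: "X = fst phi" "Y = fst (snd phi)" if "phi : hm X Y" for phi X Y using hmD(1)[OF that] by (auto simp: homs_def)
 have ex: "?P phi (MAr E phi)" if p: "phi : hm X Y" for phi X Y
 proof -
  from TT_map[OF e e hmD(2,3)[OF p] mfF(3)[OF p] ga_whisk_hom[OF a p], OF equiD(5)[OF e p]]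
  obtain h where "h : mod_hom R (TT a F act X) (TT a F act Y)"
   "ALL g:cg (a**X). ALL v:cM F X. h (bb a F act X g v) = bb a F act Y (ga (whisk a phi) g) (MAr F phi v)"
   by (rule bexE)
  then have "?P phi h" unfolding ends[OF p, symmetric] by (rule conjI)
  from someI[where P = "?P phi", OF this] show ?thesis by (simp add: E_def)
 qed
 have "isL a E F act"
 proof (rule isLI[OF e])
  show "MOb E X = TT a F act X" for X by (simp add: E_def)
  show "MAr E phi : mod_hom R (TT a F act X) (TT a F act Y)" if "phi : hm X Y" for phi X Y
   using ex[OF that] ends[OF that] by simp
  show "MAr E phi (bb a F act X g v) = bb a F act Y (ga (whisk a phi) g) (MAr F phi v)"
   if "phi : hm X Y" "g : cg (a**X)" "v : cM F X" for phi X Y g v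
   using ex[OF that(1)] ends[OF that(1)] that by simp
 qed
 then show ?thesis by blast
qed

text \<open>By right exactness, dividing by the span of \<open>gK\<close> replaces the coefficients
  \<open>F\<close> by \<open>F/K\<close>. The elements of \<open>gI\<close> come from the
  augmentation ideal of \<open>A X\<close>. Hence \<open>IK\<close> presents
  \<open>I \<otimes> F/K\<close> for the group of \<open>a \<natural> X\<close>, and
  \<open>IN\<close> its quotient by the part of \<open>A X\<close>.\<close>

definition gK where "gK a F act K X = {bb a F act X g k | g k. g : cg (a**X) & k : K X}"
definition gI where "gI a F act X = {bb a F act X (ga (inc a X) h) v | h v. h : cg X & v : cM F X}"
definition IK where "IK a F act K X = aspan (TT a F act X) (gK a F act K X)"
definition IN where "IN a F act K X = aspan (TT a F act X) (gK a F act K X \<union> gI a F act X)"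

definition stable where
 "stable a F act K \<longleftrightarrow> subf F K & (ALL X:St. ALL g:cg (a**X). ALL k:K X. act X g k : K X)"

lemma stableD:
 assumes "stable a F act K"
 shows "subf F K" "X : St ==> asub (MOb F X) (K X)" "X : St ==> K X <= cM F X"
  "X : St ==> k : K X ==> k : cM F X" "phi : hm X Y ==> k : K X ==> MAr F phi k : K Y"
  "X : St ==> g : cg (a**X) ==> k : K X ==> act X g k : K X"
proof -
 have s: "subf F K" using assms by (simp add: stable_def)
 show "subf F K" "X : St ==> asub (MOb F X) (K X)" "X : St ==> K X <= cM F X"
  "X : St ==> k : K X ==> k : cM F X" "phi : hm X Y ==> k : K X ==> MAr F phi k : K Y"
  using s subfD[OF s] asubD(1,2)[OF subfD(1)[OF s]] by auto
 show "X : St ==> g : cg (a**X) ==> k : K X ==> act X g k : K X"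
  using assms by (simp add: stable_def)
qed

lemma inc_closed: "a : M ==> X : St ==> h : cg X ==> ga (inc a X) h : cg (a**X)"
 using ga_closed inc_hom M_obj St_obj by blast

lemma gens_sub:
 assumes e: "equi a F act" and K: "stable a F act K" and X: "X : St"
 shows "gK a F act K X <= cr (TT a F act X)" "gI a F act X <= cr (TT a F act X)"
  "asub (TT a F act X) (IK a F act K X)" "asub (TT a F act X) (IN a F act K X)"
  "IK a F act K X <= IN a F act K X" "gK a F act K X <= IN a F act K X" "gI a F act X <= IN a F act K X"
  "gK a F act K X <= IK a F act K X"
proof -
 show 1: "gK a F act K X <= cr (TT a F act X)" and 2: "gI a F act X <= cr (TT a F act X)"
  using TT(3)[OF e X] stableD(4)[OF K X] inc_closed[OF equiD(1)[OF e] X] by (auto simp: gK_def gI_def)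
 show "asub (TT a F act X) (IK a F act K X)" "asub (TT a F act X) (IN a F act K X)"
  unfolding IK_def IN_def using aspan_asub[OF TT(2)[OF e X]] 1 2 by simp_all
 show "IK a F act K X <= IN a F act K X" "gK a F act K X <= IN a F act K X" "gI a F act X <= IN a F act K X"
  "gK a F act K X <= IK a F act K X"
  by (auto simp: IK_def IN_def intro: aspan_mono aspan_gen)
qed

lemma gens_map:
 assumes L: "isL a E F act" and K: "stable a F act K" and p: "phi : hm X Y"
 shows "x : gK a F act K X ==> MAr E phi x : gK a F act K Y" "x : gI a F act X ==> MAr E phi x : gI a F act Y"
proof -
 note e = isLD(1)[OF L]
 note a = equiD(1)[OF e] and X = hmD(2)[OF p] and mfF = mf[OF equiD(2)[OF e]]
 assume "x : gK a F act K X"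
 then obtain g k where x: "x = bb a F act X g k" "g : cg (a**X)" "k : K X" by (auto simp: gK_def)
 then show "MAr E phi x : gK a F act K Y"
  using isLD(4)[OF L p x(2) stableD(4)[OF K X x(3)]] ga_whisk_closed[OF a p x(2)] stableD(5)[OF K p x(3)] by (auto simp: gK_def)
next
 note e = isLD(1)[OF L]
 note a = equiD(1)[OF e] and X = hmD(2)[OF p] and mfF = mf[OF equiD(2)[OF e]]
 assume "x : gI a F act X"
 then obtain h v where x: "x = bb a F act X (ga (inc a X) h) v" "h : cg X" "v : cM F X" by (auto simp: gI_def)
 have "MAr E phi x = bb a F act Y (ga (inc a Y) (ga phi h)) (MAr F phi v)"
  using isLD(4)[OF L p inc_closed[OF a X x(2)] x(3)] ga_inc[OF M_obj[OF a] hmD(1)[OF p] x(2)] x(1) by simp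
 then show "MAr E phi x : gI a F act Y"
  using ga_closed[OF hmD(1)[OF p] x(2)] mfF(5)[OF p x(3)] by (auto simp: gI_def)
qed

lemma span_subf:
 assumes E: "module_functor R S E" and g: "!!X. X : St ==> W X <= cM E X"
  "!!X Y phi x. phi : hm X Y ==> x : W X ==> MAr E phi x : W Y" and N: "!!X. X : St ==> N X = aspan (MOb E X) (W X)"
 shows "subf E N"
 unfolding subf_def
proof (intro conjI ballI allI)
 note mfE = mf[OF E]
 fix X assume X: "X : St"
 show "asub (MOb E X) (N X)" using aspan_asub[OF mfE(2)[OF X] g(1)[OF X]] N[OF X] by simp
next
 note mfE = mf[OF E]
 fix X Y phi v assume p: "phi : hm X Y" and v: "v : N X"
 note X = hmD(2)[OF p] and Y = hmD(3)[OF p]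
 show "MAr E phi v : N Y" unfolding N[OF Y]
  by (rule addmap_zero_on_aspan[OF mfE(4)[OF p] mfE(2)[OF X] mfE(2)[OF Y] g(1)[OF X] v[unfolded N[OF X]] _
    aspan_asub[OF mfE(2)[OF Y] g(1)[OF Y]]]) (rule aspan_gen[OF g(2)[OF p]])
qed

lemma IK_subf:
 assumes L: "isL a E F act" and K: "stable a F act K"
 shows "subf E (IK a F act K)" "subf E (IN a F act K)"
proof -
 note g = gens_sub[OF isLD(1)[OF L] K]
 show "subf E (IK a F act K)"
  by (rule span_subf[OF isLD(2)[OF L] _ _, where W = "gK a F act K"])
   (use g isLD(3)[OF L] gens_map[OF L K] in \<open>auto simp: IK_def\<close>)
 show "subf E (IN a F act K)"
  by (rule span_subf[OF isLD(2)[OF L] _ _, where W = "%X. gK a F act K X \<union> gI a F act X"])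
   (use g isLD(3)[OF L] gens_map[OF L K] in \<open>auto simp: IN_def\<close>)
qed

text \<open>A generator \<open>(g - 1) \<otimes> v\<close> lies in the subfunctor as soon as
  \<open>v\<close> lies in \<open>K\<close>, possibly after an inclusion. The elements with this
  property form a subgroup, so it is enough to treat generators.\<close>

lemma pol_base:
 assumes L: "isL a E F act" and K: "stable a F act K" and p: "pol k s 0 F K"
  and N: "subf E N" "!!X. X : St ==> gK a F act K X <= N X"
 shows "pol k s 0 E N"
proof -
 note e = isLD(1)[OF L] and mfE = mf[OF isLD(2)[OF L]]
 note a = equiD(1)[OF e] and mfF = mf[OF equiD(2)[OF e]]
 have gen: "N' = cM E X" if N': "asub (MOb E X) N'" and X: "X : St"
  and g: "!!g v. g : cg (a**X) ==> v : cM F X ==> bb a F act X g v : N'" for N' X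
  using aspan_least[OF N' _ TT(4)[OF e X, folded isLD(3)[OF L X]]] g asubD(1)[OF N'] by blast
 show ?thesis
 proof (cases s)
  case False
  have "N X = cM E X" if X: "X : St" for X
  proof (rule gen[OF subfD(1)[OF N(1) X] X])
   fix g v assume g: "g : cg (a**X)" and v: "v : cM F X"
   have "v : K X" using p False X v by simp
   then have "bb a F act X g v : gK a F act K X" using g unfolding gK_def by blast
   then show "bb a F act X g v : N X" using N(2)[OF X] by blast
  qed
  then show ?thesis using False by simp
 next
  case True
  have "stab E N X = cM E X" if X: "X : St" for X
  proof (rule gen[OF subfD(1)[OF stab_subf[OF isLD(2)[OF L] N(1)] X] X])
   fix g v assume g: "g : cg (a**X)" and v: "v : cM F X"
   obtain m where m: "m : M" "MAr F (inc m X) v : K (m**X)" using p True X v by auto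
   note i = inc_hm[OF m(1) X]
   have "MAr E (inc m X) (bb a F act X g v) : N (m**X)"
    using isLD(4)[OF L i g v] N(2)[OF hmD(3)[OF i]] ga_whisk_closed[OF a i g] m(2) by (auto simp: gK_def)
   then show "bb a F act X g v : stab E N X" using m(1) TT(3)[OF e X g v] isLD(3)[OF L X] by (auto simp: stab_def)
  qed
  then show ?thesis using stab_full[of k E N] True by simp
 qed
qed

end

end

section \<open>Shifting the coefficients without shifting the group\<close>

context reliable_long_moody_system
begin

text \<open>There are two ways to shift by \<open>m\<close>. Shifting the whole functor turns the
  parameter \<open>a\<close> into \<open>a \<natural> m\<close>; here \<open>a\<close> is kept, and
  its group acts on the shifted coefficients through the group of
  \<open>a \<natural> m \<natural> X\<close>. The comparison of the two carries the upper
  bound.\<close>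

abbreviation sact where "sact a m act == %X g. act (m**X) (ga (whisk a (inc m X)) g)"
abbreviation (input) TTs where "TTs R a m F act == TT R a (tau G m F) (sact a m act)"
abbreviation (input) bbs where "bbs R a m F act == bb R a (tau G m F) (sact a m act)"
abbreviation (input) gKs where "gKs R a m F act == gK R a (tau G m F) (sact a m act)"
abbreviation (input) gIs where "gIs R a m F act == gI R a (tau G m F) (sact a m act)"
abbreviation (input) IKs where "IKs R a m F act == IK R a (tau G m F) (sact a m act)"
abbreviation (input) INs where "INs R a m F act == IN R a (tau G m F) (sact a m act)"

context
 fixes R :: "'r ring"
begin



lemma equi_shift:
 assumes e: "equi R a F act" and m: "m : M"
 shows "equi R a (tau G m F) (sact a m act)"
 unfolding equi_def
proof (intro conjI ballI allI)
 note a = equiD(1)[OF e] and F = equiD(2)[OF e]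
 show "a : M" by (rule a)
 show "module_functor R S (tau G m F)" by (rule tau_mf[OF F m])
 show "rep R (gr (a**X)) (MOb (tau G m F) X) (sact a m act X)" if X: "X : St" for X
  using rep_pullback[OF equiD(3)[OF e M_St[OF m X]] gr_group ga_whisk_hom[OF a inc_hm[OF m X]]] M_obj[OF a] St_obj[OF X]
  by (simp add: tau_simps)
 fix X Y phi g v assume p: "phi : hm X Y" and g: "g : cg (a**X)" and v: "v : cM (tau G m F) X"
 note X = hmD(2)[OF p] and Y = hmD(3)[OF p] and w = whisk_hm[OF m p]
 have "ga (whisk a (whisk m phi)) (ga (whisk a (inc m X)) g) = ga (whisk a (inc m Y)) (ga (whisk a phi) g)"
  using ga_whisk_cmp[OF a inc_hm[OF m X] w g] ga_whisk_cmp[OF a p inc_hm[OF m Y] g] inc_nat[OF m p] by simp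
 then show "MAr (tau G m F) phi (sact a m act X g v) = sact a m act Y (ga (whisk a phi) g) (MAr (tau G m F) phi v)"
  using equiD(5)[OF e w ga_whisk_closed[OF a inc_hm[OF m X] g]] v by (simp add: tau_simps)
qed

lemma tau_TT:
 assumes "a : M" "m : M" "X : St"
 shows "TT R (a**m) (tau G m F) (%X. act (m**X)) X = TT R a F act (m**X)"
  "bb R (a**m) (tau G m F) (%X. act (m**X)) X = bb R a F act (m**X)"
  "gr ((a**m)**X) = gr (a**m**X)"
 using assms M_obj St_obj by (simp_all add: tau_simps)

lemma isL_tau:
 assumes L: "isL R a E F act" and m: "m : M"
 shows "isL R (a**m) (tau G m E) (tau G m F) (%X. act (m**X))"
proof -
 note e = isLD(1)[OF L]
 note a = equiD(1)[OF e] and F = equiD(2)[OF e]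
 have w: "whisk (a**m) phi = whisk a (whisk m phi)" if "phi : hm X Y" for phi X Y
  using whisk_whisk[OF M_obj[OF a] M_obj[OF m] hmD(1)[OF that]] by simp
 have "equi R (a**m) (tau G m F) (%X. act (m**X))"
  unfolding equi_def
  using M_tensor[OF a m] tau_mf[OF F m] tau_TT(3)[OF a m] hmD(2) equiD(3)[OF e M_St[OF m]] equiD(5)[OF e whisk_hm[OF m]] w
  by (simp add: tau_simps)
 then show ?thesis unfolding isL_def
  using tau_mf[OF isLD(2)[OF L] m] isLD(3)[OF L M_St[OF m]] isLD(4)[OF L whisk_hm[OF m]] tau_TT[OF a m] hmD(2,3) w
  by (simp add: tau_simps)
qed

lemma stable_tau:
 assumes e: "equi R a F act" and K: "stable a F act K" and m: "m : M"
 shows "stable (a**m) (tau G m F) (%X. act (m**X)) (%X. K (m**X))"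
 unfolding stable_def
 using tau_subf[OF stableD(1)[OF K] m] stableD(6)[OF K M_St[OF m]] tau_TT(3)[OF equiD(1)[OF e] m] by simp

lemma stable_dsub:
 assumes e: "equi R a F act" and K: "stable a F act K" and m: "m : M"
 shows "stable a (tau G m F) (sact a m act) (dsub m F K)"
 unfolding stable_def
proof (intro conjI ballI)
 note a = equiD(1)[OF e] and F = equiD(2)[OF e]
 note mfF = mf[OF F]
 show "subf (tau G m F) (dsub m F K)" by (rule dsub_subf[OF F stableD(1)[OF K] m])
 fix X g k assume X: "X : St" and g: "g : cg (a**X)" and k: "k : dsub m F K X"
 note i = inc_hm[OF m X]
 obtain b x where b: "b : K (m**X)" "x : cM F X" "k = b \<oplus>\<^bsub>MOb F (m**X)\<^esub> MAr F (inc m X) x"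
  using k by (auto simp: dsub_def)
 have g': "ga (whisk a (inc m X)) g : cg (a**m**X)" by (rule ga_whisk_closed[OF a i g])
 note r = equiD(3)[OF e M_St[OF m X]] and r0 = equiD(3)[OF e X]
 have "sact a m act X g k = act (m**X) (ga (whisk a (inc m X)) g) b \<oplus>\<^bsub>MOb F (m**X)\<^esub> MAr F (inc m X) (act X g x)"
  using b mod_homD(2)[OF repD(3)[OF r g']] stableD(4)[OF K M_St[OF m X] b(1)] mfF(5)[OF i b(2)] equiD(5)[OF e i g b(2)] by simp
 then show "sact a m act X g k : dsub m F K X"
  using stableD(6)[OF K M_St[OF m X] g' b(1)] repD(4)[OF r0 g b(2)] by (auto simp: dsub_def)
qed

lemma shift_map:
 assumes e: "equi R a F act" and m: "m : M" and X: "X : St"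
 shows "EX h:mod_hom R (TTs R a m F act X) (TT R a F act (m**X)).
  ALL g:cg (a**X). ALL v:cM F (m**X).
   h (bbs R a m F act X g v) = bb R a F act (m**X) (ga (whisk a (inc m X)) g) v"
proof -
 have "(%v. v) : mod_hom R (MOb (tau G m F) X) (MOb F (m**X))" by (auto simp: tau_simps mod_hom_def)
 from TT_map[OF equi_shift[OF e m] e X M_St[OF m X] this ga_whisk_hom[OF equiD(1)[OF e] inc_hm[OF m X]]]
 show ?thesis by (simp add: tau_simps)
qed

text \<open>Enlarges the group from that of \<open>a \<natural> X\<close> to that of
  \<open>a \<natural> m \<natural> X\<close> and leaves the coefficients alone. Being natural in
  \<open>X\<close>, it can serve as the map \<open>j\<close> of
  \<open>pol_extension\<close>.\<close>

definition jj where
 "jj a m F act X = (SOME h. h : mod_hom R (TTs R a m F act X) (TT R a F act (m**X)) &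
  (ALL g:cg (a**X). ALL v:cM F (m**X).
   h (bbs R a m F act X g v) = bb R a F act (m**X) (ga (whisk a (inc m X)) g) v))"

lemma jj:
 assumes e: "equi R a F act" and m: "m : M" and X: "X : St"
 shows "jj a m F act X : mod_hom R (TTs R a m F act X) (TT R a F act (m**X))"
  "g : cg (a**X) ==> v : cM F (m**X) ==>
   jj a m F act X (bbs R a m F act X g v) = bb R a F act (m**X) (ga (whisk a (inc m X)) g) v"
proof -
 from shift_map[OF e m X] have "EX h. h : mod_hom R (TTs R a m F act X) (TT R a F act (m**X)) &
  (ALL g:cg (a**X). ALL v:cM F (m**X).
   h (bbs R a m F act X g v) = bb R a F act (m**X) (ga (whisk a (inc m X)) g) v)"
  unfolding Bex_def .
 from someI_ex[OF this, folded jj_def]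
 show "jj a m F act X : mod_hom R (TTs R a m F act X) (TT R a F act (m**X))"
  "g : cg (a**X) ==> v : cM F (m**X) ==>
   jj a m F act X (bbs R a m F act X g v) = bb R a F act (m**X) (ga (whisk a (inc m X)) g) v"
  by blast+
qed

lemma jj_natural:
 assumes L: "isL R a E F act" and L': "isL R a E' (tau G m F) (sact a m act)" and m: "m : M" and p: "phi : hm X Y"
  and y: "y : cM E' X"
 shows "jj a m F act Y (MAr E' phi y) = MAr E (whisk m phi) (jj a m F act X y)"
proof -
 note e = isLD(1)[OF L] and e' = isLD(1)[OF L'] and X = hmD(2)[OF p] and Y = hmD(3)[OF p] and w = whisk_hm[OF m p]
 note a = equiD(1)[OF e] and mfE = mf[OF isLD(2)[OF L]] and mfE' = mf[OF isLD(2)[OF L']]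
 note jX = jj[OF e m X] and jY = jj[OF e m Y] and ob = isLD(3)[OF L'] isLD(3)[OF L M_St[OF m]]
 have 1: "addmap (TTs R a m F act X) (TT R a F act (m**Y)) (%y. jj a m F act Y (MAr E' phi y))"
  by (rule mod_hom_addmap[OF mod_hom_comp[OF mfE'(3)[OF p, unfolded ob(1)[OF X] ob(1)[OF Y]] jY(1)]])
 have 2: "addmap (TTs R a m F act X) (TT R a F act (m**Y)) (%y. MAr E (whisk m phi) (jj a m F act X y))"
  by (rule mod_hom_addmap[OF mod_hom_comp[OF jX(1) mfE(3)[OF w, unfolded ob(2)[OF X] ob(2)[OF Y]]]])
 show ?thesis
 proof (rule TT_eq[OF e' X 1 2 TT(2)[OF e M_St[OF m Y]] _ y[unfolded ob(1)[OF X]]])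
  fix g v assume g: "g : cg (a**X)" and v: "v : cM (tau G m F) X"
  have v': "v : cM F (m**X)" using v by (simp add: tau_simps)
  have fv: "MAr F (whisk m phi) v : cM F (m**Y)" using mf(5)[OF equiD(2)[OF e] w v'] .
  have "ga (whisk a (whisk m phi)) (ga (whisk a (inc m X)) g) = ga (whisk a (inc m Y)) (ga (whisk a phi) g)"
   using ga_whisk_cmp[OF a inc_hm[OF m X] w g] ga_whisk_cmp[OF a p inc_hm[OF m Y] g] inc_nat[OF m p] by simp
  then show "jj a m F act Y (MAr E' phi (bbs R a m F act X g v)) =
    MAr E (whisk m phi) (jj a m F act X (bbs R a m F act X g v))"
   unfolding isLD(4)[OF L' p g v] jX(2)[OF g v'] isLD(4)[OF L w ga_whisk_closed[OF a inc_hm[OF m X] g] v']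
   using jY(2)[OF ga_whisk_closed[OF a p g] fv] by (simp add: tau_simps)
 qed
qed

text \<open>An element of \<open>dsub m F K\<close> is one of \<open>K\<close> plus one coming from
  \<open>F X\<close>. With the first as coefficient one obtains a generator from \<open>gK\<close>,
  with the second an element in the image of the inclusion of \<open>E\<close>.\<close>

lemma shift_mem:
 assumes L: "isL R a E F act" and K: "stable a F act K" and m: "m : M" and X: "X : St" and N: "asub (MOb E (m**X)) N"
  "gK R a F act K (m**X) <= N" "!!x. x : cM E X ==> MAr E (inc m X) x : N"
  and y: "y : IKs R a m F act (dsub m F K) X"
 shows "jj a m F act X y : N"
proof -
 note e = isLD(1)[OF L]
 note a = equiD(1)[OF e] and F = equiD(2)[OF e] and mfE = mf[OF isLD(2)[OF L]] and e' = equi_shift[OF e m]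
 note mfF = mf[OF F] and K' = stable_dsub[OF e K m] and i = inc_hm[OF m X] and mX = M_St[OF m X]
 show ?thesis
 proof (rule addmap_zero_on_aspan[OF mod_hom_addmap[OF jj(1)[OF e m X]] TT(2)[OF e' X] TT(2)[OF e mX] gens_sub(1)[OF e' K' X]
    y[unfolded IK_def] _ N(1)[unfolded isLD(3)[OF L mX]]])
  fix s assume "s : gKs R a m F act (dsub m F K) X"
  then obtain g k where s: "s = bbs R a m F act X g k" "g : cg (a**X)" "k : dsub m F K X"
   by (auto simp: gK_def)
  obtain b x where b: "b : K (m**X)" "x : cM F X" "k = b \<oplus>\<^bsub>MOb F (m**X)\<^esub> MAr F (inc m X) x"
   using s(3) by (auto simp: dsub_def)
  note g = ga_whisk_closed[OF a i s(2)] and bc = stableD(4)[OF K mX b(1)] and xc = mfF(5)[OF i b(2)]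
  have kc: "k : cM F (m**X)" using abelian_monoid.a_closed[OF abelian_group.axioms(1)[OF mfF(2)[OF mX]] bc xc] b(3) by simp
  interpret t: tensor_ctx R "gr (a**m**X)" "MOb F (m**X)" "act (m**X)" by (rule equiD(4)[OF e mX])
  have "jj a m F act X s = bb R a F act (m**X) (ga (whisk a (inc m X)) g) b \<oplus>\<^bsub>TT R a F act (m**X)\<^esub> MAr E (inc m X) (bb R a F act X g x)"
   unfolding s(1) jj(2)[OF e m X s(2) kc] isLD(4)[OF L i s(2) b(2)] unfolding b(3)
   by (rule mod_homD(2)[OF derD(2)[OF t.br_der g] bc xc])
  moreover have "bb R a F act (m**X) (ga (whisk a (inc m X)) g) b : N" using N(2) g b(1) by (auto simp: gK_def)
  moreover have "MAr E (inc m X) (bb R a F act X g x) : N" using N(3) TT(3)[OF e X s(2) b(2)] isLD(3)[OF L X] by simp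
  ultimately show "jj a m F act X s : N" using asubD(4)[OF N(1)] isLD(3)[OF L mX] by simp
 qed
qed

end

end

section \<open>Retractions and projections of tensor products\<close>

context reliable_long_moody_system
begin

context
 fixes R :: "'r ring"
begin

lemma dsub_inc:
 assumes "module_functor R S F" "subf F K" "m : M" "X : St" "x : cM F X"
 shows "MAr F (inc m X) x : dsub m F K X"
proof -
 note mfF = mf[OF assms(1)]
 interpret abelian_group "MOb F (m**X)" by (rule mfF(2)[OF M_St[OF assms(3,4)]])
 have "MAr F (inc m X) x = \<zero>\<^bsub>MOb F (m**X)\<^esub> \<oplus>\<^bsub>MOb F (m**X)\<^esub> MAr F (inc m X) x"
  using mfF(5)[OF inc_hm[OF assms(3,4)] assms(5)] by simp
 then show ?thesis unfolding dsub_def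
  using asubD(3)[OF subfD(1)[OF assms(2) M_St[OF assms(3,4)]]] assms(5) by blast
qed

text \<open>The inclusion of \<open>E\<close> into its shift is done in two stages, first on the
  coefficients and then on the group. The second stage has a left inverse, so questions about the
  inclusion become questions about coefficients.\<close>

lemma phi_map:
 assumes L: "isL R a E F act" and m: "m : M" and X: "X : St"
 shows "EX Phi:mod_hom R (TT R a F act X) (TTs R a m F act X).
  (ALL g:cg (a**X). ALL v:cM F X.
   Phi (bb R a F act X g v) = bbs R a m F act X g (MAr F (inc m X) v)) &
  (ALL x:cr (TT R a F act X). MAr E (inc m X) x = jj R a m F act X (Phi x))"
proof -
 note e = isLD(1)[OF L]
 note e' = equi_shift[OF e m] and i = inc_hm[OF m X] and mX = M_St[OF m X]
 note mfF = mf[OF equiD(2)[OF e]] and mfE = mf[OF isLD(2)[OF L]] and ob = isLD(3)[OF L]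
 have f: "MAr F (inc m X) : mod_hom R (MOb F X) (MOb (tau G m F) X)" using mfF(3)[OF i] by (simp add: tau_simps)
 have idh: "(%g. g) : hom (gr (a**X)) (gr (a**X))" by (simp add: hom_def)
 obtain Phi where Phi: "Phi : mod_hom R (TT R a F act X) (TTs R a m F act X)"
  "ALL g:cg (a**X). ALL v:cM F X.
   Phi (bb R a F act X g v) = bbs R a m F act X g (MAr F (inc m X) v)"
  using TT_map[OF e e' X X f idh, OF equiD(5)[OF e i]] by (rule bexE)
 have "MAr E (inc m X) x = jj R a m F act X (Phi x)" if x: "x : cr (TT R a F act X)" for x
 proof (rule TT_eq[OF e X mfE(4)[OF i, unfolded ob[OF X] ob[OF mX]] mod_hom_addmap[OF mod_hom_comp[OF Phi(1) jj(1)[OF e m X]]]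
    TT(2)[OF e mX] _ x])
  fix g v assume g: "g : cg (a**X)" and v: "v : cM F X"
  show "MAr E (inc m X) (bb R a F act X g v) = jj R a m F act X (Phi (bb R a F act X g v))"
   using Phi(2) g v jj(2)[OF e m X g mfF(5)[OF i v]] isLD(4)[OF L i g v] by simp
 qed
 then show ?thesis using Phi by (intro bexI[of _ Phi]) simp_all
qed

text \<open>The map \<open>rho\<close> with \<open>a\<close> in the place of \<open>m\<close> and
  \<open>m\<close> in the place of \<open>n\<close>. It is a left inverse of \<open>jj\<close> that
  respects both families of generators. It will be applied at a fixed \<open>X\<close>, so no
  naturality in \<open>X\<close> is asked for.\<close>

lemma retraction:
 assumes e: "equi R a F act" and m: "m : M" and X: "X : St"
 shows "EX rho:mod_hom R (TT R a F act (m**X)) (TTs R a m F act X).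
  (ALL y:cr (TTs R a m F act X). rho (jj R a m F act X y) = y) &
  (ALL x:gI R a F act (m**X). rho x : aspan (TTs R a m F act X) (gIs R a m F act X)) &
  (ALL K. stable a F act K --> (ALL x:gK R a F act K (m**X).
   rho x : aspan (TTs R a m F act X) (gKs R a m F act (%X. K (m**X)) X)))"
  (is "EX rho:_. ?A rho & ?B rho & ?C rho")
proof -
 note a = equiD(1)[OF e] and mX = M_St[OF m X] and e' = equi_shift[OF e m]
 note r = rho(1)[OF a m X equiD(3)[OF e mX]]
 have tt: "TTs R a m F act X = tens R (gr (a**X)) (MOb F (m**X)) (sact a m act X)"
  "bbs R a m F act X = br R (gr (a**X)) (MOb F (m**X)) (sact a m act X)" by (simp_all add: tau_simps)
 from r obtain rho where rho: "rho : mod_hom R (TT R a F act (m**X)) (TTs R a m F act X)"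
  "ALL x:cg (a**X). ALL v:cM F (m**X).
   rho (bb R a F act (m**X) (ga (whisk a (inc m X)) x) v) = bbs R a m F act X x v"
  "ALL x:cg (m**X). ALL v:cM F (m**X). rho (bb R a F act (m**X) (ga (inc a (m**X)) x) v) : 
    aspan (TTs R a m F act X) {bbs R a m F act X (ga (inc a X) c) w | c w. c : cg X & w : cM F (m**X)}"
  "ALL K. K <= cM F (m**X) & (ALL g:cg (a**m**X). ALL k:K. act (m**X) g k : K) -->
    (ALL g:cg (a**m**X). ALL k:K. rho (bb R a F act (m**X) g k) : 
     aspan (TTs R a m F act X) {bbs R a m F act X x w | x w. x : cg (a**X) & w : K})"
  unfolding tt by (elim bexE conjE) (rule that[unfolded tt]; assumption)
 have A: "?A rho"
 proof
  fix y assume y: "y : cr (TTs R a m F act X)"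
  show "rho (jj R a m F act X y) = y"
  proof (rule TT_eq[OF e' X mod_hom_addmap[OF mod_hom_comp[OF jj(1)[OF e m X] rho(1)]] _ TT(2)[OF e' X] _ y, where f' = "%y. y"])
   show "addmap (TTs R a m F act X) (TTs R a m F act X) (%y. y)" by (simp add: addmap_def)
   show "rho (jj R a m F act X (bbs R a m F act X g v)) = bbs R a m F act X g v"
    if "g : cg (a**X)" "v : cM (tau G m F) X" for g v
    using jj(2)[OF e m X that(1)] rho(2) that by (simp add: tau_simps)
  qed
 qed
 have B: "?B rho"
 proof
  fix x assume "x : gI R a F act (m**X)"
  then obtain h v where "x = bb R a F act (m**X) (ga (inc a (m**X)) h) v" "h : cg (m**X)" "v : cM F (m**X)"
   by (auto simp: gI_def)
  then show "rho x : aspan (TTs R a m F act X) (gIs R a m F act X)"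
   using rho(3) unfolding gI_def tau_simps by blast
 qed
 have C: "?C rho"
 proof (intro allI impI ballI)
  fix K x assume K: "stable a F act K" and "x : gK R a F act K (m**X)"
  then obtain g k where x: "x = bb R a F act (m**X) g k" "g : cg (a**m**X)" "k : K (m**X)" by (auto simp: gK_def)
  have "K (m**X) <= cM F (m**X) & (ALL g:cg (a**m**X). ALL k:K (m**X). act (m**X) g k : K (m**X))"
   using stableD(3)[OF K mX] stableD(6)[OF K mX] by blast
  with rho(4) have "rho x : aspan (TTs R a m F act X) {bbs R a m F act X x w | x w. x : cg (a**X) & w : K (m**X)}"
   using x by blast
  then show "rho x : aspan (TTs R a m F act X) (gKs R a m F act (%X. K (m**X)) X)"
   by (simp only: gK_def)
 qed
 show ?thesis using rho(1) A B C by blast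
qed

text \<open>The map \<open>rho\<close> with the unit in the place of \<open>m\<close> and
  \<open>a\<close> in the place of \<open>n\<close> retracts onto the tensor product over the group
  of \<open>X\<close>. Followed by the map back it becomes an endomorphism that fixes the part
  generated by \<open>A X\<close>. Its compatibility with a change of coefficients is
  \<open>rho_natural\<close>.\<close>

lemma projection:
 assumes a: "a : M" and X: "X : St" and rp: "rep R (gr (a**X)) V act" "rep R (gr (a**X)) V' act'"
  and f: "f : mod_hom R V V'" "!!g v. g : cg (a**X) ==> v : cr V ==> f (act g v) = act' g (f v)"
  and Phi: "Phi : mod_hom R (tens R (gr (a**X)) V act) (tens R (gr (a**X)) V' act')"
   "!!g v. g : cg (a**X) ==> v : cr V ==>
    Phi (br R (gr (a**X)) V act g v) = br R (gr (a**X)) V' act' g (f v)"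
 defines "T == tens R (gr (a**X)) V act" and "T' == tens R (gr (a**X)) V' act'"
  and "b == br R (gr (a**X)) V act" and "b' == br R (gr (a**X)) V' act'"
 shows "EX p p'. p : mod_hom R T T & p' : mod_hom R T' T' & (ALL x:cr T. p' (Phi x) = Phi (p x)) &
  (ALL x:cr T. p x : aspan T {b (ga (inc a X) h) v | h v. h : cg X & v : cr V}) &
  (ALL h:cg X. ALL v:cr V'. p' (b' (ga (inc a X) h) v) = b' (ga (inc a X) h) v) &
  (ALL K. K <= cr V' & (ALL g:cg (a**X). ALL k:K. act' g k : K) -->
   (ALL g:cg (a**X). ALL k:K. p' (b' g k) : aspan T' {b' x w | x w. x : cg (a**X) & w : K}))"
proof -
 note i = inc_hm[OF a X] and oX = St_obj[OF X]
 have u: "Unit G**X = X" "Unit G**a**X = a**X" "whisk (Unit G) (inc a X) = inc a X"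
  using oX M_obj[OF a] whisk_unit[OF hmD(1)[OF i]] by simp_all
 note ih = ga_hom[OF hmD(1)[OF i]] and ic = inc_closed[OF a X]
 let ?a = "%h. act (ga (inc a X) h)" and ?a' = "%h. act' (ga (inc a X) h)"
 let ?U = "tens R (gr X) V ?a" and ?U' = "tens R (gr X) V' ?a'" and ?c = "br R (gr X) V ?a" and ?c' = "br R (gr X) V' ?a'"
 interpret t: tensor_ctx R "gr (a**X)" V act by (rule tensor_ctx.intro[OF rp(1)])
 interpret t': tensor_ctx R "gr (a**X)" V' act' by (rule tensor_ctx.intro[OF rp(2)])
 interpret s: tensor_ctx R "gr X" V ?a by (rule tensor_ctx.intro[OF rep_pullback[OF rp(1) gr_group[OF oX] ih]])
 interpret s': tensor_ctx R "gr X" V' ?a' by (rule tensor_ctx.intro[OF rep_pullback[OF rp(2) gr_group[OF oX] ih]])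
 note aT = module_abelian[OF t.tens_module, folded T_def] and aT' = module_abelian[OF t'.tens_module, folded T'_def]
 note aU = module_abelian[OF s.tens_module] and aU' = module_abelian[OF s'.tens_module]
 have bc: "b g v : cr T" if "g : cg (a**X)" "v : cr V" for g v
  using derD(3)[OF t.br_der that] by (simp add: b_def T_def)
 have bc': "b' g v : cr T'" if "g : cg (a**X)" "v : cr V'" for g v
  using derD(3)[OF t'.br_der that] by (simp add: b'_def T'_def)
 have uc: "?c h v : cr ?U" if "h : cg X" "v : cr V" for h v by (rule derD(3)[OF s.br_der that])
 have uc': "?c' h v : cr ?U'" if "h : cg X" "v : cr V'" for h v by (rule derD(3)[OF s'.br_der that])
 have "rep R (gr (Unit G**a**X)) V act" "rep R (gr (Unit G**a**X)) V' act'" using rp u by simp_all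
 note rr = this
 note r = rho(1)[OF M_unit a X rr(1), unfolded u] and r' = rho(1)[OF M_unit a X rr(2), unfolded u]
 from r obtain rho where rho: "rho : mod_hom R T ?U" "is_rho (Unit G) a X R V act rho"
  unfolding T_def by (elim bexE conjE) (rule that[unfolded T_def]; assumption)
 from r' obtain rho' where rho': "rho' : mod_hom R T' ?U'" "is_rho (Unit G) a X R V' act' rho'"
  "ALL h:cg X. ALL v:cr V'. rho' (b' (ga (inc a X) h) v) = ?c' h v"
  "ALL K. K <= cr V' & (ALL g:cg (a**X). ALL k:K. act' g k : K) -->
    (ALL g:cg (a**X). ALL k:K. rho' (b' g k) : aspan ?U' {?c' x w | x w. x : cg X & w : K})"
  unfolding T'_def b'_def by (elim bexE conjE) (rule that[unfolded T'_def b'_def]; assumption)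
 have "der R (gr X) V ?a T (%h. b (ga (inc a X) h))" unfolding T_def b_def
  by (rule der_pullback[OF t.br_der gr_group[OF oX] ih rp(1)]) simp
 from s.tens_universal[OF this] obtain \<iota> where \<iota>: "\<iota> : mod_hom R ?U T"
  "ALL h:cg X. ALL v:cr V. \<iota> (?c h v) = b (ga (inc a X) h) v" by (rule bexE)
 have "der R (gr X) V' ?a' T' (%h. b' (ga (inc a X) h))" unfolding T'_def b'_def
  by (rule der_pullback[OF t'.br_der gr_group[OF oX] ih rp(2)]) simp
 from s'.tens_universal[OF this] obtain \<iota>' where \<iota>': "\<iota>' : mod_hom R ?U' T'"
  "ALL h:cg X. ALL v:cr V'. \<iota>' (?c' h v) = b' (ga (inc a X) h) v" by (rule bexE)
 have "der R (gr X) V ?a ?U' (%h v. ?c' h (f v))"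
  unfolding der_def
  using mod_hom_comp[OF f(1) derD(2)[OF s'.br_der]] derD(4)[OF s'.br_der _ _ mod_homD(1)[OF f(1)]] f(2)[OF ic] s'.tens_module by simp
 from s.tens_universal[OF this] obtain Psi where Psi: "Psi : mod_hom R ?U ?U'"
  "ALL h:cg X. ALL v:cr V. Psi (?c h v) = ?c' h (f v)" by (rule bexE)
 have Phi': "Phi : mod_hom R T T'" "!!g v. g : cg (a**X) ==> v : cr V ==> Phi (b g v) = b' g (f v)"
  using Phi by (simp_all add: T_def T'_def b_def b'_def)
 have s1: "\<iota>' (Psi y) = Phi (\<iota> y)" if y: "y : cr ?U" for y
 proof (rule addmap_eq_on_aspan[OF mod_hom_addmap[OF mod_hom_comp[OF Psi(1) \<iota>'(1)]] mod_hom_addmap[OF mod_hom_comp[OF \<iota>(1) Phi'(1)]] aU aT' _ s.tens_span[OF y]])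
  show "{?c h v |h v. h : cg X & v : cr V} <= cr ?U" using uc by auto
  fix w assume "w : {?c h v |h v. h : cg X & v : cr V}"
  then obtain h v where w: "w = ?c h v" "h : cg X" "v : cr V" by auto
  show "\<iota>' (Psi w) = Phi (\<iota> w)" using w Psi(2) \<iota>(2) \<iota>'(2) mod_homD(1)[OF f(1) w(3)] Phi'(2)[OF ic[OF w(2)] w(3)] by simp
 qed
 have n: "rho' (Phi x) = Psi (rho x)" if x: "x : cr T" for x
 proof (rule addmap_eq_on_aspan[OF mod_hom_addmap[OF mod_hom_comp[OF Phi'(1) rho'(1)]] mod_hom_addmap[OF mod_hom_comp[OF rho(1) Psi(1)]] aT aU' _
    t.tens_span[folded T_def b_def, OF x]])
  show "{b h v |h v. h : cg (a**X) & v : cr V} <= cr T" using bc by auto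
  fix w assume "w : {b h v |h v. h : cg (a**X) & v : cr V}"
  then obtain g v where w: "w = b g v" "g : cg (a**X)" "v : cr V" by auto
  have "rho' (b' g (f v)) = Psi (rho (b g v))"
   unfolding b_def b'_def
   by (rule rho_natural[OF M_unit a X rr rho(2) rho'(2) f(1), unfolded u, of Psi g v])
    (use f(2) Psi w in simp_all)
  then show "rho' (Phi w) = Psi (rho w)" using w Phi'(2) by simp
 qed
 show ?thesis
 proof (intro exI[of _ "%x. \<iota> (rho x)"] exI[of _ "%x. \<iota>' (rho' x)"] conjI ballI allI impI)
  show "(%x. \<iota> (rho x)) : mod_hom R T T" "(%x. \<iota>' (rho' x)) : mod_hom R T' T'"
   by (rule mod_hom_comp[OF rho(1) \<iota>(1)], rule mod_hom_comp[OF rho'(1) \<iota>'(1)])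
  fix x assume x: "x : cr T"
  note rx = mod_homD(1)[OF rho(1) x]
  show "\<iota>' (rho' (Phi x)) = Phi (\<iota> (rho x))" using n[OF x] s1[OF rx] by simp
  let ?N = "aspan T {b (ga (inc a X) h) v | h v. h : cg X & v : cr V}"
  show "\<iota> (rho x) : ?N"
  proof (rule addmap_zero_on_aspan[OF mod_hom_addmap[OF \<iota>(1)] aU aT _ s.tens_span[OF rx]])
   show "{?c h v |h v. h : cg X & v : cr V} <= cr ?U" using uc by auto
   show "asub T ?N" by (rule aspan_asub[OF aT]) (use bc ic in auto)
   show "\<iota> w : ?N" if "w : {?c h v |h v. h : cg X & v : cr V}" for w
    by (rule aspan_gen) (use \<iota>(2) that in auto)
  qed
 next
  show "\<iota>' (rho' (b' (ga (inc a X) h) v)) = b' (ga (inc a X) h) v" if "h : cg X" "v : cr V'" for h v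
   using rho'(3) \<iota>'(2) that by simp
  fix K g k assume K: "K <= cr V' & (ALL g:cg (a**X). ALL k:K. act' g k : K)"
   and g: "g : cg (a**X)" and k: "k : K"
  let ?N = "aspan T' {b' x w | x w. x : cg (a**X) & w : K}"
  have *: "rho' (b' g k) : aspan ?U' {?c' x w | x w. x : cg X & w : K}" using rho'(4) K g k by blast
  show "\<iota>' (rho' (b' g k)) : ?N"
  proof (rule addmap_zero_on_aspan[OF mod_hom_addmap[OF \<iota>'(1)] aU' aT' _ *])
   show "{?c' x w | x w. x : cg X & w : K} <= cr ?U'" using uc' K by auto
   show "asub T' ?N" by (rule aspan_asub[OF aT']) (use bc' K in auto)
   show "\<iota>' y : ?N" if y': "y : {?c' x w | x w. x : cg X & w : K}" for y
   proof (rule aspan_gen)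
    obtain x w where y: "y = ?c' x w" "x : cg X" "w : K" using y' by auto
    have "\<iota>' y = b' (ga (inc a X) x) w" using \<iota>'(2) y K by auto
    then show "\<iota>' y : {b' x w | x w. x : cg (a**X) & w : K}" using ic[OF y(2)] y(3) by blast
   qed
  qed
 qed
qed

end

end

lemma sum_asub:
 assumes D: "asub T D" and j: "addmap T' T j" and T: "abelian_group T" "abelian_group T'"
 shows "asub T {b \<oplus>\<^bsub>T\<^esub> j y | b y. b : D & y : cr T'}" (is "asub T ?W")
  "b : D ==> b : {b \<oplus>\<^bsub>T\<^esub> j y | b y. b : D & y : cr T'}"
  "y : cr T' ==> j y : {b \<oplus>\<^bsub>T\<^esub> j y | b y. b : D & y : cr T'}"
proof -
 interpret T: abelian_group T by (rule T(1))
 interpret T': abelian_group T' by (rule T(2))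
 note ja = addmapD[OF j T(2,1)] and D = asubD[OF D]
 show 1: "b : ?W" if "b : D" for b
 proof -
  have "b = b \<oplus>\<^bsub>T\<^esub> j \<zero>\<^bsub>T'\<^esub>" using ja(3) D(2)[OF that] by simp
  then show ?thesis using that T'.zero_closed by blast
 qed
 show "j y : ?W" if "y : cr T'" for y
 proof -
  have "j y = \<zero>\<^bsub>T\<^esub> \<oplus>\<^bsub>T\<^esub> j y" using ja(1)[OF that] by simp
  then show ?thesis using that D(3) by blast
 qed
 show "asub T ?W" unfolding asub_def
 proof (intro conjI ballI)
  show "?W <= cr T" using D(2) ja(1) by auto
  show "\<zero>\<^bsub>T\<^esub> : ?W" by (rule 1[OF D(3)])
  fix x assume "x : ?W"
  then obtain b y where x: "x = b \<oplus>\<^bsub>T\<^esub> j y" "b : D" "y : cr T'" by blast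
  have "\<ominus>\<^bsub>T\<^esub> x = \<ominus>\<^bsub>T\<^esub> b \<oplus>\<^bsub>T\<^esub> j (\<ominus>\<^bsub>T'\<^esub> y)"
   using x D(2)[OF x(2)] ja(1)[OF x(3)] ja(4)[OF x(3)] by (simp add: T.minus_add)
  then show "\<ominus>\<^bsub>T\<^esub> x : ?W" using D(5)[OF x(2)] T'.a_inv_closed[OF x(3)] by blast
  fix x' assume "x' : ?W"
  then obtain b' y' where x': "x' = b' \<oplus>\<^bsub>T\<^esub> j y'" "b' : D" "y' : cr T'" by blast
  have "x \<oplus>\<^bsub>T\<^esub> x' = (b \<oplus>\<^bsub>T\<^esub> b') \<oplus>\<^bsub>T\<^esub> j (y \<oplus>\<^bsub>T'\<^esub> y')"
   using x x' D(2)[OF x(2)] D(2)[OF x'(2)] ja(1)[OF x(3)] ja(1)[OF x'(3)] ja(2)[OF x(3) x'(3)] by (simp add: T.a_ac)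
  then show "x \<oplus>\<^bsub>T\<^esub> x' : ?W" using D(4)[OF x(2) x'(2)] T'.a_closed[OF x(3) x'(3)] by blast
 qed
qed

section \<open>Injectivity of the shift maps modulo subfunctors\<close>

context reliable_long_moody_system
begin

context
 fixes R :: "'r ring"
begin

lemma retraction_dsub:
 assumes L: "isL R a E F act" and K: "stable a F act K" and m: "m : M" and X: "X : St"
  and rho: "addmap (TT R a F act (m**X)) (TTs R a m F act X) rho"
  "ALL y:cr (TTs R a m F act X). rho (jj R a m F act X y) = y"
  and W: "subf E W" "!!x. x : W (m**X) ==> rho x : N"
  and N: "asub (TTs R a m F act X) N" "gKs R a m F act (dsub m F K) X <= N"
  and x: "x : dsub m E W X"
 shows "rho x : N"
proof -
 note e = isLD(1)[OF L]
 note e' = equi_shift[OF e m] and i = inc_hm[OF m X] and mX = M_St[OF m X]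
 note mfF = mf[OF equiD(2)[OF e]] and mfE = mf[OF isLD(2)[OF L]] and ob = isLD(3)[OF L]
 obtain w y where y: "w : W (m**X)" "y : cM E X" "x = w \<oplus>\<^bsub>MOb E (m**X)\<^esub> MAr E (inc m X) y"
  using x by (auto simp: dsub_def)
 obtain Phi where Phi: "Phi : mod_hom R (TT R a F act X) (TTs R a m F act X)"
  "ALL g:cg (a**X). ALL v:cM F X.
   Phi (bb R a F act X g v) = bbs R a m F act X g (MAr F (inc m X) v)"
  "ALL x:cr (TT R a F act X). MAr E (inc m X) x = jj R a m F act X (Phi x)"
  using phi_map[OF L m X] by (elim bexE conjE) (rule that; assumption)
 have yT: "y : cr (TT R a F act X)" using y(2) ob[OF X] by simp
 have "Phi y : N"
 proof (rule addmap_zero_on_aspan[OF mod_hom_addmap[OF Phi(1)] TT(2)[OF e X] TT(2)[OF e' X] _ TT(4)[OF e X yT] _ N(1)])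
  show "{bb R a F act X g v |g v. g : cg (a**X) & v : cM F X} <= cr (TT R a F act X)"
   using TT(3)[OF e X] by auto
  fix s assume "s : {bb R a F act X g v |g v. g : cg (a**X) & v : cM F X}"
  then obtain g v where s: "s = bb R a F act X g v" "g : cg (a**X)" "v : cM F X" by auto
  have "Phi s = bbs R a m F act X g (MAr F (inc m X) v)" using s Phi(2) by simp
  moreover have "MAr F (inc m X) v : dsub m F K X" by (rule dsub_inc[OF equiD(2)[OF e] stableD(1)[OF K] m X s(3)])
  ultimately show "Phi s : N" using N(2) s(2) by (auto simp: gK_def)
 qed
 moreover have "rho (MAr E (inc m X) y) = Phi y" using Phi(3) rho(2) yT mod_homD(1)[OF Phi(1) yT] by simp
 moreover have "w : cr (TT R a F act (m**X))" using asubD(2)[OF subfD(1)[OF W(1) mX] y(1)] ob[OF mX] by simp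
 moreover have "MAr E (inc m X) y : cr (TT R a F act (m**X))" using mfE(5)[OF i y(2)] ob[OF mX] by simp
 ultimately show ?thesis
  using y(3) ob[OF mX] addmapD(2)[OF rho(1) TT(2)[OF e mX] TT(2)[OF e' X]] W(2)[OF y(1)] asubD(4)[OF N(1)] by simp
qed

lemma retraction_span:
 assumes e: "equi R a F act" and K: "stable a F act K" and m: "m : M" and X: "X : St"
  and rho: "addmap (TT R a F act (m**X)) (TTs R a m F act X) rho"
  and N: "asub (TTs R a m F act X) N" "gKs R a m F act (%X. K (m**X)) X <= N"
  and 1: "!!x. x : gK R a F act K (m**X) ==>
   rho x : aspan (TTs R a m F act X) (gKs R a m F act (%X. K (m**X)) X)"
 shows "x : IK R a F act K (m**X) ==> rho x : N"
  "(!!x. x : gI R a F act (m**X) ==> rho x : N) ==> x : IN R a F act K (m**X) ==> rho x : N"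
proof -
 note e' = equi_shift[OF e m] and mX = M_St[OF m X]
 note z = addmap_zero_on_aspan[OF rho TT(2)[OF e mX] TT(2)[OF e' X]]
 have 2: "rho x : N" if "x : gK R a F act K (m**X)" for x by (rule aspan_least[OF N(1,2) 1[OF that]])
 note g = gens_sub(1,2)[OF e K mX]
 show "x : IK R a F act K (m**X) ==> rho x : N" unfolding IK_def by (rule z[OF g(1) _ 2 N(1)])
 assume 3: "!!x. x : gI R a F act (m**X) ==> rho x : N" and x: "x : IN R a F act K (m**X)"
 show "rho x : N" by (rule z[OF _ x[unfolded IN_def] _ N(1)]) (use g 2 3 in auto)
qed

text \<open>Since \<open>y = rho (jj y)\<close>, it is enough that \<open>rho\<close> sends the
  subfunctor of the target into that of the source. It does so on the generators, and on the image
  of the inclusion of \<open>E\<close> it gives the map \<open>Phi\<close> on coefficients.\<close>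

lemma shift_exact:
 assumes L: "isL R a E F act" and K: "stable a F act K" and m: "m : M" and X: "X : St"
  and y: "y : cr (TTs R a m F act X)"
 shows "jj R a m F act X y : dsub m E (IK R a F act K) X ==> y : IKs R a m F act (dsub m F K) X"
  "jj R a m F act X y : dsub m E (IN R a F act K) X ==> y : INs R a m F act (dsub m F K) X"
proof -
 note e = isLD(1)[OF L]
 note e' = equi_shift[OF e m] and mX = M_St[OF m X] and K' = stable_dsub[OF e K m]
 obtain rho where rho: "rho : mod_hom R (TT R a F act (m**X)) (TTs R a m F act X)"
  "ALL y:cr (TTs R a m F act X). rho (jj R a m F act X y) = y"
  "ALL x:gI R a F act (m**X). rho x : aspan (TTs R a m F act X) (gIs R a m F act X)"
  "ALL K. stable a F act K --> (ALL x:gK R a F act K (m**X).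
   rho x : aspan (TTs R a m F act X) (gKs R a m F act (%X. K (m**X)) X))"
  using retraction[OF e m X] by (elim bexE conjE) (rule that; assumption)
 note g = gens_sub[OF e' K' X]
 have sub: "gKs R a m F act (%X. K (m**X)) X <= gKs R a m F act (dsub m F K) X"
  using dsub_full[OF equiD(2)[OF e] stableD(1)[OF K] m X] by (auto simp: gK_def)
 have r4: "rho x : aspan (TTs R a m F act X) (gKs R a m F act (%X. K (m**X)) X)"
  if "x : gK R a F act K (m**X)" for x using rho(4) K that by blast
 have s: "gKs R a m F act (%X. K (m**X)) X <= IKs R a m F act (dsub m F K) X"
  "gKs R a m F act (%X. K (m**X)) X <= INs R a m F act (dsub m F K) X"
  using sub g(6,8) by blast+
 have r3: "rho x : INs R a m F act (dsub m F K) X" if "x : gI R a F act (m**X)" for x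
  by (rule aspan_least[OF g(4,7) bspec[OF rho(3) that]])
 note S = IK_subf[OF L K]
 show "y : IKs R a m F act (dsub m F K) X" if "jj R a m F act X y : dsub m E (IK R a F act K) X"
  using retraction_dsub[OF L K m X mod_hom_addmap[OF rho(1)] rho(2) S(1)
    retraction_span(1)[OF e K m X mod_hom_addmap[OF rho(1)] g(3) s(1) r4] g(3,8) that] rho(2) y by simp
 show "y : INs R a m F act (dsub m F K) X" if "jj R a m F act X y : dsub m E (IN R a F act K) X"
  using retraction_dsub[OF L K m X mod_hom_addmap[OF rho(1)] rho(2) S(2)
    retraction_span(2)[OF e K m X mod_hom_addmap[OF rho(1)] g(4) s(2) r4 r3] g(4,6) that] rho(2) y by simp
qed

text \<open>The retraction removes the change of group from the inclusion and leaves the change of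
  coefficients \<open>Phi\<close>, for which \<open>free_exact\<close> transfers the hypothesis on
  \<open>F\<close> to the tensor product; this is where freeness serves the upper bound. For
  \<open>IN\<close> the generators coming from \<open>A X\<close> are first split off with
  \<open>projection\<close>.\<close>

lemma inc_detect:
 assumes L: "isL R a E F act" and K: "stable a F act K" and m: "m : M" and X: "X : St"
  and fr: "free_group (gr (a**X))" and pull: "!!v. v : cM F X ==> MAr F (inc m X) v : K (m**X) ==> v : K X"
  and x: "x : cM E X"
 shows "MAr E (inc m X) x : IK R a F act K (m**X) ==> x : IK R a F act K X"
  "MAr E (inc m X) x : IN R a F act K (m**X) ==> x : IN R a F act K X"
proof -
 note e = isLD(1)[OF L]
 note e' = equi_shift[OF e m] and mX = M_St[OF m X] and i = inc_hm[OF m X] and a = equiD(1)[OF e]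
 note mfF = mf[OF equiD(2)[OF e]]
 let ?F = "tau G m F" and ?act = "sact a m act" and ?K = "%X. K (m**X)"
 let ?T = "TT R a F act X" and ?T' = "TT R a ?F ?act X"
 have K': "asub (MOb ?F X) (?K X)" "!!g k. g : cg (a**X) ==> k : ?K X ==> ?act X g k : ?K X"
  using stableD(2)[OF K mX] stableD(6)[OF K mX ga_whisk_closed[OF a i]] by (simp_all add: tau_simps)
 have gK': "gK R a ?F ?act ?K X <= cr ?T'"
  using TT(3)[OF e' X] asubD(2)[OF K'(1)] by (auto simp: gK_def)
 have gI': "gI R a ?F ?act X <= cr ?T'"
  using TT(3)[OF e' X] inc_closed[OF a X] by (auto simp: gI_def)
 obtain rho where rho: "rho : mod_hom R (TT R a F act (m**X)) ?T'"
  "ALL y:cr ?T'. rho (jj R a m F act X y) = y"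
  "ALL x:gI R a F act (m**X). rho x : aspan ?T' (gI R a ?F ?act X)"
  "ALL K. stable a F act K --> (ALL x:gK R a F act K (m**X). rho x : aspan ?T' (gK R a ?F ?act (%X. K (m**X)) X))"
  using retraction[OF e m X] by (elim bexE conjE) (rule that; assumption)
 obtain Phi where Phi: "Phi : mod_hom R ?T ?T'"
  "ALL g:cg (a**X). ALL v:cM F X. Phi (bb R a F act X g v) = bb R a ?F ?act X g (MAr F (inc m X) v)"
  "ALL x:cr ?T. MAr E (inc m X) x = jj R a m F act X (Phi x)"
  using phi_map[OF L m X] by (elim bexE conjE) (rule that; assumption)
 have xT: "x : cr ?T" using x isLD(3)[OF L X] by simp
 have rhoi: "rho (MAr E (inc m X) x) = Phi x" using Phi(3) rho(2) xT mod_homD(1)[OF Phi(1) xT] by simp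
 have r4: "rho x : aspan ?T' (gK R a ?F ?act ?K X)" if "x : gK R a F act K (m**X)" for x using rho(4) K that by blast
 note rs = retraction_span[OF e K m X mod_hom_addmap[OF rho(1)] _ _ r4]
 have f: "MAr F (inc m X) : mod_hom R (MOb F X) (MOb ?F X)"
  "!!g v. g : cg (a**X) ==> v : cM F X ==> MAr F (inc m X) (act X g v) = ?act X g (MAr F (inc m X) v)"
  using mfF(3)[OF i] equiD(5)[OF e i] by (simp_all add: tau_simps)
 have Phi2: "!!g v. g : cg (a**X) ==> v : cM F X ==> Phi (bb R a F act X g v) = bb R a ?F ?act X g (MAr F (inc m X) v)"
  using Phi(2) by blast
 have ex: "w : IK R a F act K X" if w: "w : cr ?T" and c: "Phi w : aspan ?T' (gK R a ?F ?act ?K X)" for w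
  unfolding IK_def gK_def
  by (rule free_exact[OF fr equiD(3)[OF e X] equiD(3)[OF e' X] f mod_hom_addmap[OF Phi(1)] Phi2 stableD(2)[OF K X] K' pull w c[unfolded gK_def]])
 note aT = TT(2)[OF e X] and aT' = TT(2)[OF e' X]
 have NK: "asub ?T' (aspan ?T' (gK R a ?F ?act ?K X))" by (rule aspan_asub[OF aT' gK'])
 show "x : IK R a F act K X" if "MAr E (inc m X) x : IK R a F act K (m**X)"
  by (rule ex[OF xT]) (use rs(1)[OF NK _ _ that] rhoi in \<open>auto intro: aspan_gen\<close>)
 assume xN: "MAr E (inc m X) x : IN R a F act K (m**X)"
 let ?N = "aspan ?T' (gK R a ?F ?act ?K X \<union> gI R a ?F ?act X)"
 have NN: "asub ?T' ?N" by (rule aspan_asub[OF aT']) (use gK' gI' in auto)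
 have r3: "rho x : ?N" if "x : gI R a F act (m**X)" for x
  by (rule aspan_mono[OF bspec[OF rho(3) that]]) simp
 have "rho (MAr E (inc m X) x) : ?N"
  by (rule rs(2)[OF NN _ _ r3 xN]) (auto intro: aspan_gen)
 then have Phix: "Phi x : ?N" using rhoi by simp
 obtain p p' where p: "p : mod_hom R ?T ?T" "p' : mod_hom R ?T' ?T'" "ALL x:cr ?T. p' (Phi x) = Phi (p x)"
  "ALL x:cr ?T. p x : aspan ?T {bb R a F act X (ga (inc a X) h) v | h v. h : cg X & v : cM F X}"
  "ALL h:cg X. ALL v:cM ?F X. p' (bb R a ?F ?act X (ga (inc a X) h) v) = bb R a ?F ?act X (ga (inc a X) h) v"
  "ALL K. K <= cM ?F X & (ALL g:cg (a**X). ALL k:K. ?act X g k : K) -->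
   (ALL g:cg (a**X). ALL k:K. p' (bb R a ?F ?act X g k) : aspan ?T' {bb R a ?F ?act X x w | x w. x : cg (a**X) & w : K})"
  by (rule projection[OF a X equiD(3)[OF e X] equiD(3)[OF e' X] f Phi(1) Phi2, THEN exE];
    (assumption | ((elim exE conjE), (rule that; assumption))))
 interpret T: abelian_group ?T by (rule aT)
 interpret T': abelian_group ?T' by (rule aT')
 note pm = mod_homD(1,2)[OF p(1)] and pm' = mod_homD(1,2)[OF p(2)]
 have d': "addmap ?T' ?T' (%y. y \<ominus>\<^bsub>?T'\<^esub> p' y)"
 proof (unfold addmap_def, intro conjI ballI)
  show "(%y. y \<ominus>\<^bsub>?T'\<^esub> p' y) : cr ?T' \<rightarrow> cr ?T'" using pm'(1) by auto
  show "y \<oplus>\<^bsub>?T'\<^esub> w \<ominus>\<^bsub>?T'\<^esub> p' (y \<oplus>\<^bsub>?T'\<^esub> w) = (y \<ominus>\<^bsub>?T'\<^esub> p' y) \<oplus>\<^bsub>?T'\<^esub> (w \<ominus>\<^bsub>?T'\<^esub> p' w)"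
   if "y : cr ?T'" "w : cr ?T'" for y w
   using that pm'(1)[OF that(1)] pm'(1)[OF that(2)] pm'(2)[OF that] T'.minus_add
   by (simp add: a_minus_def T'.a_ac)
 qed
 \<comment> \<open>The projection fixes the generators coming from \<open>A X\<close> and preserves
   the part generated by \<open>K\<close>, so the difference lies in the latter part. Thus
   \<open>free_exact\<close> applies to \<open>x - p x\<close>, while \<open>p x\<close> belongs to
   \<open>IN\<close> by construction.\<close>
 have "Phi x \<ominus>\<^bsub>?T'\<^esub> p' (Phi x) : aspan ?T' (gK R a ?F ?act ?K X)"
 proof (rule addmap_zero_on_aspan[OF d' aT' aT' _ Phix _ NK])
  show "gK R a ?F ?act ?K X \<union> gI R a ?F ?act X <= cr ?T'" using gK' gI' by simp
  fix y assume y: "y : gK R a ?F ?act ?K X \<union> gI R a ?F ?act X"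
  show "y \<ominus>\<^bsub>?T'\<^esub> p' y : aspan ?T' (gK R a ?F ?act ?K X)"
  proof (cases "y : gI R a ?F ?act X")
   case True
   then obtain h v where "y = bb R a ?F ?act X (ga (inc a X) h) v" "h : cg X" "v : cM ?F X"
    unfolding gI_def by blast
   then have "p' y = y" using p(5) by blast
   moreover have "y : cr ?T'" using gI' True by blast
   ultimately show ?thesis using asubD(3)[OF NK] by (simp add: a_minus_def T'.r_neg)
  next
   case False
   then have yK: "y : gK R a ?F ?act ?K X" using y by blast
   then obtain g k where gk: "y = bb R a ?F ?act X g k" "g : cg (a**X)" "k : ?K X" unfolding gK_def by blast
   have "?K X <= cM ?F X & (ALL g:cg (a**X). ALL k:?K X. ?act X g k : ?K X)"
    using asubD(1)[OF K'(1)] K'(2) by blast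
   with p(6) have "p' y : aspan ?T' (gK R a ?F ?act ?K X)" using gk unfolding gK_def by blast
   moreover have "y : aspan ?T' (gK R a ?F ?act ?K X)" by (rule aspan_gen[OF yK])
   ultimately show ?thesis by (intro asubD(6)[OF NK])
  qed
 qed
 moreover have "Phi (x \<ominus>\<^bsub>?T\<^esub> p x) = Phi x \<ominus>\<^bsub>?T'\<^esub> p' (Phi x)"
  using addmapD(5)[OF mod_hom_addmap[OF Phi(1)] aT aT' xT pm(1)[OF xT]] p(3) xT by simp
 ultimately have 1: "x \<ominus>\<^bsub>?T\<^esub> p x : IK R a F act K X" using ex[of "x \<ominus>\<^bsub>?T\<^esub> p x"] xT pm(1)[OF xT] by simp
 note g = gens_sub[OF e K X]
 have "p x : aspan ?T (gI R a F act X)" using p(4) xT unfolding gI_def by blast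
 then have 2: "p x : IN R a F act K X" by (rule aspan_least[OF g(4,7)])
 have "x = (x \<ominus>\<^bsub>?T\<^esub> p x) \<oplus>\<^bsub>?T\<^esub> p x" using xT pm(1)[OF xT] by (simp add: a_minus_def T.a_assoc T.l_neg)
 moreover have "(x \<ominus>\<^bsub>?T\<^esub> p x) \<oplus>\<^bsub>?T\<^esub> p x : IN R a F act K X" by (rule asubD(4)[OF g(4) subsetD[OF g(5) 1] 2])
 ultimately show "x : IN R a F act K X" by (simp only:)
qed

section \<open>The upper bound\<close>

lemma pol_zero_kernel:
 assumes "pol k s n F K" "k" "\<not> s" "m : M" "X : St" "v : cM F X" "MAr F (inc m X) v : K (m**X)"
 shows "v : K X"
 using assms by (cases n) auto

text \<open>Modulo the augmentation ideal of \<open>A X\<close>, the tensor product over the group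
  of \<open>a \<natural> X\<close> has the degree of its coefficients. Indeed \<open>jj\<close>
  identifies the cokernel along \<open>m\<close> with the same construction for the cokernel of
  \<open>F/K\<close>: it is injective by \<open>shift_exact\<close>, and surjective because the
  additional group elements come from \<open>A (m \<natural> X)\<close>, which is divided
  out.\<close>

theorem pol_IN:
 assumes "isL R a E F act" "stable a F act K" "k ==> ALL X:St. free_group (gr X)" "\<not> (k & s)" "pol k s n F K"
 shows "pol k s n E (IN R a F act K)"
 using assms
proof (induction n arbitrary: E F act K)
 case 0
 note e = isLD(1)[OF 0(1)]
 show ?case by (rule pol_base[OF 0(1,2,5) IK_subf(2)[OF 0(1,2)] gens_sub(6)[OF e 0(2)]])
next
 case (Suc n)
 note L = Suc.prems(1) and K = Suc.prems(2) and fr = Suc.prems(3) and ks = Suc.prems(4)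
 note e = isLD(1)[OF L]
 note a = equiD(1)[OF e] and E = isLD(2)[OF L] and F = equiD(2)[OF e]
 note SN = IK_subf(2)[OF L K]
 have kap: "x : IN R a F act K X" if k and m: "m : M" and X: "X : St" and x: "x : cM E X"
  "MAr E (inc m X) x : IN R a F act K (m**X)" for m X x
 proof -
  have fr': "free_group (gr (a**X))" using fr[OF \<open>k\<close>] M_St[OF a X] by blast
  have pull: "v : K X" if "v : cM F X" "MAr F (inc m X) v : K (m**X)" for v
   using pol_zero_kernel[OF Suc.prems(5) \<open>k\<close> _ m X that] ks \<open>k\<close> by simp
  show ?thesis by (rule inc_detect(2)[OF L K m X fr' pull x])
 qed
 have step: "pol k s n (tau G m E) (dsub m E (IN R a F act K))" if m: "m : M" for m
 proof -
  note e' = equi_shift[OF e m] and K' = stable_dsub[OF e K m]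
  obtain E' where L': "isL R a E' (tau G m F) (sact a m act)" using isL_exists[OF e'] by blast
  have p: "pol k s n (tau G m F) (dsub m F K)" using Suc.prems(5) m by simp
  note ih = Suc.IH[OF L' K' fr ks p]
  note mfE = mf[OF E]
  show ?thesis
  proof (rule pol_quotient[OF tau_mf[OF E m] isLD(2)[OF L'] dsub_subf[OF E SN m] IK_subf(2)[OF L' K'] _ _ _ _ _ ih ks,
     where j = "jj R a m F act"])
   fix X assume X: "X : St"
   note mX = M_St[OF m X] and ob = isLD(3)[OF L M_St[OF m X]] isLD(3)[OF L' X]
   have dN: "asub (MOb E (m**X)) (dsub m E (IN R a F act K) X)"
    using subfD(1)[OF dsub_subf[OF E SN m] X] by (simp add: tau_simps)
   have sub: "IN R a F act K (m**X) <= dsub m E (IN R a F act K) X" using dsub_full[OF E SN m X] by blast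
   note g = gens_sub[OF e K mX] and g' = gens_sub[OF e' K' X]
   note jh = mod_hom_addmap[OF jj(1)[OF e m X]]
   show "addmap (MOb E' X) (MOb (tau G m E) X) (jj R a m F act X)"
    using jh ob by (simp add: tau_simps)
   show "jj R a m F act X y : dsub m E (IN R a F act K) X" if y: "y : INs R a m F act (dsub m F K) X" for y
   proof (rule addmap_zero_on_aspan[OF jh TT(2)[OF e' X] TT(2)[OF e mX] _ y[unfolded IN_def] _ dN[unfolded ob]])
    show "gKs R a m F act (dsub m F K) X \<union> gIs R a m F act X <= cr (TTs R a m F act X)"
     using g' by simp
    fix w assume w: "w : gKs R a m F act (dsub m F K) X \<union> gIs R a m F act X"
    show "jj R a m F act X w : dsub m E (IN R a F act K) X"
    proof (cases "w : gIs R a m F act X")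
     case True
     then obtain h v where h: "w = bbs R a m F act X (ga (inc a X) h) v" "h : cg X" "v : cM F (m**X)"
      unfolding gI_def tau_simps by blast
     note i = inc_hm[OF m X]
     have "jj R a m F act X w = bb R a F act (m**X) (ga (inc a (m**X)) (ga (inc m X) h)) v"
      using jj(2)[OF e m X inc_closed[OF a X h(2)] h(3)] h(1) ga_inc[OF M_obj[OF a] hmD(1)[OF i] h(2)] by simp
     then have "jj R a m F act X w : gI R a F act (m**X)"
      using inc_closed[OF m X h(2)] h(3) unfolding gI_def by blast
     then show ?thesis using g(7) sub by blast
    next
     case False
     then have "w : IKs R a m F act (dsub m F K) X" using w g'(8) by blast
     then show ?thesis
      by (rule shift_mem[OF L K m X dN, rotated -1]) (use g(6) sub dsub_inc[OF E SN m X] in auto)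
    qed
   qed
   show "y : INs R a m F act (dsub m F K) X" if "y : cM E' X" "jj R a m F act X y : dsub m E (IN R a F act K) X" for y
    by (rule shift_exact(2)[OF L K m X _ that(2)]) (use that(1) ob in simp)
   show "EX b:dsub m E (IN R a F act K) X. EX y:cM E' X. x = b \<oplus>\<^bsub>MOb (tau G m E) X\<^esub> jj R a m F act X y"
    if x: "x : cM (tau G m E) X" for x
   proof -
    let ?D = "dsub m E (IN R a F act K) X" and ?j = "jj R a m F act X" and ?T = "TT R a F act (m**X)" and ?T' = "TTs R a m F act X"
    let ?B = "{bb R a F act (m**X) g v | g v. g : cg (a**m**X) & v : cM F (m**X)}"
    let ?W = "{b \<oplus>\<^bsub>?T\<^esub> ?j y | b y. b : ?D & y : cr ?T'}"
    note W = sum_asub[OF dN[unfolded ob] jh TT(2)[OF e mX] TT(2)[OF e' X]]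
    \<comment> \<open>Surjectivity: by \<open>rho\<close> the tensor product is spanned by
      generators from the groups of \<open>a \<natural> X\<close> and \<open>m \<natural> X\<close>.
      The former are values of \<open>jj\<close>, the latter lie in \<open>IN\<close>.\<close>
    have "?B <= ?W"
    proof
     fix w assume "w : ?B"
     then obtain g v where w: "w = bb R a F act (m**X) g v" "g : cg (a**m**X)" "v : cM F (m**X)" by blast
     show "w : ?W" unfolding w(1)
     proof (rule aspan_least[OF W(1) _ rho(2)[OF a m X equiD(3)[OF e mX] w(2,3)]])
      have 1: "bb R a F act (m**X) (ga (whisk a (inc m X)) x) v : ?W" if "x : cg (a**X)" "v : cM F (m**X)" for x v
      proof -
       have v: "v : cM (tau G m F) X" using that(2) by (simp add: tau_simps)
       show ?thesis unfolding jj(2)[OF e m X that, symmetric] by (rule W(3)[OF TT(3)[OF e' X that(1) v]])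
      qed
      have 2: "bb R a F act (m**X) (ga (inc a (m**X)) x) v : ?W" if "x : cg (m**X)" "v : cM F (m**X)" for x v
      proof -
       have "bb R a F act (m**X) (ga (inc a (m**X)) x) v : gI R a F act (m**X)" using that unfolding gI_def by blast
       then have d: "bb R a F act (m**X) (ga (inc a (m**X)) x) v : ?D" using g(7) sub by blast
       show ?thesis by (rule W(2)[OF d])
      qed
      show "{bb R a F act (m**X) (ga (whisk a (inc m X)) x) w |x w. x : cg (a**X) & w : cM F (m**X)} \<union>
       {bb R a F act (m**X) (ga (inc a (m**X)) x) w |x w. x : cg (m**X) & w : cM F (m**X)} <= ?W"
       using 1 2 by blast
     qed
    qed
    then have "x : ?W" using aspan_least[OF W(1) _ TT(4)[OF e mX]] x ob by (simp add: tau_simps)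
    then show ?thesis using ob by (auto simp: tau_simps)
   qed
  next
   fix X Y phi y assume "phi : hm X Y" "y : cM E' X"
   then show "jj R a m F act Y (MAr E' phi y) = MAr (tau G m E) phi (jj R a m F act X y)"
    using jj_natural[OF L L' m] by (simp add: tau_simps)
  qed
 qed
 show ?case using kap step by simp
qed


text \<open>With the unit as parameter the augmentation ideal of \<open>A X\<close> is all there is,
  and nothing of it is divided out. Then \<open>jj\<close> is no longer surjective: it embeds
  \<open>I \<otimes> delta m (F/K)\<close> into the cokernel along \<open>m\<close>, and the
  quotient is the functor of \<open>pol_IN\<close> with parameter \<open>m\<close> and coefficients
  \<open>tau m F\<close>. That quotient has the degree of \<open>F/K\<close>, so the cokernel does,
  and the degree of the whole goes up by one.\<close>

theorem pol_IK:
 assumes "isL R (Unit G) E F act" "stable (Unit G) F act K" "k ==> ALL X:St. free_group (gr X)" "\<not> (k & s)" "pol k s n F K"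
 shows "pol k s (Suc n) E (IK R (Unit G) F act K)"
 using assms
proof (induction n arbitrary: E F act K)
 \<comment> \<open>One \<open>delta\<close> step, with the bound for the left-hand term of the exact
   sequence passed in as \<open>p'\<close>. It is the induction hypothesis for a successor, and
   \<open>pol_base\<close> when \<open>F/K\<close> is already (stably) zero.\<close>
 have main: "pol k s (Suc n) E (IK R (Unit G) F act K)"
  if L: "isL R (Unit G) E F act" and K: "stable (Unit G) F act K" and fr: "k ==> ALL X:St. free_group (gr X)"
   and ks: "\<not> (k & s)" and p: "pol k s n F K"
   and p': "!!m E'. m : M ==> isL R (Unit G) E' (tau G m F) (sact (Unit G) m act) ==>
    pol k s n E' (IK R (Unit G) (tau G m F) (sact (Unit G) m act) (dsub m F K))" for n E F act K
 proof -
  let ?u = "Unit G"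
  note e = isLD(1)[OF L]
  note a = equiD(1)[OF e] and E = isLD(2)[OF L] and F = equiD(2)[OF e]
  note SK = IK_subf(1)[OF L K]
  have kap: "x : IK R ?u F act K X" if k and m: "m : M" and X: "X : St" and x: "x : cM E X"
   "MAr E (inc m X) x : IK R ?u F act K (m**X)" for m X x
  proof -
   have fr': "free_group (gr (?u**X))" using fr[OF \<open>k\<close>] M_St[OF a X] by blast
   have pull: "v : K X" if "v : cM F X" "MAr F (inc m X) v : K (m**X)" for v
    using pol_zero_kernel[OF p \<open>k\<close> _ m X that] ks \<open>k\<close> by simp
   show ?thesis by (rule inc_detect(1)[OF L K m X fr' pull x])
  qed
  have step: "pol k s n (tau G m E) (dsub m E (IK R ?u F act K))" if m: "m : M" for m
  proof -
   note e' = equi_shift[OF e m] and K' = stable_dsub[OF e K m] and Lt = isL_tau[OF L m] and Kt = stable_tau[OF e K m]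
   note et = isLD(1)[OF Lt]
   obtain E' where L': "isL R ?u E' (tau G m F) (sact ?u m act)" using isL_exists[OF e'] by blast
   note p'' = pol_IN[OF Lt Kt fr ks pol_tau[OF F stableD(1)[OF K] m ks p]]
   let ?N = "dsub m E (IK R ?u F act K)" and ?N'' = "IN R (?u**m) (tau G m F) (%X. act (m**X)) (%X. K (m**X))"
   note mfE = mf[OF E] and mfF = mf[OF F]
   have um: "?u**m = m" using M_obj[OF m] by simp
   have wu: "whisk ?u (inc m X) = inc m X" "?u**X = X" if "X : St" for X
    using whisk_unit[OF hmD(1)[OF inc_hm[OF m that]]] St_obj[OF that] by simp_all
   have gIt: "bb R ?u F act (m**X) (ga (inc m X) h) v : gI R (?u**m) (tau G m F) (%X. act (m**X)) X"
    if "X : St" "h : cg X" "v : cM F (m**X)" for X h v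
    using that um wu[OF that(1)] tau_TT(2)[OF a m that(1), of R F act] unfolding gI_def by (auto simp: tau_simps)
   have gKt: "gK R (?u**m) (tau G m F) (%X. act (m**X)) (%X. K (m**X)) X = gK R ?u F act K (m**X)" if "X : St" for X
    unfolding gK_def tau_TT(2,3)[OF a m that] by (simp only: tau_simps)
   show ?thesis
   proof (rule pol_extension[OF tau_mf[OF E m] isLD(2)[OF L'] dsub_subf[OF E SK m] IK_subf(1)[OF L' K'] IK_subf(2)[OF Lt Kt]
      _ _ _ _ _ _ _ p'[OF m L'] p'' ks, where j = "jj R ?u m F act"])
    fix X assume X: "X : St"
    note mX = M_St[OF m X] and ob = isLD(3)[OF L M_St[OF m X]] isLD(3)[OF L' X]
    have dN: "asub (MOb E (m**X)) (?N X)"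
     using subfD(1)[OF dsub_subf[OF E SK m] X] by (simp add: tau_simps)
    have sub: "IK R ?u F act K (m**X) <= ?N X" using dsub_full[OF E SK m X] by blast
    note g = gens_sub[OF e K mX] and g' = gens_sub[OF e' K' X] and gt = gens_sub[OF et Kt X]
    note jh = mod_hom_addmap[OF jj(1)[OF e m X]] and i = inc_hm[OF m X]
    have NT: "asub (TT R ?u F act (m**X)) (?N'' X)" using gt(4) unfolding tau_TT(1)[OF a m X] .
    note i1 = phi_map[OF L m X]
    have jN: "jj R ?u m F act X y : ?N'' X" if y: "y : cr (TT R ?u (tau G m F) (sact ?u m act) X)" for y
    proof (rule addmap_zero_on_aspan[OF jh TT(2)[OF e' X] TT(2)[OF e mX] _ TT(4)[OF e' X y] _ NT])
     show "{bb R ?u (tau G m F) (sact ?u m act) X g v |g v. g : cg (?u**X) & v : cM (tau G m F) X}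
      <= cr (TT R ?u (tau G m F) (sact ?u m act) X)" using TT(3)[OF e' X] by blast
     fix w assume "w : {bb R ?u (tau G m F) (sact ?u m act) X g v |g v. g : cg (?u**X) & v : cM (tau G m F) X}"
     then obtain h v where w: "w = bb R ?u (tau G m F) (sact ?u m act) X h v" "h : cg (?u**X)" "v : cM F (m**X)"
      unfolding tau_simps by blast
     show "jj R ?u m F act X w : ?N'' X"
      using jj(2)[OF e m X w(2,3)] w(1) gIt[OF X _ w(3), of h] w(2) gt(7) wu[OF X] by auto
    qed
    show "addmap (MOb E' X) (MOb (tau G m E) X) (jj R ?u m F act X)"
     using jh ob by (simp add: tau_simps)
    show "jj R ?u m F act X y : ?N X" if y: "y : IK R ?u (tau G m F) (sact ?u m act) (dsub m F K) X" for y
     by (rule shift_mem[OF L K m X dN _ _ y]) (use g(8) sub dsub_inc[OF E SK m X] in auto)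
    show "y : IK R ?u (tau G m F) (sact ?u m act) (dsub m F K) X" if "y : cM E' X" "jj R ?u m F act X y : ?N X" for y
     by (rule shift_exact(1)[OF L K m X _ that(2)]) (use that(1) ob in simp)
    have KN: "IK R ?u F act K (m**X) <= ?N'' X"
     using aspan_least[OF NT] gt(6) unfolding IK_def gKt[OF X] by blast
    show "?N X <= ?N'' X"
    proof
     fix x assume "x : ?N X"
     then obtain w y where x: "w : IK R ?u F act K (m**X)" "y : cM E X" "x = w \<oplus>\<^bsub>MOb E (m**X)\<^esub> MAr E (inc m X) y"
      by (auto simp: dsub_def)
     obtain Phi where Phi: "Phi : mod_hom R (TT R ?u F act X) (TT R ?u (tau G m F) (sact ?u m act) X)"
      "ALL x:cr (TT R ?u F act X). MAr E (inc m X) x = jj R ?u m F act X (Phi x)"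
      using phi_map[OF L m X] by (elim bexE conjE) (rule that; assumption)
     have yT: "y : cr (TT R ?u F act X)" using x(2) isLD(3)[OF L X] by simp
     have "MAr E (inc m X) y : ?N'' X" using Phi(2) yT jN[OF mod_homD(1)[OF Phi(1) yT]] by simp
     then show "x : ?N'' X" using x(1,3) KN asubD(4)[OF NT] ob by auto
    qed
    show "jj R ?u m F act X y : ?N'' X" if "y : cM E' X" for y using jN that ob by simp
    show "EX b:?N X. EX y:cM E' X. x = b \<oplus>\<^bsub>MOb (tau G m E) X\<^esub> jj R ?u m F act X y" if x: "x : ?N'' X" for x
    proof -
     let ?T = "TT R ?u F act (m**X)" and ?T' = "TT R ?u (tau G m F) (sact ?u m act) X"
     let ?W = "{b \<oplus>\<^bsub>?T\<^esub> jj R ?u m F act X y | b y. b : ?N X & y : cr ?T'}"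
     note W = sum_asub[OF dN[unfolded ob] jh TT(2)[OF e mX] TT(2)[OF e' X]]
     have 1: "gK R (?u**m) (tau G m F) (%X. act (m**X)) (%X. K (m**X)) X <= ?W"
      unfolding gKt[OF X] using W(2) g(8) sub by blast
     have 2: "gI R (?u**m) (tau G m F) (%X. act (m**X)) X <= ?W"
     proof
      fix w assume "w : gI R (?u**m) (tau G m F) (%X. act (m**X)) X"
      then obtain h v where w: "w = bb R ?u F act (m**X) (ga (inc m X) h) v" "h : cg X" "v : cM F (m**X)"
       using um tau_TT(2)[OF a m X, of R F act] unfolding gI_def by (auto simp: tau_simps)
      have h: "h : cg (?u**X)" and v: "v : cM (tau G m F) X" using w wu[OF X] by (simp_all add: tau_simps)
      have "w = jj R ?u m F act X (bb R ?u (tau G m F) (sact ?u m act) X h v)"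
       using jj(2)[OF e m X h w(3)] w(1) wu[OF X] by simp
      then show "w : ?W" using W(3)[OF TT(3)[OF e' X h v]] by simp
     qed
     have "x : aspan ?T (gK R (?u**m) (tau G m F) (%X. act (m**X)) (%X. K (m**X)) X \<union> gI R (?u**m) (tau G m F) (%X. act (m**X)) X)"
      using x unfolding IN_def tau_TT(1)[OF a m X] .
     from aspan_least[OF W(1) _ this] 1 2 have "x : ?W" by blast
     then show ?thesis using ob by (auto simp: tau_simps)
    qed
   next
    fix X Y phi y assume "phi : hm X Y" "y : cM E' X"
    then show "jj R ?u m F act Y (MAr E' phi y) = MAr (tau G m E) phi (jj R ?u m F act X y)"
     using jj_natural[OF L L' m] by (simp add: tau_simps)
   qed
  qed
  show ?thesis using kap step by simp
 qed
 {
  case 0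
  note L = 0(1) and K = 0(2)
  note e = isLD(1)[OF L]
  show ?case
  proof (rule main[OF 0])
   fix m E' assume m: "m : M" and L': "isL R (Unit G) E' (tau G m F) (sact (Unit G) m act)"
   note e' = isLD(1)[OF L'] and K' = stable_dsub[OF e K m]
   \<comment> \<open>Enlarging the subfunctor is available for the flag \<open>k = False\<close>; at
     index 0 the flag does not occur in \<open>pol\<close>, so the result is also the one for
     \<open>k\<close>.\<close>
   have "pol False s 0 (tau G m F) (%X. K (m**X))"
    using pol_tau[OF equiD(2)[OF e] stableD(1)[OF K] m 0(4,5)] by simp
   then have "pol False s 0 (tau G m F) (dsub m F K)"
    by (rule pol_mono[rotated]) (use dsub_full[OF equiD(2)[OF e] stableD(1)[OF K] m] in blast)
   then have "pol k s 0 (tau G m F) (dsub m F K)" by simp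
   from pol_base[OF L' K' this IK_subf(1)[OF L' K'] gens_sub(8)[OF e' K']]
   show "pol k s 0 E' (IK R (Unit G) (tau G m F) (sact (Unit G) m act) (dsub m F K))" .
  qed
 next
  case (Suc n)
  note L = Suc.prems(1) and K = Suc.prems(2)
  note e = isLD(1)[OF L]
  show ?case
  proof (rule main[OF Suc.prems])
   fix m E' assume m: "m : M" and L': "isL R (Unit G) E' (tau G m F) (sact (Unit G) m act)"
   have "pol k s n (tau G m F) (dsub m F K)" using Suc.prems(5) m by simp
   from Suc.IH[OF L' stable_dsub[OF e K m] Suc.prems(3,4) this]
   show "pol k s (Suc n) E' (IK R (Unit G) (tau G m F) (sact (Unit G) m act) (dsub m F K))" .
  qed
 }
qed

end

end

section \<open>The lower bound\<close>

lemma (in group) int_pow_kernel: "x : cr G ==> EX n::int. ALL k::int. x [^] k = \<one> \<longleftrightarrow> n dvd k"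
proof -
 assume x: "x : cr G"
 show ?thesis
 proof (cases "EX k::nat. k > 0 & x [^] int k = \<one>")
  case False
  have "k = 0" if "x [^] k = \<one>" for k :: int
  proof (rule ccontr)
   assume "k ~= 0"
   moreover have "x [^] int (nat \<bar>k\<bar>) = \<one>" using that x by (cases "k \<ge> 0") (simp_all add: int_pow_neg)
   ultimately show False using False by (metis zero_less_abs_iff zero_less_nat_eq)
  qed
  then show ?thesis by (intro exI[of _ 0]) auto
 next
  case True
  define n where "n = (LEAST k::nat. k > 0 & x [^] int k = \<one>)"
  have n: "n > 0" "x [^] int n = \<one>" using LeastI_ex[OF True] by (simp_all add: n_def)
  have "x [^] k = \<one> \<longleftrightarrow> int n dvd k" for k :: int
  proof -
   have "x [^] k = x [^] (int n * (k div int n) + k mod int n)" by simp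
   also have "\<dots> = (x [^] int n) [^] (k div int n) \<otimes> x [^] (k mod int n)"
    using x by (simp only: int_pow_mult int_pow_pow)
   also have "\<dots> = x [^] (k mod int n)" using n x by simp
   finally have e: "x [^] k = x [^] int (nat (k mod int n))" using n(1) by simp
   have "nat (k mod int n) < n" using n(1) by (simp add: nat_less_iff)
   from not_less_Least[OF this[unfolded n_def]] have "x [^] int (nat (k mod int n)) = \<one> \<longleftrightarrow> nat (k mod int n) = 0"
    by (auto simp: n_def)
   then show ?thesis using e n(1) by (simp add: dvd_eq_mod_eq_0 order_antisym_conv)
  qed
  then show ?thesis by blast
 qed
qed

text \<open>If \<open>W\<close> were proper, the Fox derivatives of the retract would vanish on
  \<open>V/W\<close>. Then the retract acts trivially there, and so does \<open>B\<close>, whose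
  action factors through \<open>r\<close>. Fox derivatives now reduce to exponent sums, which must
  all annihilate some nonzero \<open>v0\<close>; \<open>free_retract_trivial\<close> forces
  \<open>r\<close> to be trivial.\<close>

lemma (in free_tensor) coef_core:
 assumes r: "r : hom B B" "!!g. g : cr B ==> r (r g) = r g"
  and ar: "!!g v. g : cr B ==> v : cr V ==> act (r g) v = act g v"
  and nt: "g0 : cr B" "r g0 ~= \<one>\<^bsub>B\<^esub>"
  and W: "asub V W" "ALL g:cr B. ALL k:W. act g k : W"
  and d: "!!g s v. g : cr B ==> s : S ==> v : cr V ==> coef s (b (r g) v) : W"
 shows "W = cr V"
proof (rule ccontr)
 assume "W ~= cr V"
 then obtain v0 where v0: "v0 : cr V" "v0 \<notin> W" using asubD(1)[OF W(1)] by blast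
 note aV = module_abelian[OF V.module_axioms]
 interpret q: module_quotient V W by (intro module_quotient.intro module_quotient_axioms.intro aV W(1))
 let ?Q = "quot_module V W" and ?q = "quot_rep V W"
 note aQ = q.quot_abelian
 interpret Q: abelian_group ?Q by (rule aQ)
 have qa: "addmap V ?Q ?q" using q.q_carrier q.q_add by (simp add: addmap_def)
 note qd = addmapD[OF qa aV aQ]
 have rc: "r g : cr B" if "g : cr B" for g using r(1) that by (auto simp: hom_def)
 note ac = repD(4)[OF rp]
 \<comment> \<open>The derivation behind the map
   \<open>(g - 1) \<otimes> v \<mapsto> g v - v\<close>. This map connects vanishing of Fox
   derivatives modulo \<open>W\<close> with triviality of the action modulo
   \<open>W\<close>.\<close>
 have "der R B V act V (%g v. act g v \<ominus>\<^bsub>V\<^esub> v)"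
  unfolding der_def
 proof (intro conjI ballI)
  show "module R V" by (rule V.module_axioms)
  fix g assume g: "g : cr B"
  have "(%v. \<ominus>\<^bsub>V\<^esub> v) : mod_hom R V V"
   by (rule mod_hom_neg[OF V.module_axioms V.module_axioms, of "%v. v"]) (simp add: mod_hom_def)
  from mod_hom_plus[OF V.module_axioms V.module_axioms repD(3)[OF rp g] this]
  show "(%v. act g v \<ominus>\<^bsub>V\<^esub> v) : mod_hom R V V" by (simp add: a_minus_def)
  fix h v assume h: "h : cr B" and v: "v : cr V"
  have c: "act h v : cr V" "act g (act h v) : cr V" using ac g h v by simp_all
  show "act (g \<otimes>\<^bsub>B\<^esub> h) v \<ominus>\<^bsub>V\<^esub> v = (act g (act h v) \<ominus>\<^bsub>V\<^esub> act h v) \<oplus>\<^bsub>V\<^esub> (act h v \<ominus>\<^bsub>V\<^esub> v)"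
   using repD(6)[OF rp g h v] c v by (simp add: a_minus_def V.M.a_assoc V.M.r_neg2 V.M.r_neg1)
 qed
 from tens_universal[OF this] obtain mu where mu: "mu : mod_hom R T V"
  "ALL h:cr B. ALL v:cr V. mu (b h v) = act h v \<ominus>\<^bsub>V\<^esub> v" by (rule bexE)
 have tr: "?q (act g v) = ?q v" if g: "g : cr B" and v: "v : cr V" for g v
 proof -
  have bW: "b (r g) v : aspan T {b g k | g k. g : cr B & k : W}"
   by (rule coef_detect[OF W(1) b_closed[OF rc[OF g] v] d[OF g _ v]])
  have "mu (b (r g) v) : W"
  proof (rule addmap_zero_on_aspan[OF mod_hom_addmap[OF mu(1)] module_abelian[OF tens_module] aV _ bW _ W(1)])
   show "{b g k | g k. g : cr B & k : W} <= cr T" using b_closed asubD(2)[OF W(1)] by blast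
   fix s assume "s : {b g k | g k. g : cr B & k : W}"
   then obtain h k where s: "s = b h k" "h : cr B" "k : W" by blast
   have "mu s = act h k \<ominus>\<^bsub>V\<^esub> k" using mu(2) s asubD(2)[OF W(1) s(3)] by blast
   then show "mu s : W" using asubD(6)[OF W(1)] W(2) s by simp
  qed
  moreover have "mu (b (r g) v) = act g v \<ominus>\<^bsub>V\<^esub> v" using mu(2) rc[OF g] v ar[OF g v] by simp
  ultimately show ?thesis using q.q_eq_iff[OF ac[OF g v] v] by simp
 qed
 let ?G = "add_monoid ?Q"
 have gQ: "group ?G" by (rule Q.a_group)
 \<comment> \<open>Once the action is trivial modulo \<open>W\<close>, the cocycle rule only adds up
   signs. The integer multiple of \<open>v\<close> is written as a power in the additive group of
   the quotient.\<close>
 have words: "?q (coef s (b (word_value B w) v)) = ?q v [^]\<^bsub>?G\<^esub> expo s w"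
  if "fst ` set w <= S" "v : cr V" for s w v
  using that
 proof (induction w)
  case Nil
  have "coef s (b \<one>\<^bsub>B\<^esub> v) = \<zero>\<^bsub>V\<^esub>" using der_one[OF coef_der rp Nil(2)] .
  then show ?case using qd(3) by (simp add: word_value_def)
 next
  case (Cons a w)
  obtain t p where a: "a = (t, p)" by fastforce
  have t: "t : S" "t : cr B" and w: "fst ` set w <= S" using Cons(2) a S(1) by auto
  let ?l = "if p then t else inv\<^bsub>B\<^esub> t" and ?x = "word_value B w" and ?v = "v"
  have x: "?x : cr B" using wval_closed[OF B.is_group _ w, of "%s. s"] S(1) by (simp add: wval_word_value Pi_iff subset_iff)
  have l: "?l : cr B" using t by simp
  have y: "act ?x v : cr V" by (rule ac[OF x Cons(3)])
  have qv: "?q v : cr ?Q" using qd(1)[OF Cons(3)] .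
  have 1: "?q (coef s (b ?l (act ?x v))) = ?q v [^]\<^bsub>?G\<^esub> (if t = s then if p then 1 else - 1 else 0 :: int)"
  proof (cases p)
   case True
   then show ?thesis using coef(2)[OF t(1) y] tr[OF x Cons(3)] qd(3) qv group.int_pow_1[OF gQ, of "?q v"] by simp
  next
   case False
   have y': "act (inv\<^bsub>B\<^esub> t) (act ?x v) : cr V" by (rule ac[OF B.inv_closed[OF t(2)] y])
   have "coef s (b (inv\<^bsub>B\<^esub> t) (act ?x v)) = \<ominus>\<^bsub>V\<^esub> coef s (b t (act (inv\<^bsub>B\<^esub> t) (act ?x v)))"
    by (rule der_inv[OF coef_der rp y t(2)])
   also have "\<dots> = \<ominus>\<^bsub>V\<^esub> (if t = s then act (inv\<^bsub>B\<^esub> t) (act ?x v) else \<zero>\<^bsub>V\<^esub>)" using coef(2)[OF t(1) y'] by simp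
   finally have "?q (coef s (b ?l (act ?x v))) = (if t = s then \<ominus>\<^bsub>?Q\<^esub> ?q v else \<zero>\<^bsub>?Q\<^esub>)"
    using False qd(4)[OF y'] tr[OF B.inv_closed[OF t(2)] y] tr[OF x Cons(3)] qd(3) a_inv_zero[OF aV]
    by (cases "t = s") (simp_all only: if_True if_False simp_thms)
   then show ?thesis using False qv group.int_pow_1[OF gQ, of "?q v"] group.int_pow_neg[OF gQ, of "?q v" 1] by (simp add: a_inv_def)
  qed
  have "word_value B (a # w) = ?l \<otimes>\<^bsub>B\<^esub> ?x" using a by (simp add: word_value_def)
  then have "?q (coef s (b (word_value B (a # w)) v)) = ?q (coef s (b ?l (act ?x v))) \<oplus>\<^bsub>?Q\<^esub> ?q (coef s (b ?x v))"
   using derD(4)[OF coef_der l x Cons(3)] qd(2) derD(3)[OF coef_der l y] derD(3)[OF coef_der x Cons(3)] by simp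
  also have "\<dots> = ?q v [^]\<^bsub>?G\<^esub> ((if t = s then if p then 1 else - 1 else 0) + expo s w)"
   using 1 Cons.IH[OF w Cons(3)] group.int_pow_mult[OF gQ, of "?q v"] qv by simp
  finally show ?case using a by simp
 qed
 have q0: "?q v0 : cr ?G" using qd(1)[OF v0(1)] by simp
 \<comment> \<open>\<open>n\<close> generates the annihilator of \<open>v0\<close> modulo
   \<open>W\<close>, and is 0 for infinite order. Since \<open>v0\<close> is nonzero there,
   \<open>n\<close> is not a unit.\<close>
 obtain n :: int where n: "?q v0 [^]\<^bsub>?G\<^esub> k = \<one>\<^bsub>?G\<^esub> \<longleftrightarrow> n dvd k" for k :: int using group.int_pow_kernel[OF gQ q0] by blast
 have "r g0 = \<one>\<^bsub>B\<^esub>"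
 proof (rule free_retract_trivial[OF fb r(1) r(2) _ _ nt(1), where n = n])
  have "?q v0 ~= \<one>\<^bsub>?G\<^esub>" using q.q_zero_iff[OF v0(1)] v0(2) by simp
  then have "\<not> n dvd 1" using n[of 1] group.int_pow_1[OF gQ q0] by simp
  then show "\<bar>n\<bar> ~= 1" by simp
  show "n dvd expo s w" if w: "fst ` set w <= S" "word_value B w : r ` cr B" "s : S" for w s
  proof -
   obtain g where g: "word_value B w = r g" "g : cr B" using w(2) by blast
   have "?q (coef s (b (r g) v0)) = \<zero>\<^bsub>?Q\<^esub>"
    using q.q_zero_iff[OF mod_homD(1)[OF coef(1) b_closed[OF rc[OF g(2)] v0(1)]]] d[OF g(2) w(3) v0(1)] by simp
   then have "?q v0 [^]\<^bsub>?G\<^esub> expo s w = \<one>\<^bsub>?G\<^esub>" using words[OF w(1) v0(1), of s] g(1) by simp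
   then show ?thesis using n by simp
  qed
 qed
 then show False using nt(2) by simp
qed

context long_moody_setting
begin

text \<open>The hypothesis \<open>core\<close> says that \<open>F\<close> has no proper subgroup
  that is stable under all \<open>beta\<close> and contains the values of all \<open>theta\<close>.
  It speaks of \<open>F\<close> at every object and not of \<open>K\<close>, so it survives shifting
  while \<open>N\<close> and \<open>K\<close> become \<open>dsub\<close>. At index 0 it is applied
  to \<open>K\<close> itself, or to its stabilization \<open>stab F K\<close>.\<close>

lemma pol_detect:
 assumes "module_functor R S E" "module_functor R S F" "subf E N" "subf F K"
  and "!!i X. i : J ==> X : St ==> addmap (MOb E X) (MOb F X) (theta i X)"
  and "!!i X Y phi x. i : J ==> phi : hm X Y ==> x : cM E X ==> theta i Y (MAr E phi x) = MAr F phi (theta i X x)"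
  and "!!h X. h : C ==> X : St ==> addmap (MOb F X) (MOb F X) (beta h X)"
  and "!!h X Y phi x. h : C ==> phi : hm X Y ==> x : cM F X ==> beta h Y (MAr F phi x) = MAr F phi (beta h X x)"
  and core: "!!X W. X : St ==> asub (MOb F X) W ==> (ALL h:C. ALL w:W. beta h X w : W) ==>
   (ALL i:J. ALL x:cM E X. theta i X x : W) ==> W = cM F X"
  and "!!h X w. h : C ==> X : St ==> w : K X ==> beta h X w : K X"
  and "!!i X x. i : J ==> X : St ==> x : N X ==> theta i X x : K X"
  and "pol False s e E N"
 shows "pol False s e F K"
 using assms
proof (induction e arbitrary: E F N K theta beta)
 case (0 E F N K theta beta)
 note mfE = mf[OF 0(1)] and mfF = mf[OF 0(2)]
 show ?case
 proof (cases s)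
  case False
  have "K X = cM F X" if X: "X : St" for X
   by (rule 0(9)[OF X subfD(1)[OF 0(4) X]]) (use 0(10,11) 0(12) False X in auto)
  then show ?thesis using False by simp
 next
  case True
  have "stab F K X = cM F X" if X: "X : St" for X
  proof (rule 0(9)[OF X subfD(1)[OF stab_subf[OF 0(2,4)] X]])
   show "ALL h:C. ALL w:stab F K X. beta h X w : stab F K X"
   proof (intro ballI)
    fix h w assume h: "h : C" and "w : stab F K X"
    then obtain m where m: "w : cM F X" "m : M" "MAr F (inc m X) w : K (m**X)" by (auto simp: stab_def)
    have "MAr F (inc m X) (beta h X w) : K (m**X)"
     using 0(8)[OF h inc_hm[OF m(2) X] m(1)] 0(10)[OF h M_St[OF m(2) X] m(3)] by simp
    then show "beta h X w : stab F K X"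
     using addmapD(1)[OF 0(7)[OF h X] mfF(2)[OF X] mfF(2)[OF X] m(1)] m(2) by (auto simp: stab_def)
   qed
   show "ALL i:J. ALL x:cM E X. theta i X x : stab F K X"
   proof (intro ballI)
    fix i x assume i: "i : J" and x: "x : cM E X"
    obtain m where m: "m : M" "MAr E (inc m X) x : N (m**X)" using 0(12) True X x by auto
    have "MAr F (inc m X) (theta i X x) : K (m**X)"
     using 0(6)[OF i inc_hm[OF m(1) X] x] 0(11)[OF i M_St[OF m(1) X] m(2)] by simp
    then show "theta i X x : stab F K X"
     using addmapD(1)[OF 0(5)[OF i X] mfE(2)[OF X] mfF(2)[OF X] x] m(1) by (auto simp: stab_def)
   qed
  qed
  then show ?thesis using stab_full[of False F K] True by simp
 qed
next
 case (Suc e E F N K theta beta)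
 note p = Suc.prems
 note mfE = mf[OF p(1)] and mfF = mf[OF p(2)]
 have "pol False s e (tau G m F) (dsub m F K)" if m: "m : M" for m
 proof (rule Suc.IH[of "tau G m E" "tau G m F" "dsub m E N" "dsub m F K" "%i X. theta i (m**X)" "%h X. beta h (m**X)",
    OF tau_mf[OF p(1) m] tau_mf[OF p(2) m] dsub_subf[OF p(1,3) m] dsub_subf[OF p(2,4) m]])
  fix X assume X: "X : St"
  note mX = M_St[OF m X] and i = inc_hm[OF m X]
  show "theta j (m**X) x : dsub m F K X" if j: "j : J" and x: "x : dsub m E N X" for j x
  proof -
   obtain w y where y: "w : N (m**X)" "y : cM E X" "x = w \<oplus>\<^bsub>MOb E (m**X)\<^esub> MAr E (inc m X) y"
    using x by (auto simp: dsub_def)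
   note t = addmapD[OF p(5)[OF j mX] mfE(2)[OF mX] mfF(2)[OF mX]]
   have "theta j (m**X) x = theta j (m**X) w \<oplus>\<^bsub>MOb F (m**X)\<^esub> MAr F (inc m X) (theta j X y)"
    using t(2)[OF asubD(2)[OF subfD(1)[OF p(3) mX] y(1)] mfE(5)[OF i y(2)]] p(6)[OF j i y(2)] y(3) by simp
   then show ?thesis using p(11)[OF j mX y(1)] addmapD(1)[OF p(5)[OF j X] mfE(2)[OF X] mfF(2)[OF X] y(2)]
    unfolding dsub_def by blast
  qed
  show "beta h (m**X) x : dsub m F K X" if h: "h : C" and x: "x : dsub m F K X" for h x
  proof -
   obtain w y where y: "w : K (m**X)" "y : cM F X" "x = w \<oplus>\<^bsub>MOb F (m**X)\<^esub> MAr F (inc m X) y"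
    using x by (auto simp: dsub_def)
   note t = addmapD[OF p(7)[OF h mX] mfF(2)[OF mX] mfF(2)[OF mX]]
   have "beta h (m**X) x = beta h (m**X) w \<oplus>\<^bsub>MOb F (m**X)\<^esub> MAr F (inc m X) (beta h X y)"
    using t(2)[OF asubD(2)[OF subfD(1)[OF p(4) mX] y(1)] mfF(5)[OF i y(2)]] p(8)[OF h i y(2)] y(3) by simp
   then show ?thesis using p(10)[OF h mX y(1)] addmapD(1)[OF p(7)[OF h X] mfF(2)[OF X] mfF(2)[OF X] y(2)]
    unfolding dsub_def by blast
  qed
  show "W = cM (tau G m F) X" if "asub (MOb (tau G m F) X) W" "ALL h:C. ALL w:W. beta h (m**X) w : W"
   "ALL i:J. ALL x:cM (tau G m E) X. theta i (m**X) x : W" for W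
   using p(9)[OF mX] that by (simp add: tau_simps)
  show "addmap (MOb (tau G m E) X) (MOb (tau G m F) X) (theta j (m**X))" if "j : J" for j
   using p(5)[OF that mX] by (simp add: tau_simps)
  show "addmap (MOb (tau G m F) X) (MOb (tau G m F) X) (beta h (m**X))" if "h : C" for h
   using p(7)[OF that mX] by (simp add: tau_simps)
 next
  fix X Y phi assume a: "phi : hm X Y"
  show "theta j (m**Y) (MAr (tau G m E) phi x) = MAr (tau G m F) phi (theta j (m**X) x)" if "j : J" "x : cM (tau G m E) X" for j x
   using p(6)[OF that(1) whisk_hm[OF m a]] that(2) by (simp add: tau_simps)
  show "beta h (m**Y) (MAr (tau G m F) phi x) = MAr (tau G m F) phi (beta h (m**X) x)" if "h : C" "x : cM (tau G m F) X" for h x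
   using p(8)[OF that(1) whisk_hm[OF m a]] that(2) by (simp add: tau_simps)
 next
  show "pol False s e (tau G m E) (dsub m E N)" using p(12) m by simp
 qed
 then show ?case by simp
qed

end

lemma (in long_moody_setting) pol_cong:
 "(!!X. X : St ==> N X = N' X) ==> pol k s n E N \<longleftrightarrow> pol k s n E N'"
proof (induction n arbitrary: E N N')
 case 0
 then show ?case by (cases s) simp_all
next
 case (Suc n)
 have "pol k s n (tau G m E) (dsub m E N) \<longleftrightarrow> pol k s n (tau G m E) (dsub m E N')" if "m : M" for m
  by (rule Suc.IH) (use Suc.prems that in \<open>simp add: dsub_def\<close>)
 then show ?case using Suc.prems by simp
qed

section \<open>The Long-Moody functor as a functor with parameters\<close>

context reliable_long_moody_system
begin

lemma chi_at:
 assumes X: "X : St"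
 shows "h : cg X ==> chi_at G chi X h : Gh (u**X) (u**X)"
  "chi_at G chi X \<one>\<^bsub>gr X\<^esub> = Idn G (u**X)"
  "h : cg X ==> h' : cg X ==>
   chi_at G chi X (h \<otimes>\<^bsub>gr X\<^esub> h') = chi_at G chi X h \<cdot> chi_at G chi X h'"
proof -
 let ?S = "stage_groupoid G u z"
 interpret c: cat_functor "grothendieck ?S (gfun_restrict G A)" ?S "%X. u**X" chi by (rule chi_functor)
 note oX = St_obj[OF X]
 have i: "Idn G X : homs ?S X X" using idn_hom[OF oX] X by (auto simp: homs_def stage_groupoid_def full_sub_def St_def)
 have s: "Idn ?S = Idn G" "Cmp ?S = Cmp G" "X : Obj (grothendieck ?S (gfun_restrict G A))"
  using X oX by (simp_all add: stage_groupoid_def full_sub_def grothendieck_def St_def)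
 have e: "GAr A (embed G (Idn G X)) h = h" if "h : cg X" for h
  using ga_idn[OF oX that] emb_idn[OF oX] by simp
 have a: "(h, Idn G X) : homs (grothendieck ?S (gfun_restrict G A)) X X" if "h : cg X" for h
  using i that by (auto simp: homs_def grothendieck_def gfun_restrict_def)
 show 1: "chi_at G chi X h : Gh (u**X) (u**X)" if "h : cg X" for h
  using c.map_hom[OF a[OF that]] by (auto simp: chi_at_def homs_def stage_groupoid_def full_sub_def)
 show "chi_at G chi X \<one>\<^bsub>gr X\<^esub> = Idn G (u**X)"
  using c.map_idn[OF s(3)] s(1) by (simp add: grothendieck_def gfun_restrict_def chi_at_def)
 show "chi_at G chi X (h \<otimes>\<^bsub>gr X\<^esub> h') = chi_at G chi X h \<cdot> chi_at G chi X h'"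
  if "h : cg X" "h' : cg X"
  using c.map_cmp[OF a[OF that(2)] a[OF that(1)]] s(2) e[OF that(2)] idn_left[OF idn_hom[OF oX]] idn_Arr(2)[OF oX]
   homsD(3)[OF idn_hom[OF oX]] by (simp add: grothendieck_def gfun_restrict_def chi_at_def stage_groupoid_def full_sub_def)
qed

text \<open>In the Grothendieck construction the arrow \<open>(ga phi h, phi)\<close> factors both
  as \<open>(1, phi)\<close> after \<open>(h, id)\<close> and as \<open>(ga phi h, id)\<close> after
  \<open>(1, phi)\<close>. The extension \<open>chi'\<close> turns the two factorizations into the
  two sides.\<close>

lemma chi_equivariant:
 assumes p: "phi : hm X Y" and h: "h : cg X"
 shows "whisk u phi $$ emb (chi_at G chi X h) = emb (chi_at G chi Y (ga phi h)) $$ whisk u phi"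
proof -
 let ?S = "stage_groupoid G u z" and ?g = "grothendieck S A"
 note X = hmD(2)[OF p] and Y = hmD(3)[OF p]
 note oX = St_obj[OF X] and oY = St_obj[OF Y]
 interpret gY: group "gr Y" by (rule gr_group[OF oY])
 interpret gX: group "gr X" by (rule gr_group[OF oX])
 obtain chi' where chi': "cat_functor ?g S (%X. u**X) chi'"
  "ALL f:Arr S. chi' (groth_section S A f) = whisk u f"
  "\<forall>(h, f)\<in>Arr (grothendieck ?S (gfun_restrict G A)). chi' (h, emb f) = emb (chi (h, f))"
  using chi_extends by auto
 interpret c: cat_functor ?g S "%X. u**X" chi' by (rule chi'(1))
 let ?i = "%X. qid X"
 have iX: "?i X : hm X X" and iY: "?i Y : hm Y Y" using c.cod.idn_hom[of X] c.cod.idn_hom[of Y] X Y by simp_all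
 have m: "(h, f) : homs ?g W Z" if "h : cg Z" "f : hm W Z" for h f W Z
  using that by (auto simp: homs_def grothendieck_def)
 have tg: "Tgt S phi = Y" "Tgt S (?i Y) = Y" using p iY by (auto simp: homs_def)
 have e: "chi' (h, ?i X) = emb (chi_at G chi X h)" if "X : St" "h : cg X" for X h
 proof -
  have "(h, Idn G X) : Arr (grothendieck ?S (gfun_restrict G A))"
   using that St_obj[OF that(1)] by (auto simp: grothendieck_def stage_groupoid_def full_sub_def gfun_restrict_def St_def)
  then show ?thesis using chi'(3) emb_idn[OF St_obj[OF that(1)]] by (auto simp: chi_at_def)
 qed
 have w: "chi' (\<one>\<^bsub>gr Y\<^esub>, phi) = whisk u phi"
  using chi'(2) p tg(1) by (auto simp: groth_section_def homs_def)
 have gh: "ga phi h : cg Y" by (rule ga_closed[OF hmD(1)[OF p] h])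
 have "chi' (ga phi h, phi) = whisk u phi $$ emb (chi_at G chi X h)"
  using c.map_cmp[OF m[OF h iX] m[OF gY.one_closed p]] w e[OF X h] tg gh c.cod.idn_right[OF p] by (simp add: grothendieck_def)
 moreover have "chi' (ga phi h, phi) = emb (chi_at G chi Y (ga phi h)) $$ whisk u phi"
  using c.map_cmp[OF m[OF gY.one_closed p] m[OF gh iY]] w e[OF Y gh] tg gh c.cod.idn_left[OF p] ga_idn[OF oY gY.one_closed]
  by (simp add: grothendieck_def)
 ultimately show ?thesis by simp
qed

context
 fixes R :: "'r ring"
begin

abbreviation cact where "cact F == %X h. MAr F (emb (chi_at G chi X h))"

lemma equi_chi:
 assumes F: "module_functor R S F"
 shows "equi R (Unit G) (tau G u F) (cact F)"
 unfolding equi_def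
proof (intro conjI ballI allI)
 note mfF = mf[OF F]
 show "Unit G : M" by (rule M_unit)
 show "module_functor R S (tau G u F)" by (rule tau_mf[OF F M_u])
 have ch: "emb (chi_at G chi X h) : hm (u**X) (u**X)" if "X : St" "h : cg X" for X h
  by (rule emb_hm[OF chi_at(1)[OF that] M_St[OF M_u that(1)] M_St[OF M_u that(1)]])
 show "rep R (gr (Unit G**X)) (MOb (tau G u F) X) (cact F X)" if X: "X : St" for X
  unfolding rep_def
 proof (intro conjI ballI)
  note uX = M_St[OF M_u X]
  have U: "Unit G**X = X" using St_obj[OF X] by simp
  show "module R (MOb (tau G u F) X)" using mfF(1)[OF uX] by (simp add: tau_simps)
  show "group (gr (Unit G**X))" using gr_group St_obj[OF X] by simp
  show "cact F X g : mod_hom R (MOb (tau G u F) X) (MOb (tau G u F) X)" if "g : cg (Unit G**X)" for g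
   using mfF(3)[OF ch[OF X]] that U by (simp add: tau_simps)
  show "cact F X \<one>\<^bsub>gr (Unit G**X)\<^esub> v = v" if "v : cM (tau G u F) X" for v
   using that U mfF(7)[OF uX] chi_at(2)[OF X] emb_idn[OF St_obj[OF uX]] by (simp add: tau_simps)
  show "cact F X (g \<otimes>\<^bsub>gr (Unit G**X)\<^esub> h) v = cact F X g (cact F X h v)"
   if "g : cg (Unit G**X)" "h : cg (Unit G**X)" "v : cM (tau G u F) X" for g h v
   using that U mfF(6)[OF ch[OF X, of h] ch[OF X, of g]] chi_at(3)[OF X, of g h] emb_cmp[OF chi_at(1)[OF X, of h] chi_at(1)[OF X, of g]]
   by (simp add: tau_simps)
 qed
 fix X Y phi g v assume p: "phi : hm X Y" and g: "g : cg (Unit G**X)" and v: "v : cM (tau G u F) X"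
 note X = hmD(2)[OF p] and w = whisk_hm[OF M_u p]
 have g': "g : cg X" using g St_obj[OF X] by simp
 have v': "v : cM F (u**X)" using v by (simp add: tau_simps)
 note gy = ga_closed[OF hmD(1)[OF p] g']
 show "MAr (tau G u F) phi (cact F X g v) = cact F Y (ga (whisk (Unit G) phi) g) (MAr (tau G u F) phi v)"
  using mfF(6)[OF ch[OF X g'] w v'] mfF(6)[OF w ch[OF hmD(3)[OF p] gy] v'] chi_equivariant[OF p g'] whisk_unit[OF hmD(1)[OF p]]
  by (simp add: tau_simps)
qed

text \<open>The parameter is the unit and the coefficients are \<open>tau u F\<close>, acted on
  through \<open>chi\<close>. On arrows, the sum over representatives is a linear extension of pure
  tensors; \<open>pushforward_pt\<close> shows that it has the form treated in
  \<open>tens_lift\<close>.\<close>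

lemma isL_long_moody:
 assumes F: "module_functor R S F"
 shows "isL R (Unit G) (long_moody R G u A chi F) (tau G u F) (cact F)"
proof -
 note e = equi_chi[OF F]
 let ?E = "long_moody R G u A chi F"
 note mfF = mf[OF F]
 have act: "chi_action R G u chi F X = lact R (MOb F (u**X)) (cact F X)" for X
  by (intro ext) (simp add: chi_action_def lact_def)
 have ob: "MOb ?E X = tens R (gr X) (MOb F (u**X)) (cact F X)" for X
  by (simp add: long_moody_def long_moody_ob_def tens_def act)
 have pu: "long_moody_pure R G u A chi F X i v = pt R (gr X) (MOb F (u**X)) (cact F X) i v" for X i v
  by (simp add: long_moody_pure_def pt_def act)
 have U: "Unit G**X = X" if "X : St" for X using St_obj[OF that] by simp
 have rp: "rep R (gr X) (MOb F (u**X)) (cact F X)" if "X : St" for X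
  using equiD(3)[OF e that] U[OF that] by (simp add: tau_simps)
 have ar: "MAr ?E phi : mod_hom R (MOb ?E X) (MOb ?E Y) & (ALL g:cg X. ALL v:cM F (u**X).
   MAr ?E phi (br R (gr X) (MOb F (u**X)) (cact F X) g v) = br R (gr Y) (MOb F (u**Y)) (cact F Y) (ga phi g) (MAr F (whisk u phi) v))"
  if p: "phi : hm X Y" for phi X Y
 proof -
  note X = hmD(2)[OF p] and Y = hmD(3)[OF p] and w = whisk_hm[OF M_u p] and h = hmD(1)[OF p]
  interpret t: tensor_ctx R "gr X" "MOb F (u**X)" "cact F X" by (rule tensor_ctx.intro[OF rp[OF X]])
  interpret t': tensor_ctx R "gr Y" "MOb F (u**Y)" "cact F Y" by (rule tensor_ctx.intro[OF rp[OF Y]])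
  let ?D = "%g v. br R (gr Y) (MOb F (u**Y)) (cact F Y) (ga phi g) (MAr F (whisk u phi) v)"
  let ?beta = "%p. pt R (gr Y) (MOb F (u**Y)) (cact F Y) (pushforward R (ga phi) (fst p)) (MAr F (whisk u phi) (snd p))"
  have gm: "ga phi (g \<otimes>\<^bsub>gr X\<^esub> h) = ga phi g \<otimes>\<^bsub>gr Y\<^esub> ga phi h" if "g : cg X" "h : cg X" for g h
   using ga_hom[OF h] that by (auto simp: hom_def)
  have eq: "MAr F (whisk u phi) (cact F X g v) = cact F Y (ga phi g) (MAr F (whisk u phi) v)"
   if "g : cg X" "v : cM F (u**X)" for g v
   using equiD(5)[OF e p, of g v] that U[OF X] whisk_unit[OF h] by (simp add: tau_simps)
  have D: "der R (gr X) (MOb F (u**X)) (cact F X) t'.T ?D"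
   unfolding der_def
   using mod_hom_comp[OF mfF(3)[OF w] derD(2)[OF t'.br_der ga_closed[OF h]]]
    derD(4)[OF t'.br_der ga_closed[OF h] ga_closed[OF h] mfF(5)[OF w]] gm eq t'.tens_module by simp
  have b: "?beta (i, v) = tl R t'.T (%h. ?D h v) i" if "i : t.I" "v : cM F (u**X)" for i v
   using pushforward_pt[OF rp[OF X] rp[OF Y] ga_hom[OF h] mfF(5)[OF w that(2)] that(1)] by simp
  note l = t.tens_lift[OF t'.tens_module b D]
  have "Tgt Q phi = Y" using h by (auto simp: homs_def)
  then have "MAr ?E phi = tl R t'.T ?beta" using ob[of Y] pu[of Y]
   by (intro ext) (simp add: long_moody_def tl_def Let_def)
  then show ?thesis using l ob by simp
 qed
 show ?thesis
 proof (rule isLI[OF e])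
  show "MOb ?E X = TT R (Unit G) (tau G u F) (cact F) X" if "X : St" for X using ob U[OF that] by (simp add: tau_simps)
  show "MAr ?E phi : mod_hom R (TT R (Unit G) (tau G u F) (cact F) X) (TT R (Unit G) (tau G u F) (cact F) Y)"
   if "phi : hm X Y" for phi X Y
   using ar[OF that] ob U[OF hmD(2)[OF that]] U[OF hmD(3)[OF that]] by (simp add: tau_simps)
  show "MAr ?E phi (bb R (Unit G) (tau G u F) (cact F) X g v) =
    bb R (Unit G) (tau G u F) (cact F) Y (ga (whisk (Unit G) phi) g) (MAr (tau G u F) phi v)"
   if "phi : hm X Y" "g : cg (Unit G**X)" "v : cM (tau G u F) X" for phi X Y g v
   using ar[OF that(1)] that(2,3) U[OF hmD(2)[OF that(1)]] U[OF hmD(3)[OF that(1)]] whisk_unit[OF hmD(1)[OF that(1)]] by (simp add: tau_simps)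
 qed
qed

text \<open>\<open>A u\<close> is a free product over a single index, into which \<open>H\<close>
  embeds because the identity of \<open>H\<close> extends to the free product.\<close>

lemma gr_u_nontrivial: "EX h:cg u. h ~= \<one>\<^bsub>gr u\<^esub>"
proof (rule ccontr)
 assume "\<not> ?thesis"
 then have t: "h = \<one>\<^bsub>gr u\<^esub>" if "h : cg u" for h using that by blast
 have "tensor_power G u 1 = u" using u_obj by (simp add: tensor_power_def)
 then obtain c where c: "c : iso (gr u) (free_product {..<1::nat} (%_. H))" using A_power[of 1] by (auto simp: is_iso_def)
 interpret f: fp_target "{..<1::nat}" "%_. H" H "%_ h. h"
  using H_group by (simp add: fp_target_def hom_def)
 interpret H: group H by (rule H_group)
 have "cr H = {\<one>\<^bsub>H\<^esub>}"
 proof -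
  have "h = \<one>\<^bsub>H\<^esub>" if h: "h : cr H" for h
  proof -
   have s: "c ` cg u = cr (free_product {..<1::nat} (%_. H))" using isoD(2)[OF c] by (simp add: bij_betw_def)
   have "x = c \<one>\<^bsub>gr u\<^esub>" if "x : cr (free_product {..<1::nat} (%_. H))" for x
    using that t unfolding s[symmetric] by blast
   from this[OF f.fp_incl_carrier[of 0 h]] this[OF f.fp_incl_carrier[of 0 "\<one>\<^bsub>H\<^esub>"]] h
   have "fp_incl {..<1::nat} (%_. H) 0 h = fp_incl {..<1::nat} (%_. H) 0 \<one>\<^bsub>H\<^esub>" by simp
   then show ?thesis using f.fplift_incl[of 0 h] f.fplift_incl[of 0 "\<one>\<^bsub>H\<^esub>"] h by simp
  qed
  then show ?thesis by auto
 qed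
 then show False using H_nontrivial H_group by (simp add: trivial_group_def)
qed

end

end

context reliable_long_moody_system
begin

context
 fixes R :: "'r ring"
begin

text \<open>\<open>A u\<close> acts on \<open>F X\<close> through its copy in the group of
  \<open>u \<natural> X\<close>. Fox derivatives of elements of this copy, extended by zero on the
  copy of \<open>A X\<close>, are natural maps from \<open>E\<close> to \<open>F\<close> that vanish
  on \<open>N\<close>. \<open>coef_core\<close> shows that their values generate \<open>F\<close>
  under the action of \<open>A u\<close>, which is what \<open>pol_detect\<close> asks for.\<close>

lemma pol_lower:
 assumes L: "isL R u E F act" and fr: "ALL X:St. free_group (gr X)" and N: "subf E N"
  "!!X x. X : St ==> x : N X ==> x : aspan (TT R u F act X) (gI R u F act X)"
  and p: "pol False s e E N"
 shows "pol False s e F (zsub F)"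
proof -
 note e = isLD(1)[OF L]
 note E = isLD(2)[OF L] and F = equiD(2)[OF e]
 note mfE = mf[OF E] and mfF = mf[OF F] and uz = M_St[OF M_u z_St]
 note dz = decomposition[OF unit_products.intros(3) St_UP[OF z_St]]
 have dX: "is_coproduct (gr (u**X)) (gr u) (gr X) (j1 u X) (j2 u X)" if "X : St" for X
  by (rule decomposition[OF unit_products.intros(3) St_UP[OF that]])
 note gu = gr_group[OF u_obj] and gz = gr_group[OF z_obj] and guz = gr_group[OF St_obj[OF uz]]
 interpret U: group "gr u" by (rule gu)
 let ?B = "gr (u**z)"
 \<comment> \<open>The basis is that of a single group, that of the stage
   \<open>u \<natural> z\<close>, which contains \<open>A u\<close> as a free factor. It does not
   depend on \<open>X\<close>.\<close>
 obtain S0 where S0: "free_basis ?B S0" using fr uz free_group_basis by blast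
 have "(%h. h) : hom (gr u) (gr u)" "(%h. \<one>\<^bsub>gr u\<^esub>) : hom (gr z) (gr u)" by (auto simp: hom_def)
 from coproduct_universal[OF dz gu this] obtain ru where ru: "ru : hom ?B (gr u)"
  "ALL h:cg u. ru (j1 u z h) = h" by (elim bexE conjE) (rule that; assumption)
 have ruc: "ru g : cg u" if "g : cr ?B" for g using ru(1) that by (auto simp: hom_def)
 have jz: "j1 u z h : cr ?B" if "h : cg u" for h using coproduct_hom(1)[OF dz] that by (auto simp: hom_def)
 have jX: "j1 u X h : cg (u**X)" if "X : St" "h : cg u" for X h
  using coproduct_hom(1)[OF dX[OF that(1)]] that by (auto simp: hom_def)
 let ?beta = "%h X v. act X (j1 u X h) v"
 \<comment> \<open>The group of \<open>u \<natural> z\<close> is made to act on every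
   \<open>F X\<close> through its retraction \<open>ru\<close> onto \<open>A u\<close>; this is the
   property of the action that \<open>coef_core\<close> requires.\<close>
 let ?a = "%X g. ?beta (ru g) X"
 have rX: "rep R (gr u) (MOb F X) (%h. ?beta h X)" if "X : St" for X
  by (rule rep_pullback[OF equiD(3)[OF e that] gu coproduct_hom(1)[OF dX[OF that]]])
 have rB: "rep R ?B (MOb F X) (?a X)" if "X : St" for X
  by (rule rep_pullback[OF rX[OF that] guz ru(1)])
 have ft: "free_tensor R ?B (MOb F X) (?a X) S0" if "X : St" for X
  by (intro free_tensor.intro tensor_ctx.intro rB[OF that] free_tensor_axioms.intro S0)
 define fox where "fox s X g v = free_tensor.coef R ?B (MOb F X) (?a X) S0 s (br R ?B (MOb F X) (?a X) g v)" for s X g v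
 have foxd: "der R ?B (MOb F X) (?a X) (MOb F X) (fox s X)" if "X : St" for X s
  unfolding fox_def by (rule free_tensor.coef_der[OF ft[OF that]])
 have foxs: "fox s X t v = (if t = s then v else \<zero>\<^bsub>MOb F X\<^esub>)" if "X : St" "t : S0" "v : cM F X" for s X t v
  unfolding fox_def by (rule free_tensor.coef(2)[OF ft[OF that(1)] that(2,3)])
 have betanat: "?beta h Y (MAr F phi v) = MAr F phi (?beta h X v)" if "phi : hm X Y" "h : cg u" "v : cM F X" for phi X Y h v
  using equiD(5)[OF e that(1) jX[OF hmD(2)[OF that(1)] that(2)] that(3)] ga_initial[OF u_obj hmD(1)[OF that(1)] that(2)] by simp
 have foxnat: "fox s Y g (MAr F phi v) = MAr F phi (fox s X g v)"
  if f: "phi : hm X Y" and g: "g : cr ?B" and v: "v : cM F X" for s phi X Y g v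
 proof -
  note X = hmD(2)[OF f] and Y = hmD(3)[OF f] and m = mfF(3)[OF f]
  have d1: "der R ?B (MOb F X) (?a X) (MOb F Y) (%g v. fox s Y g (MAr F phi v))"
   unfolding der_def
   using mod_hom_comp[OF m derD(2)[OF foxd[OF Y]]] derD(4)[OF foxd[OF Y] _ _ mfF(5)[OF f]] betanat[OF f ruc] mfF(1)[OF Y] by simp
  have d2: "der R ?B (MOb F X) (?a X) (MOb F Y) (%g v. MAr F phi (fox s X g v))"
   unfolding der_def
   using mod_hom_comp[OF derD(2)[OF foxd[OF X]] m] derD(4)[OF foxd[OF X]] mfF(1)[OF Y]
    mfF(8)[OF f derD(3)[OF foxd[OF X]] derD(3)[OF foxd[OF X]]] repD(4)[OF rB[OF X]] by simp
  have "ALL v:cM F X. fox s Y g (MAr F phi v) = MAr F phi (fox s X g v)"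
   by (rule der_generate_eq[OF d1 d2 rB[OF X], where S = S0])
    (use S0 g foxs[OF X] foxs[OF Y] mfF(5)[OF f] mfF(9)[OF f] in \<open>auto simp: free_basis_def\<close>)
  then show ?thesis using v by blast
 qed
 let ?b = "%X. bb R u F act X"
 \<comment> \<open>Since the group of \<open>u \<natural> X\<close> is the free product of
   \<open>A u\<close> and \<open>A X\<close>, a derivation may be prescribed on the two factors.
   Zero on \<open>A X\<close> makes the map factor through the quotient by \<open>N\<close>.\<close>
 let ?P = "%s X t. t : mod_hom R (TT R u F act X) (MOb F X) &
   (ALL h:cg u. ALL v:cM F X. t (?b X (j1 u X h) v) = fox s X (j1 u z h) v) &
   (ALL x:cg X. ALL v:cM F X. t (?b X (j2 u X x) v) = \<zero>\<^bsub>MOb F X\<^esub>)"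
 have ex: "EX t. ?P s X t" if X: "X : St" for X s
 proof -
  interpret t: tensor_ctx R "gr (u**X)" "MOb F X" "act X" by (rule equiD(4)[OF e X])
  have d1: "der R (gr u) (MOb F X) (%h. act X (j1 u X h)) (MOb F X) (%h. fox s X (j1 u z h))"
   by (rule der_pullback[OF foxd[OF X] gu coproduct_hom(1)[OF dz] rB[OF X]]) (simp add: ru(2))
  have d2: "der R (gr X) (MOb F X) (%h. act X (j2 u X h)) (MOb F X) (%h v. \<zero>\<^bsub>MOb F X\<^esub>)"
   by (rule der_zero[OF rep_pullback[OF t.rp gr_group[OF St_obj[OF X]] coproduct_hom(2)[OF dX[OF X]]] mfF(1)[OF X]])
  from coproduct_der[OF dX[OF X] t.rp d1 d2] obtain D where D: "der R (gr (u**X)) (MOb F X) (act X) (MOb F X) D"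
   "ALL h:cg u. ALL v:cM F X. D (j1 u X h) v = fox s X (j1 u z h) v"
   "ALL x:cg X. ALL v:cM F X. D (j2 u X x) v = \<zero>\<^bsub>MOb F X\<^esub>"
   by (elim exE conjE) (rule that; assumption)
  from t.tens_universal[OF D(1)] obtain f where f: "f : mod_hom R t.T (MOb F X)"
   "ALL h:cg (u**X). ALL v:cM F X. f (?b X h v) = D h v" by (rule bexE)
  have "j2 u X x : cg (u**X)" if "x : cg X" for x
   using coproduct_hom(2)[OF dX[OF X]] that by (auto simp: hom_def)
  then show ?thesis using f D(2,3) jX[OF X] by (intro exI[of _ f]) simp
 qed
 define theta where "theta s X = (SOME t. ?P s X t)" for s X
 have "?P s X (theta s X)" if "X : St" for s X unfolding theta_def by (rule someI_ex[OF ex[OF that]])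
 then have theta: "!!s X. X : St ==> theta s X : mod_hom R (TT R u F act X) (MOb F X)"
  "!!s X h v. X : St ==> h : cg u ==> v : cM F X ==> theta s X (?b X (j1 u X h) v) = fox s X (j1 u z h) v"
  "!!s X x v. X : St ==> x : cg X ==> v : cM F X ==> theta s X (?b X (j2 u X x) v) = \<zero>\<^bsub>MOb F X\<^esub>"
  by blast+
 have thetader: "der R (gr (u**X)) (MOb F X) (act X) (MOb F X) (%g v. theta s X (?b X g v))" if X: "X : St" for s X
 proof -
  interpret t: tensor_ctx R "gr (u**X)" "MOb F X" "act X" by (rule equiD(4)[OF e X])
  show ?thesis unfolding der_def
   using mod_hom_comp[OF derD(2)[OF t.br_der] theta(1)[OF X]] derD(4)[OF t.br_der] mfF(1)[OF X]
    mod_homD(2)[OF theta(1)[OF X] derD(3)[OF t.br_der] derD(3)[OF t.br_der]] repD(4)[OF t.rp] by simp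
 qed
 note ob = isLD(3)[OF L]
 have thetanat: "theta s Y (MAr E phi x) = MAr F phi (theta s X x)" if f: "phi : hm X Y" and x: "x : cM E X" for s phi X Y x
 proof -
  note X = hmD(2)[OF f] and Y = hmD(3)[OF f] and m = mfF(3)[OF f] and w = ga_whisk_hom[OF M_u f]
  have a1: "addmap (TT R u F act X) (MOb F Y) (%x. theta s Y (MAr E phi x))"
   by (rule mod_hom_addmap[OF mod_hom_comp[OF mfE(3)[OF f, unfolded ob[OF X] ob[OF Y]] theta(1)[OF Y]]])
  have a2: "addmap (TT R u F act X) (MOb F Y) (%x. MAr F phi (theta s X x))"
   by (rule mod_hom_addmap[OF mod_hom_comp[OF theta(1)[OF X] m]])
  note rX' = equiD(3)[OF e X]
  have wc: "ga (whisk u phi) g : cg (u**Y)" if "g : cg (u**X)" for g by (rule ga_whisk_closed[OF M_u f that])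
  have d1: "der R (gr (u**X)) (MOb F X) (act X) (MOb F Y) (%g v. theta s Y (?b Y (ga (whisk u phi) g) (MAr F phi v)))"
   unfolding der_def
   using mod_hom_comp[OF m derD(2)[OF thetader[OF Y] wc]] derD(4)[OF thetader[OF Y] wc wc mfF(5)[OF f]]
    equiD(5)[OF e f] hom_mult[OF w] mfF(1)[OF Y] by simp
  have d2: "der R (gr (u**X)) (MOb F X) (act X) (MOb F Y) (%g v. MAr F phi (theta s X (?b X g v)))"
   unfolding der_def
   using mod_hom_comp[OF derD(2)[OF thetader[OF X]] m] derD(4)[OF thetader[OF X]] mfF(1)[OF Y]
    mfF(8)[OF f derD(3)[OF thetader[OF X]] derD(3)[OF thetader[OF X]]] repD(4)[OF rX'] by simp
  show ?thesis
  proof (rule TT_eq[OF e X a1 a2 mfF(2)[OF Y] _ x[unfolded ob[OF X]]])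
   fix g v assume g: "g : cg (u**X)" and v: "v : cM F X"
   have "ALL v:cM F X. theta s Y (?b Y (ga (whisk u phi) g) (MAr F phi v)) = MAr F phi (theta s X (?b X g v))"
   proof (rule coproduct_der_eq[OF dX[OF X] rX' d1 d2 _ _ g])
    fix b v assume v: "v : cM F X"
    show "theta s Y (?b Y (ga (whisk u phi) (j1 u X b)) (MAr F phi v)) = MAr F phi (theta s X (?b X (j1 u X b) v))" if "b : cg u"
     using ga_initial[OF u_obj hmD(1)[OF f] that] theta(2)[OF Y that mfF(5)[OF f v]] theta(2)[OF X that v] foxnat[OF f jz[OF that] v] by simp
    show "theta s Y (?b Y (ga (whisk u phi) (j2 u X b)) (MAr F phi v)) = MAr F phi (theta s X (?b X (j2 u X b) v))" if "b : cg X"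
     using ga_inc[OF u_obj hmD(1)[OF f] that] theta(3)[OF Y ga_closed[OF hmD(1)[OF f] that] mfF(5)[OF f v]] theta(3)[OF X that v] mfF(9)[OF f] by simp
   qed
   then show "theta s Y (MAr E phi (?b X g v)) = MAr F phi (theta s X (?b X g v))" using isLD(4)[OF L f g v] v by simp
  qed
 qed
 obtain h0 where h0: "h0 : cg u" "h0 ~= \<one>\<^bsub>gr u\<^esub>" using gr_u_nontrivial by blast
 have ru1: "ru \<one>\<^bsub>?B\<^esub> = \<one>\<^bsub>gr u\<^esub>" by (rule hom_one[OF ru(1) guz gu])
 have zs: "k = \<zero>\<^bsub>MOb F X\<^esub>" if "k : zsub F X" for k X using that by (simp add: zsub_def)
 show ?thesis
 proof (rule pol_detect[where theta = theta and J = S0 and beta = ?beta and C = "cg u", OF E F N(1) zsub_subf[OF F] _ thetanat _ betanat _ _ _ p])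
  fix X assume X: "X : St"
  show "addmap (MOb E X) (MOb F X) (theta s X)" for s using mod_hom_addmap[OF theta(1)[OF X]] ob[OF X] by simp
  show am: "addmap (MOb F X) (MOb F X) (?beta h X)" if "h : cg u" for h
   by (rule mod_hom_addmap[OF repD(3)[OF rX[OF X] that]])
  show "?beta h X w : zsub F X" if "h : cg u" "w : zsub F X" for h w
   using addmapD(3)[OF am[OF that(1)] mfF(2)[OF X] mfF(2)[OF X]] zs[OF that(2)] by (simp add: zsub_def)
  show "theta s X x : zsub F X" if x: "x : N X" for s x
  proof (rule addmap_zero_on_aspan[OF mod_hom_addmap[OF theta(1)[OF X]] TT(2)[OF e X] mfF(2)[OF X] _ N(2)[OF X x] _ subfD(1)[OF zsub_subf[OF F] X]])
   show "gI R u F act X <= cr (TT R u F act X)" using TT(3)[OF e X] inc_closed[OF M_u X] by (auto simp: gI_def)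
   show "theta s X y : zsub F X" if "y : gI R u F act X" for y
    using that theta(3)[OF X] by (auto simp: gI_def zsub_def)
  qed
  fix W assume W: "asub (MOb F X) W" "ALL h:cg u. ALL w:W. ?beta h X w : W"
   "ALL s:S0. ALL x:cM E X. theta s X x : W"
  show "W = cM F X"
  proof (rule free_tensor.coef_core[OF ft[OF X], where r = "%g. j1 u z (ru g)"])
   show "(%g. j1 u z (ru g)) : hom ?B ?B"
    using hom_compose[OF ru(1) coproduct_hom(1)[OF dz]] by (simp add: comp_def)
   show "j1 u z (ru (j1 u z (ru g))) = j1 u z (ru g)" if "g : cr ?B" for g using ru(2) ruc[OF that] by simp
   show "?a X (j1 u z (ru g)) v = ?a X g v" if "g : cr ?B" for g v using ru(2) ruc[OF that] by simp
   show "j1 u z h0 : cr ?B" by (rule jz[OF h0(1)])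
   show "j1 u z (ru (j1 u z h0)) ~= \<one>\<^bsub>?B\<^esub>" using ru(2) h0 ru1 by metis
   show "asub (MOb F X) W" by (rule W(1))
   show "ALL g:cr ?B. ALL k:W. ?a X g k : W" using W(2) ruc by blast
   show "free_tensor.coef R ?B (MOb F X) (?a X) S0 s (br R ?B (MOb F X) (?a X) (j1 u z (ru g)) v) : W"
    if "g : cr ?B" "s : S0" "v : cM F X" for g s v
    using W(3) that(2) theta(2)[OF X ruc[OF that(1)] that(3), of s] TT(3)[OF e X jX[OF X ruc[OF that(1)]] that(3)] ob[OF X]
    unfolding fox_def by metis
  qed
 qed
qed

text \<open>The second claim is \<open>pol_IK\<close> for coefficients \<open>tau u F\<close>. For
  the third, one cokernel along \<open>u\<close> gives a functor as in \<open>pol_lower\<close> with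
  coefficients \<open>tau u (tau u F)\<close>; the bound obtained for these is brought down to
  \<open>F\<close> by \<open>pol_tau_reverse\<close>, applied twice.\<close>

theorem long_moody_degree:
 assumes F: "module_functor R S F" and fr: "ALL X:St. free_group (gr X)"
 defines "E == long_moody R G u A chi F"
 shows "module_functor R S E"
  "\<not> (k & s) ==> pol k s n F (zsub F) ==> pol k s (Suc n) E (zsub E)"
  "(\<not> s ==> pol True False c F (zsub F)) ==> pol False s (Suc n) E (zsub E) ==> pol False s n F (zsub F)"
proof -
 have L: "isL R (Unit G) E (tau G u F) (cact F)" unfolding E_def by (rule isL_long_moody[OF F])
 note e = isLD(1)[OF L] and ob = isLD(3)[OF L]
 note F1 = tau_mf[OF F M_u]
 note F2 = tau_mf[OF F1 M_u]
 show E: "module_functor R S E" by (rule isLD(2)[OF L])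
 note mfE = mf[OF E] and mfF = mf[OF F]
 have z: "(%X. zsub E' (m**X)) = zsub (tau G m E')" for m and E' :: "('o, ('o, 'a) qarr, 'r, 'v) mfun"
  by (simp add: zsub_def tau_simps fun_eq_iff)
 have K: "stable (Unit G) (tau G u F) (cact F) (zsub (tau G u F))"
  unfolding stable_def
 proof (intro conjI ballI)
  show "subf (tau G u F) (zsub (tau G u F))" by (rule zsub_subf[OF F1])
  fix X g k assume X: "X : St" and g: "g : cg (Unit G**X)" and k: "k : zsub (tau G u F) X"
  note a = module_abelian[OF repD(1)[OF equiD(3)[OF e X]]]
  show "cact F X g k : zsub (tau G u F) X"
   using addmapD(3)[OF mod_hom_addmap[OF repD(3)[OF equiD(3)[OF e X] g]] a a] k by (simp add: zsub_def)
 qed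
 have IKz: "IK R (Unit G) (tau G u F) (cact F) (zsub (tau G u F)) X = zsub E X" if X: "X : St" for X
 proof -
  interpret t: tensor_ctx R "gr (Unit G**X)" "MOb (tau G u F) X" "cact F X" by (rule equiD(4)[OF e X])
  note g = gens_sub[OF e K X] and zE = subfD(1)[OF zsub_subf[OF E] X]
  have "gK R (Unit G) (tau G u F) (cact F) (zsub (tau G u F)) X <= zsub E X"
   using addmapD(3)[OF mod_hom_addmap[OF derD(2)[OF t.br_der]] module_abelian[OF t.V.module_axioms] module_abelian[OF t.tens_module]] ob[OF X]
   by (auto simp: gK_def zsub_def)
  then have "IK R (Unit G) (tau G u F) (cact F) (zsub (tau G u F)) X <= zsub E X"
   using aspan_least[OF zE[unfolded ob[OF X]]] by (auto simp: IK_def)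
  moreover have "zsub E X <= IK R (Unit G) (tau G u F) (cact F) (zsub (tau G u F)) X"
   using asubD(3)[OF g(3)] ob[OF X] by (simp add: zsub_def)
  ultimately show ?thesis by blast
 qed
 show "pol k s (Suc n) E (zsub E)" if ks: "\<not> (k & s)" and p: "pol k s n F (zsub F)"
 proof -
  have "pol k s n (tau G u F) (zsub (tau G u F))" using pol_tau[OF F zsub_subf[OF F] M_u ks p] by (simp only: z)
  from pol_IK[OF L K _ ks this] fr have "pol k s (Suc n) E (IK R (Unit G) (tau G u F) (cact F) (zsub (tau G u F)))" by blast
  then show ?thesis by (rule iffD1[OF pol_cong, rotated]) (rule IKz)
 qed
 show "pol False s n F (zsub F)" if v: "\<not> s ==> pol True False c F (zsub F)" and p: "pol False s (Suc n) E (zsub E)"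
 proof -
  let ?F2 = "tau G u (tau G u F)" and ?act = "%X. cact F (u**X)"
  have uu: "Unit G**u = u" using u_obj by simp
  have Lu: "isL R u (tau G u E) ?F2 ?act" using isL_tau[OF L M_u] unfolding uu .
  note eu = isLD(1)[OF Lu]
  have 3: "pol False s n (tau G u E) (dsub u E (zsub E))" using p M_u by simp
  \<comment> \<open>In the shifted functor the image of \<open>long_moody F\<close> is generated by
    elements of \<open>A X\<close>, so the Fox maps vanish on it and descend to the
    cokernel.\<close>
  have 2: "pol False s n ?F2 (zsub ?F2)"
  proof (rule pol_lower[OF Lu fr dsub_subf[OF E zsub_subf[OF E] M_u] _ 3])
   fix X x assume X: "X : St" and x: "x : dsub u E (zsub E) X"
   note uX = M_St[OF M_u X] and i = inc_hm[OF M_u X]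
   have U: "Unit G**Y = Y" if "Y : St" for Y using St_obj[OF that] by simp
   have wi: "whisk (Unit G) (inc u X) = inc u X" by (rule whisk_unit[OF hmD(1)[OF i]])
   let ?N = "aspan (TT R u ?F2 ?act X) (gI R u ?F2 ?act X)"
   have T: "MOb E (u**X) = TT R u ?F2 ?act X" using isLD(3)[OF Lu X] by (simp add: tau_simps)
   have "gI R u ?F2 ?act X <= cr (TT R u ?F2 ?act X)" using TT(3)[OF eu X] inc_closed[OF M_u X] by (auto simp: gI_def)
   note N = aspan_asub[OF TT(2)[OF eu X] this]
   obtain y where y: "y : cM E X" "x = \<zero>\<^bsub>MOb E (u**X)\<^esub> \<oplus>\<^bsub>MOb E (u**X)\<^esub> MAr E (inc u X) y"
    using x by (auto simp: dsub_def zsub_def)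
   have yT: "y : cr (TT R (Unit G) (tau G u F) (cact F) X)" using y(1) ob[OF X] by simp
   have "MAr E (inc u X) y : ?N"
   proof (rule addmap_zero_on_aspan[OF mfE(4)[OF i, unfolded ob[OF X] T] TT(2)[OF e X] TT(2)[OF eu X] _ TT(4)[OF e X yT] _ N])
    show "{bb R (Unit G) (tau G u F) (cact F) X g v |g v. g : cg (Unit G**X) & v : cM (tau G u F) X}
     <= cr (TT R (Unit G) (tau G u F) (cact F) X)" using TT(3)[OF e X] by blast
    fix w assume "w : {bb R (Unit G) (tau G u F) (cact F) X g v |g v. g : cg (Unit G**X) & v : cM (tau G u F) X}"
    then obtain g v where w: "w = bb R (Unit G) (tau G u F) (cact F) X g v" "g : cg (Unit G**X)" "v : cM (tau G u F) X" by blast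
    have v: "MAr (tau G u F) (inc u X) v : cM ?F2 X" using mf(5)[OF F1 i w(3)] by (simp add: tau_simps)
    have "MAr E (inc u X) w = bb R u ?F2 ?act X (ga (inc u X) g) (MAr (tau G u F) (inc u X) v)"
     using isLD(4)[OF L i w(2,3)] w(1) wi U[OF uX] by (simp add: tau_simps)
    then have "MAr E (inc u X) w : gI R u ?F2 ?act X" using v w(2) U[OF X] unfolding gI_def by auto
    then show "MAr E (inc u X) w : ?N" by (rule aspan_gen)
   qed
   moreover have "x = MAr E (inc u X) y"
    using y(2) mfE(5)[OF i y(1)] abelian_monoid.l_zero[OF abelian_group.axioms(1)[OF mfE(2)[OF uX]]] by simp
   ultimately show "x : ?N" by simp
  qed
  have v1: "\<not> s ==> pol True False c (tau G u F) (zsub (tau G u F))"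
   using pol_tau[OF F zsub_subf[OF F] M_u _ v] by (simp add: z)
  have 1: "pol False s n (tau G u F) (zsub (tau G u F))"
   by (rule pol_tau_reverse[OF F1 zsub_subf[OF F1] M_u v1]) (use 2 in \<open>simp_all add: z\<close>)
  show ?thesis by (rule pol_tau_reverse[OF F zsub_subf[OF F] M_u v]) (use 1 in \<open>simp_all add: z\<close>)
 qed
qed

end

end

text \<open>Zero functors are set apart in the first claim and stably zero ones in the second: with
  degrees in the natural numbers such an \<open>F\<close> has degree 0, and its Long-Moody functor
  is again zero, respectively stably zero, hence of degree 0 as well.\<close>

theorem theoremB:
  fixes R :: "'r ring"
    and G :: "('o, 'a) brcat"
    and u z :: 'o
    and A :: "('o, ('o, 'a) qarr, 'g) gfun"
    and chi :: "'g \<times> 'a \<Rightarrow> 'a"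
    and H H0 :: "'g monoid"
    and F :: "('o, ('o, 'a) qarr, 'r, 'm) mfun"
    and d :: nat
  assumes "cring R" and "\<one>\<^bsub>R\<^esub> \<noteq> \<zero>\<^bsub>R\<^esub>"
    and "reliable_long_moody_system G u z A chi H H0"
    and "\<And>n. free_group (GOb A (stage G u z n))"
    and "module_functor R (stage_quillen G u z) F"
  shows "(very_strong_pol_of_degree G u z d F \<and> \<not> zero_functor G u z F \<longrightarrow>
            very_strong_pol_of_degree G u z (d + 1) (long_moody R G u A chi F)) \<and>
         (weak_pol_of_degree G u z d F \<and> \<not> stably_zero G u z F \<longrightarrow>
            weak_pol_of_degree G u z (d + 1) (long_moody R G u A chi F))"
proof -
 interpret reliable_long_moody_system G u z A chi H H0 by (rule assms(3))
 note F = assms(5)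
 have fr: "ALL X:St. free_group (GOb A X)" using assms(4) by (auto simp: St_def)
 let ?E = "long_moody R G u A chi F"
 note d = long_moody_degree[OF F fr]
 note pF = pres_self[OF F] and pE = pres_self[OF d(1)]
 note zF = zsub_subf[OF F] and zE = zsub_subf[OF d(1)]
 have vF: "very_strong_pol G u z (int n) F \<longleftrightarrow> pol True False (Suc n) F (zsub F)" for n
  using pres_pol(2)[OF F zF pF, of "Suc n"] by simp
 have vE: "very_strong_pol G u z (int n) ?E \<longleftrightarrow> pol True False (Suc n) ?E (zsub ?E)" for n
  using pres_pol(2)[OF d(1) zE pE, of "Suc n"] by simp
 have wF: "weak_pol G u z (int n) F \<longleftrightarrow> pol False True (Suc n) F (zsub F)" for n
  using pres_pol(3)[OF F zF pF, of "Suc n"] by simp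
 have wE: "weak_pol G u z (int n) ?E \<longleftrightarrow> pol False True (Suc n) ?E (zsub ?E)" for n
  using pres_pol(3)[OF d(1) zE pE, of "Suc n"] by simp
 \<comment> \<open>The upper bound gives membership at \<open>d + 1\<close>. Minimality follows if
   every bound \<open>n\<close> for the Long-Moody functor is a successor \<open>Suc k\<close> with
   \<open>k\<close> a bound for \<open>F\<close>.\<close>
 have least: "d + 1 = (LEAST n. Q n)" if 1: "Q (d + 1)" and 2: "!!n. Q n ==> EX k. n = Suc k & P k" and 3: "d = (LEAST n. P n)" for P Q :: "nat => bool"
 proof (rule sym, rule Least_equality)
  show "Q (d + 1)" by (rule 1)
  fix n assume "Q n"
  then obtain k where "n = Suc k" "P k" using 2 by blast
  then show "d + 1 \<le> n" using 3 Least_le[of P k] by simp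
 qed
 show ?thesis
 proof (intro conjI impI; elim conjE)
  assume v: "very_strong_pol_of_degree G u z d F" and nz: "\<not> zero_functor G u z F"
  have vd: "very_strong_pol G u z (int d) F" and dl: "d = (LEAST n. very_strong_pol G u z (int n) F)"
   using v LeastI_ex[of "%n. very_strong_pol G u z (int n) F"] by (auto simp: very_strong_pol_of_degree_def)
  have up: "very_strong_pol G u z (int (d + 1)) ?E" using d(2)[of True False "Suc d"] vd unfolding vE vF by simp
  have "EX k. n = Suc k & very_strong_pol G u z (int k) F" if n: "very_strong_pol G u z (int n) ?E" for n
  proof -
   \<comment> \<open>The index of \<open>pol\<close> is the degree plus one, so degree at most
     \<open>n\<close> for the Long-Moody functor yields index \<open>n\<close>, that is degree at
     most \<open>n - 1\<close>, for \<open>F\<close>. The very strong hypothesis at index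
     \<open>Suc d\<close> supplies the vanishing kernels needed for the descent.\<close>
   have p: "pol False False n F (zsub F)"
    using d(3)[of False "Suc d" n] vd pol_very_strong n unfolding vE vF by blast
   show ?thesis
   \<comment> \<open>Index 0 would mean that \<open>F\<close> is zero, which is excluded. Otherwise
     the strong bound is upgraded to a very strong one, as \<open>F\<close> is very strong of degree
     \<open>d\<close>.\<close>
   proof (cases n)
    case 0
    then show ?thesis using p nz pres_zero[OF F pF, of False] by simp
   next
    case (Suc k)
    have "pol True False (Suc k) F (zsub F)" by (rule pol_strong_very[OF vd[unfolded vF] p[unfolded Suc] F zF]) simp
    then show ?thesis using Suc unfolding vF by blast
   qed
  qed
  from least[of "%n. very_strong_pol G u z (int n) ?E" "%n. very_strong_pol G u z (int n) F", OF up this dl] up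
  show "very_strong_pol_of_degree G u z (d + 1) ?E"
   unfolding very_strong_pol_of_degree_def by blast
 next
  assume v: "weak_pol_of_degree G u z d F" and nz: "\<not> stably_zero G u z F"
  have vd: "weak_pol G u z (int d) F" and dl: "d = (LEAST n. weak_pol G u z (int n) F)"
   using v LeastI_ex[of "%n. weak_pol G u z (int n) F"] by (auto simp: weak_pol_of_degree_def)
  have up: "weak_pol G u z (int (d + 1)) ?E" using d(2)[of False True "Suc d"] vd unfolding wE wF by simp
  have "EX k. n = Suc k & weak_pol G u z (int k) F" if n: "weak_pol G u z (int n) ?E" for n
  proof -
   have p: "pol False True n F (zsub F)" using d(3)[of True _ n] n unfolding wE by blast
   show ?thesis
   \<comment> \<open>Index 0 means stably zero here, which is excluded; any other index is a bound
     on the weak degree of \<open>F\<close>.\<close>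
   proof (cases n)
    case 0
    then show ?thesis using p nz pres_stably_zero[OF F zF pF, of False] by simp
   next
    case (Suc k)
    then show ?thesis using p unfolding wF by blast
   qed
  qed
  from least[of "%n. weak_pol G u z (int n) ?E" "%n. weak_pol G u z (int n) F", OF up this dl] up
  show "weak_pol_of_degree G u z (d + 1) ?E"
   unfolding weak_pol_of_degree_def by blast
 qed
qed

end
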